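(* Let $s\in(3/4,1)$, $a,b,m>0$, $1<q<2$ and $p=2^*_s=\frac{6}{3-2s}$. Then there exists $\lambda_*>0$ such that, for all $\lambda\in(0,\lambda_* )$, the problem $$\left\{\begin{array}{ll}(a+b|u|^{2}_{\mathbb{H}^{s}_{2\pi}})(-\Delta+m^{2})^{s}u=\lambda|u|^{q-2}u+|u|^{p-2}u & \text{in } (-\pi,\pi)^{3},\\ u(x+2\pi e_{i})=u(x) & \text{for all } x\in\mathbb{R}^{3},\ i=1,2,3,\end{array}\right.$$ has infinitely many (weak) periodic solutions.
   Context: All functions are real-valued. $\{e_i\}_{i=1,2,3}$ is the canonical basis of $\mathbb{R}^3$; $|\cdot|_r$ is the norm of $L^r((-\pi,\pi)^3)$; $2^*_s=\frac{6}{3-2s}$ (so $2^*_s>4$ when $s>3/4$). For a $2\pi$-periodic (in each variable) function $u=\sum_{k\in\mathbb{Z}^3}c_k\frac{e^{\imath k\cdot x}}{(2\pi)^{3/2}}$ with Fourier coefficients $c_k=(2\pi)^{-3/2}\int_{(-\pi,\pi)^3}u(x)e^{-\imath k\cdot x}dx$, set $(-\Delta+m^2)^su=\sum_k c_k(|k|^2+m^2)^s\frac{e^{\imath k\cdot x}}{(2\pi)^{3/2}}$ and $|u|_{\mathbb{H}^s_{2\pi}}^2=\sum_k(|k|^2+m^2)^s|c_k|^2$. The Hilbert space $\mathbb{H}^s_{2\pi}$ consists of those $u\in L^2((-\pi,\pi)^3)$ with $|u|_{\mathbb{H}^s_{2\pi}}<\infty$. Let $\mathcal{S}_{2\pi}=(-\pi,\pi)^3\times(0,\infty)$,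 with points $(x,y)$, and $\kappa_s=2^{1-2s}\Gamma(1-s)/\Gamma(s)$. The Hilbert space $\mathbb{X}^s_{2\pi}$ is the closure of the set of smooth functions on $\mathbb{R}^3\times[0,\infty)$ that are $2\pi$-periodic in each $x_i$ (and of finite norm) with respect to the norm induced by the inner product $$\langle U,V\rangle_{\mathbb{X}^s_{2\pi}}=\frac1{\kappa_s}\iint_{\mathcal{S}_{2\pi}}y^{1-2s}(\nabla U\cdot\nabla V+m^2UV)\,dx\,dy .$$ There is a bounded surjective linear trace operator $\mathrm{Tr}:\mathbb{X}^s_{2\pi}\to\mathbb{H}^s_{2\pi}$ extending $U\mapsto U(\cdot,0)$ from smooth functions; it satisfies $|\mathrm{Tr}(U)|_{\mathbb{H}^s_{2\pi}}\le\|U\|_{\mathbb{X}^s_{2\pi}}$, and $\mathrm{Tr}(\mathbb{X}^s_{2\pi})\subset L^r((-\pi,\pi)^3)$ continuously for $1\le r\le 2^*_s$. Weak solution: $u\in\mathbb{H}^s_{2\pi}$ is a weak (periodic) solution of the problem if $u=\mathrm{Tr}(U)$ for some $U\in\mathbb{X}^s_{2\pi}$ such that, for every $V\in\mathbb{X}^s_{2\pi}$, $$(a+b\|U\|^2_{\mathbb{X}^s_{2\pi}})\langle U,V\rangle_{\mathbb{X}^s_{2\pi}}=\int_{(-\pi,\pi)^3}\big[\lambda|u|^{q-2}u+|u|^{p-2}u\big]\mathrm{Tr}(V)\,dx .$$ *)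

theory Defs
  imports "HOL-Analysis.Analysis"
begin

definition cube :: "(real^3) set" where
  "cube = box (\<chi> i. - pi) (\<chi> i. pi)"

definition cylinder :: "((real^3) \<times> real) set" where
  "cylinder = cube \<times> {0<..}"

definition ae_eq :: "((real^3 \<Rightarrow> real) \<times> (real^3 \<Rightarrow> real)) set" where
  "ae_eq = {(u, v). AE x in lebesgue_on cube. u x = v x}"

definition critical_exponent :: "real \<Rightarrow> real" where
  "critical_exponent s = 6 / (3 - 2 * s)"

definition kappa :: "real \<Rightarrow> real" where
  "kappa s = 2 powr (1 - 2 * s) * Gamma (1 - s) / Gamma s"

definition periodic :: "(real^3 \<Rightarrow> 'a) \<Rightarrow> bool" where
  "periodic u \<longleftrightarrow> (\<forall>x i. u (x + (2 * pi) *\<^sub>R axis i 1) = u x)"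


section \<open>The fractional periodic Sobolev space\<close>

definition fourier_coeff :: "(real^3 \<Rightarrow> real) \<Rightarrow> int^3 \<Rightarrow> complex" where
  "fourier_coeff u k = complex_of_real ((2 * pi) powr (- 3 / 2)) *
     (LINT x | lebesgue_on cube. complex_of_real (u x) *
        exp (- \<i> * complex_of_real (\<Sum>j\<in>UNIV. real_of_int (k $ j) * x $ j)))"

definition H_term :: "real \<Rightarrow> real \<Rightarrow> (real^3 \<Rightarrow> real) \<Rightarrow> int^3 \<Rightarrow> real" where
  "H_term s m u k =
     ((\<Sum>j\<in>UNIV. (real_of_int (k $ j))\<^sup>2) + m\<^sup>2) powr s * (cmod (fourier_coeff u k))\<^sup>2"

definition H_norm :: "real \<Rightarrow> real \<Rightarrow> (real^3 \<Rightarrow> real) \<Rightarrow> real" where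
  "H_norm s m u = sqrt (\<Sum>\<^sub>\<infinity>k. H_term s m u k)"

text \<open>Elements are periodic functions on the whole space; they are to be identified
  when they agree almost everywhere, i.e. modulo \<^const>\<open>ae_eq\<close>.\<close>

definition H_space :: "real \<Rightarrow> real \<Rightarrow> (real^3 \<Rightarrow> real) set" where
  "H_space s m = {u. periodic u \<and>
     u \<in> borel_measurable (lebesgue_on cube) \<and>
     integrable (lebesgue_on cube) (\<lambda>x. (u x)\<^sup>2) \<and>
     H_term s m u summable_on UNIV}"


section \<open>The weighted Sobolev space on the half-cylinder\<close>

text \<open>On a closed half-space, derivatives within the set are one-sided at the boundary and are
  unique everywhere; so \<open>C_on k\<close> is \<open>k\<close>-fold continuous differentiability
  up to the boundary.\<close>

primrec C_on :: "nat \<Rightarrow> 'a::euclidean_space set \<Rightarrow> ('a \<Rightarrow> real) \<Rightarrow> bool" where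
  "C_on 0 S f \<longleftrightarrow> continuous_on S f"
| "C_on (Suc k) S f \<longleftrightarrow> (\<exists>D.
     (\<forall>x\<in>S. (f has_derivative (\<lambda>h. \<Sum>b\<in>Basis. (h \<bullet> b) * D b x)) (at x within S)) \<and>
     (\<forall>b\<in>Basis. C_on k S (D b)))"

definition smooth_on :: "'a::euclidean_space set \<Rightarrow> ('a \<Rightarrow> real) \<Rightarrow> bool" where
  "smooth_on S f \<longleftrightarrow> (\<forall>k. C_on k S f)"

definition grad :: "('a::euclidean_space \<Rightarrow> real) \<Rightarrow> 'a \<Rightarrow> 'a" where
  "grad f z = (\<Sum>b\<in>Basis. frechet_derivative f (at z) b *\<^sub>R b)"

text \<open>The completion of the smooth periodic functions is realised concretely, as the closure of
  the set of pairs \<open>(\<phi>, grad \<phi>)\<close> in the weighted \<open>L\<^sup>2\<close> space of pairs \<open>(U, G)\<close> of a function and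
  a vector field on the half-cylinder. The component \<open>G\<close> is the gradient of \<open>U\<close> (it is
  determined by \<open>U\<close> up to null sets).\<close>

type_synonym X_elem = "((real^3) \<times> real \<Rightarrow> real) \<times> ((real^3) \<times> real \<Rightarrow> (real^3) \<times> real)"

definition X_inner :: "real \<Rightarrow> real \<Rightarrow> X_elem \<Rightarrow> X_elem \<Rightarrow> real" where
  "X_inner s m P Q = 1 / kappa s *
     (LINT z | lebesgue_on cylinder.
        snd z powr (1 - 2 * s) * (snd P z \<bullet> snd Q z + m\<^sup>2 * fst P z * fst Q z))"

definition X_norm :: "real \<Rightarrow> real \<Rightarrow> X_elem \<Rightarrow> real" where
  "X_norm s m P = sqrt (X_inner s m P P)"

definition X_finite :: "real \<Rightarrow> X_elem \<Rightarrow> bool" where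
  "X_finite s P \<longleftrightarrow>
     fst P \<in> borel_measurable (lebesgue_on cylinder) \<and>
     snd P \<in> borel_measurable (lebesgue_on cylinder) \<and>
     integrable (lebesgue_on cylinder) (\<lambda>z. snd z powr (1 - 2 * s) * (fst P z)\<^sup>2) \<and>
     integrable (lebesgue_on cylinder) (\<lambda>z. snd z powr (1 - 2 * s) * (norm (snd P z))\<^sup>2)"

definition smooth_periodic :: "real \<Rightarrow> ((real^3) \<times> real \<Rightarrow> real) set" where
  "smooth_periodic s = {\<phi>. smooth_on (UNIV \<times> {0..}) \<phi> \<and>
     (\<forall>y\<ge>0. periodic (\<lambda>x. \<phi> (x, y))) \<and> X_finite s (\<phi>, grad \<phi>)}"

definition X_approx :: "real \<Rightarrow> real \<Rightarrow> (nat \<Rightarrow> (real^3) \<times> real \<Rightarrow> real) \<Rightarrow> X_elem \<Rightarrow> bool" where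
  "X_approx s m \<phi> P \<longleftrightarrow> range \<phi> \<subseteq> smooth_periodic s \<and>
     (\<lambda>n. X_norm s m (\<lambda>z. fst P z - \<phi> n z, \<lambda>z. snd P z - grad (\<phi> n) z)) \<longlonglongrightarrow> 0"

definition X_space :: "real \<Rightarrow> real \<Rightarrow> X_elem set" where
  "X_space s m = {P. X_finite s P \<and> (\<exists>\<phi>. X_approx s m \<phi> P)}"

text \<open>\<open>is_trace s m P u\<close>: the function \<open>u\<close> represents the trace of \<open>P\<close>, i.e. the value at \<open>P\<close> of
  the continuous extension of \<open>\<phi> \<mapsto> \<phi>(\<cdot>, 0)\<close>. This is a relation since \<open>u\<close> is determined only
  up to null sets.\<close>

definition is_trace :: "real \<Rightarrow> real \<Rightarrow> X_elem \<Rightarrow> (real^3 \<Rightarrow> real) \<Rightarrow> bool" where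
  "is_trace s m P u \<longleftrightarrow> P \<in> X_space s m \<and> u \<in> H_space s m \<and>
     (\<exists>\<phi>. X_approx s m \<phi> P \<and>
        (\<forall>n. (\<lambda>x. \<phi> n (x, 0) - u x) \<in> H_space s m) \<and>
        (\<lambda>n. H_norm s m (\<lambda>x. \<phi> n (x, 0) - u x)) \<longlonglongrightarrow> 0)"


section \<open>Weak periodic solutions\<close>

definition weak_solution ::
  "real \<Rightarrow> real \<Rightarrow> real \<Rightarrow> real \<Rightarrow> real \<Rightarrow> real \<Rightarrow> real \<Rightarrow> (real^3 \<Rightarrow> real) \<Rightarrow> bool" where
  "weak_solution s a b m q p lam u \<longleftrightarrow> u \<in> H_space s m \<and>
     (\<exists>U\<in>X_space s m. is_trace s m U u \<and>
       (\<forall>V\<in>X_space s m. \<forall>v. is_trace s m V v \<longrightarrow>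
          (a + b * (X_norm s m U)\<^sup>2) * X_inner s m U V =
          (LINT x | lebesgue_on cube.
             (lam * \<bar>u x\<bar> powr (q - 2) * u x + \<bar>u x\<bar> powr (p - 2) * u x) * v x)))"

end

theory Submission
  imports Defs "HOL-Complex_Analysis.Great_Picard"
begin

text \<open>
  The equation does not depend on \<open>x\<close> explicitly, so every translate of a solution is again a solution.
  Hence one nonconstant solution that depends on \<open>x\<^sub>1\<close> alone yields infinitely many: its translates
  along the first axis take infinitely many values at the origin, because the range of a nonconstant
  continuous function on a connected set is infinite (\<open>infinite_translate_classes\<close>). So it suffices to
  find \<open>u(x) = \<Sum> b\<^sub>k sin (k (x\<^sub>1 + \<tau>))\<close> with coefficients \<open>b\<close> independent of \<open>\<tau>\<close>.

  For such functions the energy is \<open>E(b) = \<Sum> (k\<^sup>2 + m\<^sup>2)\<^sup>s b\<^sub>k\<^sup>2\<close>. As \<open>s > 1/2\<close>, the inverse weights are summable,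
  so \<open>E\<close> controls the sum of \<open>|b\<^sub>k|\<close>, and coordinatewise convergence inside a ball of \<open>E\<close> is uniform
  convergence of the series: in one variable the space is compactly embedded into the continuous functions,
  and the power \<open>p\<close>, critical in three variables, causes no loss of compactness. The functional
  \<open>al/2 E + be/4 E\<^sup>2 - \<integral>F(u)\<close> therefore has a minimiser on every ball (\<open>sine_functional_minimizer\<close>). For small
  \<open>\<lambda>\<close> there is a radius on whose sphere the functional is positive, since \<open>p > 2\<close>, while it is negative at
  \<open>\<epsilon> sin t\<close>, since \<open>q < 2\<close>. So the minimiser is nonzero and interior, and it solves the coefficientwise
  equation (\<open>sine_functional_euler_lagrange\<close>, \<open>sine_problem_solution\<close>). Bessel's inequality for the right-hand
  side then improves the decay of \<open>b\<close> (\<open>sine_coeff_regularity\<close>), and all later series converge absolutely.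

  To see that the coefficients give a weak solution, each \<open>sin (k (x\<^sub>1 + \<tau>))\<close> is extended to the half-cylinder
  by a factor \<open>\<theta>(y)\<close> that solves \<open>(y\<^sup>1\<^sup>-\<^sup>2\<^sup>s \<theta>')' = y\<^sup>1\<^sup>-\<^sup>2\<^sup>s \<omega>\<^sup>2 \<theta>\<close> with \<open>\<omega>\<^sup>2 = k\<^sup>2 + m\<^sup>2\<close>. This \<open>\<theta>\<close> is the integral of
  \<open>t\<^sup>s\<^sup>-\<^sup>1 exp (- t - z/t)\<close> at \<open>z = \<omega>\<^sup>2 y\<^sup>2 / 4\<close>, normalised at 0. The substitution \<open>t \<mapsto> z/t\<close>
  (\<open>bessel_int_reflect\<close>) turns its weighted derivative into the same profile with \<open>1 - s\<close> in place of
  \<open>s\<close> (\<open>matern_weighted_deriv\<close>), which gives the differential equation, the boundary flux and the energy at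
  once. Shifting \<open>z\<close> by a small positive number makes the profile smooth up to the boundary and
  preserves its bounds up to a constant factor, so the extension lies in the closure of the smooth functions (\<open>extension_approx\<close>).

  Integration by parts against a smooth periodic function leaves only the boundary flux
  (\<open>bessel_mode_test\<close>), so the inner product of the extension \<open>U\<close> with a smooth \<open>\<phi>\<close> is the sum of the
  products of the coefficients of \<open>u\<close> and of \<open>\<phi>(\<cdot>, 0)\<close> (\<open>extension_inner_smooth\<close>). The right-hand side of the equation
  has the same expansion by a Parseval identity, which comes from Fejer means (\<open>fejer_sine\<close>,
  \<open>sine_parseval\<close>). General test functions follow by density (\<open>weak_solution_of_coefficients\<close>).
\<close>

section \<open>Sine coefficients and Fejer means\<close>

lemma sin_nat_periodic: "sin (real k * (t + 2 * pi)) = sin (real k * t)"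
proof -
  have "real k * (t + 2 * pi) = real k * t + 2 * real k * pi" by (simp add: algebra_simps)
  then show ?thesis using sin_add[of "real k * t" "2 * real k * pi"] unfolding sin_2npi cos_2npi by auto
qed

lemma cos_nat_periodic: "cos (real k * (t + 2 * pi)) = cos (real k * t)"
proof -
  have "real k * (t + 2 * pi) = real k * t + 2 * real k * pi" by (simp add: algebra_simps)
  then show ?thesis using cos_add[of "real k * t" "2 * real k * pi"] unfolding sin_2npi cos_2npi by auto
qed

lemma periodic_coord1:
  assumes "\<And>t. f (t + 2 * pi) = f t"
  shows "periodic (\<lambda>x. f (x $ 1 + \<tau>))"
  unfolding periodic_def
proof (intro allI)
  fix x :: "real^3" and i :: 3
  show "f ((x + (2 * pi) *\<^sub>R axis i 1) $ 1 + \<tau>) = f (x $ 1 + \<tau>)"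
    using assms[of "x $ 1 + \<tau>"] by (cases "i = 1") (simp_all add: axis_def algebra_simps)
qed

lemma integral_cos_multiple:
  "integral {-pi..pi} (\<lambda>t. cos (real_of_int n * t)) = (if n = 0 then 2 * pi else 0)"
proof (cases "n = 0")
  case False
  have "((\<lambda>t. cos (real_of_int n * t)) has_integral
      (sin (real_of_int n * pi) / real_of_int n - sin (real_of_int n * (-pi)) / real_of_int n)) {-pi..pi}"
    by (rule fundamental_theorem_of_calculus)
       (use False in \<open>auto intro!: derivative_eq_intros simp flip: has_real_derivative_iff_has_vector_derivative\<close>)
  moreover have "sin (real_of_int n * pi) = 0" by (simp add: mult.commute sin_zero_iff_int2)
  ultimately show ?thesis using False by (simp add: integral_unique)
qed simp

lemma integral_sin_multiple:
  "integral {-pi..pi} (\<lambda>t. sin (c * t)) = 0"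
proof (cases "c = 0")
  case False
  have "((\<lambda>t. sin (c * t)) has_integral (- cos (c * pi) / c - (- cos (c * (-pi)) / c))) {-pi..pi}"
    by (rule fundamental_theorem_of_calculus)
       (use False in \<open>auto intro!: derivative_eq_intros simp flip: has_real_derivative_iff_has_vector_derivative\<close>)
  then show ?thesis by (simp add: integral_unique)
qed simp

lemma integral_double_sum:
  fixes f :: "nat \<Rightarrow> nat \<Rightarrow> real \<Rightarrow> real"
  assumes "\<And>i j. continuous_on {a..b} (f i j)"
  shows "integral {a..b} (\<lambda>x. \<Sum>i<N. \<Sum>j<N. f i j x) = (\<Sum>i<N. \<Sum>j<N. integral {a..b} (f i j))"
proof -
  have "integral {a..b} (\<lambda>x. \<Sum>i<N. \<Sum>j<N. f i j x) = (\<Sum>i<N. integral {a..b} (\<lambda>x. \<Sum>j<N. f i j x))"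
    by (intro integral_sum integrable_continuous_real continuous_intros assms) auto
  also have "\<dots> = (\<Sum>i<N. \<Sum>j<N. integral {a..b} (f i j))"
    by (intro sum.cong refl integral_sum integrable_continuous_real assms) auto
  finally show ?thesis .
qed

lemma integral_sin_sin:
  "integral {-pi..pi} (\<lambda>t. sin (real j * t) * sin (real k * t)) = (if j = k \<and> j \<noteq> 0 then pi else 0)"
proof -
  have eq: "(\<lambda>t. sin (real j * t) * sin (real k * t)) =
      (\<lambda>t. (1/2) * (cos (real_of_int (int j - int k) * t) - cos (real_of_int (int j + int k) * t)))"
    by (simp add: sin_times_sin fun_eq_iff left_diff_distrib distrib_right)
  show ?thesis unfolding eq integral_mult_right
    by (subst integral_diff)
       (auto intro!: integrable_continuous_real continuous_intros simp: integral_cos_multiple simp del: of_int_diff of_int_add)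
qed

definition sine_coeff :: "(real \<Rightarrow> real) \<Rightarrow> nat \<Rightarrow> real" where
  "sine_coeff g k = integral {-pi..pi} (\<lambda>t. g t * sin (real k * t)) / pi"

text \<open>Bessel's inequality: the integral of the square of \<open>g\<close> minus a partial sum of its sine series is
  nonnegative. The index 0 contributes nothing, since \<open>sin (0 t)\<close> vanishes.\<close>

lemma bessel_sine:
  assumes g: "continuous_on {-pi..pi} g"
  shows "summable (\<lambda>k. (sine_coeff g k)\<^sup>2)"
proof -
  have part: "(\<Sum>k<n. (sine_coeff g k)\<^sup>2) \<le> integral {-pi..pi} (\<lambda>t. (g t)\<^sup>2) / pi" for n
  proof -
    let ?c = "sine_coeff g" and ?I = "integral {-pi..pi}"
    let ?s = "\<lambda>k t. sin (real k * t)"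
    have c: "?I (\<lambda>t. g t * ?s k t) = pi * ?c k" for k by (simp add: sine_coeff_def)
    have i1: "(\<lambda>t. (g t)\<^sup>2) integrable_on {-pi..pi}" "(\<lambda>t. g t * ?s k t) integrable_on {-pi..pi}"
      "(\<lambda>t. ?s j t * ?s k t) integrable_on {-pi..pi}" for j k
      by (intro integrable_continuous_real continuous_intros g)+
    have "0 \<le> ?I (\<lambda>t. (g t - (\<Sum>k<n. ?c k * ?s k t))\<^sup>2)"
      by (intro integral_nonneg integrable_continuous_real continuous_intros g) auto
    also have "(\<lambda>t. (g t - (\<Sum>k<n. ?c k * ?s k t))\<^sup>2) =
       (\<lambda>t. (g t)\<^sup>2 - (\<Sum>k<n. (2 * ?c k) * (g t * ?s k t)) +
           (\<Sum>j<n. \<Sum>k<n. (?c j * ?c k) * (?s j t * ?s k t)))"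
    proof
      fix t
      have "(\<Sum>k<n. ?c k * ?s k t)\<^sup>2 = (\<Sum>j<n. \<Sum>k<n. (?c j * ?c k) * (?s j t * ?s k t))"
        by (simp add: power2_eq_square sum_product mult_ac)
      moreover have "2 * g t * (\<Sum>k<n. ?c k * ?s k t) = (\<Sum>k<n. (2 * ?c k) * (g t * ?s k t))"
        by (simp add: sum_distrib_left mult_ac)
      ultimately show "(g t - (\<Sum>k<n. ?c k * ?s k t))\<^sup>2 = (g t)\<^sup>2 - (\<Sum>k<n. (2 * ?c k) * (g t * ?s k t)) +
           (\<Sum>j<n. \<Sum>k<n. (?c j * ?c k) * (?s j t * ?s k t))" by (simp add: power2_diff)
    qed
    also have "?I \<dots> = ?I (\<lambda>t. (g t)\<^sup>2) - (\<Sum>k<n. (2 * ?c k) * ?I (\<lambda>t. g t * ?s k t)) +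
        (\<Sum>j<n. \<Sum>k<n. (?c j * ?c k) * ?I (\<lambda>t. ?s j t * ?s k t))"
    proof -
      have "?I (\<lambda>t. \<Sum>k<n. (2 * ?c k) * (g t * ?s k t)) = (\<Sum>k<n. (2 * ?c k) * ?I (\<lambda>t. g t * ?s k t))"
        by (subst integral_sum) (auto intro!: integrable_continuous_real continuous_intros g)
      moreover have "?I (\<lambda>t. \<Sum>j<n. \<Sum>k<n. (?c j * ?c k) * (?s j t * ?s k t)) =
          (\<Sum>j<n. \<Sum>k<n. (?c j * ?c k) * ?I (\<lambda>t. ?s j t * ?s k t))"
        by (subst integral_double_sum) (auto intro!: continuous_intros)
      ultimately show ?thesis
        by (subst integral_add, (intro integrable_continuous_real continuous_intros g)+,
            subst integral_diff, (intro integrable_continuous_real continuous_intros g)+) simp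
    qed
    also have "\<dots> \<le> ?I (\<lambda>t. (g t)\<^sup>2) - pi * (\<Sum>k<n. (?c k)\<^sup>2)"
    proof -
      have "(\<Sum>j<n. \<Sum>k<n. (?c j * ?c k) * ?I (\<lambda>t. ?s j t * ?s k t)) \<le> (\<Sum>j<n. pi * (?c j)\<^sup>2)"
      proof (rule sum_mono)
        fix j assume "j \<in> {..<n}"
        have "(\<Sum>k<n. (?c j * ?c k) * ?I (\<lambda>t. ?s j t * ?s k t)) =
            (\<Sum>k<n. if j = k then (if j \<noteq> 0 then pi * (?c j)\<^sup>2 else 0) else 0)"
          by (intro sum.cong) (auto simp: integral_sin_sin power2_eq_square)
        also have "\<dots> \<le> pi * (?c j)\<^sup>2" using \<open>j \<in> _\<close> by (subst sum.delta') auto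
        finally show "(\<Sum>k<n. (?c j * ?c k) * ?I (\<lambda>t. ?s j t * ?s k t)) \<le> pi * (?c j)\<^sup>2" .
      qed
      moreover have "(\<Sum>k<n. (2 * ?c k) * ?I (\<lambda>t. g t * ?s k t)) = 2 * pi * (\<Sum>k<n. (?c k)\<^sup>2)"
        unfolding c by (simp add: sum_distrib_left power2_eq_square mult_ac)
      ultimately show ?thesis unfolding sum_distrib_left[symmetric] by linarith
    qed
    finally show ?thesis by (simp add: field_simps)
  qed
  show ?thesis
    by (rule bounded_imp_summable[of _ "integral {-pi..pi} (\<lambda>t. (g t)\<^sup>2) / pi"])
       (use part[of "Suc _"] in \<open>auto simp: lessThan_Suc_atMost\<close>)
qed

text \<open>Written as a normalised square modulus of \<open>\<Sum> exp (i j u)\<close>, so that positivity is evident; \<open>fejer_kernel_eq\<close> is the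
  expansion into cosines.\<close>

definition fejer_kernel :: "nat \<Rightarrow> real \<Rightarrow> real" where
  "fejer_kernel N u = ((\<Sum>j<N. cos (real j * u))\<^sup>2 + (\<Sum>j<N. sin (real j * u))\<^sup>2) / real N"

lemma fejer_kernel_nonneg: "fejer_kernel N u \<ge> 0"
  by (simp add: fejer_kernel_def)

lemma fejer_kernel_eq:
  "fejer_kernel N u = (\<Sum>i<N. \<Sum>j<N. cos (real_of_int (int i - int j) * u)) / real N"
proof -
  have "(\<Sum>i<N. \<Sum>j<N. cos (real_of_int (int i - int j) * u)) =
     (\<Sum>i<N. \<Sum>j<N. cos (real i * u) * cos (real j * u) + sin (real i * u) * sin (real j * u))"
    by (intro sum.cong) (auto simp: cos_diff left_diff_distrib)
  also have "\<dots> = (\<Sum>j<N. cos (real j * u))\<^sup>2 + (\<Sum>j<N. sin (real j * u))\<^sup>2"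
    by (simp add: sum.distrib power2_eq_square sum_product)
  finally show ?thesis by (simp add: fejer_kernel_def)
qed

text \<open>The geometric sum gives \<open>|1 - exp (i u)|\<^sup>2 |\<Sum> exp (i j u)|\<^sup>2 = |1 - exp (i N u)|\<^sup>2 \<le> 4\<close>, and
  \<open>|1 - exp (i u)|\<^sup>2 = 2 (1 - cos u)\<close>. The kernel times \<open>1 - cos u\<close> tends to 0 uniformly, which is its concentration at multiples
  of \<open>2 \<pi>\<close>.\<close>

lemma fejer_kernel_concentrates:
  assumes "N > 0"
  shows "fejer_kernel N u * (1 - cos u) \<le> 2 / real N"
proof -
  let ?z = "cis u" and ?S = "\<Sum>j<N. cis (real j * u)"
  have S: "(\<Sum>j<N. ?z ^ j) = ?S" by (intro sum.cong refl Complex.DeMoivre)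
  have "(1 - ?z) * ?S = 1 - ?z ^ N"
    using one_diff_power_eq[of ?z N] S by simp
  then have "(cmod (1 - ?z))\<^sup>2 * (cmod ?S)\<^sup>2 = (cmod (1 - ?z ^ N))\<^sup>2"
    by (metis norm_mult power_mult_distrib)
  also have "\<dots> \<le> 2\<^sup>2"
    using norm_triangle_ineq4[of 1 "?z ^ N"] by (intro power_mono) (auto simp: norm_power)
  finally have "(cmod (1 - ?z))\<^sup>2 * (cmod ?S)\<^sup>2 \<le> 4" by simp
  moreover have "(cmod (1 - ?z))\<^sup>2 = 2 * (1 - cos u)"
  proof -
    have "(cmod (1 - ?z))\<^sup>2 = 1 - 2 * cos u + ((cos u)\<^sup>2 + (sin u)\<^sup>2)"
      unfolding cmod_power2 by (simp add: power2_eq_square algebra_simps)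
    then show ?thesis by simp
  qed
  moreover have "(cmod ?S)\<^sup>2 = real N * fejer_kernel N u"
    using assms by (simp add: cmod_power2 fejer_kernel_def)
  ultimately show ?thesis using assms by (simp add: field_simps)
qed

lemma fejer_kernel_continuous [continuous_intros]:
  "continuous_on (A :: real set) f \<Longrightarrow> continuous_on A (\<lambda>x. fejer_kernel N (f x))"
  unfolding fejer_kernel_eq divide_inverse by (intro continuous_intros) auto

lemma integral_cos_shift_mult:
  assumes "continuous_on {-pi..pi} g"
  shows "integral {-pi..pi} (\<lambda>x. g x * cos (d * (x - t))) =
    cos (d * t) * integral {-pi..pi} (\<lambda>x. g x * cos (d * x)) + sin (d * t) * integral {-pi..pi} (\<lambda>x. g x * sin (d * x))"
proof -
  have "(\<lambda>x. g x * cos (d * (x - t))) = (\<lambda>x. cos (d * t) * (g x * cos (d * x)) + sin (d * t) * (g x * sin (d * x)))"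
    by (simp add: fun_eq_iff cos_diff right_diff_distrib algebra_simps)
  then show ?thesis using assms
    by (simp only:) (subst integral_add, auto intro!: integrable_continuous_real continuous_intros)
qed

lemma integral_fejer_kernel:
  assumes "N > 0"
  shows "integral {-pi..pi} (\<lambda>x. fejer_kernel N (x - t)) = 2 * pi"
proof -
  have c: "integral {-pi..pi} (\<lambda>x. cos (real_of_int d * (x - t))) = (if d = 0 then 2 * pi else 0)" for d
    using integral_cos_shift_mult[of "\<lambda>_. 1" "real_of_int d" t]
    by (auto simp: integral_cos_multiple integral_sin_multiple)
  have "integral {-pi..pi} (\<lambda>x. fejer_kernel N (x - t)) =
     (\<Sum>i<N. \<Sum>j<N. integral {-pi..pi} (\<lambda>x. cos (real_of_int (int i - int j) * (x - t)))) / real N"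
    unfolding fejer_kernel_eq integral_divide
    by (subst integral_double_sum) (intro continuous_intros, simp)
  also have "\<dots> = (\<Sum>i<N. \<Sum>j<N. if i = j then 2 * pi else 0) / real N"
    unfolding c by simp
  also have "\<dots> = 2 * pi" using assms by (simp add: sum.delta')
  finally show ?thesis .
qed

lemma periodic_int:
  fixes g :: "real \<Rightarrow> 'a"
  assumes "\<And>t. g (t + 2 * pi) = g t"
  shows "g (t + 2 * pi * real_of_int n) = g t"
proof -
  have nat: "g (t + 2 * pi * real m) = g t" for m t
  proof (induction m)
    case (Suc m)
    have "g (t + 2 * pi * real (Suc m)) = g ((t + 2 * pi * real m) + 2 * pi)" by (simp add: algebra_simps)
    then show ?case using Suc assms by simp
  qed simp
  show ?thesis
  proof (cases "n \<ge> 0")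
    case True then show ?thesis using nat[of t "nat n"] by simp
  next
    case False
    have "g (t + 2 * pi * real_of_int n) = g ((t + 2 * pi * real_of_int n) + 2 * pi * real (nat (- n)))"
      by (rule nat[symmetric])
    also have "(t + 2 * pi * real_of_int n) + 2 * pi * real (nat (- n)) = t" using False by simp
    finally show ?thesis .
  qed
qed

lemma reduce_mod_2pi: "\<exists>n::int. \<bar>y - 2 * pi * real_of_int n\<bar> \<le> pi"
proof -
  have "\<bar>y / (2 * pi) - real_of_int (round (y / (2 * pi)))\<bar> \<le> 1 / 2"
    using of_int_round_abs_le[of "y / (2 * pi)"] by (simp add: abs_minus_commute)
  then have "2 * pi * \<bar>y / (2 * pi) - real_of_int (round (y / (2 * pi)))\<bar> \<le> 2 * pi * (1 / 2)"
    by (intro mult_left_mono) auto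
  also have "2 * pi * \<bar>y / (2 * pi) - real_of_int (round (y / (2 * pi)))\<bar> =
     \<bar>2 * pi * (y / (2 * pi) - real_of_int (round (y / (2 * pi))))\<bar>" by (simp add: abs_mult)
  also have "2 * pi * (y / (2 * pi) - real_of_int (round (y / (2 * pi)))) = y - 2 * pi * real_of_int (round (y / (2 * pi)))"
    by (simp add: field_simps)
  finally show ?thesis by auto
qed

text \<open>Uniform continuity with \<open>1 - cos (x - t)\<close> as distance, in the style of Korovkin's theorem: for points closer than \<open>d'\<close>
  modulo the period the difference is at most \<open>e\<close>; for the others \<open>1 - cos\<close> is at least
  \<open>1 - cos d'\<close> and the bound \<open>2 B\<close> on the difference is absorbed. This form fits \<open>fejer_kernel_concentrates\<close>.\<close>

lemma periodic_modulus:
  fixes g :: "real \<Rightarrow> real"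
  assumes g: "continuous_on UNIV g" and per: "\<And>t. g (t + 2 * pi) = g t" and e: "e > 0"
  obtains M where "M \<ge> 0" "\<And>x t. \<bar>g x - g t\<bar> \<le> e + M * (1 - cos (x - t))"
proof -
  have cpt: "compact {-2*pi..2*pi::real}" by simp
  have "uniformly_continuous_on {-2*pi..2*pi} g"
    by (intro compact_uniformly_continuous continuous_on_subset[OF g]) auto
  then obtain d where d: "d > 0" "\<And>x t. x \<in> {-2*pi..2*pi} \<Longrightarrow> t \<in> {-2*pi..2*pi} \<Longrightarrow> \<bar>x - t\<bar> < d \<Longrightarrow> \<bar>g x - g t\<bar> < e"
    unfolding uniformly_continuous_on_def using e by (metis dist_real_def abs_minus_commute)
  have "compact (g ` {-2*pi..2*pi})"
    by (intro compact_continuous_image continuous_on_subset[OF g]) auto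
  then obtain B where B: "\<And>x. x \<in> {-2*pi..2*pi} \<Longrightarrow> \<bar>g x\<bar> \<le> B"
    by (metis compact_imp_bounded bounded_iff imageI real_norm_def)
  have B0: "B \<ge> 0" using B[of 0] by auto
  define d' where "d' = min d pi"
  have d': "0 < d'" "d' \<le> pi" using d by (auto simp: d'_def)
  have c1: "cos d' < 1" using cos_monotone_0_pi[of 0 d'] d' by auto
  show thesis
  proof (rule that[of "2 * B / (1 - cos d')"])
    show "2 * B / (1 - cos d') \<ge> 0" using B0 c1 by simp
    fix x t
    obtain n where n: "\<bar>t - 2 * pi * real_of_int n\<bar> \<le> pi" using reduce_mod_2pi by blast
    define t' where "t' = t - 2 * pi * real_of_int n"
    obtain m where m: "\<bar>(x - t') - 2 * pi * real_of_int m\<bar> \<le> pi" using reduce_mod_2pi by blast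
    define x' where "x' = x - 2 * pi * real_of_int m"
    have r: "x' \<in> {-2*pi..2*pi}" "t' \<in> {-2*pi..2*pi}" "\<bar>x' - t'\<bar> \<le> pi"
      using n m by (auto simp: x'_def t'_def abs_le_iff)
    have gx: "g x' = g x" "g t' = g t"
      using periodic_int[where g = g, OF per, of "x - 2 * pi * real_of_int m" m] periodic_int[where g = g, OF per, of "t - 2 * pi * real_of_int n" n] by (auto simp: x'_def t'_def)
    have "cos (x' - t') = cos ((x' - t') + 2 * pi * real_of_int (m - n))"
      by (rule periodic_int[symmetric]) simp
    also have "\<dots> = cos (x - t)" by (simp add: x'_def t'_def algebra_simps)
    finally have cc: "cos (x' - t') = cos (x - t)" .
    show "\<bar>g x - g t\<bar> \<le> e + 2 * B / (1 - cos d') * (1 - cos (x - t))"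
    proof (cases "\<bar>x' - t'\<bar> < d'")
      case True
      then have "\<bar>g x' - g t'\<bar> < e" using d(2)[OF r(1,2)] by (simp add: d'_def)
      moreover have "0 \<le> 2 * B / (1 - cos d') * (1 - cos (x - t))"
        using B0 c1 by (intro mult_nonneg_nonneg) auto
      ultimately show ?thesis using gx by simp
    next
      case False
      have "cos \<bar>x' - t'\<bar> \<le> cos d'" using False d' r(3) by (intro cos_monotone_0_pi_le) auto
      then have "1 - cos d' \<le> 1 - cos (x - t)" using cc by (simp add: cos_abs_real)
      then have "2 * B / (1 - cos d') * (1 - cos d') \<le> 2 * B / (1 - cos d') * (1 - cos (x - t))"
        using B0 c1 by (intro mult_left_mono) auto
      moreover have "\<bar>g x - g t\<bar> \<le> 2 * B" using B[OF r(1)] B[OF r(2)] gx by linarith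
      ultimately show ?thesis using c1 e by simp
    qed
  qed
qed

text \<open>The Fejer means of an odd continuous function are sine sums whose coefficients are those of \<open>g\<close>, damped by
  factors of modulus at most 1. What matters for \<open>sine_parseval\<close> is that the approximating coefficients are dominated by those
  of \<open>g\<close>, not just that sine sums are dense.\<close>

lemma fejer_sine:
  fixes g :: "real \<Rightarrow> real"
  assumes g: "continuous_on UNIV g" and per: "\<And>t. g (t + 2 * pi) = g t"
    and odd: "\<And>t. g (- t) = - g t" and e: "e > 0"
  obtains n c where "\<And>k. \<bar>c k\<bar> \<le> 1" "\<And>t. \<bar>g t - (\<Sum>k<n. c k * sine_coeff g k * sin (real k * t))\<bar> \<le> e"
proof -
  obtain M where M: "M \<ge> 0" "\<And>x t. \<bar>g x - g t\<bar> \<le> e / 2 + M * (1 - cos (x - t))"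
    using periodic_modulus[OF g per, of "e / 2"] e by auto
  obtain N :: nat where N: "N > 0" "2 * M / real N < e / 2"
  proof -
    obtain N :: nat where "4 * M / e < real N" using reals_Archimedean2 by blast
    then show thesis using M(1) e by (intro that[of "Suc N"]) (auto simp: field_simps)
  qed
  have gc: "continuous_on A g" for A using g continuous_on_subset by blast
  define A where "A t = integral {-pi..pi} (\<lambda>x. g x * fejer_kernel N (x - t)) / (2 * pi)" for t
  have err: "\<bar>A t - g t\<bar> \<le> e" for t
  proof -
    have "A t - g t = integral {-pi..pi} (\<lambda>x. (g x - g t) * fejer_kernel N (x - t)) / (2 * pi)"
    proof -
      have "integral {-pi..pi} (\<lambda>x. (g x - g t) * fejer_kernel N (x - t)) =
          integral {-pi..pi} (\<lambda>x. g x * fejer_kernel N (x - t)) - integral {-pi..pi} (\<lambda>x. g t * fejer_kernel N (x - t))"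
        unfolding left_diff_distrib
        by (intro integral_diff integrable_continuous_real continuous_intros gc)
      also have "integral {-pi..pi} (\<lambda>x. g t * fejer_kernel N (x - t)) = g t * (2 * pi)"
        by (simp add: integral_fejer_kernel[OF N(1)])
      finally show ?thesis by (simp add: A_def field_simps)
    qed
    moreover have "norm (integral {-pi..pi} (\<lambda>x. (g x - g t) * fejer_kernel N (x - t))) \<le>
        integral {-pi..pi} (\<lambda>x. e / 2 * fejer_kernel N (x - t) + M * (2 / real N))"
    proof (rule integral_norm_bound_integral)
      fix x assume "x \<in> {-pi..pi}"
      have "norm ((g x - g t) * fejer_kernel N (x - t)) \<le> (e / 2 + M * (1 - cos (x - t))) * fejer_kernel N (x - t)"
        using M(2) fejer_kernel_nonneg by (auto simp: abs_mult intro!: mult_right_mono)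
      also have "\<dots> = e / 2 * fejer_kernel N (x - t) + M * (fejer_kernel N (x - t) * (1 - cos (x - t)))"
        by (simp add: algebra_simps)
      also have "\<dots> \<le> e / 2 * fejer_kernel N (x - t) + M * (2 / real N)"
        using fejer_kernel_concentrates[OF N(1)] M(1) by (intro add_left_mono mult_left_mono) auto
      finally show "norm ((g x - g t) * fejer_kernel N (x - t)) \<le> e / 2 * fejer_kernel N (x - t) + M * (2 / real N)" .
    qed (intro integrable_continuous_real continuous_intros gc)+
    moreover have "integral {-pi..pi} (\<lambda>x. e / 2 * fejer_kernel N (x - t) + M * (2 / real N)) =
        e / 2 * (2 * pi) + M * (2 / real N) * (2 * pi)"
    proof (subst integral_add)
      show "(\<lambda>x. e / 2 * fejer_kernel N (x - t)) integrable_on {-pi..pi}"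
        by (intro integrable_continuous_real continuous_intros)
      show "(\<lambda>x. M * (2 / real N)) integrable_on {-pi..pi}"
        by (intro integrable_continuous_real continuous_intros)
    qed (use integral_fejer_kernel[OF N(1), of t] in simp_all)
    ultimately have "\<bar>A t - g t\<bar> \<le> (e / 2 * (2 * pi) + M * (2 / real N) * (2 * pi)) / (2 * pi)"
      by (simp add: abs_divide divide_right_mono)
    also have "\<dots> = e / 2 + 2 * M / real N" using N(1) by (simp add: field_simps)
    finally show ?thesis using N(2) by simp
  qed
  (* The kernel is a sum over pairs \<open>(i, j)\<close> of cosines of \<open>(i - j) u\<close>; \<open>c k\<close> counts the pairs with
     |i - j| = k, divided by 2 N since A carries the factor 1 / (2 pi) and a coefficient carries 1 / pi. *)
  define c where "c k = real (card {(i, j). i < N \<and> j < N \<and> nat \<bar>int i - int j\<bar> = k}) / (2 * real N)" for k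
  have c1: "\<bar>c k\<bar> \<le> 1" for k
  proof -
    have "{(i, j). i < N \<and> j < N \<and> nat \<bar>int i - int j\<bar> = k} \<subseteq>
       (\<lambda>i. (i, i + k)) ` {..<N} \<union> (\<lambda>i. (i + k, i)) ` {..<N}"
    proof clarify
      fix i j assume a: "i < N" "j < N" "(i, j) \<notin> (\<lambda>x. (x + nat \<bar>int i - int j\<bar>, x)) ` {..<N}"
      show "(i, j) \<in> (\<lambda>x. (x, x + nat \<bar>int i - int j\<bar>)) ` {..<N}"
      proof (cases "i \<le> j")
        case True then show ?thesis using a by (auto intro!: image_eqI[of _ _ i])
      next
        case False
        then have "(i, j) \<in> (\<lambda>x. (x + nat \<bar>int i - int j\<bar>, x)) ` {..<N}"
          using a by (auto intro!: image_eqI[of _ _ j])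
        then show ?thesis using a by auto
      qed
    qed
    then have "card {(i, j). i < N \<and> j < N \<and> nat \<bar>int i - int j\<bar> = k} \<le>
       card ((\<lambda>i. (i, i + k)) ` {..<N} \<union> (\<lambda>i. (i + k, i)) ` {..<N})"
      by (intro card_mono) auto
    also have "\<dots> \<le> card ((\<lambda>i. (i, i + k)) ` {..<N}) + card ((\<lambda>i. (i + k, i)) ` {..<N})"
      by (rule card_Un_le)
    also have "\<dots> \<le> N + N" by (intro add_mono order_trans[OF card_image_le]) auto
    finally show ?thesis using N(1) by (simp add: c_def field_simps)
  qed
  have A_eq: "A t = (\<Sum>k<N. c k * sine_coeff g k * sin (real k * t))" for t
  proof -
    let ?h = "\<lambda>k. pi * sine_coeff g k * sin (real k * t)"
    have cos0: "integral {-pi..pi} (\<lambda>x. g x * cos (d * x)) = 0" for d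
    proof -
      have "integral {-pi..pi} (\<lambda>x. g (-x) * cos (d * (- x))) = integral {-pi..pi} (\<lambda>x. g x * cos (d * x))"
        using Henstock_Kurzweil_Integration.integral_reflect_real[of pi "-pi" "\<lambda>x. g x * cos (d * x)"] by simp
      then show ?thesis by (simp add: odd)
    qed
    have I: "integral {-pi..pi} (\<lambda>x. g x * cos (real_of_int d * (x - t))) = ?h (nat \<bar>d\<bar>)" for d
    proof -
      have "integral {-pi..pi} (\<lambda>x. g x * cos (real_of_int d * (x - t))) =
          sin (real_of_int d * t) * integral {-pi..pi} (\<lambda>x. g x * sin (real_of_int d * x))"
        by (subst integral_cos_shift_mult[OF gc]) (simp add: cos0)
      also have "\<dots> = ?h (nat \<bar>d\<bar>)"
        by (cases "d \<ge> 0") (simp_all add: sine_coeff_def)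
      finally show ?thesis .
    qed
    have "A t = integral {-pi..pi} (\<lambda>x. (\<Sum>i<N. \<Sum>j<N. g x * cos (real_of_int (int i - int j) * (x - t))) / real N) / (2 * pi)"
      unfolding A_def fejer_kernel_eq by (simp add: sum_distrib_left)
    also have "\<dots> = (\<Sum>i<N. \<Sum>j<N. integral {-pi..pi} (\<lambda>x. g x * cos (real_of_int (int i - int j) * (x - t)))) / real N / (2 * pi)"
      unfolding integral_divide
      by (subst integral_double_sum) (intro continuous_intros gc, simp)
    also have "\<dots> = (\<Sum>i<N. \<Sum>j<N. ?h (nat \<bar>int i - int j\<bar>)) / real N / (2 * pi)"
      unfolding I ..
    also have "(\<Sum>i<N. \<Sum>j<N. ?h (nat \<bar>int i - int j\<bar>)) = (\<Sum>(i, j)\<in>{..<N} \<times> {..<N}. ?h (nat \<bar>int i - int j\<bar>))"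
      by (rule sum.cartesian_product)
    also have "\<dots> = (\<Sum>k<N. \<Sum>x\<in>{x \<in> {..<N} \<times> {..<N}. (\<lambda>(i, j). nat \<bar>int i - int j\<bar>) x = k}. (\<lambda>(i, j). ?h (nat \<bar>int i - int j\<bar>)) x)"
      by (rule sum.group[symmetric]) auto
    also have "\<dots> = (\<Sum>k<N. (2 * real N * c k) * ?h k)"
    proof (rule sum.cong[OF refl])
      fix k
      have "{x \<in> {..<N} \<times> {..<N}. (\<lambda>(i, j). nat \<bar>int i - int j\<bar>) x = k} = {(i, j). i < N \<and> j < N \<and> nat \<bar>int i - int j\<bar> = k}"
        by auto
      moreover have "(\<Sum>x\<in>{(i, j). i < N \<and> j < N \<and> nat \<bar>int i - int j\<bar> = k}. (\<lambda>(i, j). ?h (nat \<bar>int i - int j\<bar>)) x)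
        = (\<Sum>x\<in>{(i, j). i < N \<and> j < N \<and> nat \<bar>int i - int j\<bar> = k}. ?h k)"
        by (intro sum.cong) auto
      ultimately show "(\<Sum>x\<in>{x \<in> {..<N} \<times> {..<N}. (\<lambda>(i, j). nat \<bar>int i - int j\<bar>) x = k}. (\<lambda>(i, j). ?h (nat \<bar>int i - int j\<bar>)) x) = (2 * real N * c k) * ?h k"
        using N(1) by (simp add: c_def)
    qed
    also have "\<dots> / real N / (2 * pi) = (\<Sum>k<N. c k * sine_coeff g k * sin (real k * t))"
      using N(1) by (simp add: sum_divide_distrib field_simps)
    finally show ?thesis .
  qed
  show thesis
    by (rule that[of c N]) (use c1 err A_eq in \<open>auto simp: abs_minus_commute\<close>)
qed

section \<open>Sine series of finite weighted energy\<close>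

definition sine_series :: "(nat \<Rightarrow> real) \<Rightarrow> real \<Rightarrow> real" where
  "sine_series b t = (\<Sum>k. b k * sin (real k * t))"

lemma sine_series_summable:
  assumes "summable (\<lambda>k. \<bar>b k\<bar>)"
  shows "summable (\<lambda>k. b k * sin (real k * t))"
proof (rule summable_comparison_test'[OF assms])
  fix n show "norm (b n * sin (real n * t)) \<le> \<bar>b n\<bar>"
    by (simp add: abs_mult mult_left_le)
qed

lemma sine_series_le:
  assumes "summable (\<lambda>k. \<bar>b k\<bar>)"
  shows "\<bar>sine_series b t\<bar> \<le> (\<Sum>k. \<bar>b k\<bar>)"
proof -
  have s: "summable (\<lambda>k. norm (b k * sin (real k * t)))"
    by (rule summable_comparison_test'[OF assms, of 0]) (simp add: abs_mult mult_left_le)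
  have "norm (sine_series b t) \<le> (\<Sum>k. norm (b k * sin (real k * t)))"
    unfolding sine_series_def by (rule summable_norm[OF s])
  also have "\<dots> \<le> (\<Sum>k. \<bar>b k\<bar>)"
    by (rule suminf_le[OF _ s assms]) (simp add: abs_mult mult_left_le)
  finally show ?thesis by simp
qed

lemma sine_series_diff:
  assumes "summable (\<lambda>k. \<bar>b k\<bar>)" "summable (\<lambda>k. \<bar>c k\<bar>)"
  shows "sine_series b t - sine_series c t = sine_series (\<lambda>k. b k - c k) t"
  unfolding sine_series_def
  by (subst suminf_diff[OF sine_series_summable sine_series_summable])
     (use assms in \<open>auto simp: algebra_simps\<close>)

lemma sine_series_continuous:
  assumes "summable (\<lambda>k. \<bar>b k\<bar>)"
  shows "continuous_on A (sine_series b)"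
proof -
  have "uniform_limit A (\<lambda>n x. \<Sum>i<n. b i * sin (real i * x)) (\<lambda>x. \<Sum>i. b i * sin (real i * x)) sequentially"
    by (rule Weierstrass_m_test[OF _ assms]) (simp add: abs_mult mult_left_le)
  then have "continuous_on A (\<lambda>x. \<Sum>i. b i * sin (real i * x))"
    by (rule uniform_limit_theorem[rotated]) (auto intro!: continuous_intros always_eventually)
  then show ?thesis by (simp add: sine_series_def[abs_def])
qed

lemma sine_series_periodic: "sine_series b (t + 2 * pi) = sine_series b t"
  by (simp only: sine_series_def sin_nat_periodic)

lemma sine_series_odd:
  assumes "summable (\<lambda>k. \<bar>b k\<bar>)"
  shows "sine_series b (- t) = - sine_series b t"
proof -
  have "(\<lambda>k. b k * sin (real k * - t)) = (\<lambda>k. - (b k * sin (real k * t)))" by simp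
  then show ?thesis
    unfolding sine_series_def using suminf_minus[OF sine_series_summable[OF assms, of t]] by simp
qed

lemma sine_series_add_single:
  assumes "summable (\<lambda>k. \<bar>b k\<bar>)"
  shows "sine_series (b(k := b k + h)) t = sine_series b t + h * sin (real k * t)"
proof -
  have "(\<lambda>j. (if j = k then h * sin (real k * t) else 0)) sums (h * sin (real k * t))"
    using sums_If_finite_set[of "{k}" "\<lambda>_. h * sin (real k * t)"] by simp
  with sine_series_summable[OF assms, of t, THEN summable_sums] 
  have "(\<lambda>j. b j * sin (real j * t) + (if j = k then h * sin (real k * t) else 0)) sums
     (sine_series b t + h * sin (real k * t))"
    unfolding sine_series_def by (rule sums_add)
  moreover have "(\<lambda>j. b j * sin (real j * t) + (if j = k then h * sin (real k * t) else 0)) =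
     (\<lambda>j. (b(k := b k + h)) j * sin (real j * t))" by (auto simp: algebra_simps)
  ultimately show ?thesis unfolding sine_series_def by (simp add: sums_iff)
qed

definition energy :: "(nat \<Rightarrow> real) \<Rightarrow> (nat \<Rightarrow> real) \<Rightarrow> real" where
  "energy w b = (\<Sum>k. w k * (b k)\<^sup>2)"

text \<open>Cauchy-Schwarz for \<open>sqrt (w k) |b k|\<close> and \<open>1 / sqrt (w k)\<close>: the one-dimensional Sobolev embedding.\<close>

lemma weighted_l1_bound:
  assumes w: "\<And>k. 0 < w k" "summable (\<lambda>k. 1 / w k)" and b: "summable (\<lambda>k. w k * (b k)\<^sup>2)"
  shows "summable (\<lambda>k. \<bar>b k\<bar>)" "(\<Sum>k. \<bar>b k\<bar>) \<le> sqrt (energy w b) * sqrt (\<Sum>k. 1 / w k)"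
proof -
  have fin: "(\<Sum>k<n. \<bar>b k\<bar>) \<le> sqrt (energy w b) * sqrt (\<Sum>k. 1 / w k)" for n
  proof -
    have "(\<Sum>k<n. \<bar>b k\<bar>) = (\<Sum>k<n. (sqrt (w k) * \<bar>b k\<bar>) * (1 / sqrt (w k)))"
      using w(1) by (intro sum.cong) (auto simp: less_imp_neq[THEN not_sym])
    then have "(\<Sum>k<n. \<bar>b k\<bar>)\<^sup>2 = (\<Sum>k<n. (sqrt (w k) * \<bar>b k\<bar>) * (1 / sqrt (w k)))\<^sup>2" by simp
    also have "\<dots> \<le> (\<Sum>k<n. (sqrt (w k) * \<bar>b k\<bar>)\<^sup>2) * (\<Sum>k<n. (1 / sqrt (w k))\<^sup>2)"
      by (rule Cauchy_Schwarz_ineq_sum)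
    also have "\<dots> = (\<Sum>k<n. w k * (b k)\<^sup>2) * (\<Sum>k<n. 1 / w k)"
      using w(1) by (simp add: power_mult_distrib power_divide less_imp_le)
    also have "\<dots> \<le> energy w b * (\<Sum>k. 1 / w k)"
      unfolding energy_def using w(1)
      by (intro mult_mono sum_le_suminf b w suminf_nonneg sum_nonneg) (auto simp: less_imp_le)
    finally have "sqrt ((\<Sum>k<n. \<bar>b k\<bar>)\<^sup>2) \<le> sqrt (energy w b * (\<Sum>k. 1 / w k))"
      by (rule real_sqrt_le_mono)
    then show ?thesis by (simp add: real_sqrt_mult sum_nonneg)
  qed
  show s: "summable (\<lambda>k. \<bar>b k\<bar>)"
    by (rule bounded_imp_summable[OF _ , of _ "sqrt (energy w b) * sqrt (\<Sum>k. 1 / w k)"])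
       (use fin[of "Suc _"] in \<open>auto simp: lessThan_Suc_atMost\<close>)
  show "(\<Sum>k. \<bar>b k\<bar>) \<le> sqrt (energy w b) * sqrt (\<Sum>k. 1 / w k)"
    by (rule suminf_le_const[OF s fin])
qed

lemma energy_split:
  assumes b: "summable (\<lambda>k. w k * (b k)\<^sup>2)"
  shows "(\<lambda>j. w j * ((b(k := b k + h)) j)\<^sup>2) sums (energy w b + 2 * h * w k * b k + h\<^sup>2 * w k)"
proof -
  have "(\<lambda>j. (if j = k then 2 * h * w k * b k + h\<^sup>2 * w k else 0)) sums (2 * h * w k * b k + h\<^sup>2 * w k)"
    using sums_If_finite_set[of "{k}" "\<lambda>_. 2 * h * w k * b k + h\<^sup>2 * w k"] by simp
  from sums_add[OF summable_sums[OF b] this]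
  have "(\<lambda>j. w j * (b j)\<^sup>2 + (if j = k then 2 * h * w k * b k + h\<^sup>2 * w k else 0)) sums
     (energy w b + 2 * h * w k * b k + h\<^sup>2 * w k)" by (simp add: energy_def add.assoc)
  moreover have "(\<lambda>j. w j * (b j)\<^sup>2 + (if j = k then 2 * h * w k * b k + h\<^sup>2 * w k else 0)) =
     (\<lambda>j. w j * ((b(k := b k + h)) j)\<^sup>2)" by (auto simp: algebra_simps power2_eq_square)
  ultimately show ?thesis by simp
qed

text \<open>The compactness of that embedding: by \<open>weighted_l1_bound\<close> for the shifted weights the tails are uniformly small on the
  ball, and the finitely many remaining coordinates converge.\<close>

lemma energy_ball_coordinatewise_imp_l1:
  fixes c :: "nat \<Rightarrow> nat \<Rightarrow> real"
  assumes w: "\<And>k. 0 < w k" "summable (\<lambda>k. 1 / w k)"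
    and c: "\<And>n. summable (\<lambda>k. w k * (c n k)\<^sup>2)" "\<And>n. energy w (c n) \<le> R"
    and lim: "\<And>k. (\<lambda>n. c n k) \<longlonglongrightarrow> 0"
  shows "(\<lambda>n. \<Sum>k. \<bar>c n k\<bar>) \<longlonglongrightarrow> 0"
proof (rule LIMSEQ_I)
  fix e :: real assume e: "0 < e"
  have "(\<lambda>K. (\<Sum>k. 1 / w (k + K))) \<longlonglongrightarrow> 0" using suminf_exist_split2[OF w(2)] .
  then have "(\<lambda>K. sqrt R * sqrt (\<Sum>k. 1 / w (k + K))) \<longlonglongrightarrow> sqrt R * sqrt 0"
    by (intro tendsto_intros)
  then have "\<forall>\<^sub>F K in sequentially. sqrt R * sqrt (\<Sum>k. 1 / w (k + K)) < e / 2"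
    using e by (intro order_tendstoD) auto
  then obtain K where K: "sqrt R * sqrt (\<Sum>k. 1 / w (k + K)) < e / 2"
    by (auto simp: eventually_sequentially)
  have "(\<lambda>n. \<Sum>k<K. \<bar>c n k\<bar>) \<longlonglongrightarrow> (\<Sum>k<K. \<bar>0\<bar>)"
    by (intro tendsto_intros lim)
  then have "\<forall>\<^sub>F n in sequentially. (\<Sum>k<K. \<bar>c n k\<bar>) < e / 2"
    using e by (intro order_tendstoD) auto
  then obtain N where N: "\<And>n. n \<ge> N \<Longrightarrow> (\<Sum>k<K. \<bar>c n k\<bar>) < e / 2"
    by (auto simp: eventually_sequentially)
  show "\<exists>N. \<forall>n\<ge>N. norm ((\<Sum>k. \<bar>c n k\<bar>) - 0) < e"
  proof (intro exI allI impI)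
    fix n assume n: "n \<ge> N"
    have s: "summable (\<lambda>k. \<bar>c n k\<bar>)" by (rule weighted_l1_bound(1)[OF w c(1)])
    have sK: "summable (\<lambda>k. w (k + K) * (c n (k + K))\<^sup>2)"
      using summable_ignore_initial_segment[OF c(1)] .
    have "(\<Sum>k. \<bar>c n (k + K)\<bar>) \<le> sqrt (energy (\<lambda>k. w (k + K)) (\<lambda>k. c n (k + K))) * sqrt (\<Sum>k. 1 / w (k + K))"
      by (rule weighted_l1_bound(2)[of "\<lambda>k. w (k + K)" "\<lambda>k. c n (k + K)"])
         (use w sK summable_ignore_initial_segment[OF w(2)] in auto)
    also have "\<dots> \<le> sqrt R * sqrt (\<Sum>k. 1 / w (k + K))"
    proof (intro mult_right_mono real_sqrt_le_mono)
      have "energy w (c n) = (\<Sum>k. w (k + K) * (c n (k + K))\<^sup>2) + (\<Sum>k<K. w k * (c n k)\<^sup>2)"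
        unfolding energy_def by (rule suminf_split_initial_segment[OF c(1)])
      moreover have "(\<Sum>k<K. w k * (c n k)\<^sup>2) \<ge> 0" using w(1) by (intro sum_nonneg) (simp add: less_imp_le)
      ultimately show "energy (\<lambda>k. w (k + K)) (\<lambda>k. c n (k + K)) \<le> R"
        using c(2)[of n] unfolding energy_def by linarith
      show "0 \<le> sqrt (\<Sum>k. 1 / w (k + K))"
        using w(1) by (intro real_sqrt_ge_zero suminf_nonneg summable_ignore_initial_segment[OF w(2)]) (simp add: less_imp_le)
    qed
    also have "\<dots> < e / 2" by (rule K)
    finally have "(\<Sum>k. \<bar>c n (k + K)\<bar>) < e / 2" .
    moreover have "(\<Sum>k. \<bar>c n k\<bar>) = (\<Sum>k. \<bar>c n (k + K)\<bar>) + (\<Sum>k<K. \<bar>c n k\<bar>)"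
      by (rule suminf_split_initial_segment[OF s])
    moreover have "(\<Sum>k. \<bar>c n k\<bar>) \<ge> 0" by (rule suminf_nonneg[OF s]) simp
    ultimately show "norm ((\<Sum>k. \<bar>c n k\<bar>) - 0) < e" using N[OF n] by simp
  qed
qed

text \<open>The tangent inequality of the convex function \<open>|x|\<^sup>r / r\<close>, obtained from Young's inequality for the product
  \<open>|x| |y|\<^sup>r\<^sup>-\<^sup>1\<close>. It turns the minimality of
  the functional into an inequality that is linear in the nonlinear term.\<close>

lemma powr_over_convex:
  fixes x y r :: real
  assumes "1 < r"
  shows "\<bar>x\<bar> powr r / r - \<bar>y\<bar> powr r / r \<ge> \<bar>y\<bar> powr (r - 2) * y * (x - y)"
proof (cases "y = 0")
  case True then show ?thesis using assms by simp
next
  case False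
  then have y: "\<bar>y\<bar> > 0" by simp
  have y2: "\<bar>y\<bar> powr (r - 2) * y * y = \<bar>y\<bar> powr r"
  proof -
    have "\<bar>y\<bar> powr r = \<bar>y\<bar> powr (r - 2) * \<bar>y\<bar> powr 2" using powr_add[of "\<bar>y\<bar>" "r - 2" 2] by simp
    also have "\<bar>y\<bar> powr 2 = y * y" using y by (simp add: powr_numeral power2_eq_square)
    finally show ?thesis by (simp add: mult.assoc)
  qed
  have y1: "\<bar>y\<bar> powr (r - 2) * \<bar>y\<bar> = \<bar>y\<bar> powr (r - 1)"
  proof -
    have "\<bar>y\<bar> powr (r - 1) = \<bar>y\<bar> powr (r - 2) * \<bar>y\<bar> powr 1" using powr_add[of "\<bar>y\<bar>" "r - 2" 1] by simp
    then show ?thesis using y by simp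
  qed
  have "\<bar>y\<bar> powr (r - 2) * y * x \<le> \<bar>y\<bar> powr (r - 2) * (\<bar>y\<bar> * \<bar>x\<bar>)"
    unfolding mult.assoc by (intro mult_left_mono) (auto simp flip: abs_mult)
  also have "\<dots> = \<bar>x\<bar> * \<bar>y\<bar> powr (r - 1)" using y1 by (simp add: mult_ac)
  also have "\<dots> \<le> \<bar>x\<bar> powr r / r + (\<bar>y\<bar> powr (r - 1)) powr (r / (r - 1)) / (r / (r - 1))"
    by (rule Youngs_inequality) (use assms in \<open>auto simp: field_simps\<close>)
  also have "(\<bar>y\<bar> powr (r - 1)) powr (r / (r - 1)) = \<bar>y\<bar> powr r"
    using assms by (simp add: powr_powr)
  finally have "\<bar>y\<bar> powr (r - 2) * y * x \<le> \<bar>x\<bar> powr r / r + \<bar>y\<bar> powr r / (r / (r - 1))" .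
  moreover have "\<bar>y\<bar> powr r / (r / (r - 1)) = \<bar>y\<bar> powr r - \<bar>y\<bar> powr r / r"
    using assms by (simp add: field_simps)
  ultimately show ?thesis using y2 by (simp add: algebra_simps)
qed

lemma continuous_powr_odd:
  fixes r :: real
  assumes "1 < r"
  shows "continuous_on A (\<lambda>x::real. \<bar>x\<bar> powr (r - 2) * x)"
proof -
  have "continuous (at x) (\<lambda>x::real. \<bar>x\<bar> powr (r - 2) * x)" for x
  proof (cases "x = 0")
    case True
    have "((\<lambda>x::real. \<bar>x\<bar> powr (r - 1)) \<longlongrightarrow> \<bar>0\<bar> powr (r - 1)) (at 0)"
      by (intro tendsto_intros tendsto_powr2) (use assms in auto)
    then have "((\<lambda>x::real. \<bar>x\<bar> powr (r - 1)) \<longlongrightarrow> 0) (at 0)" by simp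
    then have "((\<lambda>x::real. \<bar>x\<bar> powr (r - 2) * x) \<longlongrightarrow> 0) (at 0)"
    proof (rule Lim_null_comparison[rotated])
      have "\<bar>x\<bar> powr (r - 2) * \<bar>x\<bar> = \<bar>x\<bar> powr (r - 1)" for x :: real
      proof (cases "x = 0")
        case False
        have "\<bar>x\<bar> powr (r - 1) = \<bar>x\<bar> powr (r - 2) * \<bar>x\<bar> powr 1" using powr_add[of "\<bar>x\<bar>" "r - 2" 1] by simp
        then show ?thesis using False by simp
      qed (use assms in auto)
      then show "\<forall>\<^sub>F x in at 0. norm (\<bar>x\<bar> powr (r - 2) * x) \<le> \<bar>x\<bar> powr (r - 1)"
        by (intro always_eventually) (simp add: abs_mult)
    qed
    then show ?thesis using True by (simp add: continuous_at)
  next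
    case False
    then show ?thesis by (intro continuous_intros) auto
  qed
  then show ?thesis by (simp add: continuous_at_imp_continuous_on)
qed

section \<open>The variational problem for sine coefficients\<close>

text \<open>The direct method. A minimising sequence has a subsequence that converges coordinatewise and whose energies
  converge to some \<open>e\<close>. The limit \<open>b\<close> has energy at most \<open>e\<close>, and the integral term passes to the limit because
  the series converge uniformly.\<close>

lemma sine_functional_minimizer:
  fixes F :: "real \<Rightarrow> real" and al be R :: real
  assumes w: "\<And>k. 0 < w k" "summable (\<lambda>k. 1 / w k)" and al: "0 \<le> al" and be: "0 \<le> be"
    and F: "continuous_on UNIV F" and R: "0 \<le> R"
  defines "J \<equiv> \<lambda>b. al / 2 * energy w b + be / 4 * (energy w b)\<^sup>2
      - integral {-pi..pi} (\<lambda>t. F (sine_series b t))"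
    and "K \<equiv> {b. summable (\<lambda>k. w k * (b k)\<^sup>2) \<and> energy w b \<le> R}"
  obtains b where "b \<in> K" "\<And>c. c \<in> K \<Longrightarrow> J b \<le> J c"
proof -
  define M where "M = sqrt R * sqrt (\<Sum>k. 1 / w k)"
  have w0: "w k \<ge> 0" for k using w(1) less_imp_le by blast
  have S0: "(\<Sum>k. 1 / w k) \<ge> 0" using w0 by (intro suminf_nonneg w) auto
  have E0: "energy w b \<ge> 0" if "b \<in> K" for b
    unfolding energy_def using that w0 by (intro suminf_nonneg) (auto simp: K_def)
  have l1: "summable (\<lambda>k. \<bar>b k\<bar>)" if "b \<in> K" for b
    using that weighted_l1_bound(1)[OF w] by (auto simp: K_def)
  have bd: "\<bar>sine_series b t\<bar> \<le> M" if "b \<in> K" for b t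
  proof -
    have "\<bar>sine_series b t\<bar> \<le> (\<Sum>k. \<bar>b k\<bar>)" by (rule sine_series_le[OF l1[OF that]])
    also have "\<dots> \<le> sqrt (energy w b) * sqrt (\<Sum>k. 1 / w k)"
      using that by (intro weighted_l1_bound w) (auto simp: K_def)
    also have "\<dots> \<le> M" unfolding M_def
      using that S0 by (intro mult_right_mono real_sqrt_le_mono) (auto simp: K_def)
    finally show ?thesis .
  qed
  have "compact (F ` {-M..M})"
    by (intro compact_continuous_image continuous_on_subset[OF F]) auto
  then obtain B where B: "\<And>x. x \<in> {-M..M} \<Longrightarrow> norm (F x) \<le> B"
    by (meson compact_imp_bounded bounded_iff imageI)
  have FB: "norm (F (sine_series b t)) \<le> B" if "b \<in> K" for b t
    using bd[OF that, of t] by (intro B) auto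
  have Fint: "(\<lambda>t. F (sine_series b t)) integrable_on {-pi..pi}" if "b \<in> K" for b
    by (intro integrable_continuous_real continuous_on_compose2[OF F]
        sine_series_continuous l1 that) auto
  have bddJ: "J b \<ge> - (2 * pi * B)" if "b \<in> K" for b
  proof -
    have "norm (integral {-pi..pi} (\<lambda>t. F (sine_series b t))) \<le> integral {-pi..pi} (\<lambda>t. B)"
      by (rule integral_norm_bound_integral[OF Fint[OF that] _ FB[OF that]]) auto
    moreover have "integral {-pi..pi} (\<lambda>t. B) = 2 * pi * B" by simp
    moreover have "0 \<le> al / 2 * energy w b + be / 4 * (energy w b)\<^sup>2"
      using al be E0[OF that] by auto
    ultimately show ?thesis unfolding J_def by (simp add: abs_le_iff)
  qed
  have K0: "(\<lambda>_. 0) \<in> K" using R by (auto simp: K_def energy_def)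
  define I where "I = Inf (J ` K)"
  have bdd: "bdd_below (J ` K)" using bddJ by (auto simp: bdd_below_def)
  have I_le: "I \<le> J c" if "c \<in> K" for c unfolding I_def by (rule cINF_lower[OF bdd that])
  have "\<exists>c\<in>K. J c < I + 1 / (real n + 1)" for n
    using cINF_less_iff[OF _ bdd, of "I + 1 / (real n + 1)"] K0 by (auto simp: I_def)
  then obtain c where c: "\<And>n. c n \<in> K" "\<And>n. J (c n) < I + 1 / (real n + 1)" by metis
  have ck: "norm (c n k) \<le> M" for n k
  proof -
    have "norm (c n k) \<le> (\<Sum>k. \<bar>c n k\<bar>)"
      using sum_le_suminf[OF l1[OF c(1)], of "{k}"] by simp
    also have "\<dots> \<le> sqrt (energy w (c n)) * sqrt (\<Sum>k. 1 / w k)"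
      using c(1)[of n] by (intro weighted_l1_bound w) (auto simp: K_def)
    also have "\<dots> \<le> M" unfolding M_def
      using c(1)[of n] S0 by (intro mult_right_mono real_sqrt_le_mono) (auto simp: K_def)
    finally show ?thesis .
  qed
  obtain r1 :: "nat \<Rightarrow> nat" where r1: "strict_mono r1" "\<And>k. k \<in> UNIV \<Longrightarrow> \<exists>l. (\<lambda>n. c (r1 n) k) \<longlonglongrightarrow> l"
    by (rule function_convergent_subsequence[of UNIV c M]) (use ck in auto)
  have "\<forall>n. energy w (c (r1 n)) \<in> {0..R}" using E0 c(1) by (auto simp: K_def)
  then obtain e r2 where r2: "e \<in> {0..R}" "strict_mono (r2 :: nat \<Rightarrow> nat)" "((\<lambda>n. energy w (c (r1 n))) \<circ> r2) \<longlonglongrightarrow> e"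
    using compact_Icc[of 0 R] unfolding compact_def by metis
  define d where "d = (\<lambda>n. c (r1 (r2 n)))"
  have dK: "d n \<in> K" for n by (simp add: d_def c)
  have dE: "(\<lambda>n. energy w (d n)) \<longlonglongrightarrow> e" using r2(3) by (simp add: d_def comp_def)
  obtain b where b: "\<And>k. (\<lambda>n. c (r1 n) k) \<longlonglongrightarrow> b k" using r1(2) by (metis UNIV_I)
  have db: "(\<lambda>n. d n k) \<longlonglongrightarrow> b k" for k
    using LIMSEQ_subseq_LIMSEQ[OF b r2(2)] by (simp add: d_def comp_def)
  have part: "(\<Sum>k<n. w k * (b k)\<^sup>2) \<le> e" for n
  proof (rule LIMSEQ_le[OF _ dE])
    show "(\<lambda>j. \<Sum>k<n. w k * (d j k)\<^sup>2) \<longlonglongrightarrow> (\<Sum>k<n. w k * (b k)\<^sup>2)"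
      by (intro tendsto_intros db)
    show "\<exists>N. \<forall>j\<ge>N. (\<Sum>k<n. w k * (d j k)\<^sup>2) \<le> energy w (d j)"
      unfolding energy_def using dK w0 by (intro exI allI impI sum_le_suminf) (auto simp: K_def)
  qed
  have bs: "summable (\<lambda>k. w k * (b k)\<^sup>2)"
    by (rule bounded_imp_summable[of _ e]) (use part[of "Suc _"] w0 in \<open>auto simp: lessThan_Suc_atMost\<close>)
  have bE: "energy w b \<le> e" unfolding energy_def by (rule suminf_le_const[OF bs part])
  have bK: "b \<in> K" using bs bE r2(1) by (auto simp: K_def)
  have diffs: "summable (\<lambda>k. w k * (d n k - b k)\<^sup>2)" "energy w (\<lambda>k. d n k - b k) \<le> 4 * R" for n
  proof -
    have le: "w k * (d n k - b k)\<^sup>2 \<le> 2 * (w k * (d n k)\<^sup>2) + 2 * (w k * (b k)\<^sup>2)" for k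
    proof -
      have "(d n k - b k)\<^sup>2 \<le> 2 * (d n k)\<^sup>2 + 2 * (b k)\<^sup>2"
        using zero_le_power2[of "d n k + b k"] by (simp add: power2_eq_square algebra_simps)
      from mult_left_mono[OF this w0[of k]] show ?thesis by (simp add: algebra_simps)
    qed
    have s: "summable (\<lambda>k. 2 * (w k * (d n k)\<^sup>2) + 2 * (w k * (b k)\<^sup>2))"
      using dK[of n] bK by (intro summable_add summable_mult) (auto simp: K_def)
    show s': "summable (\<lambda>k. w k * (d n k - b k)\<^sup>2)"
      by (rule summable_comparison_test'[OF s, of 0]) (use le w0 in auto)
    have "energy w (\<lambda>k. d n k - b k) \<le> (\<Sum>k. 2 * (w k * (d n k)\<^sup>2) + 2 * (w k * (b k)\<^sup>2))"
      unfolding energy_def by (rule suminf_le[OF le s' s])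
    also have "\<dots> = 2 * energy w (d n) + 2 * energy w b"
      using dK[of n] bK unfolding energy_def
      by (subst suminf_add[symmetric]) (auto simp: K_def suminf_mult summable_mult)
    also have "\<dots> \<le> 4 * R" using dK[of n] bK by (auto simp: K_def)
    finally show "energy w (\<lambda>k. d n k - b k) \<le> 4 * R" .
  qed
  have l1conv: "(\<lambda>n. \<Sum>k. \<bar>d n k - b k\<bar>) \<longlonglongrightarrow> 0"
  proof (rule energy_ball_coordinatewise_imp_l1[OF w diffs])
    show "(\<lambda>n. d n k - b k) \<longlonglongrightarrow> 0" for k using tendsto_diff[OF db[of k] tendsto_const[of "b k"]] by simp
  qed
  have uconv: "(\<lambda>n. sine_series (d n) t) \<longlonglongrightarrow> sine_series b t" for t
  proof (rule LIM_zero_cancel, rule Lim_null_comparison[OF _ l1conv])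
    show "\<forall>\<^sub>F n in sequentially. norm (sine_series (d n) t - sine_series b t) \<le> (\<Sum>k. \<bar>d n k - b k\<bar>)"
      using sine_series_le[OF weighted_l1_bound(1)[OF w diffs(1)]]
      by (intro always_eventually allI) (simp add: sine_series_diff l1 dK bK)
  qed
  have Fconv: "(\<lambda>n. integral {-pi..pi} (\<lambda>t. F (sine_series (d n) t)))
      \<longlonglongrightarrow> integral {-pi..pi} (\<lambda>t. F (sine_series b t))"
  proof (rule dominated_convergence(2))
    show "(\<lambda>t. B) integrable_on {-pi..pi}" by auto
    show "(\<lambda>n. F (sine_series (d n) t)) \<longlonglongrightarrow> F (sine_series b t)" for t
      using F uconv[of t] by (intro continuous_on_tendsto_compose[OF F]) auto
  qed (use Fint dK FB in auto)
  have "(\<lambda>n. J (d n)) \<longlonglongrightarrow> al / 2 * e + be / 4 * e\<^sup>2 - integral {-pi..pi} (\<lambda>t. F (sine_series b t))"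
    unfolding J_def by (intro tendsto_intros dE Fconv)
  moreover have "(\<lambda>n. I + 1 / (real n + 1)) \<longlonglongrightarrow> I + 0"
    by (intro tendsto_intros) (use LIMSEQ_inverse_real_of_nat in \<open>simp add: inverse_eq_divide add.commute\<close>)
  moreover have "J (d n) \<le> I + 1 / (real n + 1)" for n
  proof -
    have "n \<le> r1 (r2 n)" using seq_suble[OF r1(1)] seq_suble[OF r2(2)] order_trans by blast
    then have "1 / (real (r1 (r2 n)) + 1) \<le> 1 / (real n + 1)" by (intro divide_left_mono) auto
    then show ?thesis using c(2)[of "r1 (r2 n)"] by (simp add: d_def)
  qed
  ultimately have "al / 2 * e + be / 4 * e\<^sup>2 - integral {-pi..pi} (\<lambda>t. F (sine_series b t)) \<le> I + 0"
    by (intro LIMSEQ_le) auto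
  moreover have "J b \<le> al / 2 * e + be / 4 * e\<^sup>2 - integral {-pi..pi} (\<lambda>t. F (sine_series b t))"
    unfolding J_def using bE E0[OF bK] al be 
    by (intro diff_right_mono add_mono mult_left_mono power_mono) auto
  ultimately have "J b \<le> J c" if "c \<in> K" for c using I_le[OF that] by simp
  then show thesis by (rule that[OF bK])
qed

text \<open>Changing one coefficient by \<open>h\<close> changes the energy by a quadratic polynomial in \<open>h\<close>, and by convexity of \<open>F\<close> it
  changes the integral by at least \<open>h\<close> times the integral of \<open>f(u) sin (k t)\<close>. Replacing the integral by this lower bound
  keeps the minimum at \<open>h = 0\<close> and leaves a polynomial, whose derivative at 0 must vanish.\<close>

lemma sine_functional_euler_lagrange:
  fixes F f :: "real \<Rightarrow> real" and al be R :: real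
  assumes w: "\<And>k. 0 < w k" "summable (\<lambda>k. 1 / w k)"
    and F: "continuous_on UNIV F" and f: "continuous_on UNIV f"
    and conv: "\<And>x y. F x - F y \<ge> f y * (x - y)"
    and b: "summable (\<lambda>k. w k * (b k)\<^sup>2)" "energy w b < R"
    and min: "\<And>c. summable (\<lambda>k. w k * (c k)\<^sup>2) \<Longrightarrow> energy w c \<le> R \<Longrightarrow> 
       al / 2 * energy w b + be / 4 * (energy w b)\<^sup>2 - integral {-pi..pi} (\<lambda>t. F (sine_series b t)) \<le>
       al / 2 * energy w c + be / 4 * (energy w c)\<^sup>2 - integral {-pi..pi} (\<lambda>t. F (sine_series c t))"
  shows "(al + be * energy w b) * w k * b k = integral {-pi..pi} (\<lambda>t. f (sine_series b t) * sin (real k * t))"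
proof -
  have l1: "summable (\<lambda>k. \<bar>b k\<bar>)" by (rule weighted_l1_bound(1)[OF w b(1)])
  define E where "E = (\<lambda>h. energy w b + 2 * h * w k * b k + h\<^sup>2 * w k)"
  define I where "I = integral {-pi..pi} (\<lambda>t. f (sine_series b t) * sin (real k * t))"
  have uc: "continuous_on A (sine_series b)" for A by (rule sine_series_continuous[OF l1])
  have "isCont E 0" unfolding E_def by (intro continuous_intros)
  moreover have "E 0 < R" using b by (simp add: E_def)
  ultimately have "\<forall>\<^sub>F h in at 0. E h < R" using order_tendstoD(2)[of E "E 0" "at 0" R] by (simp add: isCont_def)
  then obtain \<delta> where \<delta>: "0 < \<delta>" "\<And>h. h \<noteq> 0 \<Longrightarrow> \<bar>h\<bar> < \<delta> \<Longrightarrow> E h < R"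
    by (auto simp: eventually_at dist_real_def)
  have ge: "al / 2 * E h + be / 4 * (E h)\<^sup>2 - h * I \<ge> al / 2 * E 0 + be / 4 * (E 0)\<^sup>2 - 0 * I"
    if h: "\<bar>h\<bar> < \<delta>" for h
  proof (cases "h = 0")
    case False
    let ?c = "b(k := b k + h)"
    have sums: "(\<lambda>j. w j * (?c j)\<^sup>2) sums E h" unfolding E_def by (rule energy_split[OF b(1)])
    then have Ec: "energy w ?c = E h" by (simp add: energy_def sums_iff)
    have cs: "summable (\<lambda>j. w j * (?c j)\<^sup>2)" using sums by (rule sums_summable)
    have l1c: "summable (\<lambda>k. \<bar>?c k\<bar>)" by (rule weighted_l1_bound(1)[OF w cs])
    have "energy w ?c \<le> R" using \<delta>(2)[OF False h] Ec by simp
    note m = min[OF cs this]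
    have "integral {-pi..pi} (\<lambda>t. h * (f (sine_series b t) * sin (real k * t))) \<le>
       integral {-pi..pi} (\<lambda>t. F (sine_series ?c t) - F (sine_series b t))"
    proof (rule integral_le)
      show "(\<lambda>t. h * (f (sine_series b t) * sin (real k * t))) integrable_on {- pi..pi}"
        by (intro integrable_continuous_real continuous_intros continuous_on_compose2[OF f] uc) auto
      show "(\<lambda>t. F (sine_series ?c t) - F (sine_series b t)) integrable_on {- pi..pi}"
        by (intro integrable_continuous_real continuous_intros continuous_on_compose2[OF F]
            uc sine_series_continuous[OF l1c]) auto
      show "h * (f (sine_series b t) * sin (real k * t)) \<le> F (sine_series ?c t) - F (sine_series b t)" for t
        using conv[where x = "sine_series ?c t" and y = "sine_series b t"]
        unfolding sine_series_add_single[OF l1] by (simp add: mult_ac)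
    qed
    also have "\<dots> = integral {-pi..pi} (\<lambda>t. F (sine_series ?c t)) - integral {-pi..pi} (\<lambda>t. F (sine_series b t))"
      by (intro integral_diff integrable_continuous_real continuous_on_compose2[OF F]
            uc sine_series_continuous[OF l1c]) auto
    finally have "h * I \<le> \<dots>" by (simp add: I_def)
    with m show ?thesis unfolding Ec by (simp add: E_def)
  qed simp
  have "((\<lambda>h. al / 2 * E h + be / 4 * (E h)\<^sup>2 - h * I) has_real_derivative
      (al / 2 * (2 * w k * b k) + be / 4 * (2 * energy w b * (2 * w k * b k)) - I)) (at 0)"
    unfolding E_def by (auto intro!: derivative_eq_intros)
  from DERIV_local_min[OF this \<delta>(1)] ge
  have "al / 2 * (2 * w k * b k) + be / 4 * (2 * energy w b * (2 * w k * b k)) - I = 0" by auto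
  then show ?thesis by (simp add: I_def algebra_simps)
qed

definition nonlinearity :: "real \<Rightarrow> real \<Rightarrow> real \<Rightarrow> real \<Rightarrow> real" where
  "nonlinearity lam q p x = lam * \<bar>x\<bar> powr (q - 2) * x + \<bar>x\<bar> powr (p - 2) * x"

lemma nonlinearity_continuous:
  assumes "1 < q" "1 < p"
  shows "continuous_on A (nonlinearity lam q p)"
proof -
  have "continuous_on A (\<lambda>x. lam * (\<bar>x\<bar> powr (q - 2) * x) + \<bar>x\<bar> powr (p - 2) * x)"
    by (intro continuous_intros continuous_powr_odd assms)
  then show ?thesis by (simp add: nonlinearity_def[abs_def] mult.assoc)
qed

text \<open>By \<open>weighted_l1_bound\<close>, \<open>|u| \<le> r S\<close> on the ball of energy \<open>r\<^sup>2\<close>, hence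
  \<open>\<integral>F(u) \<le> \<lambda> D r\<^sup>q + C r\<^sup>p\<close> there. The radius makes the second term an eighth of \<open>al r\<^sup>2\<close>, possible as
  \<open>p > 2\<close>, and \<open>L\<close> does the same for the first term, so on the sphere the functional is positive.\<close>

lemma sine_problem_solution:
  fixes al be q p :: real
  assumes w: "\<And>k. 0 < w k" "summable (\<lambda>k. 1 / w k)" and al: "0 < al" and be: "0 \<le> be"
    and q: "1 < q" "q < 2" and p: "2 < p"
  obtains L where "0 < L" "\<And>lam. 0 < lam \<Longrightarrow> lam < L \<Longrightarrow>
    \<exists>b. summable (\<lambda>k. w k * (b k)\<^sup>2) \<and> (\<exists>k. b k \<noteq> 0) \<and>
      (\<forall>k. (al + be * energy w b) * w k * b k =
         integral {-pi..pi} (\<lambda>t. nonlinearity lam q p (sine_series b t) * sin (real k * t)))"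
proof -
  define S where "S = sqrt (\<Sum>k. 1 / w k)"
  have "(\<Sum>k. 1 / w k) > 0" using w by (intro suminf_pos) auto
  then have S: "S > 0" by (simp add: S_def)
  define C where "C = 2 * pi / p * S powr p"
  define D where "D = 2 * pi / q * S powr q"
  have C: "C > 0" and D: "D > 0" using S p q by (auto simp: C_def D_def)
  define r where "r = (al / (8 * C)) powr (1 / (p - 2))"
  have r: "r > 0" using al C by (simp add: r_def)
  have rp: "C * r powr p = al * r\<^sup>2 / 8"
  proof -
    have "r powr (p - 2) = al / (8 * C)" using al C p by (simp add: r_def powr_powr)
    moreover have "r powr p = r powr (p - 2) * r powr 2" using powr_add[of r "p - 2" 2] by simp
    ultimately show ?thesis using C r by (simp add: powr_numeral field_simps)
  qed
  define L where "L = al * r\<^sup>2 / (8 * D * r powr q)"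
  have L: "L > 0" using al r D by (simp add: L_def)
  show thesis
  proof (rule that[OF L])
    fix lam assume lam: "0 < lam" "lam < L"
    define F where "F = (\<lambda>x. lam * (\<bar>x\<bar> powr q / q) + \<bar>x\<bar> powr p / p)"
    have Fc: "continuous_on UNIV F" unfolding F_def
      using q p by (intro continuous_intros continuous_on_powr') auto
    have Fconv: "F x - F y \<ge> nonlinearity lam q p y * (x - y)" for x y
    proof -
      have "lam * (\<bar>x\<bar> powr q / q - \<bar>y\<bar> powr q / q) \<ge> lam * (\<bar>y\<bar> powr (q - 2) * y * (x - y))"
        using lam q by (intro mult_left_mono powr_over_convex) auto
      moreover have "\<bar>x\<bar> powr p / p - \<bar>y\<bar> powr p / p \<ge> \<bar>y\<bar> powr (p - 2) * y * (x - y)"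
        using p by (intro powr_over_convex) auto
      ultimately show ?thesis by (simp add: F_def nonlinearity_def algebra_simps)
    qed
    let ?E = "energy w"
    let ?Int = "\<lambda>b. integral {-pi..pi} (\<lambda>t. F (sine_series b t))"
    have w0: "w k \<ge> 0" for k using w(1) less_imp_le by blast
    have al0: "0 \<le> al" and r2: "0 \<le> r\<^sup>2" using al by auto
    obtain b where b': "b \<in> {b. summable (\<lambda>k. w k * (b k)\<^sup>2) \<and> ?E b \<le> r\<^sup>2}"
      and min': "\<And>c. c \<in> {b. summable (\<lambda>k. w k * (b k)\<^sup>2) \<and> ?E b \<le> r\<^sup>2} \<Longrightarrow>
         al / 2 * ?E b + be / 4 * (?E b)\<^sup>2 - ?Int b \<le> al / 2 * ?E c + be / 4 * (?E c)\<^sup>2 - ?Int c"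
      by (rule sine_functional_minimizer[OF w al0 be Fc r2]) (use that in blast)
    have b: "summable (\<lambda>k. w k * (b k)\<^sup>2)" "?E b \<le> r\<^sup>2" using b' by auto
    have min: "\<And>c. summable (\<lambda>k. w k * (c k)\<^sup>2) \<Longrightarrow> ?E c \<le> r\<^sup>2 \<Longrightarrow>
         al / 2 * ?E b + be / 4 * (?E b)\<^sup>2 - ?Int b \<le> al / 2 * ?E c + be / 4 * (?E c)\<^sup>2 - ?Int c"
      using min' by blast
    have neg: "al / 2 * ?E b + be / 4 * (?E b)\<^sup>2 - ?Int b < 0"
    proof -
      (* At eps sin t the positive terms are of order eps^2, while the term with exponent q is of order eps^q,
         and q < 2. *)
      define A where "A = al / 2 * w 1 + be / 4 * (w 1)\<^sup>2"
      have "((\<lambda>\<epsilon>. \<epsilon> powr (2 - q) * A) \<longlongrightarrow> 0 powr (2 - q) * A) (at_right 0)"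
        using q by (intro tendsto_intros tendsto_powr2) (auto intro: eventually_mono[OF eventually_at_right_less])
      then have e1: "\<forall>\<^sub>F \<epsilon> in at_right 0. \<epsilon> powr (2 - q) * A < lam * pi / q"
        using lam q by (intro order_tendstoD) auto
      have "((\<lambda>\<epsilon>. w 1 * \<epsilon>\<^sup>2) \<longlongrightarrow> w 1 * 0\<^sup>2) (at_right 0)" by (intro tendsto_intros)
      then have e2: "\<forall>\<^sub>F \<epsilon> in at_right 0. w 1 * \<epsilon>\<^sup>2 < r\<^sup>2" using r by (intro order_tendstoD) auto
      have e3: "\<forall>\<^sub>F \<epsilon> in at_right (0::real). 0 < \<epsilon> \<and> \<epsilon> < 1"
        using eventually_at_right_real[of 0 1] by (auto elim: eventually_mono)
      obtain \<epsilon> where \<epsilon>: "\<epsilon> powr (2 - q) * A < lam * pi / q" "w 1 * \<epsilon>\<^sup>2 < r\<^sup>2" "0 < \<epsilon>" "\<epsilon> < 1"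
        using eventually_happens[OF eventually_conj[OF e1 eventually_conj[OF e2 e3]]] by auto
      define c where "c = (\<lambda>k::nat. if k = 1 then \<epsilon> else 0)"
      have "(\<lambda>k. if k = 1 then w 1 * \<epsilon>\<^sup>2 else 0) sums (w 1 * \<epsilon>\<^sup>2)"
        using sums_If_finite_set[of "{1::nat}" "\<lambda>_. w 1 * \<epsilon>\<^sup>2"] by simp
      moreover have "(\<lambda>k. if k = 1 then w 1 * \<epsilon>\<^sup>2 else 0) = (\<lambda>k. w k * (c k)\<^sup>2)" by (auto simp: c_def)
      ultimately have cE: "(\<lambda>k. w k * (c k)\<^sup>2) sums (w 1 * \<epsilon>\<^sup>2)" by simp
      then have cs: "summable (\<lambda>k. w k * (c k)\<^sup>2)" and Ec: "?E c = w 1 * \<epsilon>\<^sup>2"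
        by (auto simp: sums_iff energy_def)
      have uc: "sine_series c t = \<epsilon> * sin t" for t
      proof -
        have "(\<lambda>k. if k = 1 then \<epsilon> * sin t else 0) sums (\<epsilon> * sin t)"
          using sums_If_finite_set[of "{1::nat}" "\<lambda>_. \<epsilon> * sin t"] by simp
        moreover have "(\<lambda>k. if k = 1 then \<epsilon> * sin t else 0) = (\<lambda>k. c k * sin (real k * t))" by (auto simp: c_def)
        ultimately show ?thesis by (simp add: sine_series_def sums_iff)
      qed
      have "lam * \<epsilon> powr q / q * pi \<le> ?Int c"
      proof -
        have "lam * \<epsilon> powr q / q * pi = integral {-pi..pi} (\<lambda>t. lam * \<epsilon> powr q / q * (sin (real 1 * t) * sin (real 1 * t)))"
          using integral_sin_sin[of 1 1] by simp
        also have "\<dots> \<le> ?Int c"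
        proof (rule integral_le)
          fix t :: real
          have "(sin t)\<^sup>2 \<le> \<bar>sin t\<bar> powr q"
          proof (cases "sin t = 0")
            case False
            have "(sin t)\<^sup>2 = \<bar>sin t\<bar> powr 2" using False by (simp add: powr_numeral)
            also have "\<dots> \<le> \<bar>sin t\<bar> powr q" using False q by (intro powr_mono') auto
            finally show ?thesis .
          qed simp
          then have "lam * \<epsilon> powr q / q * (sin t)\<^sup>2 \<le> lam * \<epsilon> powr q / q * \<bar>sin t\<bar> powr q"
            using lam q by (intro mult_left_mono) auto
          also have "\<dots> = lam * (\<bar>\<epsilon> * sin t\<bar> powr q / q)" using \<epsilon>(3) by (simp add: abs_mult powr_mult)
          also have "\<dots> \<le> F (\<epsilon> * sin t)" using p by (simp add: F_def)
          finally show "lam * \<epsilon> powr q / q * (sin (real 1 * t) * sin (real 1 * t)) \<le> F (sine_series c t)"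
            by (simp add: uc power2_eq_square)
        qed (use q in \<open>auto simp: uc intro!: integrable_continuous_real continuous_intros continuous_on_compose2[OF Fc]\<close>)
        finally show ?thesis .
      qed
      moreover have "al / 2 * ?E c + be / 4 * (?E c)\<^sup>2 < lam * \<epsilon> powr q / q * pi"
      proof -
        have "\<epsilon>\<^sup>2 * \<epsilon>\<^sup>2 \<le> \<epsilon>\<^sup>2 * 1" using \<epsilon> by (intro mult_left_mono power_le_one) auto
        then have "be / 4 * (w 1)\<^sup>2 * (\<epsilon>\<^sup>2 * \<epsilon>\<^sup>2) \<le> be / 4 * (w 1)\<^sup>2 * \<epsilon>\<^sup>2"
          using be by (intro mult_left_mono) auto
        then have "al / 2 * ?E c + be / 4 * (?E c)\<^sup>2 \<le> \<epsilon>\<^sup>2 * A"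
          by (simp add: Ec A_def power_mult_distrib algebra_simps power2_eq_square)
        also have "\<epsilon>\<^sup>2 = \<epsilon> powr (2 - q) * \<epsilon> powr q" using \<epsilon>(3) powr_add[of \<epsilon> "2 - q" q] by (simp add: powr_numeral)
        also have "\<epsilon> powr (2 - q) * \<epsilon> powr q * A < \<epsilon> powr q * (lam * pi / q)"
          using mult_strict_left_mono[OF \<epsilon>(1), of "\<epsilon> powr q"] \<epsilon>(3) by (simp add: mult_ac)
        finally show ?thesis by (simp add: mult_ac)
      qed
      ultimately show ?thesis using min[OF cs] \<epsilon>(2) Ec by fastforce
    qed
    have inner: "?E b < r\<^sup>2"
    proof (rule ccontr)
      assume "\<not> ?E b < r\<^sup>2"
      then have Eb: "?E b = r\<^sup>2" using b(2) by simp
      have ub: "\<bar>sine_series b t\<bar> \<le> r * S" for t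
        using sine_series_le[OF weighted_l1_bound(1)[OF w b(1)], of t] weighted_l1_bound(2)[OF w b(1)] r
        by (simp add: Eb S_def)
      have "?Int b \<le> integral {-pi..pi} (\<lambda>t. lam * ((r * S) powr q / q) + (r * S) powr p / p)"
      proof (rule integral_le)
        show "F (sine_series b t) \<le> lam * ((r * S) powr q / q) + (r * S) powr p / p" for t
          unfolding F_def using lam q p ub[of t]
          by (intro add_mono mult_left_mono divide_right_mono powr_mono2) auto
      qed (auto intro!: integrable_continuous_real continuous_on_compose2[OF Fc]
             sine_series_continuous weighted_l1_bound(1)[OF w b(1)])
      also have "\<dots> = lam * (D * r powr q) + C * r powr p"
        using r S by (simp add: D_def C_def powr_mult field_simps)
      also have "lam * (D * r powr q) \<le> L * (D * r powr q)"
        using lam D by (intro mult_right_mono) auto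
      also have "L * (D * r powr q) = al * r\<^sup>2 / 8" using D r by (simp add: L_def)
      finally have "?Int b \<le> al * r\<^sup>2 / 8 + al * r\<^sup>2 / 8" using rp by simp
      moreover have "al * r\<^sup>2 > 0" using al r by simp
      moreover have "be / 4 * (?E b)\<^sup>2 \<ge> 0" using be by simp
      moreover have "al / 2 * ?E b = al * r\<^sup>2 / 2" by (simp add: Eb)
      ultimately show False using neg by linarith
    qed
    have "\<exists>k. b k \<noteq> 0"
    proof (rule ccontr)
      assume "\<not> (\<exists>k. b k \<noteq> 0)"
      then have "b = (\<lambda>_. 0)" by auto
      then show False using neg q p by (simp add: energy_def sine_series_def F_def)
    qed
    moreover have "(al + be * ?E b) * w k * b k =
         integral {-pi..pi} (\<lambda>t. nonlinearity lam q p (sine_series b t) * sin (real k * t))" for k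
      by (rule sine_functional_euler_lagrange[OF w Fc _ Fconv b(1) inner min])
         (use q p in \<open>auto intro!: nonlinearity_continuous\<close>)
    ultimately show "\<exists>b. summable (\<lambda>k. w k * (b k)\<^sup>2) \<and> (\<exists>k. b k \<noteq> 0) \<and>
      (\<forall>k. (al + be * energy w b) * w k * b k =
         integral {-pi..pi} (\<lambda>t. nonlinearity lam q p (sine_series b t) * sin (real k * t)))"
      using b(1) by blast
  qed
qed

text \<open>The equation gives \<open>sqrt (w k) |b k|\<close> as a product of a square-summable coefficient and \<open>1 / sqrt (w k)\<close>.\<close>

lemma sine_coeff_regularity:
  assumes w: "\<And>k. 0 < w k" "summable (\<lambda>k. 1 / w k)" and g: "continuous_on {-pi..pi} g"
    and eq: "\<And>k. w k * b k = c * sine_coeff g k"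
  shows "summable (\<lambda>k. sqrt (w k) * \<bar>b k\<bar>)"
proof (rule summable_comparison_test'[of _ 0])
  show "summable (\<lambda>k. \<bar>c\<bar> * ((sine_coeff g k)\<^sup>2 + 1 / w k))"
    by (intro summable_mult summable_add bessel_sine[OF g] w)
  fix k
  have s: "sqrt (w k) > 0" "sqrt (w k) * sqrt (w k) = w k" using w(1)[of k] by auto
  have "\<bar>b k\<bar> = \<bar>c\<bar> * \<bar>sine_coeff g k\<bar> / w k"
    using arg_cong[OF eq[of k], of abs] w(1)[of k] by (simp add: abs_mult field_simps)
  then have "sqrt (w k) * \<bar>b k\<bar> = \<bar>c\<bar> * (\<bar>sine_coeff g k\<bar> * (1 / sqrt (w k)))"
    using s by (simp add: field_simps)
  also have "\<dots> \<le> \<bar>c\<bar> * ((sine_coeff g k)\<^sup>2 + 1 / w k)"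
  proof (intro mult_left_mono)
    have "0 \<le> (\<bar>sine_coeff g k\<bar> - 1 / sqrt (w k))\<^sup>2" by simp
    also have "\<dots> = (sine_coeff g k)\<^sup>2 + 1 / w k - 2 * (\<bar>sine_coeff g k\<bar> * (1 / sqrt (w k)))"
      using s w(1)[of k] by (simp add: power2_diff power_divide)
    finally show "\<bar>sine_coeff g k\<bar> * (1 / sqrt (w k)) \<le> (sine_coeff g k)\<^sup>2 + 1 / w k"
      using mult_nonneg_nonneg[of "\<bar>sine_coeff g k\<bar>" "1 / sqrt (w k)"] s by (smt (verit) divide_nonneg_pos)
  qed simp
  finally show "norm (sqrt (w k) * \<bar>b k\<bar>) \<le> \<bar>c\<bar> * ((sine_coeff g k)\<^sup>2 + 1 / w k)"
    using s by simp
qed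

section \<open>Integrals of Bessel type\<close>

text \<open>For \<open>z > 0\<close> the integral over \<open>t\<close> is \<open>2 z\<^sup>\<sigma>\<^sup>/\<^sup>2 K\<^sub>\<sigma>(2 sqrt z)\<close> with the modified Bessel function \<open>K\<^sub>\<sigma>\<close>,
  and for \<open>z = 0\<close> it is the Gamma integral. Negative \<open>\<sigma>\<close> occurs for derivatives; then \<open>z\<close> must be positive.\<close>

definition bessel_kernel :: "real \<Rightarrow> real \<Rightarrow> real \<Rightarrow> real" where
  "bessel_kernel \<sigma> z t = t powr (\<sigma> - 1) * exp (- t - z / t)"

definition bessel_int :: "real \<Rightarrow> real \<Rightarrow> real" where
  "bessel_int \<sigma> z = integral {0<..} (bessel_kernel \<sigma> z)"

lemma bessel_kernel_pos: "t > 0 \<Longrightarrow> bessel_kernel \<sigma> z t > 0"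
  by (simp add: bessel_kernel_def)

lemma bessel_kernel_measurable: "bessel_kernel \<sigma> z \<in> borel_measurable (lebesgue_on {0<..})"
  unfolding bessel_kernel_def[abs_def]
  by (intro continuous_imp_measurable_on_sets_lebesgue continuous_intros) auto

lemma bessel_kernel_integrable_0:
  assumes "\<sigma> > 0"
  shows "bessel_kernel \<sigma> 0 integrable_on {0<..}"
proof -
  have "(\<lambda>t. t powr (\<sigma> - 1) / exp t) integrable_on {0..}"
    by (rule has_integral_integrable[OF Gamma_integral_real[OF assms]])
  then have "(\<lambda>t. t powr (\<sigma> - 1) / exp t) integrable_on {0<..}"
    by (rule integrable_spike_set) (auto intro: negligible_subset[OF negligible_sing[of 0]])
  moreover have "bessel_kernel \<sigma> 0 = (\<lambda>t. t powr (\<sigma> - 1) / exp t)"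
    unfolding bessel_kernel_def divide_inverse exp_minus[symmetric] by (rule ext) simp
  ultimately show ?thesis by simp
qed

lemma power_le_exp: 
  fixes x :: real
  assumes "x \<ge> 0" "n > 0"
  shows "x ^ n \<le> real n ^ n * exp x"
proof -
  have "x / real n \<le> exp (x / real n)" using exp_ge_add_one_self[of "x / real n"] by linarith
  then have "(x / real n) ^ n \<le> exp (x / real n) ^ n" using assms by (intro power_mono) auto
  also have "exp (x / real n) ^ n = exp x" using assms by (simp flip: exp_of_nat_mult)
  finally show ?thesis using assms by (simp add: power_divide field_simps)
qed

text \<open>For \<open>\<sigma> \<le> 0\<close> the factor \<open>exp (- z/t)\<close> compensates the singularity at 0: it is at most a constant times \<open>t\<^sup>n\<close>.\<close>

lemma bessel_kernel_integrable:
  assumes "z \<ge> 0" "\<sigma> > 0 \<or> z > 0"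
  shows "bessel_kernel \<sigma> z integrable_on {0<..}"
proof (cases "\<sigma> > 0")
  case True
  show ?thesis
  proof (rule measurable_bounded_by_integrable_imp_integrable[OF bessel_kernel_measurable bessel_kernel_integrable_0[OF True]])
    show "norm (bessel_kernel \<sigma> z t) \<le> bessel_kernel \<sigma> 0 t" if "t \<in> {0<..}" for t
      using that assms by (simp add: bessel_kernel_def)
  qed auto
next
  case False
  then have z: "z > 0" using assms by auto
  obtain n :: nat where n: "- \<sigma> < real n" using reals_Archimedean2 by blast
  with False have n0: "n > 0" by (intro gr0I) auto
  show ?thesis
  proof (rule measurable_bounded_by_integrable_imp_integrable[OF bessel_kernel_measurable])
    show "(\<lambda>t. (real n ^ n / z ^ n) * bessel_kernel (\<sigma> + real n) 0 t) integrable_on {0<..}"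
      using n by (intro integrable_on_mult_right bessel_kernel_integrable_0) auto
    show "norm (bessel_kernel \<sigma> z t) \<le> (real n ^ n / z ^ n) * bessel_kernel (\<sigma> + real n) 0 t" if "t \<in> {0<..}" for t
    proof -
      have t: "t > 0" using that by simp
      have "(z / t) ^ n \<le> real n ^ n * exp (z / t)" using z t n0 by (intro power_le_exp) auto
      then have "z ^ n / t ^ n \<le> real n ^ n * exp (z / t)" by (simp add: power_divide)
      then have "z ^ n / t ^ n * (t ^ n * exp (- (z / t)) / z ^ n) \<le> real n ^ n * exp (z / t) * (t ^ n * exp (- (z / t)) / z ^ n)"
        using z t by (intro mult_right_mono) auto
      moreover have "z ^ n / t ^ n * (t ^ n * exp (- (z / t)) / z ^ n) = exp (- (z / t))" using z t by simp
      moreover have "real n ^ n * exp (z / t) * (t ^ n * exp (- (z / t)) / z ^ n) = real n ^ n / z ^ n * t ^ n * (exp (z / t) * exp (- (z / t)))"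
        by simp
      moreover have "exp (z / t) * exp (- (z / t)) = 1" by (simp flip: exp_add)
      ultimately have "exp (- (z / t)) \<le> real n ^ n / z ^ n * t ^ n" by (metis mult.right_neutral)
      then have "t powr (\<sigma> - 1) * exp (- t) * exp (- (z / t)) \<le> t powr (\<sigma> - 1) * exp (- t) * (real n ^ n / z ^ n * t ^ n)"
        by (intro mult_left_mono) auto
      also have "\<dots> = (real n ^ n / z ^ n) * bessel_kernel (\<sigma> + real n) 0 t"
      proof -
        have "t powr (\<sigma> + real n - 1) = t powr (\<sigma> - 1) * t ^ n"
          using t powr_add[of t "\<sigma> - 1" "real n"] by (simp add: powr_realpow algebra_simps)
        then show ?thesis by (simp add: bessel_kernel_def)
      qed
      also have "t powr (\<sigma> - 1) * exp (- t) * exp (- (z / t)) = norm (bessel_kernel \<sigma> z t)"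
        by (simp add: bessel_kernel_def exp_add[symmetric] mult.assoc)
      finally show ?thesis .
    qed
  qed auto
qed

lemma bessel_int_mono:
  assumes "z \<ge> 0" "\<sigma> > 0 \<or> z > 0" "z \<le> z'"
  shows "bessel_int \<sigma> z' \<le> bessel_int \<sigma> z"
  unfolding bessel_int_def
proof (rule integral_le)
  show "bessel_kernel \<sigma> z' t \<le> bessel_kernel \<sigma> z t" if "t \<in> {0<..}" for t
  proof -
    have "z / t \<le> z' / t" using assms that by (intro divide_right_mono) auto
    then show ?thesis unfolding bessel_kernel_def by (intro mult_left_mono) auto
  qed
  show "bessel_kernel \<sigma> z integrable_on {0<..}" "bessel_kernel \<sigma> z' integrable_on {0<..}"
    using assms by (force intro: bessel_kernel_integrable)+
qed

lemma bessel_int_pos: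
  assumes "z \<ge> 0" "\<sigma> > 0 \<or> z > 0"
  shows "bessel_int \<sigma> z > 0"
proof -
  have "integral {1..2::real} (bessel_kernel \<sigma> z) \<le> bessel_int \<sigma> z"
    unfolding bessel_int_def
    by (intro integral_subset_le integrable_on_subinterval[OF bessel_kernel_integrable[OF assms]] bessel_kernel_integrable assms)
       (auto simp: bessel_kernel_def)
  moreover have "integral {1..2::real} (bessel_kernel \<sigma> z) > 0"
  proof -
    have c: "continuous_on {1..2} (bessel_kernel \<sigma> z)" unfolding bessel_kernel_def[abs_def]
      by (intro continuous_intros) auto
    then obtain x where x: "x \<in> {1..2}" "\<And>t. t \<in> {1..2} \<Longrightarrow> bessel_kernel \<sigma> z x \<le> bessel_kernel \<sigma> z t"
      using continuous_attains_inf[of "{1..2}" "bessel_kernel \<sigma> z"] by auto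
    have "0 < bessel_kernel \<sigma> z x" using x by (intro bessel_kernel_pos) auto
    also have "\<dots> = integral {1..2::real} (\<lambda>_. bessel_kernel \<sigma> z x)" by simp
    also have "\<dots> \<le> integral {1..2::real} (bessel_kernel \<sigma> z)"
      using x c by (intro integral_le integrable_continuous_real) auto
    finally show ?thesis .
  qed
  ultimately show ?thesis by linarith
qed

lemma exp_second_order:
  fixes u :: real
  shows "\<bar>exp u - 1 - u\<bar> \<le> u\<^sup>2 * exp \<bar>u\<bar>"
proof -
  have 1: "0 \<le> exp u - 1 - u" using exp_ge_add_one_self[of u] by linarith
  have "1 - u \<le> exp (- u)" using exp_ge_add_one_self[of "-u"] by linarith
  then have "exp u * (1 - u) \<le> exp u * exp (- u)" by (intro mult_left_mono) auto
  then have 2: "exp u - 1 - u \<le> u * (exp u - 1)" by (simp add: algebra_simps flip: exp_add)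
  show ?thesis
  proof (cases "u \<ge> 0")
    case True
    have "exp u - 1 \<le> u * exp u" using \<open>exp u * (1 - u) \<le> _\<close> by (simp add: algebra_simps flip: exp_add)
    then have "u * (exp u - 1) \<le> u * (u * exp u)" using True by (intro mult_left_mono) auto
    then show ?thesis using 1 2 True by (simp add: power2_eq_square)
  next
    case False
    have "u * (exp u - 1) = (- u) * (1 - exp u)" by (simp add: algebra_simps)
    also have "\<dots> \<le> (- u) * (- u)" using False 1 by (intro mult_left_mono) auto
    also have "\<dots> = u\<^sup>2 * 1" by (simp add: power2_eq_square)
    also have "\<dots> \<le> u\<^sup>2 * exp \<bar>u\<bar>" by (intro mult_left_mono) auto
    finally show ?thesis using 1 2 by simp
  qed
qed

text \<open>Differentiation under the integral sign. The second-order remainder of \<open>exp (- h/t)\<close> is bounded by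
  \<open>(h/t)\<^sup>2 exp (|h|/t)\<close>, which for \<open>|h| \<le> z/2\<close> produces the kernel with \<open>\<sigma> - 2\<close> and \<open>z/2\<close>.\<close>

lemma bessel_int_deriv:
  assumes z: "z > 0"
  shows "(bessel_int \<sigma> has_real_derivative - bessel_int (\<sigma> - 1) z) (at z)"
proof -
  have int: "bessel_kernel r y integrable_on {0<..}" if "y > 0" for r y
    using that by (intro bessel_kernel_integrable) auto
  have key: "\<bar>bessel_int \<sigma> (z + h) - bessel_int \<sigma> z + h * bessel_int (\<sigma> - 1) z\<bar> \<le> h\<^sup>2 * bessel_int (\<sigma> - 2) (z / 2)"
    if h: "\<bar>h\<bar> \<le> z / 2" for h
  proof -
    have zh: "z + h > 0" "z / 2 > 0" using z h by linarith+
    have "norm (integral {0<..} (\<lambda>t. bessel_kernel \<sigma> (z + h) t - bessel_kernel \<sigma> z t + h * bessel_kernel (\<sigma> - 1) z t))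
        \<le> integral {0<..} (\<lambda>t. h\<^sup>2 * bessel_kernel (\<sigma> - 2) (z / 2) t)"
    proof (rule integral_norm_bound_integral)
      fix t :: real assume "t \<in> {0<..}"
      then have t: "t > 0" by simp
      define x where "x = 1 / t"
      have x: "x > 0" using t by (simp add: x_def)
      have k: "bessel_kernel r y t = t powr (r - 1) * exp (- t) * exp (- y * x)" for r y
        by (simp add: bessel_kernel_def x_def mult.assoc flip: exp_add)
      have k1: "bessel_kernel (\<sigma> - 1) z t = t powr (\<sigma> - 1) * exp (- t) * exp (- z * x) * x"
        using t powr_diff[of t "\<sigma> - 1" 1] unfolding k by (simp add: x_def)
      have k2: "bessel_kernel (\<sigma> - 2) (z / 2) t = t powr (\<sigma> - 1) * exp (- t) * exp (- (z / 2) * x) * x\<^sup>2"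
      proof -
        have "t powr (\<sigma> - 2 - 1) = t powr (\<sigma> - 1) * x\<^sup>2"
          using t powr_diff[of t "\<sigma> - 1" 2] by (simp add: x_def powr_numeral power_divide power2_eq_square)
        then show ?thesis unfolding k by simp
      qed
      have "bessel_kernel \<sigma> (z + h) t - bessel_kernel \<sigma> z t + h * bessel_kernel (\<sigma> - 1) z t =
          t powr (\<sigma> - 1) * exp (- t) * exp (- z * x) * (exp (- (h * x)) - 1 - (- (h * x)))"
      proof -
        have "exp (- (z + h) * x) = exp (- z * x) * exp (- (h * x))" by (simp add: algebra_simps flip: exp_add)
        then show ?thesis unfolding k1 k[of \<sigma> "z + h"] k[of \<sigma> z] by (simp add: algebra_simps)
      qed
      also have "\<bar>\<dots>\<bar> \<le> t powr (\<sigma> - 1) * exp (- t) * exp (- z * x) * ((h * x)\<^sup>2 * exp (z / 2 * x))"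
      proof -
        have "\<bar>exp (- (h * x)) - 1 - (- (h * x))\<bar> \<le> (h * x)\<^sup>2 * exp \<bar>h * x\<bar>"
          using exp_second_order[of "- (h * x)"] by simp
        also have "\<dots> \<le> (h * x)\<^sup>2 * exp (z / 2 * x)"
          using h x by (intro mult_left_mono) (auto simp: abs_mult)
        finally show ?thesis by (simp add: abs_mult mult_left_mono)
      qed
      also have "\<dots> = h\<^sup>2 * bessel_kernel (\<sigma> - 2) (z / 2) t"
      proof -
        have "exp (- z * x) * exp (z / 2 * x) = exp (- (z / 2) * x)" by (simp flip: exp_add)
        then show ?thesis unfolding k2 by (simp add: power_mult_distrib mult_ac)
      qed
      finally show "norm (bessel_kernel \<sigma> (z + h) t - bessel_kernel \<sigma> z t + h * bessel_kernel (\<sigma> - 1) z t)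
          \<le> h\<^sup>2 * bessel_kernel (\<sigma> - 2) (z / 2) t" by simp
    qed (intro integrable_add integrable_diff integrable_on_mult_right int zh z)+
    also have "integral {0<..} (\<lambda>t. bessel_kernel \<sigma> (z + h) t - bessel_kernel \<sigma> z t + h * bessel_kernel (\<sigma> - 1) z t) =
       bessel_int \<sigma> (z + h) - bessel_int \<sigma> z + h * bessel_int (\<sigma> - 1) z"
      unfolding bessel_int_def
      by (subst integral_add, (intro integrable_add integrable_diff integrable_on_mult_right int zh z)+,
          subst integral_diff, (intro int zh z)+) simp
    finally show ?thesis by (simp add: bessel_int_def)
  qed
  have lim: "((\<lambda>h. (bessel_int \<sigma> (z + h) - bessel_int \<sigma> z) / h - - bessel_int (\<sigma> - 1) z) \<longlongrightarrow> 0) (at 0)"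
  proof (rule Lim_null_comparison)
    show "((\<lambda>h. \<bar>h\<bar> * bessel_int (\<sigma> - 2) (z / 2)) \<longlongrightarrow> 0) (at 0)"
      by (auto intro!: tendsto_eq_intros)
    have "\<forall>\<^sub>F h in at 0. h \<noteq> 0 \<and> \<bar>h\<bar> < z / 2"
      using z unfolding eventually_at by (intro exI[of _ "z / 2"]) auto
    then show "\<forall>\<^sub>F h in at 0. norm ((bessel_int \<sigma> (z + h) - bessel_int \<sigma> z) / h - - bessel_int (\<sigma> - 1) z)
        \<le> \<bar>h\<bar> * bessel_int (\<sigma> - 2) (z / 2)"
    proof eventually_elim
      case (elim h)
      have "(bessel_int \<sigma> (z + h) - bessel_int \<sigma> z) / h - - bessel_int (\<sigma> - 1) z =
         (bessel_int \<sigma> (z + h) - bessel_int \<sigma> z + h * bessel_int (\<sigma> - 1) z) / h" using elim by (simp add: field_simps)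
      also have "norm \<dots> \<le> h\<^sup>2 * bessel_int (\<sigma> - 2) (z / 2) / \<bar>h\<bar>"
        using key[of h] elim by (simp add: divide_right_mono)
      also have "\<dots> = \<bar>h\<bar> * bessel_int (\<sigma> - 2) (z / 2)" 
      proof -
        have "h\<^sup>2 = \<bar>h\<bar> * \<bar>h\<bar>" by (simp add: power2_eq_square)
        then have "h\<^sup>2 / \<bar>h\<bar> = \<bar>h\<bar>" using elim by (metis nonzero_mult_div_cancel_left abs_eq_0)
        then show ?thesis by (metis times_divide_eq_left)
      qed
      finally show ?case .
    qed
  qed
  then show ?thesis unfolding DERIV_def by (rule LIM_zero_cancel)
qed

lemma bessel_int_continuous_0:
  assumes \<sigma>: "0 < \<sigma>"
  shows "(bessel_int \<sigma> \<longlongrightarrow> bessel_int \<sigma> 0) (at_right 0)"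
proof -
  (* The exponent d interpolates between the bounds 1 and z/t of 1 - exp (- z/t); it stays below sigma so that
     the resulting kernel is integrable at z = 0. *)
  define d where "d = min 1 (\<sigma> / 2)"
  have d: "0 < d" "d \<le> 1" "d < \<sigma>" using \<sigma> by (auto simp: d_def)
  have b: "\<bar>bessel_int \<sigma> z - bessel_int \<sigma> 0\<bar> \<le> z powr d * bessel_int (\<sigma> - d) 0" if z: "z > 0" for z
  proof -
    have "bessel_int \<sigma> 0 - bessel_int \<sigma> z = integral {0<..} (\<lambda>t. bessel_kernel \<sigma> 0 t - bessel_kernel \<sigma> z t)"
      unfolding bessel_int_def using z \<sigma> by (intro integral_diff[symmetric] bessel_kernel_integrable) auto
    also have "\<dots> \<le> integral {0<..} (\<lambda>t. z powr d * bessel_kernel (\<sigma> - d) 0 t)"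
    proof (rule integral_le)
      fix t :: real assume "t \<in> {0<..}"
      then have t: "t > 0" by simp
      have "1 - exp (- (z / t)) \<le> (z / t) powr d"
      proof (cases "z / t \<le> 1")
        case True
        have "1 - exp (- (z / t)) \<le> z / t" using exp_ge_add_one_self[of "- (z / t)"] by linarith
        also have "\<dots> = (z / t) powr 1" using z t by simp
        also have "\<dots> \<le> (z / t) powr d" using True z t d by (intro powr_mono') auto
        finally show ?thesis .
      next
        case False
        have "1 - exp (- (z / t)) \<le> 1" by simp
        also have "\<dots> \<le> (z / t) powr d" using False d by (intro ge_one_powr_ge_zero) auto
        finally show ?thesis .
      qed
      then have "t powr (\<sigma> - 1) * exp (- t) * (1 - exp (- (z / t))) \<le> t powr (\<sigma> - 1) * exp (- t) * (z / t) powr d"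
        by (intro mult_left_mono) auto
      also have "\<dots> = z powr d * bessel_kernel (\<sigma> - d) 0 t"
      proof -
        have "t powr (\<sigma> - d - 1) = t powr (\<sigma> - 1) / t powr d"
          using powr_diff[of t "\<sigma> - 1" d] by (simp add: algebra_simps)
        then show ?thesis using t z by (simp add: bessel_kernel_def powr_divide)
      qed
      also have "t powr (\<sigma> - 1) * exp (- t) * (1 - exp (- (z / t))) = bessel_kernel \<sigma> 0 t - bessel_kernel \<sigma> z t"
        by (simp add: bessel_kernel_def right_diff_distrib mult.assoc flip: exp_add)
      finally show "bessel_kernel \<sigma> 0 t - bessel_kernel \<sigma> z t \<le> z powr d * bessel_kernel (\<sigma> - d) 0 t" .
    qed (use \<sigma> d z in \<open>auto intro!: integrable_diff bessel_kernel_integrable integrable_on_mult_right\<close>)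
    also have "\<dots> = z powr d * bessel_int (\<sigma> - d) 0" by (simp add: bessel_int_def)
    finally show ?thesis using bessel_int_mono[of 0 \<sigma> z] z \<sigma> by auto
  qed
  have "((\<lambda>z. bessel_int \<sigma> z - bessel_int \<sigma> 0) \<longlongrightarrow> 0) (at_right 0)"
  proof (rule Lim_null_comparison)
    have "((\<lambda>z. z powr d * bessel_int (\<sigma> - d) 0) \<longlongrightarrow> 0 powr d * bessel_int (\<sigma> - d) 0) (at_right 0)"
      using d by (intro tendsto_intros tendsto_powr2) (auto intro: eventually_mono[OF eventually_at_right_less])
    then show "((\<lambda>z. z powr d * bessel_int (\<sigma> - d) 0) \<longlongrightarrow> 0) (at_right 0)" by simp
    show "\<forall>\<^sub>F z in at_right 0. norm (bessel_int \<sigma> z - bessel_int \<sigma> 0) \<le> z powr d * bessel_int (\<sigma> - d) 0"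
      using b by (auto intro: eventually_mono[OF eventually_at_right_less])
  qed
  then show ?thesis by (rule LIM_zero_cancel)
qed

text \<open>The substitution \<open>t \<mapsto> z/t\<close>, which preserves \<open>t + z/t\<close>; this is the symmetry of \<open>K\<^sub>\<sigma>\<close> in \<open>\<sigma>\<close>.\<close>

lemma bessel_int_reflect:
  fixes z :: real
  assumes z: "z > 0"
  shows "bessel_int (- \<sigma>) z = z powr (- \<sigma>) * bessel_int \<sigma> z"
proof -
  let ?g = "\<lambda>t::real. z / t" and ?g' = "\<lambda>t::real. - z / t\<^sup>2"
  have img: "?g ` {0<..} = {0<..}"
  proof (intro equalityI subsetI)
    fix x :: real assume "x \<in> {0<..}"
    then show "x \<in> ?g ` {0<..}" using z by (intro image_eqI[of _ _ "z / x"]) auto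
  qed (use z in auto)
  have eq: "\<bar>?g' t\<bar> * bessel_kernel \<sigma> z (?g t) = z powr \<sigma> * bessel_kernel (- \<sigma>) z t" if "t \<in> {0<..}" for t
  proof -
    have t: "t > 0" using that by simp
    have p: "\<bar>?g' t\<bar> * (z / t) powr (\<sigma> - 1) = z powr \<sigma> * t powr (- \<sigma> - 1)"
    proof -
      have 1: "z powr \<sigma> = z * z powr (\<sigma> - 1)" using z powr_add[of z 1 "\<sigma> - 1"] by simp
      have "t powr (\<sigma> + 1) = t powr (\<sigma> - 1) * t\<^sup>2"
        using t powr_add[of t "\<sigma> - 1" 2] by (simp add: powr_numeral add.commute)
      then have 2: "t powr (- \<sigma> - 1) = inverse (t powr (\<sigma> - 1) * t\<^sup>2)"
        using powr_minus[of t "\<sigma> + 1"] by simp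
      show ?thesis unfolding 1 2 using t z by (simp add: powr_divide divide_simps power2_eq_square)
    qed
    have e: "- (z / t) - z / (z / t) = - t - z / t" using t z by (simp add: field_simps)
    show ?thesis unfolding bessel_kernel_def e mult.assoc[symmetric] p ..
  qed
  have nn: "bessel_kernel \<sigma> z absolutely_integrable_on {0<..}"
    using z bessel_kernel_pos by (intro nonnegative_absolutely_integrable_1 bessel_kernel_integrable) (auto simp: less_imp_le)
  have "(\<lambda>t. \<bar>?g' t\<bar> * bessel_kernel \<sigma> z (?g t)) absolutely_integrable_on {0<..} \<and>
    integral {0<..} (\<lambda>t. \<bar>?g' t\<bar> * bessel_kernel \<sigma> z (?g t)) = bessel_int \<sigma> z"
    by (subst has_absolute_integral_change_of_variables_1'[where g = ?g])
       (use z nn in \<open>auto simp: img bessel_int_def inj_on_def power2_eq_square intro!: derivative_eq_intros\<close>)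
  moreover have "integral {0<..} (\<lambda>t. \<bar>?g' t\<bar> * bessel_kernel \<sigma> z (?g t)) = integral {0<..} (\<lambda>t. z powr \<sigma> * bessel_kernel (- \<sigma>) z t)"
    by (intro integral_cong eq)
  ultimately have "z powr \<sigma> * bessel_int (- \<sigma>) z = bessel_int \<sigma> z" by (simp add: bessel_int_def)
  then show ?thesis using z by (simp add: powr_minus field_simps)
qed

lemma bessel_int_decay:
  assumes "0 < \<sigma>" "0 < z"
  shows "sqrt z * bessel_int \<sigma> z \<le> bessel_int (\<sigma> + 1 / 2) 0"
proof -
  have "sqrt z * bessel_int \<sigma> z = integral {0<..} (\<lambda>t. sqrt z * bessel_kernel \<sigma> z t)"
    by (simp add: bessel_int_def)
  also have "\<dots> \<le> bessel_int (\<sigma> + 1 / 2) 0"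
    unfolding bessel_int_def
  proof (rule integral_le)
    fix t :: real assume "t \<in> {0<..}"
    then have t: "t > 0" by simp
    have "sqrt (z / t) \<le> exp (z / t)"
    proof (rule real_le_lsqrt)
      show "z / t \<le> (exp (z / t))\<^sup>2"
      proof -
        have "z / t \<le> exp (z / t)" using exp_ge_add_one_self[of "z / t"] by linarith
        also have "\<dots> \<le> exp (z / t) * exp (z / t)" using assms t by simp
        finally show ?thesis by (simp add: power2_eq_square)
      qed
    qed auto
    then have "sqrt (z / t) * exp (- (z / t)) \<le> 1" using exp_minus_inverse[of "z / t"]
      by (metis exp_ge_zero mult_right_mono)
    then have "(t powr (\<sigma> - 1 / 2) * exp (- t)) * (sqrt (z / t) * exp (- (z / t))) \<le> (t powr (\<sigma> - 1 / 2) * exp (- t)) * 1"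
      by (intro mult_left_mono) auto
    also have "(t powr (\<sigma> - 1 / 2) * exp (- t)) * (sqrt (z / t) * exp (- (z / t))) = sqrt z * bessel_kernel \<sigma> z t"
    proof -
      have "t powr (\<sigma> - 1 / 2) = t powr (\<sigma> - 1) * sqrt t"
        using t powr_add[of t "\<sigma> - 1" "1 / 2"] by (simp add: powr_half_sqrt)
      then show ?thesis using t by (simp add: bessel_kernel_def real_sqrt_divide flip: exp_add)
    qed
    also have "(t powr (\<sigma> - 1 / 2) * exp (- t)) * 1 = bessel_kernel (\<sigma> + 1 / 2) 0 t"
      by (simp add: bessel_kernel_def)
    finally show "sqrt z * bessel_kernel \<sigma> z t \<le> bessel_kernel (\<sigma> + 1 / 2) 0 t" .
  qed (use assms in \<open>auto intro!: integrable_on_mult_right bessel_kernel_integrable\<close>)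
  finally show ?thesis .
qed

lemma bessel_int_deriv_bound:
  assumes "0 < \<sigma>" "0 < z"
  shows "z * bessel_int (\<sigma> - 1) z \<le> bessel_int \<sigma> 0"
proof -
  have "z * bessel_int (\<sigma> - 1) z = integral {0<..} (\<lambda>t. z * bessel_kernel (\<sigma> - 1) z t)"
    by (simp add: bessel_int_def)
  also have "\<dots> \<le> bessel_int \<sigma> 0"
    unfolding bessel_int_def
  proof (rule integral_le)
    fix t :: real assume "t \<in> {0<..}"
    then have t: "t > 0" by simp
    have "z / t \<le> exp (z / t)" using exp_ge_add_one_self[of "z / t"] by linarith
    then have "(z / t) * exp (- (z / t)) \<le> 1" using exp_minus_inverse[of "z / t"]
      by (metis exp_ge_zero mult_right_mono)
    then have "(t powr (\<sigma> - 1) * exp (- t)) * ((z / t) * exp (- (z / t))) \<le> (t powr (\<sigma> - 1) * exp (- t)) * 1"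
      by (intro mult_left_mono) auto
    also have "(t powr (\<sigma> - 1) * exp (- t)) * ((z / t) * exp (- (z / t))) = z * bessel_kernel (\<sigma> - 1) z t"
    proof -
      have "t powr (\<sigma> - 1 - 1) = t powr (\<sigma> - 1) / t" using t powr_diff[of t "\<sigma> - 1" 1] by simp
      moreover have "exp (- t - z / t) = exp (- t) * exp (- (z / t))" by (simp flip: exp_add)
      ultimately show ?thesis by (simp add: bessel_kernel_def)
    qed
    finally show "z * bessel_kernel (\<sigma> - 1) z t \<le> bessel_kernel \<sigma> 0 t" by (simp add: bessel_kernel_def)
  qed (use assms in \<open>auto intro!: integrable_on_mult_right bessel_kernel_integrable\<close>)
  finally show ?thesis .
qed

section \<open>The vertical profile of the extension\<close>

text \<open>The solution \<open>\<theta>\<close> of \<open>(y\<^sup>1\<^sup>-\<^sup>2\<^sup>\<sigma> \<theta>')' = y\<^sup>1\<^sup>-\<^sup>2\<^sup>\<sigma> \<omega>\<^sup>2 \<theta>\<close> that equals 1 at 0 and decays at infinity. As a function of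
  \<open>y\<close> it is the Matern covariance function of smoothness \<open>\<sigma>\<close>.\<close>

definition matern :: "real \<Rightarrow> real \<Rightarrow> real \<Rightarrow> real" where
  "matern \<sigma> \<omega> y = bessel_int \<sigma> (\<omega>\<^sup>2 * y\<^sup>2 / 4) / bessel_int \<sigma> 0"

definition matern_deriv :: "real \<Rightarrow> real \<Rightarrow> real \<Rightarrow> real" where
  "matern_deriv \<sigma> \<omega> y = - (\<omega>\<^sup>2 * y / 2) * bessel_int (\<sigma> - 1) (\<omega>\<^sup>2 * y\<^sup>2 / 4) / bessel_int \<sigma> 0"

text \<open>The limit of \<open>- y\<^sup>1\<^sup>-\<^sup>2\<^sup>\<sigma> \<theta>'(y)\<close> at 0 for \<open>\<omega> = 1\<close>. The values at 0 in this quotient are Gamma integrals, so it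
  is the constant \<open>kappa \<sigma>\<close>; the ratio of the two is carried along below as a positive factor.\<close>

definition flux :: "real \<Rightarrow> real" where
  "flux \<sigma> = 2 powr (1 - 2 * \<sigma>) * bessel_int (1 - \<sigma>) 0 / bessel_int \<sigma> 0"

lemma flux_pos: "0 < \<sigma> \<Longrightarrow> \<sigma> < 1 \<Longrightarrow> 0 < flux \<sigma>"
  by (simp add: flux_def bessel_int_pos)

text \<open>This makes the profiles for \<open>\<sigma>\<close> and \<open>1 - \<sigma>\<close> conjugate: applying \<open>matern_deriv_eq\<close> twice returns the original
  profile with factor 1.\<close>

lemma flux_mult: 
  assumes "0 < \<sigma>" "\<sigma> < 1"
  shows "flux \<sigma> * flux (1 - \<sigma>) = 1"
proof -
  have "(2::real) powr (1 - 2 * \<sigma>) * 2 powr (1 - 2 * (1 - \<sigma>)) = 1" by (simp flip: powr_add)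
  moreover have "bessel_int \<sigma> 0 > 0" "bessel_int (1 - \<sigma>) 0 > 0" using assms by (auto intro!: bessel_int_pos)
  moreover have "flux \<sigma> * flux (1 - \<sigma>) = (2 powr (1 - 2 * \<sigma>) * 2 powr (1 - 2 * (1 - \<sigma>))) *
     (bessel_int (1 - \<sigma>) 0 * bessel_int \<sigma> 0) / (bessel_int \<sigma> 0 * bessel_int (1 - \<sigma>) 0)"
    by (simp add: flux_def)
  ultimately show ?thesis by simp
qed

lemma matern_pos: "0 < \<sigma> \<Longrightarrow> 0 < matern \<sigma> \<omega> y"
  by (simp add: matern_def bessel_int_pos)

lemma matern_le_1: "0 < \<sigma> \<Longrightarrow> matern \<sigma> \<omega> y \<le> 1"
  using bessel_int_mono[of 0 \<sigma> "\<omega>\<^sup>2 * y\<^sup>2 / 4"] bessel_int_pos[of 0 \<sigma>] by (simp add: matern_def)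

lemma matern_has_deriv:
  assumes "0 < \<omega>" "0 < y"
  shows "(matern \<sigma> \<omega> has_real_derivative matern_deriv \<sigma> \<omega> y) (at y)"
proof -
  have "((\<lambda>y. \<omega>\<^sup>2 * y\<^sup>2 / 4) has_real_derivative \<omega>\<^sup>2 * y / 2) (at y)"
    by (auto intro!: derivative_eq_intros)
  from DERIV_chain2[OF bessel_int_deriv this, of \<sigma>]
  have "((\<lambda>y. bessel_int \<sigma> (\<omega>\<^sup>2 * y\<^sup>2 / 4)) has_real_derivative
     - bessel_int (\<sigma> - 1) (\<omega>\<^sup>2 * y\<^sup>2 / 4) * (\<omega>\<^sup>2 * y / 2)) (at y)" using assms by simp
  from DERIV_cdivide[OF this, of "bessel_int \<sigma> 0"] show ?thesis
    unfolding matern_def[abs_def] matern_deriv_def by (simp add: mult_ac)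
qed

text \<open>The derivative of the Bessel-type integral lowers \<open>\<sigma>\<close> by one, and reflection turns \<open>\<sigma> - 1\<close> into \<open>1 - \<sigma>\<close>.\<close>

lemma matern_deriv_eq:
  assumes "0 < \<omega>" "0 < y" "0 < \<sigma>" "\<sigma> < 1"
  shows "matern_deriv \<sigma> \<omega> y = - flux \<sigma> * \<omega> powr (2 * \<sigma>) * y powr (2 * \<sigma> - 1) * matern (1 - \<sigma>) \<omega> y"
proof -
  define z where "z = \<omega>\<^sup>2 * y\<^sup>2 / 4"
  have z: "z > 0" using assms by (simp add: z_def)
  have "bessel_int (\<sigma> - 1) z = z powr (\<sigma> - 1) * bessel_int (1 - \<sigma>) z"
    using bessel_int_reflect[OF z, of "1 - \<sigma>"] by simp
  moreover have "\<omega>\<^sup>2 * y / 2 * z powr (\<sigma> - 1) = 2 powr (1 - 2 * \<sigma>) * \<omega> powr (2 * \<sigma>) * y powr (2 * \<sigma> - 1)"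
  proof -
    have lz: "ln z = 2 * ln \<omega> + 2 * ln y - 2 * ln 2"
    proof -
      have "ln z = ln (\<omega>\<^sup>2) + ln (y\<^sup>2) - ln (2\<^sup>2)" using assms unfolding z_def by (simp add: ln_div ln_mult)
      moreover have "ln (\<omega>\<^sup>2) = 2 * ln \<omega>" "ln (y\<^sup>2) = 2 * ln y" using assms by (simp_all add: ln_realpow)
      moreover have "ln ((2::real)\<^sup>2) = 2 * ln 2" using ln_realpow[of "2::real" 2] by simp
      ultimately show ?thesis by linarith
    qed
    have "\<omega>\<^sup>2 * y / 2 = exp (2 * ln \<omega> + ln y - ln 2)"
      using assms by (simp add: exp_add exp_diff exp_double)
    moreover have "z powr (\<sigma> - 1) = exp ((\<sigma> - 1) * (2 * ln \<omega> + 2 * ln y - 2 * ln 2))"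
      using z lz by (simp add: powr_def)
    moreover have "2 powr (1 - 2 * \<sigma>) * \<omega> powr (2 * \<sigma>) * y powr (2 * \<sigma> - 1) =
        exp ((1 - 2 * \<sigma>) * ln 2 + 2 * \<sigma> * ln \<omega> + (2 * \<sigma> - 1) * ln y)"
      using assms by (simp add: powr_def exp_add)
    moreover have "(2 * ln \<omega> + ln y - ln 2) + (\<sigma> - 1) * (2 * ln \<omega> + 2 * ln y - 2 * ln 2) =
       (1 - 2 * \<sigma>) * ln 2 + 2 * \<sigma> * ln \<omega> + (2 * \<sigma> - 1) * ln y" by (simp add: algebra_simps)
    ultimately show ?thesis by (metis exp_add)
  qed
  moreover have "bessel_int (1 - \<sigma>) 0 > 0" using assms by (intro bessel_int_pos) auto
  ultimately show ?thesis
    unfolding matern_deriv_def z_def[symmetric] matern_def flux_def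
    by (simp add: mult.assoc[symmetric])
qed

lemma matern_weighted_deriv:
  assumes "0 < \<omega>" "0 < y" "0 < \<sigma>" "\<sigma> < 1"
  shows "y powr (1 - 2 * \<sigma>) * matern_deriv \<sigma> \<omega> y = - flux \<sigma> * \<omega> powr (2 * \<sigma>) * matern (1 - \<sigma>) \<omega> y"
proof -
  have "y powr (1 - 2 * \<sigma>) * y powr (2 * \<sigma> - 1) = 1" using assms by (simp flip: powr_add)
  moreover have "y powr (1 - 2 * \<sigma>) * matern_deriv \<sigma> \<omega> y =
      - flux \<sigma> * \<omega> powr (2 * \<sigma>) * matern (1 - \<sigma>) \<omega> y * (y powr (1 - 2 * \<sigma>) * y powr (2 * \<sigma> - 1))"
    unfolding matern_deriv_eq[OF assms] by (simp only: mult_ac)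
  ultimately show ?thesis by simp
qed

text \<open>The differential equation of the profile, stated for its weighted derivative as identified by
  \<open>matern_weighted_deriv\<close>.\<close>

lemma matern_conj_deriv:
  assumes "0 < \<omega>" "0 < y" "0 < \<sigma>" "\<sigma> < 1"
  shows "((\<lambda>y. flux \<sigma> * \<omega> powr (2 * \<sigma>) * matern (1 - \<sigma>) \<omega> y) has_real_derivative
     - (y powr (1 - 2 * \<sigma>) * \<omega>\<^sup>2 * matern \<sigma> \<omega> y)) (at y)"
proof -
  have "flux \<sigma> * \<omega> powr (2 * \<sigma>) * matern_deriv (1 - \<sigma>) \<omega> y =
    - (flux \<sigma> * flux (1 - \<sigma>)) * (\<omega> powr (2 * \<sigma>) * \<omega> powr (2 * (1 - \<sigma>))) * (y powr (1 - 2 * \<sigma>) * matern \<sigma> \<omega> y)"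
    using assms by (simp add: matern_deriv_eq algebra_simps)
  also have "\<omega> powr (2 * \<sigma>) * \<omega> powr (2 * (1 - \<sigma>)) = \<omega>\<^sup>2"
    using assms by (simp add: powr_numeral flip: powr_add)
  finally have "flux \<sigma> * \<omega> powr (2 * \<sigma>) * matern_deriv (1 - \<sigma>) \<omega> y = - (y powr (1 - 2 * \<sigma>) * \<omega>\<^sup>2 * matern \<sigma> \<omega> y)"
    using flux_mult[of \<sigma>] assms by simp
  moreover have "((\<lambda>y. flux \<sigma> * \<omega> powr (2 * \<sigma>) * matern (1 - \<sigma>) \<omega> y) has_real_derivative
     flux \<sigma> * \<omega> powr (2 * \<sigma>) * matern_deriv (1 - \<sigma>) \<omega> y) (at y)"
    by (intro DERIV_cmult matern_has_deriv assms)
  ultimately show ?thesis by simp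
qed

lemma matern_decay:
  assumes "0 < \<omega>" "0 < y" "0 < \<sigma>"
  shows "\<omega> * y * matern \<sigma> \<omega> y \<le> 2 * bessel_int (\<sigma> + 1 / 2) 0 / bessel_int \<sigma> 0"
proof -
  have "sqrt (\<omega>\<^sup>2 * y\<^sup>2 / 4) = \<omega> * y / 2" using assms by (simp add: real_sqrt_divide real_sqrt_mult)
  moreover have "sqrt (\<omega>\<^sup>2 * y\<^sup>2 / 4) * bessel_int \<sigma> (\<omega>\<^sup>2 * y\<^sup>2 / 4) \<le> bessel_int (\<sigma> + 1 / 2) 0"
    using assms by (intro bessel_int_decay) auto
  ultimately have "\<omega> * y / 2 * bessel_int \<sigma> (\<omega>\<^sup>2 * y\<^sup>2 / 4) \<le> bessel_int (\<sigma> + 1 / 2) 0" by metis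
  then have "\<omega> * y * bessel_int \<sigma> (\<omega>\<^sup>2 * y\<^sup>2 / 4) \<le> 2 * bessel_int (\<sigma> + 1 / 2) 0" by simp
  then have "\<omega> * y * bessel_int \<sigma> (\<omega>\<^sup>2 * y\<^sup>2 / 4) / bessel_int \<sigma> 0 \<le> 2 * bessel_int (\<sigma> + 1 / 2) 0 / bessel_int \<sigma> 0"
    using bessel_int_pos[of 0 \<sigma>] assms by (intro divide_right_mono) auto
  then show ?thesis by (simp add: matern_def)
qed

lemma matern_deriv_bound:
  assumes "0 < \<omega>" "0 < y" "0 < \<sigma>"
  shows "y * \<bar>matern_deriv \<sigma> \<omega> y\<bar> \<le> 2"
proof -
  define z where "z = \<omega>\<^sup>2 * y\<^sup>2 / 4"
  have z: "z > 0" using assms by (simp add: z_def)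
  have b: "bessel_int (\<sigma> - 1) z > 0" "bessel_int \<sigma> 0 > 0" using assms z by (auto intro!: bessel_int_pos)
  have "y * \<bar>matern_deriv \<sigma> \<omega> y\<bar> = 2 * (z * bessel_int (\<sigma> - 1) z) / bessel_int \<sigma> 0"
    using assms b unfolding matern_deriv_def z_def[symmetric]
    by (simp add: abs_mult z_def power2_eq_square)
  also have "\<dots> \<le> 2 * bessel_int \<sigma> 0 / bessel_int \<sigma> 0"
    using bessel_int_deriv_bound[OF assms(3) z] b by (intro divide_right_mono) auto
  finally show ?thesis using b by simp
qed

lemma matern_tendsto_0:
  assumes "0 < \<omega>" "0 < \<sigma>"
  shows "(matern \<sigma> \<omega> \<longlongrightarrow> 1) (at_right 0)"
proof -
  have "filterlim (\<lambda>y::real. \<omega>\<^sup>2 * y\<^sup>2 / 4) (at_right 0) (at_right 0)"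
    unfolding filterlim_at
  proof
    show "\<forall>\<^sub>F y in at_right 0. \<omega>\<^sup>2 * y\<^sup>2 / 4 \<in> {0<..} \<and> \<omega>\<^sup>2 * y\<^sup>2 / 4 \<noteq> 0"
      using eventually_at_right_less[of "0::real"] by eventually_elim (use assms in auto)
    have "((\<lambda>y::real. \<omega>\<^sup>2 * y\<^sup>2 / 4) \<longlongrightarrow> \<omega>\<^sup>2 * 0\<^sup>2 / 4) (at_right 0)" by (intro tendsto_intros) auto
    then show "((\<lambda>y::real. \<omega>\<^sup>2 * y\<^sup>2 / 4) \<longlongrightarrow> 0) (at_right 0)" by simp
  qed
  from filterlim_compose[OF bessel_int_continuous_0[OF assms(2)] this]
  have "((\<lambda>y. bessel_int \<sigma> (\<omega>\<^sup>2 * y\<^sup>2 / 4) / bessel_int \<sigma> 0) \<longlongrightarrow> bessel_int \<sigma> 0 / bessel_int \<sigma> 0) (at_right 0)"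
    using bessel_int_pos[of 0 \<sigma>] assms by (intro tendsto_intros) auto
  then show ?thesis using bessel_int_pos[of 0 \<sigma>] assms by (simp add: matern_def[abs_def])
qed

lemma matern_tendsto_infinity:
  assumes "0 < \<omega>" "0 < \<sigma>"
  shows "(matern \<sigma> \<omega> \<longlongrightarrow> 0) at_top"
proof (rule Lim_null_comparison)
  let ?C = "2 * bessel_int (\<sigma> + 1 / 2) 0 / bessel_int \<sigma> 0 / \<omega>"
  show "((\<lambda>y. ?C / y) \<longlongrightarrow> 0) at_top" by (intro tendsto_divide_0[OF tendsto_const] filterlim_at_top_imp_at_infinity filterlim_ident)
  show "\<forall>\<^sub>F y in at_top. norm (matern \<sigma> \<omega> y) \<le> ?C / y"
    using eventually_gt_at_top[of 0]
  proof eventually_elim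
    case (elim y)
    have "matern \<sigma> \<omega> y = \<omega> * y * matern \<sigma> \<omega> y / (\<omega> * y)" using elim assms by simp
    also have "\<dots> \<le> (2 * bessel_int (\<sigma> + 1 / 2) 0 / bessel_int \<sigma> 0) / (\<omega> * y)"
      using elim assms by (intro divide_right_mono matern_decay) auto
    finally show ?case using matern_pos[OF assms(2), of \<omega> y] by simp
  qed
qed

lemma matern_continuous: 
  assumes "0 < \<omega>" shows "continuous_on {0<..} (matern \<sigma> \<omega>)"
  using matern_has_deriv[OF assms] by (meson DERIV_isCont continuous_at_imp_continuous_on greaterThan_iff)

lemma bessel_int_isCont: "z > 0 \<Longrightarrow> isCont (bessel_int \<sigma>) z"
  using bessel_int_deriv DERIV_isCont by blast

lemma matern_deriv_isCont:
  assumes "0 < \<omega>" "0 < y"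
  shows "isCont (matern_deriv \<sigma> \<omega>) y"
proof -
  have "isCont (\<lambda>y. bessel_int (\<sigma> - 1) (\<omega>\<^sup>2 * y\<^sup>2 / 4)) y"
    by (rule isCont_o2[where g = "bessel_int (\<sigma> - 1)"]) (use assms in \<open>auto intro!: bessel_int_isCont continuous_intros\<close>)
  then show ?thesis unfolding matern_deriv_def[abs_def] divide_inverse by (intro continuous_intros)
qed

lemma matern_deriv_continuous:
  assumes "0 < \<omega>" shows "continuous_on {0<..} (matern_deriv \<sigma> \<omega>)"
  using matern_deriv_isCont[OF assms] by (meson continuous_at_imp_continuous_on greaterThan_iff)

text \<open>By the differential equation the energy density is the derivative of \<open>y\<^sup>1\<^sup>-\<^sup>2\<^sup>\<sigma> \<theta>' \<theta>\<close>. In terms of the two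
  conjugate profiles this product is bounded, with limit \<open>- flux \<sigma> * \<omega> powr (2 * \<sigma>)\<close> at 0 and limit 0 at infinity.\<close>

lemma matern_energy:
  assumes \<omega>: "0 < \<omega>" and \<sigma>: "0 < \<sigma>" "\<sigma> < 1"
  shows "set_integrable lborel {0<..} (\<lambda>y. y powr (1 - 2 * \<sigma>) * ((matern_deriv \<sigma> \<omega> y)\<^sup>2 + \<omega>\<^sup>2 * (matern \<sigma> \<omega> y)\<^sup>2))"
    "(LINT y:{0<..}|lborel. y powr (1 - 2 * \<sigma>) * ((matern_deriv \<sigma> \<omega> y)\<^sup>2 + \<omega>\<^sup>2 * (matern \<sigma> \<omega> y)\<^sup>2)) = flux \<sigma> * \<omega> powr (2 * \<sigma>)"
proof -
  let ?f = "\<lambda>y. y powr (1 - 2 * \<sigma>) * ((matern_deriv \<sigma> \<omega> y)\<^sup>2 + \<omega>\<^sup>2 * (matern \<sigma> \<omega> y)\<^sup>2)"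
  let ?F = "\<lambda>y. - (flux \<sigma> * \<omega> powr (2 * \<sigma>) * matern (1 - \<sigma>) \<omega> y * matern \<sigma> \<omega> y)"
  let ?c = "flux \<sigma> * \<omega> powr (2 * \<sigma>)"
  have D: "(?F has_real_derivative ?f y) (at y)" if "0 < y" for y
  proof -
    have "((\<lambda>y. - (flux \<sigma> * \<omega> powr (2 * \<sigma>) * matern (1 - \<sigma>) \<omega> y * matern \<sigma> \<omega> y)) has_real_derivative
       - (- (y powr (1 - 2 * \<sigma>) * \<omega>\<^sup>2 * matern \<sigma> \<omega> y) * matern \<sigma> \<omega> y +
          matern_deriv \<sigma> \<omega> y * (flux \<sigma> * \<omega> powr (2 * \<sigma>) * matern (1 - \<sigma>) \<omega> y))) (at y)"
      by (intro DERIV_minus DERIV_mult matern_conj_deriv matern_has_deriv assms that)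
    moreover have w: "flux \<sigma> * \<omega> powr (2 * \<sigma>) * matern (1 - \<sigma>) \<omega> y = - (y powr (1 - 2 * \<sigma>) * matern_deriv \<sigma> \<omega> y)"
      using matern_weighted_deriv[OF \<omega> that \<sigma>] by simp
    have "- (- (y powr (1 - 2 * \<sigma>) * \<omega>\<^sup>2 * matern \<sigma> \<omega> y) * matern \<sigma> \<omega> y +
          matern_deriv \<sigma> \<omega> y * (flux \<sigma> * \<omega> powr (2 * \<sigma>) * matern (1 - \<sigma>) \<omega> y)) = ?f y"
      unfolding w by (simp add: algebra_simps power2_eq_square)
    ultimately show ?thesis by (simp only:)
  qed
  have cont: "isCont ?f y" if "0 < y" for y
    using that matern_deriv_isCont[OF \<omega> that] DERIV_isCont[OF matern_has_deriv[OF \<omega> that]]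
    by (intro continuous_intros) auto
  have A: "((?F \<circ> real_of_ereal) \<longlongrightarrow> - ?c) (at_right (ereal 0))"
  proof -
    have "(?F \<longlongrightarrow> - (?c * 1 * 1)) (at_right 0)"
      by (intro tendsto_intros matern_tendsto_0 \<omega>) (use \<sigma> in auto)
    then show ?thesis unfolding ereal_tendsto_simps by simp
  qed
  have B: "((?F \<circ> real_of_ereal) \<longlongrightarrow> 0) (at_left \<infinity>)"
  proof -
    have "(?F \<longlongrightarrow> - (?c * 0 * 0)) at_top"
      by (intro tendsto_intros matern_tendsto_infinity \<omega>) (use \<sigma> in auto)
    then show ?thesis unfolding ereal_tendsto_simps by simp
  qed
  have "set_integrable lborel (einterval (ereal 0) \<infinity>) ?f" "(LBINT y=ereal 0..\<infinity>. ?f y) = 0 - (- ?c)"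
    by (rule interval_integral_FTC_nonneg[of "ereal 0" \<infinity> ?F ?f "- ?c" 0, OF _ _ _ _ A B]; use D cont in auto)+
  moreover have "einterval (ereal 0) \<infinity> = {0<..}" by (auto simp: einterval_def)
  ultimately show "set_integrable lborel {0<..} ?f" "(LINT y:{0<..}|lborel. ?f y) = ?c"
    by (auto simp: interval_lebesgue_integral_def)
qed

text \<open>The shift by \<open>\<epsilon>\<close> keeps the argument away from 0, where the Bessel-type integral is not smooth; the quotient is
  renormalised so that the boundary value is still 1.\<close>

definition matern_reg :: "real \<Rightarrow> real \<Rightarrow> real \<Rightarrow> real \<Rightarrow> real" where
  "matern_reg \<epsilon> \<sigma> \<omega> y = bessel_int \<sigma> (\<omega>\<^sup>2 * y\<^sup>2 / 4 + \<epsilon>) / bessel_int \<sigma> \<epsilon>"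

definition matern_reg_deriv :: "real \<Rightarrow> real \<Rightarrow> real \<Rightarrow> real \<Rightarrow> real" where
  "matern_reg_deriv \<epsilon> \<sigma> \<omega> y = - (\<omega>\<^sup>2 * y / 2) * bessel_int (\<sigma> - 1) (\<omega>\<^sup>2 * y\<^sup>2 / 4 + \<epsilon>) / bessel_int \<sigma> \<epsilon>"

lemma matern_reg_0: "0 < \<epsilon> \<Longrightarrow> matern_reg \<epsilon> \<sigma> \<omega> 0 = 1"
  using bessel_int_pos[of \<epsilon> \<sigma>] by (simp add: matern_reg_def)

lemma bessel_int_quadratic_deriv:
  assumes "0 < \<epsilon>"
  shows "((\<lambda>y. bessel_int \<sigma> (\<omega>\<^sup>2 * y\<^sup>2 / 4 + \<epsilon>)) has_real_derivative
     - (\<omega>\<^sup>2 * y / 2) * bessel_int (\<sigma> - 1) (\<omega>\<^sup>2 * y\<^sup>2 / 4 + \<epsilon>)) (at y within A)"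
proof -
  have "0 < \<omega>\<^sup>2 * y\<^sup>2 / 4 + \<epsilon>" using add_nonneg_pos[of "\<omega>\<^sup>2 * y\<^sup>2 / 4" \<epsilon>] assms by simp
  moreover have "((\<lambda>y. \<omega>\<^sup>2 * y\<^sup>2 / 4 + \<epsilon>) has_real_derivative \<omega>\<^sup>2 * y / 2) (at y within A)"
    by (auto intro!: derivative_eq_intros)
  ultimately have "((\<lambda>y. bessel_int \<sigma> (\<omega>\<^sup>2 * y\<^sup>2 / 4 + \<epsilon>)) has_real_derivative
     - bessel_int (\<sigma> - 1) (\<omega>\<^sup>2 * y\<^sup>2 / 4 + \<epsilon>) * (\<omega>\<^sup>2 * y / 2)) (at y within A)"
    by (intro DERIV_chain2[OF bessel_int_deriv])
  then show ?thesis by (simp add: mult_ac)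
qed

lemma matern_reg_has_deriv:
  assumes "0 < \<epsilon>"
  shows "(matern_reg \<epsilon> \<sigma> \<omega> has_real_derivative matern_reg_deriv \<epsilon> \<sigma> \<omega> y) (at y)"
  unfolding matern_reg_def[abs_def] matern_reg_deriv_def
  by (intro DERIV_cdivide bessel_int_quadratic_deriv assms)

text \<open>Monotonicity of the Bessel-type integral bounds the regularised profile by the limiting one, uniformly in \<open>\<epsilon>\<close>;
  this is the domination behind \<open>smooth_mode_converges\<close>.\<close>

lemma matern_reg_bounds:
  assumes "0 < \<epsilon>" "\<epsilon> \<le> 1" "0 < \<omega>" "0 < y" "0 < \<sigma>"
  shows "\<bar>matern_reg \<epsilon> \<sigma> \<omega> y\<bar> \<le> bessel_int \<sigma> 0 / bessel_int \<sigma> 1 * matern \<sigma> \<omega> y"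
    "\<bar>matern_reg_deriv \<epsilon> \<sigma> \<omega> y\<bar> \<le> bessel_int \<sigma> 0 / bessel_int \<sigma> 1 * \<bar>matern_deriv \<sigma> \<omega> y\<bar>"
proof -
  define z where "z = \<omega>\<^sup>2 * y\<^sup>2 / 4"
  have z: "z > 0" using assms by (simp add: z_def)
  have b: "bessel_int (\<sigma> - 1) z > 0" "bessel_int \<sigma> 0 > 0" "bessel_int \<sigma> z > 0"
     "bessel_int (\<sigma> - 1) (z + \<epsilon>) > 0" "bessel_int \<sigma> (z + \<epsilon>) > 0" "bessel_int \<sigma> 1 > 0" "bessel_int \<sigma> \<epsilon> > 0"
    using assms z by (auto intro!: bessel_int_pos)
  have m: "bessel_int \<sigma> (z + \<epsilon>) \<le> bessel_int \<sigma> z" "bessel_int (\<sigma> - 1) (z + \<epsilon>) \<le> bessel_int (\<sigma> - 1) z"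
    "bessel_int \<sigma> 1 \<le> bessel_int \<sigma> \<epsilon>"
    using assms z by (auto intro!: bessel_int_mono)
  have "bessel_int \<sigma> (z + \<epsilon>) / bessel_int \<sigma> \<epsilon> \<le> bessel_int \<sigma> z / bessel_int \<sigma> 1"
    using b m by (intro frac_le) auto
  then show "\<bar>matern_reg \<epsilon> \<sigma> \<omega> y\<bar> \<le> bessel_int \<sigma> 0 / bessel_int \<sigma> 1 * matern \<sigma> \<omega> y"
    unfolding matern_reg_def matern_def z_def[symmetric] using b by simp
  have "bessel_int (\<sigma> - 1) (z + \<epsilon>) / bessel_int \<sigma> \<epsilon> \<le> bessel_int (\<sigma> - 1) z / bessel_int \<sigma> 1"
    using b m by (intro frac_le) auto
  then have "(\<omega>\<^sup>2 * y / 2) * (bessel_int (\<sigma> - 1) (z + \<epsilon>) / bessel_int \<sigma> \<epsilon>) \<le> (\<omega>\<^sup>2 * y / 2) * (bessel_int (\<sigma> - 1) z / bessel_int \<sigma> 1)"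
    using assms by (intro mult_left_mono) auto
  moreover have "\<bar>matern_reg_deriv \<epsilon> \<sigma> \<omega> y\<bar> = (\<omega>\<^sup>2 * y / 2) * (bessel_int (\<sigma> - 1) (z + \<epsilon>) / bessel_int \<sigma> \<epsilon>)"
    unfolding matern_reg_deriv_def z_def[symmetric] using b assms by (simp add: abs_mult)
  moreover have "bessel_int \<sigma> 0 / bessel_int \<sigma> 1 * \<bar>matern_deriv \<sigma> \<omega> y\<bar> = (\<omega>\<^sup>2 * y / 2) * (bessel_int (\<sigma> - 1) z / bessel_int \<sigma> 1)"
    unfolding matern_deriv_def z_def[symmetric] using b assms by (simp add: abs_mult)
  ultimately show "\<bar>matern_reg_deriv \<epsilon> \<sigma> \<omega> y\<bar> \<le> bessel_int \<sigma> 0 / bessel_int \<sigma> 1 * \<bar>matern_deriv \<sigma> \<omega> y\<bar>" by simp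
qed

lemma matern_reg_tendsto:
  assumes "0 < \<omega>" "0 < y" "0 < \<sigma>"
  shows "((\<lambda>\<epsilon>. matern_reg \<epsilon> \<sigma> \<omega> y) \<longlongrightarrow> matern \<sigma> \<omega> y) (at_right 0)"
    "((\<lambda>\<epsilon>. matern_reg_deriv \<epsilon> \<sigma> \<omega> y) \<longlongrightarrow> matern_deriv \<sigma> \<omega> y) (at_right 0)"
proof -
  define z where "z = \<omega>\<^sup>2 * y\<^sup>2 / 4"
  have z: "z > 0" using assms by (simp add: z_def)
  have b: "bessel_int \<sigma> 0 \<noteq> 0" using bessel_int_pos[of 0 \<sigma>] assms by simp
  have l: "((\<lambda>\<epsilon>. bessel_int r (z + \<epsilon>)) \<longlongrightarrow> bessel_int r z) (at_right 0)" for r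
  proof -
    have "((\<lambda>\<epsilon>. z + \<epsilon>) \<longlongrightarrow> z + 0) (at_right 0)" by (intro tendsto_intros)
    then show ?thesis using isCont_tendsto_compose[OF bessel_int_isCont[OF z]] by simp
  qed
  show "((\<lambda>\<epsilon>. matern_reg \<epsilon> \<sigma> \<omega> y) \<longlongrightarrow> matern \<sigma> \<omega> y) (at_right 0)"
    unfolding matern_reg_def matern_def z_def[symmetric]
    by (intro tendsto_divide l bessel_int_continuous_0 b assms)
  show "((\<lambda>\<epsilon>. matern_reg_deriv \<epsilon> \<sigma> \<omega> y) \<longlongrightarrow> matern_deriv \<sigma> \<omega> y) (at_right 0)"
    unfolding matern_reg_deriv_def matern_deriv_def z_def[symmetric]
    by (intro tendsto_divide tendsto_mult tendsto_const l bessel_int_continuous_0 b assms)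
qed

section \<open>Square-integrable vector functions and the half-line\<close>

definition sq_integrable :: "'a measure \<Rightarrow> ('a \<Rightarrow> 'b::euclidean_space) \<Rightarrow> bool" where
  "sq_integrable M f \<longleftrightarrow> f \<in> borel_measurable M \<and> integrable M (\<lambda>x. (norm (f x))\<^sup>2)"

definition l2norm :: "'a measure \<Rightarrow> ('a \<Rightarrow> 'b::euclidean_space) \<Rightarrow> real" where
  "l2norm M f = sqrt (\<integral>x. (norm (f x))\<^sup>2 \<partial>M)"

lemma l2norm_nonneg [simp]: "l2norm M f \<ge> 0"
  by (simp add: l2norm_def)

lemma l2norm_sq: "(l2norm M f)\<^sup>2 = (\<integral>x. (norm (f x))\<^sup>2 \<partial>M)"
  by (simp add: l2norm_def)

lemma l2norm_cong: "(\<And>x. x \<in> space M \<Longrightarrow> f x = g x) \<Longrightarrow> l2norm M f = l2norm M g"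
  unfolding l2norm_def by (intro arg_cong[of _ _ sqrt] Bochner_Integration.integral_cong) auto

lemma sq_integrable_bound:
  assumes "sq_integrable M g" "f \<in> borel_measurable M" "\<And>x. x \<in> space M \<Longrightarrow> norm (f x) \<le> norm (g x)"
  shows "sq_integrable M f"
  unfolding sq_integrable_def
proof
  show "integrable M (\<lambda>x. (norm (f x))\<^sup>2)"
    by (rule Bochner_Integration.integrable_bound[of M "\<lambda>x. (norm (g x))\<^sup>2"])
       (use assms in \<open>auto simp: sq_integrable_def intro!: AE_I2 power_mono\<close>)
qed fact

lemma sq_integrable_scale: "sq_integrable M f \<Longrightarrow> sq_integrable M (\<lambda>x. c *\<^sub>R f x)"
  by (auto simp: sq_integrable_def power_mult_distrib)

lemma sq_integrable_zero: "sq_integrable M (\<lambda>_. 0)"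
  by (simp add: sq_integrable_def)

lemma sq_integrable_inner:
  assumes "sq_integrable M f" "sq_integrable M g"
  shows "integrable M (\<lambda>x. f x \<bullet> g x)"
proof (rule Bochner_Integration.integrable_bound[of M "\<lambda>x. (norm (f x))\<^sup>2 + (norm (g x))\<^sup>2"])
  show "AE x in M. norm (f x \<bullet> g x) \<le> norm ((norm (f x))\<^sup>2 + (norm (g x))\<^sup>2)"
  proof (rule AE_I2)
    fix x
    have "\<bar>f x \<bullet> g x\<bar> \<le> norm (f x) * norm (g x)" by (rule Cauchy_Schwarz_ineq2)
    also have "\<dots> \<le> (norm (f x))\<^sup>2 + (norm (g x))\<^sup>2"
      using sum_squares_bound[of "norm (f x)" "norm (g x)"] zero_le_power2[of "norm (f x)"] zero_le_power2[of "norm (g x)"]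
        mult_nonneg_nonneg[of "norm (f x)" "norm (g x)"] by linarith
    finally show "norm (f x \<bullet> g x) \<le> norm ((norm (f x))\<^sup>2 + (norm (g x))\<^sup>2)" by simp
  qed
qed (use assms in \<open>auto simp: sq_integrable_def\<close>)

lemma norm_add_sq: "(norm (a + b))\<^sup>2 = (norm a)\<^sup>2 + 2 * (a \<bullet> b) + (norm (b :: 'b :: real_inner))\<^sup>2"
  by (simp add: power2_norm_eq_inner inner_add_left inner_add_right inner_commute)

lemma sq_integrable_add:
  assumes "sq_integrable M f" "sq_integrable M g"
  shows "sq_integrable M (\<lambda>x. f x + g x)"
  unfolding sq_integrable_def norm_add_sq using assms sq_integrable_inner[OF assms]
  by (auto simp: sq_integrable_def)

lemma sq_integrable_diff:
  assumes "sq_integrable M f" "sq_integrable M g"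
  shows "sq_integrable M (\<lambda>x. f x - g x)"
  using sq_integrable_add[OF assms(1) sq_integrable_scale[OF assms(2), of "-1"]] by simp

lemma sq_integrable_sum:
  assumes "\<And>k. k \<in> A \<Longrightarrow> sq_integrable M (f k)"
  shows "sq_integrable M (\<lambda>x. \<Sum>k\<in>A. f k x)"
  using assms by (induction A rule: infinite_finite_induct) (auto intro: sq_integrable_zero sq_integrable_add)

lemma l2norm_scale: "l2norm M (\<lambda>x. c *\<^sub>R f x) = \<bar>c\<bar> * l2norm M f"
  by (simp add: l2norm_def power_mult_distrib real_sqrt_mult)

lemma nonneg_quadratic_discriminant:
  fixes A B C :: real
  assumes "\<And>t. A * t\<^sup>2 + 2 * B * t + C \<ge> 0" "A \<ge> 0"
  shows "B\<^sup>2 \<le> A * C"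
proof (cases "A = 0")
  case True
  have "B = 0"
  proof (rule ccontr)
    assume "B \<noteq> 0"
    then show False using assms(1)[of "- (C + 1) / (2 * B)"] True by simp
  qed
  then show ?thesis using True by simp
next
  case False
  define t where "t = - B / A"
  have At: "A * t = - B" using False by (simp add: t_def)
  have "0 \<le> A * (A * t\<^sup>2 + 2 * B * t + C)" by (rule mult_nonneg_nonneg[OF assms(2) assms(1)])
  also have "\<dots> = (A * t)\<^sup>2 + 2 * B * (A * t) + A * C" by (simp add: algebra_simps power2_eq_square)
  also have "\<dots> = A * C - B\<^sup>2" unfolding At by (simp add: power2_eq_square)
  finally show ?thesis by simp
qed

lemma l2_Cauchy_Schwarz:
  assumes f: "sq_integrable M f" and g: "sq_integrable M g"
  shows "\<bar>\<integral>x. f x \<bullet> g x \<partial>M\<bar> \<le> l2norm M f * l2norm M g"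
proof -
  let ?B = "\<integral>x. f x \<bullet> g x \<partial>M"
  have "(l2norm M f)\<^sup>2 * t\<^sup>2 + 2 * ?B * t + (l2norm M g)\<^sup>2 \<ge> 0" for t
  proof -
    have "0 \<le> (\<integral>x. (norm (t *\<^sub>R f x + g x))\<^sup>2 \<partial>M)" by simp
    also have "(\<lambda>x. (norm (t *\<^sub>R f x + g x))\<^sup>2) = (\<lambda>x. t\<^sup>2 * (norm (f x))\<^sup>2 + 2 * t * (f x \<bullet> g x) + (norm (g x))\<^sup>2)"
      by (simp add: norm_add_sq power_mult_distrib mult.assoc)
    also have "(\<integral>x. \<dots> x \<partial>M) = t\<^sup>2 * (l2norm M f)\<^sup>2 + 2 * t * ?B + (l2norm M g)\<^sup>2"
      using f g sq_integrable_inner[OF f g] by (simp add: l2norm_sq sq_integrable_def)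
    finally show ?thesis by (simp add: mult_ac)
  qed
  from nonneg_quadratic_discriminant[OF this]
  have "?B\<^sup>2 \<le> (l2norm M f * l2norm M g)\<^sup>2" by (simp add: power_mult_distrib)
  then have "\<bar>?B\<bar> \<le> \<bar>l2norm M f * l2norm M g\<bar>" by (simp only: abs_le_square_iff)
  also have "\<dots> = l2norm M f * l2norm M g" by (simp add: abs_mult)
  finally show ?thesis .
qed

lemma l2norm_triangle:
  assumes f: "sq_integrable M f" and g: "sq_integrable M g"
  shows "l2norm M (\<lambda>x. f x + g x) \<le> l2norm M f + l2norm M g"
proof (rule power2_le_imp_le)
  have "(l2norm M (\<lambda>x. f x + g x))\<^sup>2 = (l2norm M f)\<^sup>2 + 2 * (\<integral>x. f x \<bullet> g x \<partial>M) + (l2norm M g)\<^sup>2"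
    using f g sq_integrable_inner[OF f g] by (simp add: l2norm_sq sq_integrable_def norm_add_sq)
  also have "\<dots> \<le> (l2norm M f)\<^sup>2 + 2 * (l2norm M f * l2norm M g) + (l2norm M g)\<^sup>2"
    using l2_Cauchy_Schwarz[OF f g] by auto
  also have "\<dots> = (l2norm M f + l2norm M g)\<^sup>2" by (simp add: power2_sum)
  finally show "(l2norm M (\<lambda>x. f x + g x))\<^sup>2 \<le> (l2norm M f + l2norm M g)\<^sup>2" .
qed auto

lemma l2norm_sum:
  assumes "\<And>k. k \<in> A \<Longrightarrow> sq_integrable M (f k)"
  shows "l2norm M (\<lambda>x. \<Sum>k\<in>A. f k x) \<le> (\<Sum>k\<in>A. l2norm M (f k))"
  using assms
proof (induction A rule: infinite_finite_induct)
  case (insert k A)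
  have "l2norm M (\<lambda>x. \<Sum>k\<in>insert k A. f k x) = l2norm M (\<lambda>x. f k x + (\<Sum>k\<in>A. f k x))"
    using insert.hyps by simp
  also have "\<dots> \<le> l2norm M (f k) + l2norm M (\<lambda>x. \<Sum>k\<in>A. f k x)"
    by (rule l2norm_triangle) (simp_all add: insert.prems sq_integrable_sum)
  also have "\<dots> \<le> l2norm M (f k) + (\<Sum>k\<in>A. l2norm M (f k))"
    by (rule add_left_mono, rule insert.IH) (simp add: insert.prems)
  finally show ?case using insert.hyps by simp
qed (auto simp: l2norm_def)

lemma l2_Fatou:
  fixes f :: "nat \<Rightarrow> 'a \<Rightarrow> 'b::euclidean_space"
  assumes f: "\<And>n. sq_integrable M (f n)" "\<And>n. l2norm M (f n) \<le> C"
    and lim: "\<And>x. x \<in> space M \<Longrightarrow> (\<lambda>n. f n x) \<longlonglongrightarrow> g x"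
  shows "sq_integrable M g" "l2norm M g \<le> C"
proof -
  have C: "C \<ge> 0" using f(2)[of 0] l2norm_nonneg[of M "f 0"] by linarith
  have fm: "\<And>n. f n \<in> borel_measurable M" using f(1) by (auto simp: sq_integrable_def)
  have gm: "g \<in> borel_measurable M" by (rule borel_measurable_LIMSEQ_metric[OF fm lim])
  have "(\<integral>\<^sup>+x. ennreal ((norm (g x))\<^sup>2) \<partial>M) = (\<integral>\<^sup>+x. liminf (\<lambda>n. ennreal ((norm (f n x))\<^sup>2)) \<partial>M)"
  proof (rule nn_integral_cong)
    fix x assume "x \<in> space M"
    then have "(\<lambda>n. ennreal ((norm (f n x))\<^sup>2)) \<longlonglongrightarrow> ennreal ((norm (g x))\<^sup>2)"
      by (intro tendsto_intros lim)
    then show "ennreal ((norm (g x))\<^sup>2) = liminf (\<lambda>n. ennreal ((norm (f n x))\<^sup>2))"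
      using lim_imp_Liminf[of sequentially] by (metis trivial_limit_sequentially)
  qed
  also have "\<dots> \<le> liminf (\<lambda>n. \<integral>\<^sup>+x. ennreal ((norm (f n x))\<^sup>2) \<partial>M)"
    by (rule nn_integral_liminf) (use fm in measurable)
  also have "\<dots> \<le> ennreal (C\<^sup>2)"
  proof -
    have "(\<integral>\<^sup>+x. ennreal ((norm (f n x))\<^sup>2) \<partial>M) \<le> ennreal (C\<^sup>2)" for n
    proof -
      have "(\<integral>\<^sup>+x. ennreal ((norm (f n x))\<^sup>2) \<partial>M) = ennreal ((l2norm M (f n))\<^sup>2)"
        unfolding l2norm_sq by (rule nn_integral_eq_integral) (use f(1) in \<open>auto simp: sq_integrable_def\<close>)
      also have "\<dots> \<le> ennreal (C\<^sup>2)" using f(2) by (intro ennreal_leI power_mono) auto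
      finally show ?thesis .
    qed
    then have "liminf (\<lambda>n. \<integral>\<^sup>+x. ennreal ((norm (f n x))\<^sup>2) \<partial>M) \<le> liminf (\<lambda>n::nat. ennreal (C\<^sup>2))"
      by (intro Liminf_mono always_eventually) auto
    then show ?thesis by (simp add: Liminf_const)
  qed
  finally have le: "(\<integral>\<^sup>+x. ennreal ((norm (g x))\<^sup>2) \<partial>M) \<le> ennreal (C\<^sup>2)" .
  have "integrable M (\<lambda>x. (norm (g x))\<^sup>2)"
    by (rule integrableI_bounded) (use gm le in \<open>auto simp: le_less_trans[OF _ ennreal_less_top]\<close>)
  then show g: "sq_integrable M g" using gm by (simp add: sq_integrable_def)
  have "ennreal ((l2norm M g)\<^sup>2) \<le> ennreal (C\<^sup>2)"
    unfolding l2norm_sq using le by (subst nn_integral_eq_integral[symmetric]) (use g in \<open>auto simp: sq_integrable_def\<close>)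
  then have "(l2norm M g)\<^sup>2 \<le> C\<^sup>2" by simp
  then show "l2norm M g \<le> C" using C by (rule power2_le_imp_le)
qed

text \<open>The triangle inequality for countably many summands, with Fatou's lemma for the limit.\<close>

lemma l2_series:
  fixes f :: "nat \<Rightarrow> 'a \<Rightarrow> 'b::euclidean_space"
  assumes f: "\<And>k. sq_integrable M (f k)" "\<And>k. l2norm M (f k) \<le> a k" and a: "summable a"
    and lim: "\<And>x. x \<in> space M \<Longrightarrow> (\<lambda>k. f k x) sums g x"
  shows "sq_integrable M g" "l2norm M (\<lambda>x. g x - (\<Sum>k<n. f k x)) \<le> (\<Sum>k. a (k + n))"
proof -
  have a0: "a k \<ge> 0" for k using f(2)[of k] l2norm_nonneg[of M "f k"] by linarith
  have s: "sq_integrable M (\<lambda>x. \<Sum>k<N. f (k + n) x)" for N n by (intro sq_integrable_sum f)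
  have b: "l2norm M (\<lambda>x. \<Sum>k<N. f (k + n) x) \<le> (\<Sum>k. a (k + n))" for N n
  proof -
    have "l2norm M (\<lambda>x. \<Sum>k<N. f (k + n) x) \<le> (\<Sum>k<N. l2norm M (f (k + n)))" by (intro l2norm_sum f)
    also have "\<dots> \<le> (\<Sum>k<N. a (k + n))" by (intro sum_mono f)
    also have "\<dots> \<le> (\<Sum>k. a (k + n))"
      using a0 by (intro sum_le_suminf summable_ignore_initial_segment[OF a]) auto
    finally show ?thesis .
  qed
  have l: "(\<lambda>N. \<Sum>k<N. f (k + n) x) \<longlonglongrightarrow> g x - (\<Sum>k<n. f k x)" if "x \<in> space M" for n x
    using sums_split_initial_segment[OF lim[OF that], of n] by (simp add: sums_def)
  show "sq_integrable M g" using l2_Fatou(1)[OF s[where n = 0] b[where n = 0] l[where n = 0]] by simp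
  show "l2norm M (\<lambda>x. g x - (\<Sum>k<n. f k x)) \<le> (\<Sum>k. a (k + n))"
    by (rule l2_Fatou(2)[OF s b l])
qed

text \<open>Integrability of \<open>h'\<close> gives a limit of \<open>h\<close> at infinity, and integrability of \<open>h\<close> forces it to be 0.\<close>

lemma half_line_FTC:
  fixes h h' :: "real \<Rightarrow> real"
  assumes d: "\<And>y. 0 < y \<Longrightarrow> (h has_real_derivative h' y) (at y)"
    and c: "\<And>y. 0 < y \<Longrightarrow> isCont h' y"
    and ih': "set_integrable lborel {0<..} h'" and ih: "set_integrable lborel {0<..} h"
    and A: "(h \<longlongrightarrow> A) (at_right 0)"
  shows "(LINT y:{0<..}|lborel. h' y) = - A"
proof -
  have i1: "set_integrable lborel {1..} h'" "set_integrable lborel {1..} h"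
    by (auto intro: set_integrable_subset[OF ih'] set_integrable_subset[OF ih])
  define L where "L = h 1 + (LINT y:{1..}|lborel. h' y)"
  have "((\<lambda>v. LINT y:{1..v}|lborel. h' y) \<longlongrightarrow> (LINT y:{1..}|lborel. h' y)) at_top"
    by (rule tendsto_set_lebesgue_integral_at_top[OF _ i1(1)]) auto
  then have "((\<lambda>v. h 1 + (LINT y:{1..v}|lborel. h' y)) \<longlongrightarrow> L) at_top"
    unfolding L_def by (intro tendsto_intros)
  moreover have "\<forall>\<^sub>F v in at_top. h 1 + (LINT y:{1..v}|lborel. h' y) = h v"
    using eventually_ge_at_top[of 1]
  proof eventually_elim
    case (elim v)
    have "(LINT y:{1..v}|lborel. h' y) = (\<integral>y. h' y * indicator {1..v} y \<partial>lborel)"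
      by (simp add: set_lebesgue_integral_def mult.commute)
    also have "\<dots> = h v - h 1"
      by (rule integral_FTC_Icc_real) (use elim d c in auto)
    finally show ?case by simp
  qed
  ultimately have hL: "(h \<longlongrightarrow> L) at_top" by (rule Lim_transform_eventually)
  have "L = 0"
  proof (rule ccontr)
    assume "L \<noteq> 0"
    then have "\<forall>\<^sub>F v in at_top. \<bar>L\<bar> / 2 < \<bar>h v\<bar>"
      using tendsto_rabs[OF hL] by (intro order_tendstoD) auto
    then obtain V where V: "\<And>v. v \<ge> V \<Longrightarrow> \<bar>L\<bar> / 2 < \<bar>h v\<bar>" by (auto simp: eventually_at_top_linorder)
    define W where "W = max V 1"
    have iW: "set_integrable lborel {W..} h" by (rule set_integrable_subset[OF i1(2)]) (auto simp: W_def)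
    have "\<bar>L\<bar> / 2 * real n \<le> (LINT y:{W..}|lborel. \<bar>h y\<bar>)" for n :: nat
    proof -
      have "(LINT y:{W..W + real n}|lborel. \<bar>L\<bar> / 2) \<le> (LINT y:{W..W + real n}|lborel. \<bar>h y\<bar>)"
      proof (rule set_integral_mono)
        show "set_integrable lborel {W..W + real n} (\<lambda>y. \<bar>h y\<bar>)"
          by (intro set_integrable_abs set_integrable_subset[OF iW]) auto
        show "\<bar>L\<bar> / 2 \<le> \<bar>h y\<bar>" if "y \<in> {W..W + real n}" for y using V[of y] that by (auto simp: W_def)
      qed (auto simp: set_integrable_def)
      also have "\<dots> \<le> (LINT y:{W..}|lborel. \<bar>h y\<bar>)"
        unfolding set_lebesgue_integral_def
        by (intro integral_mono) (use set_integrable_abs[OF iW] set_integrable_abs[OF set_integrable_subset[OF iW, of "{W..W + real n}"]]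
          in \<open>auto simp: set_integrable_def indicator_def\<close>)
      finally show ?thesis by (simp add: set_lebesgue_integral_def mult_ac)
    qed
    moreover obtain n :: nat where "(LINT y:{W..}|lborel. \<bar>h y\<bar>) / (\<bar>L\<bar> / 2) < real n" using reals_Archimedean2 by blast
    ultimately show False using \<open>L \<noteq> 0\<close> by (auto simp: field_simps not_le[symmetric])
  qed
  have "(LBINT y=ereal 0..\<infinity>. h' y) = 0 - A"
  proof (rule interval_integral_FTC_integrable[where F = h])
    show "(h has_vector_derivative h' y) (at y)" if "ereal 0 < ereal y" "ereal y < \<infinity>" for y
      using d[of y] that by (simp add: has_real_derivative_iff_has_vector_derivative)
    show "set_integrable lborel (einterval (ereal 0) \<infinity>) h'"
      using ih' by (simp add: einterval_def greaterThan_def)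
    show "((h \<circ> real_of_ereal) \<longlongrightarrow> A) (at_right (ereal 0))"
      using A unfolding ereal_tendsto_simps by simp
    show "((h \<circ> real_of_ereal) \<longlongrightarrow> 0) (at_left \<infinity>)"
      using hL \<open>L = 0\<close> unfolding ereal_tendsto_simps by simp
  qed (use c in auto)
  then show ?thesis by (simp add: interval_lebesgue_integral_def einterval_def greaterThan_def)
qed

section \<open>Integration over the cube and the half-cylinder\<close>

abbreviation period :: "real set" where "period \<equiv> {-pi<..<pi}"

definition vec3 :: "real \<Rightarrow> real \<Rightarrow> real \<Rightarrow> real^3" where
  "vec3 a b c = (\<chi> i. if i = 1 then a else if i = 2 then b else c)"

lemma vec3_nth [simp]: "vec3 a b c $ 1 = a" "vec3 a b c $ 2 = b" "vec3 a b c $ 3 = c"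
  by (simp_all add: vec3_def)

lemma vec3_continuous [continuous_intros]:
  assumes "continuous_on A f" "continuous_on A g" "continuous_on A h"
  shows "continuous_on A (\<lambda>x. vec3 (f x) (g x) (h x))"
  unfolding vec3_def
proof (rule continuous_on_vec_lambda)
  show "continuous_on A (\<lambda>x. if i = 1 then f x else if i = 2 then g x else h x)" for i :: 3
    using assms by (cases "i = 1"; cases "i = 2") auto
qed

lemma vec3_measurable [measurable]: "(\<lambda>(a, b, c). vec3 a b c) \<in> borel_measurable borel"
  by (intro borel_measurable_continuous_onI) (auto simp: case_prod_unfold intro!: continuous_intros)

text \<open>Both measures give a box the product of its side lengths. Fubini's theorem for the iterated product thus applies to
  functions of a vector.\<close>

lemma lborel_vec3:
  "(lborel :: (real^3) measure) = distr (lborel :: (real \<times> real \<times> real) measure) borel (\<lambda>(a, b, c). vec3 a b c)"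
proof (rule lborel_eqI)
  fix l u :: "real^3" assume le: "\<And>b. b \<in> Basis \<Longrightarrow> l \<bullet> b \<le> u \<bullet> b"
  have le': "l $ i \<le> u $ i" for i using le[of "axis i 1"] by (simp add: axis_in_Basis_iff inner_axis)
  have vim: "(\<lambda>(a, b, c). vec3 a b c) -` box l u = box (l $ 1, l $ 2, l $ 3) (u $ 1, u $ 2, u $ 3)"
    by (auto simp: mem_box_cart forall_3 mem_box Basis_prod_def)
  have "emeasure (distr lborel borel (\<lambda>(a, b, c). vec3 a b c)) (box l u) =
      emeasure (lborel :: (real \<times> real \<times> real) measure) (box (l $ 1, l $ 2, l $ 3) (u $ 1, u $ 2, u $ 3))"
    by (subst emeasure_distr) (auto simp: vim intro: vec3_measurable)
  also have "\<dots> = (u $ 1 - l $ 1) * (u $ 2 - l $ 2) * (u $ 3 - l $ 3)"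
  proof -
    have B: "(Basis :: (real \<times> real \<times> real) set) = {(1, 0, 0), (0, 1, 0), (0, 0, 1)}"
      by (auto simp: Basis_prod_def zero_prod_def)
    show ?thesis by (subst emeasure_lborel_box) (auto simp: B le' mult.assoc)
  qed
  also have "\<dots> = (\<Prod>b\<in>Basis. (u - l) \<bullet> b)"
  proof -
    have "(\<Prod>b\<in>Basis. (u - l) \<bullet> b) = (\<Prod>i\<in>(UNIV :: 3 set). (u - l) $ i)"
    proof (rule prod.reindex_bij_witness[of _ "\<lambda>i. axis i 1" "\<lambda>b. SOME i. b = axis i 1"])
      fix b :: "real^3" assume "b \<in> Basis"
      then obtain i where b: "b = axis i 1" by (auto simp: Basis_vec_def)
      define j where "j = (SOME i. b = axis i 1)"
      have j: "b = axis j 1" unfolding j_def using b by (rule someI)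
      then show "axis (SOME i. b = axis i 1) 1 = b" by (simp add: j_def)
      have "(u - l) $ j = (u - l) \<bullet> b" unfolding j by (simp add: inner_axis)
      then show "(u - l) $ (SOME i. b = axis i 1) = (u - l) \<bullet> b" by (simp add: j_def)
    next
      fix i :: 3
      show "(SOME j. (axis i 1 :: real^3) = axis j 1) = i" by (simp add: axis_eq_axis)
    qed (auto simp: axis_in_Basis_iff)
    also have "\<dots> = (u - l) $ 1 * (u - l) $ 2 * (u - l) $ 3"
      unfolding UNIV_3 by (simp add: ac_simps)
    finally show ?thesis by (simp only: vector_minus_component)
  qed
  finally show "emeasure (distr lborel borel (\<lambda>(a, b, c). vec3 a b c)) (box l u) = (\<Prod>b\<in>Basis. (u - l) \<bullet> b)" .
qed simp

lemma cube_mem: "x \<in> cube \<longleftrightarrow> (\<forall>i. x $ i \<in> period)"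
  by (auto simp: cube_def mem_box_cart)

lemma cube_sets [measurable]: "cube \<in> sets borel" by (simp add: cube_def)

lemma cube_finite: "emeasure lborel cube < \<infinity>" unfolding cube_def by (rule emeasure_lborel_box_finite)

lemma cylinder_sets [measurable]: "cylinder \<in> sets borel"
  unfolding cylinder_def by (intro borel_open open_Times) (auto simp: cube_def open_box)

text \<open>Passage from the completed measure to Borel measure, where Fubini's theorem and the fundamental theorem of
  calculus apply.\<close>

lemma lebesgue_on_eq_set:
  fixes f :: "'a::euclidean_space \<Rightarrow> 'b::euclidean_space"
  assumes S: "S \<in> sets borel" and f: "(\<lambda>x. indicator S x *\<^sub>R f x) \<in> borel_measurable borel"
  shows "integrable (lebesgue_on S) f \<longleftrightarrow> set_integrable lborel S f"
    "(LINT x|lebesgue_on S. f x) = (LINT x:S|lborel. f x)"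
    "f \<in> borel_measurable (lebesgue_on S)"
proof -
  have S': "S \<in> sets lebesgue" using S by auto
  have "integrable (lebesgue_on S) f \<longleftrightarrow> integrable lebesgue (\<lambda>x. indicator S x *\<^sub>R f x)"
    using S' by (subst integrable_restrict_space) auto
  also have "\<dots> \<longleftrightarrow> integrable lborel (\<lambda>x. indicator S x *\<^sub>R f x)"
    using f by (intro integrable_completion) auto
  finally show "integrable (lebesgue_on S) f \<longleftrightarrow> set_integrable lborel S f" by (simp add: set_integrable_def)
  have "(LINT x|lebesgue_on S. f x) = (LINT x|lebesgue. indicator S x *\<^sub>R f x)"
    using S' by (subst integral_restrict_space) auto
  also have "\<dots> = (LINT x|lborel. indicator S x *\<^sub>R f x)"
    using f by (intro integral_completion) auto
  finally show "(LINT x|lebesgue_on S. f x) = (LINT x:S|lborel. f x)" by (simp add: set_lebesgue_integral_def)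
  have "(\<lambda>x. indicator S x *\<^sub>R f x) \<in> borel_measurable lebesgue"
    using f by (intro measurable_completion) auto
  then show "f \<in> borel_measurable (lebesgue_on S)"
    using S' by (subst borel_measurable_restrict_space_iff) auto
qed

lemma continuous_indicator_measurable:
  fixes f :: "'a::euclidean_space \<Rightarrow> 'b::euclidean_space"
  assumes "continuous_on S f" "S \<in> sets borel"
  shows "(\<lambda>x. indicator S x *\<^sub>R f x) \<in> borel_measurable borel"
  using assms by (intro borel_measurable_continuous_on_indicator) auto

lemma cube_integrable:
  fixes F :: "real^3 \<Rightarrow> 'b::euclidean_space"
  assumes F: "continuous_on UNIV F"
  shows "integrable (lebesgue_on cube) F" "set_integrable lborel cube F"
proof -
  have "set_integrable lborel (cbox (\<chi> i. - pi) (\<chi> i. pi)) F"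
    unfolding set_integrable_def by (rule borel_integrable_compact) (auto intro: continuous_on_subset[OF F])
  then show s: "set_integrable lborel cube F"
    by (rule set_integrable_subset) (auto simp: cube_def intro!: box_subset_cbox[THEN subsetD])
  show "integrable (lebesgue_on cube) F"
    by (subst lebesgue_on_eq_set(1)) (auto intro!: s continuous_indicator_measurable continuous_on_subset[OF F])
qed

lemma cube_integral_iterated:
  fixes F :: "real^3 \<Rightarrow> 'b::euclidean_space"
  assumes F: "continuous_on UNIV F"
  shows "(LINT x|lebesgue_on cube. F x) = (LINT p:period \<times> period|lborel. LINT a:period|lborel. F (vec3 a (fst p) (snd p)))"
proof -
  let ?v = "\<lambda>(a, b, c). vec3 a b c"
  have F': "(\<lambda>x. indicator cube x *\<^sub>R F x) \<in> borel_measurable borel"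
    by (intro continuous_indicator_measurable continuous_on_subset[OF F]) auto
  have ind: "indicator cube (vec3 a b c) = (indicator period a * indicator period b * indicator period c :: real)" for a b c
    by (auto simp: indicator_def cube_mem forall_3)
  have "(LINT x|lebesgue_on cube. F x) = (LINT x|lborel. indicator cube x *\<^sub>R F x)"
    by (subst lebesgue_on_eq_set(2)) (auto simp: set_lebesgue_integral_def F')
  also have "\<dots> = (LINT t|lborel. indicator cube (?v t) *\<^sub>R F (?v t))"
    by (subst lborel_vec3, subst integral_distr) (use F' vec3_measurable in auto)
  also have "\<dots> = (LINT t|(lborel \<Otimes>\<^sub>M lborel). (\<lambda>(a, p). indicator cube (vec3 a (fst p) (snd p)) *\<^sub>R F (vec3 a (fst p) (snd p))) t)"
    unfolding lborel_prod by (simp add: case_prod_unfold)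
  also have "\<dots> = (LINT p|lborel. LINT a|lborel. indicator cube (vec3 a (fst p) (snd p)) *\<^sub>R F (vec3 a (fst p) (snd p)))"
  proof (rule lborel_pair.integral_snd[symmetric])
    have "integrable (distr lborel borel ?v) (\<lambda>x. indicator cube x *\<^sub>R F x)"
      unfolding lborel_vec3[symmetric] using cube_integrable(2)[OF F] by (simp add: set_integrable_def)
    then have "integrable lborel (\<lambda>t. indicator cube (?v t) *\<^sub>R F (?v t))"
      by (subst (asm) integrable_distr_eq) (use F' vec3_measurable in auto)
    then show "integrable (lborel \<Otimes>\<^sub>M lborel) (\<lambda>(a, p). indicator cube (vec3 a (fst p) (snd p)) *\<^sub>R F (vec3 a (fst p) (snd p)))"
      unfolding lborel_prod by (simp add: case_prod_unfold)
  qed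
  also have "\<dots> = (LINT p:period \<times> period|lborel. LINT a:period|lborel. F (vec3 a (fst p) (snd p)))"
    unfolding set_lebesgue_integral_def
  proof (rule Bochner_Integration.integral_cong[OF refl])
    fix p :: "real \<times> real"
    have "(LINT a|lborel. indicator cube (vec3 a (fst p) (snd p)) *\<^sub>R F (vec3 a (fst p) (snd p))) =
       (LINT a|lborel. indicator (period \<times> period) p *\<^sub>R (indicator period a *\<^sub>R F (vec3 a (fst p) (snd p))))"
      by (intro Bochner_Integration.integral_cong refl)
         (cases p, simp only: ind fst_conv snd_conv, auto simp: indicator_def)
    then show "(LINT a|lborel. indicator cube (vec3 a (fst p) (snd p)) *\<^sub>R F (vec3 a (fst p) (snd p))) =
       indicator (period \<times> period) p *\<^sub>R (LINT a|lborel. indicator period a *\<^sub>R F (vec3 a (fst p) (snd p)))" by (simp only: integral_scaleR_right)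
  qed
  finally show ?thesis .
qed

lemma period_integrable:
  fixes f :: "real \<Rightarrow> 'b::euclidean_space"
  assumes "continuous_on UNIV f"
  shows "set_integrable lborel period f"
proof -
  have "set_integrable lborel {-pi..pi} f"
    unfolding set_integrable_def by (rule borel_integrable_compact) (auto intro: continuous_on_subset[OF assms])
  then show ?thesis by (rule set_integrable_subset) auto
qed

lemma period_integral_eq:
  fixes f :: "real \<Rightarrow> 'b::euclidean_space"
  assumes "continuous_on UNIV f"
  shows "(LINT t:period|lborel. f t) = integral {-pi..pi} f"
  using set_borel_integral_eq_integral(2)[OF period_integrable[OF assms]]
  by (simp add: integral_open_interval_real)

lemma cube_integral_prod:
  fixes f g h :: "real \<Rightarrow> complex"
  assumes [continuous_intros]: "continuous_on UNIV f" "continuous_on UNIV g" "continuous_on UNIV h"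
  shows "(LINT x|lebesgue_on cube. f (x $ 1) * g (x $ 2) * h (x $ 3)) =
     integral {-pi..pi} f * integral {-pi..pi} g * integral {-pi..pi} h"
proof -
  have c: "continuous_on UNIV (\<lambda>x::real^3. f (x $ 1) * g (x $ 2) * h (x $ 3))"
    by (intro continuous_intros continuous_on_compose2[OF assms(1)] continuous_on_compose2[OF assms(2)]
         continuous_on_compose2[OF assms(3)]) auto
  have "(LINT x|lebesgue_on cube. f (x $ 1) * g (x $ 2) * h (x $ 3)) =
     (LINT p:period \<times> period|lborel. LINT a:period|lborel. f a * g (fst p) * h (snd p))"
    unfolding cube_integral_iterated[OF c] by simp
  also have "(\<lambda>p. LINT a:period|lborel. f a * g (fst p) * h (snd p)) = (\<lambda>p. (LINT a:period|lborel. f a) * g (fst p) * h (snd p))"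
    by simp
  also have "(LINT p:period \<times> period|lborel. (LINT a:period|lborel. f a) * g (fst p) * h (snd p)) =
     (LINT p|(lborel \<Otimes>\<^sub>M lborel). (\<lambda>(x, y). ((LINT a:period|lborel. f a) * (indicator period x *\<^sub>R g x)) * (indicator period y *\<^sub>R h y)) p)"
    unfolding lborel_prod set_lebesgue_integral_def
    by (intro Bochner_Integration.integral_cong) (auto simp: indicator_def)
  also have "\<dots> = (LINT x|lborel. LINT y|lborel. ((LINT a:period|lborel. f a) * (indicator period x *\<^sub>R g x)) * (indicator period y *\<^sub>R h y))"
  proof (rule lborel_pair.integral_fst[symmetric])
    have "continuous_on UNIV (\<lambda>p. (LINT a:period|lborel. f a) * g (fst p) * h (snd p))"
      by (intro continuous_intros continuous_on_compose2[OF assms(2)] continuous_on_compose2[OF assms(3)]) auto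
    then have "set_integrable lborel ({-pi..pi} \<times> {-pi..pi}) (\<lambda>p. (LINT a:period|lborel. f a) * g (fst p) * h (snd p))"
      unfolding set_integrable_def by (intro borel_integrable_compact compact_Times) (auto intro: continuous_on_subset)
    then have "set_integrable lborel (period \<times> period) (\<lambda>p. (LINT a:period|lborel. f a) * g (fst p) * h (snd p))"
      by (rule set_integrable_subset) (auto intro!: borel_open open_Times)
    then show "integrable (lborel \<Otimes>\<^sub>M lborel) (\<lambda>(x, y). ((LINT a:period|lborel. f a) * (indicator period x *\<^sub>R g x)) * (indicator period y *\<^sub>R h y))"
      unfolding lborel_prod set_integrable_def
      by (rule Bochner_Integration.integrable_cong[THEN iffD1, rotated -1]) (auto simp: indicator_def)
  qed
  also have "\<dots> = (LINT a:period|lborel. f a) * (LINT a:period|lborel. g a) * (LINT a:period|lborel. h a)"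
    unfolding set_lebesgue_integral_def by (simp only: integral_mult_right_zero integral_mult_left_zero)
  finally show ?thesis by (simp add: period_integral_eq assms)
qed

text \<open>Integrating the first variable first, the fundamental theorem leaves the difference of \<open>G\<close> at opposite
  faces, which vanishes by periodicity.\<close>

lemma cube_integral_partial1:
  fixes G G' :: "real^3 \<Rightarrow> real"
  assumes c: "continuous_on UNIV G'" and per: "periodic G"
    and d: "\<And>a b c. ((\<lambda>a. G (vec3 a b c)) has_real_derivative G' (vec3 a b c)) (at a)"
  shows "(LINT x|lebesgue_on cube. G' x) = 0"
proof -
  have "(LINT a:period|lborel. G' (vec3 a b c)) = 0" for b c
  proof -
    have cc: "continuous_on UNIV (\<lambda>a. G' (vec3 a b c))"
      by (intro continuous_on_compose2[OF assms(1)] continuous_intros) auto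
    have "((\<lambda>a. G' (vec3 a b c)) has_integral (G (vec3 pi b c) - G (vec3 (-pi) b c))) {-pi..pi}"
      by (rule fundamental_theorem_of_calculus)
         (use d in \<open>auto simp flip: has_real_derivative_iff_has_vector_derivative intro: DERIV_subset\<close>)
    moreover have "G (vec3 pi b c) = G (vec3 (-pi) b c)"
    proof -
      have "vec3 pi b c = vec3 (-pi) b c + (2 * pi) *\<^sub>R axis 1 1"
        by (simp add: vec_eq_iff forall_3 vec3_def axis_def)
      then show ?thesis using per by (metis periodic_def)
    qed
    ultimately show ?thesis unfolding period_integral_eq[OF cc] by (simp add: integral_unique)
  qed
  then show ?thesis unfolding cube_integral_iterated[OF c] by (simp add: set_lebesgue_integral_def)
qed

lemma cylinder_integral:
  fixes f :: "(real^3) \<times> real \<Rightarrow> real"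
  assumes f: "set_integrable lborel cylinder f"
  shows "(LINT z:cylinder|lborel. f z) = (LINT y:{0<..}|lborel. LINT x:cube|lborel. f (x, y))"
    "(LINT z:cylinder|lborel. f z) = (LINT x:cube|lborel. LINT y:{0<..}|lborel. f (x, y))"
    "(\<lambda>x. indicator cube x * (LINT y:{0<..}|lborel. f (x, y))) \<in> borel_measurable lborel"
    "AE x in lborel. x \<in> cube \<longrightarrow> set_integrable lborel {0<..} (\<lambda>y. f (x, y))"
proof -
  have ind: "indicator cylinder (x, y) = (indicator cube x * indicator {0<..} y :: real)" for x :: "real^3" and y :: real
    by (auto simp: cylinder_def indicator_def)
  have int: "integrable (lborel \<Otimes>\<^sub>M lborel) (\<lambda>(x, y). indicator cylinder (x, y) *\<^sub>R f (x, y))"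
    using f unfolding lborel_prod set_integrable_def by (simp add: case_prod_unfold)
  have eq: "(LINT z:cylinder|lborel. f z) = (LINT z|(lborel \<Otimes>\<^sub>M lborel). (\<lambda>(x, y). indicator cylinder (x, y) *\<^sub>R f (x, y)) z)"
    unfolding lborel_prod set_lebesgue_integral_def by (simp add: case_prod_unfold)
  have "(LINT z:cylinder|lborel. f z) = (LINT y|lborel. LINT x|lborel. indicator cylinder (x, y) *\<^sub>R f (x, y))"
    unfolding eq by (rule lborel_pair.integral_snd[OF int, symmetric])
  also have "\<dots> = (LINT y|lborel. LINT x|lborel. indicator {0<..} y * (indicator cube x * f (x, y)))"
    unfolding ind by (simp only: mult_ac real_scaleR_def)
  also have "\<dots> = (LINT y:{0<..}|lborel. LINT x:cube|lborel. f (x, y))"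
    unfolding set_lebesgue_integral_def by (simp only: integral_mult_right_zero real_scaleR_def)
  finally show "(LINT z:cylinder|lborel. f z) = (LINT y:{0<..}|lborel. LINT x:cube|lborel. f (x, y))" .
  have "(LINT z:cylinder|lborel. f z) = (LINT x|lborel. LINT y|lborel. indicator cylinder (x, y) *\<^sub>R f (x, y))"
    unfolding eq by (rule lborel_pair.integral_fst[OF int, symmetric])
  also have "\<dots> = (LINT x|lborel. LINT y|lborel. indicator cube x * (indicator {0<..} y * f (x, y)))"
    unfolding ind by (simp only: mult_ac real_scaleR_def)
  also have "\<dots> = (LINT x:cube|lborel. LINT y:{0<..}|lborel. f (x, y))"
    unfolding set_lebesgue_integral_def by (simp only: integral_mult_right_zero real_scaleR_def)
  finally show "(LINT z:cylinder|lborel. f z) = (LINT x:cube|lborel. LINT y:{0<..}|lborel. f (x, y))" .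
  have "integrable lborel (\<lambda>x. LINT y|lborel. indicator cylinder (x, y) *\<^sub>R f (x, y))"
    using lborel_pair.integrable_fst[OF int] .
  then show "(\<lambda>x. indicator cube x * (LINT y:{0<..}|lborel. f (x, y))) \<in> borel_measurable lborel"
    unfolding ind set_lebesgue_integral_def by (auto simp: mult.assoc dest!: borel_measurable_integrable)
  show "AE x in lborel. x \<in> cube \<longrightarrow> set_integrable lborel {0<..} (\<lambda>y. f (x, y))"
    using lborel_pair.AE_integrable_fst[OF int]
    by eventually_elim (auto simp: set_integrable_def ind)
qed

lemma cylinder_integrable_snd:
  fixes k :: "real \<Rightarrow> real"
  assumes k: "set_integrable lborel {0<..} k" and k0: "\<And>y. 0 < y \<Longrightarrow> k y \<ge> 0"
    and kc: "continuous_on {0<..} k"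
  shows "integrable (lebesgue_on cylinder) (\<lambda>z. k (snd z))"
    "(LINT z|lebesgue_on cylinder. k (snd z)) = measure lborel cube * (LINT y:{0<..}|lborel. k y)"
proof -
  have m: "(\<lambda>z. indicator cylinder z *\<^sub>R k (snd z)) \<in> borel_measurable borel"
    by (intro continuous_indicator_measurable continuous_on_compose2[OF kc] continuous_intros)
       (use cylinder_sets in \<open>auto simp: cylinder_def\<close>)
  have ind: "indicator cylinder (x, y) = (indicator cube x * indicator {0<..} y :: real)" for x :: "real^3" and y :: real
    by (auto simp: cylinder_def indicator_def)
  have [measurable]: "(\<lambda>y. indicator {0<..} y * k y) \<in> borel_measurable borel"
    using k by (auto simp: set_integrable_def)
  have fin: "emeasure lborel cube = ennreal (measure lborel cube)"
    using cube_finite by (intro emeasure_eq_ennreal_measure) auto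
  have "(\<integral>\<^sup>+z. ennreal (indicator cylinder z *\<^sub>R k (snd z)) \<partial>lborel) =
    (\<integral>\<^sup>+x. \<integral>\<^sup>+y. ennreal (indicator cylinder (x, y) *\<^sub>R k (snd (x, y))) \<partial>lborel \<partial>lborel)"
    unfolding lborel_prod[symmetric] by (rule lborel.nn_integral_fst[symmetric]) (use m in \<open>simp add: lborel_prod\<close>)
  also have "\<dots> = (\<integral>\<^sup>+x. indicator cube x * (\<integral>\<^sup>+y. ennreal (indicator {0<..} y * k y) \<partial>lborel) \<partial>lborel)"
  proof (rule nn_integral_cong)
    fix x :: "real^3"
    have "(\<integral>\<^sup>+y. ennreal (indicator cylinder (x, y) *\<^sub>R k (snd (x, y))) \<partial>lborel) =
       (\<integral>\<^sup>+y. indicator cube x * ennreal (indicator {0<..} y * k y) \<partial>lborel)"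
      by (intro nn_integral_cong) (auto simp: indicator_def cylinder_def)
    also have "\<dots> = indicator cube x * (\<integral>\<^sup>+y. ennreal (indicator {0<..} y * k y) \<partial>lborel)"
      by (rule nn_integral_cmult) simp
    finally show "(\<integral>\<^sup>+y. ennreal (indicator cylinder (x, y) *\<^sub>R k (snd (x, y))) \<partial>lborel) = \<dots>" .
  qed
  also have "\<dots> = emeasure lborel cube * (\<integral>\<^sup>+y. ennreal (indicator {0<..} y * k y) \<partial>lborel)"
    by (subst nn_integral_multc) auto
  also have "(\<integral>\<^sup>+y. ennreal (indicator {0<..} y * k y) \<partial>lborel) = ennreal (LINT y:{0<..}|lborel. k y)"
    unfolding set_lebesgue_integral_def using k k0
    by (subst nn_integral_eq_integral) (auto simp: set_integrable_def indicator_def)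
  finally have nn: "(\<integral>\<^sup>+z. ennreal (indicator cylinder z *\<^sub>R k (snd z)) \<partial>lborel) =
      ennreal (measure lborel cube * (LINT y:{0<..}|lborel. k y))" by (simp add: fin ennreal_mult')
  have nonneg: "0 \<le> indicator cylinder z *\<^sub>R k (snd z)" for z using k0 by (auto simp: indicator_def cylinder_def)
  have pos: "0 \<le> measure lborel cube * (LINT y:{0<..}|lborel. k y)"
    unfolding set_lebesgue_integral_def using k0
    by (intro mult_nonneg_nonneg Bochner_Integration.integral_nonneg) (auto simp: indicator_def)
  have i: "has_bochner_integral lborel (\<lambda>z. indicator cylinder z *\<^sub>R k (snd z)) (measure lborel cube * (LINT y:{0<..}|lborel. k y))"
    by (rule has_bochner_integral_nn_integral) (use m nn nonneg pos in auto)
  show "integrable (lebesgue_on cylinder) (\<lambda>z. k (snd z))"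
    using i by (subst lebesgue_on_eq_set(1)[OF _ m]) (auto simp: set_integrable_def has_bochner_integral_iff)
  show "(LINT z|lebesgue_on cylinder. k (snd z)) = measure lborel cube * (LINT y:{0<..}|lborel. k y)"
    using i by (subst lebesgue_on_eq_set(2)[OF _ m]) (auto simp: set_lebesgue_integral_def has_bochner_integral_iff)
qed

section \<open>The extension space as a weighted Lebesgue space\<close>

text \<open>Multiplication by the square root of the weight, with the function and its gradient collected in one vector:
  an isometry, up to the factor \<open>1 / sqrt (kappa s)\<close>, into the square-integrable functions on the half-cylinder.\<close>

definition weighted :: "real \<Rightarrow> real \<Rightarrow> X_elem \<Rightarrow> (real^3) \<times> real \<Rightarrow> real \<times> (real^3) \<times> real" where
  "weighted s m P z = (snd z powr ((1 - 2 * s) / 2)) *\<^sub>R (m * fst P z, snd P z)"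

abbreviation "cyl \<equiv> lebesgue_on cylinder"

lemma powr_half_sq: "(y powr (r / 2)) * (y powr (r / 2)) = y powr (r::real)"
  by (simp flip: powr_add)

lemma weighted_inner:
  "weighted s m P z \<bullet> weighted s m Q z = snd z powr (1 - 2 * s) * (snd P z \<bullet> snd Q z + m\<^sup>2 * fst P z * fst Q z)"
proof -
  have "weighted s m P z \<bullet> weighted s m Q z =
    (snd z powr ((1 - 2 * s) / 2) * snd z powr ((1 - 2 * s) / 2)) * (snd P z \<bullet> snd Q z + m\<^sup>2 * fst P z * fst Q z)"
    by (simp add: weighted_def power2_eq_square algebra_simps inner_prod_def)
  then show ?thesis by (simp only: powr_half_sq)
qed

lemma weighted_norm_sq:
  "(norm (weighted s m P z))\<^sup>2 = snd z powr (1 - 2 * s) * ((norm (snd P z))\<^sup>2 + m\<^sup>2 * (fst P z)\<^sup>2)"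
  unfolding power2_norm_eq_inner weighted_inner by (simp add: power2_eq_square mult.assoc)

lemma kappa_pos: "0 < s \<Longrightarrow> s < 1 \<Longrightarrow> kappa s > 0"
  by (simp add: kappa_def Gamma_real_pos)

lemma X_inner_eq: "X_inner s m P Q = (LINT z|cyl. weighted s m P z \<bullet> weighted s m Q z) / kappa s"
  by (simp add: X_inner_def weighted_inner)

lemma X_norm_eq: "X_norm s m P = l2norm cyl (weighted s m P) / sqrt (kappa s)"
  by (simp add: X_norm_def X_inner_eq l2norm_def power2_norm_eq_inner real_sqrt_divide)

lemma snd_powr_measurable: "(\<lambda>z. snd z powr r) \<in> borel_measurable cyl"
proof -
  have "snd \<in> borel_measurable (borel :: ((real^3) \<times> real) measure)"
    by (intro borel_measurable_continuous_onI continuous_intros)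
  then have "(\<lambda>z :: (real^3) \<times> real. snd z powr r) \<in> borel_measurable borel"
    by (rule powr_real_measurable) simp
  then show ?thesis
    by (intro measurable_restrict_space1 measurable_completion) auto
qed

lemma weighted_measurable:
  assumes "fst P \<in> borel_measurable cyl" "snd P \<in> borel_measurable cyl"
  shows "weighted s m P \<in> borel_measurable cyl"
  unfolding weighted_def[abs_def] using assms snd_powr_measurable[of "(1 - 2 * s) / 2"] by measurable

lemma X_finite_weighted:
  assumes "X_finite s P"
  shows "sq_integrable cyl (weighted s m P)"
  unfolding sq_integrable_def weighted_norm_sq
proof
  show "weighted s m P \<in> borel_measurable cyl" using assms by (intro weighted_measurable) (auto simp: X_finite_def)
  have "integrable cyl (\<lambda>z. snd z powr (1 - 2 * s) * (norm (snd P z))\<^sup>2 + m\<^sup>2 * (snd z powr (1 - 2 * s) * (fst P z)\<^sup>2))"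
    using assms by (intro Bochner_Integration.integrable_add Bochner_Integration.integrable_mult_right) (auto simp: X_finite_def)
  then show "integrable cyl (\<lambda>z. snd z powr (1 - 2 * s) * ((norm (snd P z))\<^sup>2 + m\<^sup>2 * (fst P z)\<^sup>2))"
    by (simp add: algebra_simps)
qed

lemma weighted_X_finite:
  assumes m: "m \<noteq> 0" and meas: "fst P \<in> borel_measurable cyl" "snd P \<in> borel_measurable cyl"
    and sq: "sq_integrable cyl (weighted s m P)"
  shows "X_finite s P"
proof -
  have i: "integrable cyl (\<lambda>z. (norm (weighted s m P z))\<^sup>2)" using sq by (simp add: sq_integrable_def)
  note w = snd_powr_measurable[of "1 - 2 * s"]
  have "integrable cyl (\<lambda>z. snd z powr (1 - 2 * s) * (norm (snd P z))\<^sup>2)"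
    by (rule Bochner_Integration.integrable_bound[OF i])
       (use w meas in \<open>auto simp: weighted_norm_sq algebra_simps intro!: AE_I2\<close>)
  moreover have "integrable cyl (\<lambda>z. m\<^sup>2 * (snd z powr (1 - 2 * s) * (fst P z)\<^sup>2))"
    by (rule Bochner_Integration.integrable_bound[OF i])
       (use w meas in \<open>auto simp: weighted_norm_sq algebra_simps intro!: AE_I2\<close>)
  then have "integrable cyl (\<lambda>z. snd z powr (1 - 2 * s) * (fst P z)\<^sup>2)" using m by simp
  ultimately show ?thesis using meas by (simp add: X_finite_def)
qed

lemma weighted_diff:
  "weighted s m (\<lambda>z. fst P z - fst Q z, \<lambda>z. snd P z - snd Q z) z = weighted s m P z - weighted s m Q z"
  by (simp add: weighted_def algebra_simps)

text \<open>The pair of \<open>sin (k (x\<^sub>1 + \<tau>)) h(y)\<close> and its gradient, when \<open>h'\<close> is the derivative of \<open>h\<close>.\<close>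

definition mode :: "real \<Rightarrow> nat \<Rightarrow> (real \<Rightarrow> real) \<Rightarrow> (real \<Rightarrow> real) \<Rightarrow> X_elem" where
  "mode \<tau> k h h' =
    (\<lambda>z. sin (real k * (fst z $ 1 + \<tau>)) * h (snd z),
     \<lambda>z. ((real k * cos (real k * (fst z $ 1 + \<tau>)) * h (snd z)) *\<^sub>R axis 1 1,
          sin (real k * (fst z $ 1 + \<tau>)) * h' (snd z)))"

text \<open>Bounding sine and cosine by 1 leaves a density in \<open>y\<close> alone, the one integrated in \<open>matern_energy\<close>.\<close>

lemma mode_norm_bound:
  "(norm (weighted s m (mode \<tau> k h h') z))\<^sup>2 \<le>
     snd z powr (1 - 2 * s) * ((h' (snd z))\<^sup>2 + ((real k)\<^sup>2 + m\<^sup>2) * (h (snd z))\<^sup>2)"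
proof -
  let ?s = "sin (real k * (fst z $ 1 + \<tau>))" and ?c = "cos (real k * (fst z $ 1 + \<tau>))"
  have le: "?s\<^sup>2 \<le> 1" "?c\<^sup>2 \<le> 1" by (auto simp: abs_square_le_1)
  have "(norm (snd (mode \<tau> k h h') z))\<^sup>2 = (real k)\<^sup>2 * (h (snd z))\<^sup>2 * ?c\<^sup>2 + (h' (snd z))\<^sup>2 * ?s\<^sup>2"
    by (simp add: mode_def norm_prod_def power_mult_distrib mult_ac)
  moreover have "m\<^sup>2 * (fst (mode \<tau> k h h') z)\<^sup>2 = m\<^sup>2 * (h (snd z))\<^sup>2 * ?s\<^sup>2"
    by (simp add: mode_def power_mult_distrib mult_ac)
  moreover have "(real k)\<^sup>2 * (h (snd z))\<^sup>2 * ?c\<^sup>2 \<le> (real k)\<^sup>2 * (h (snd z))\<^sup>2 * 1"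
    "(h' (snd z))\<^sup>2 * ?s\<^sup>2 \<le> (h' (snd z))\<^sup>2 * 1" "m\<^sup>2 * (h (snd z))\<^sup>2 * ?s\<^sup>2 \<le> m\<^sup>2 * (h (snd z))\<^sup>2 * 1"
    using le by (intro mult_left_mono; simp)+
  ultimately have "(norm (snd (mode \<tau> k h h') z))\<^sup>2 + m\<^sup>2 * (fst (mode \<tau> k h h') z)\<^sup>2 \<le>
     (h' (snd z))\<^sup>2 + ((real k)\<^sup>2 + m\<^sup>2) * (h (snd z))\<^sup>2" unfolding distrib_right by linarith
  then show ?thesis unfolding weighted_norm_sq by (intro mult_left_mono) auto
qed

lemma cyl_measurable_continuous:
  fixes f :: "(real^3) \<times> real \<Rightarrow> 'b::euclidean_space"
  assumes "continuous_on cylinder f"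
  shows "f \<in> borel_measurable cyl"
  using lebesgue_on_eq_set(3)[OF cylinder_sets continuous_indicator_measurable[OF assms cylinder_sets]] .

lemma mode_measurable:
  assumes "continuous_on {0<..} h" "continuous_on {0<..} h'"
  shows "fst (mode \<tau> k h h') \<in> borel_measurable cyl" "snd (mode \<tau> k h h') \<in> borel_measurable cyl"
proof -
  have [continuous_intros]: "continuous_on cylinder (\<lambda>z. h (snd z))" "continuous_on cylinder (\<lambda>z. h' (snd z))"
    by (intro continuous_on_compose2[OF assms(1)] continuous_on_compose2[OF assms(2)] continuous_intros; force simp: cylinder_def)+
  show "fst (mode \<tau> k h h') \<in> borel_measurable cyl" "snd (mode \<tau> k h h') \<in> borel_measurable cyl"
    unfolding mode_def fst_conv snd_conv by (intro cyl_measurable_continuous continuous_intros)+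
qed

lemma mode_diff:
  "weighted s m (mode \<tau> k h h') z - weighted s m (mode \<tau> k g g') z =
    weighted s m (mode \<tau> k (\<lambda>y. h y - g y) (\<lambda>y. h' y - g' y)) z"
  by (simp add: weighted_def mode_def algebra_simps)

definition freq :: "real \<Rightarrow> nat \<Rightarrow> real" where
  "freq m k = sqrt ((real k)\<^sup>2 + m\<^sup>2)"

lemma freq_pos: "0 < m \<Longrightarrow> 0 < freq m k"
  by (simp add: freq_def add_nonneg_pos)

lemma freq_sq: "(freq m k)\<^sup>2 = (real k)\<^sup>2 + m\<^sup>2"
  by (simp add: freq_def)

lemma freq_ge: "real k \<le> freq m k" "m \<le> freq m k"
  unfolding freq_def by (rule real_le_rsqrt, simp)+

definition bessel_mode :: "real \<Rightarrow> real \<Rightarrow> real \<Rightarrow> nat \<Rightarrow> X_elem" where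
  "bessel_mode s m \<tau> k = mode \<tau> k (matern s (freq m k)) (matern_deriv s (freq m k))"

definition smooth_mode :: "real \<Rightarrow> real \<Rightarrow> real \<Rightarrow> real \<Rightarrow> nat \<Rightarrow> X_elem" where
  "smooth_mode \<epsilon> s m \<tau> k = mode \<tau> k (matern_reg \<epsilon> s (freq m k)) (matern_reg_deriv \<epsilon> s (freq m k))"

lemma energy_density_cylinder:
  assumes m: "0 < m" and s: "0 < s" "s < 1"
  shows "integrable cyl (\<lambda>z. snd z powr (1 - 2 * s) * ((matern_deriv s (freq m k) (snd z))\<^sup>2 + ((real k)\<^sup>2 + m\<^sup>2) * (matern s (freq m k) (snd z))\<^sup>2))"
    "(LINT z|cyl. snd z powr (1 - 2 * s) * ((matern_deriv s (freq m k) (snd z))\<^sup>2 + ((real k)\<^sup>2 + m\<^sup>2) * (matern s (freq m k) (snd z))\<^sup>2)) =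
      measure lborel cube * (flux s * freq m k powr (2 * s))"
proof -
  let ?k = "\<lambda>y. y powr (1 - 2 * s) * ((matern_deriv s (freq m k) y)\<^sup>2 + ((real k)\<^sup>2 + m\<^sup>2) * (matern s (freq m k) y)\<^sup>2)"
  note e = matern_energy[OF freq_pos[OF m, of k] s, unfolded freq_sq]
  have c: "continuous_on {0<..} ?k"
    by (intro continuous_intros matern_continuous matern_deriv_continuous freq_pos m) auto
  have n: "0 \<le> ?k y" for y by (intro mult_nonneg_nonneg add_nonneg_nonneg) auto
  show "integrable cyl (\<lambda>z. ?k (snd z))" by (rule cylinder_integrable_snd(1)[OF e(1) n c])
  show "(LINT z|cyl. ?k (snd z)) = measure lborel cube * (flux s * freq m k powr (2 * s))"
    using cylinder_integrable_snd(2)[OF e(1) n c] e(2) by simp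
qed

lemma bessel_mode_measurable:
  assumes m: "0 < m"
  shows "fst (bessel_mode s m \<tau> k) \<in> borel_measurable cyl" "snd (bessel_mode s m \<tau> k) \<in> borel_measurable cyl"
  unfolding bessel_mode_def by (intro mode_measurable matern_continuous matern_deriv_continuous freq_pos m)+

lemma bessel_mode_sq_integrable:
  assumes m: "0 < m" and s: "0 < s" "s < 1"
  shows "sq_integrable cyl (weighted s m (bessel_mode s m \<tau> k))"
    "l2norm cyl (weighted s m (bessel_mode s m \<tau> k)) \<le> sqrt (measure lborel cube * flux s) * freq m k powr s"
proof -
  let ?e = "\<lambda>z::(real^3)\<times>real. snd z powr (1 - 2 * s) * ((matern_deriv s (freq m k) (snd z))\<^sup>2 + ((real k)\<^sup>2 + m\<^sup>2) * (matern s (freq m k) (snd z))\<^sup>2)"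
  have meas: "weighted s m (bessel_mode s m \<tau> k) \<in> borel_measurable cyl"
    by (intro weighted_measurable bessel_mode_measurable m)
  have le: "(norm (weighted s m (bessel_mode s m \<tau> k) z))\<^sup>2 \<le> ?e z" for z
    unfolding bessel_mode_def by (rule mode_norm_bound)
  have i: "integrable cyl (\<lambda>z. (norm (weighted s m (bessel_mode s m \<tau> k) z))\<^sup>2)"
    by (rule Bochner_Integration.integrable_bound[OF energy_density_cylinder(1)[OF assms, of k]])
       (use meas le in \<open>auto intro!: AE_I2 simp: order_trans[OF _ abs_ge_self]\<close>)
  then show sq: "sq_integrable cyl (weighted s m (bessel_mode s m \<tau> k))" using meas by (simp add: sq_integrable_def)
  have "l2norm cyl (weighted s m (bessel_mode s m \<tau> k)) \<le> sqrt (LINT z|cyl. ?e z)"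
    unfolding l2norm_def by (intro real_sqrt_le_mono integral_mono i energy_density_cylinder(1) assms le)
  also have "\<dots> = sqrt (measure lborel cube * flux s) * sqrt ((freq m k powr s)\<^sup>2)"
    unfolding energy_density_cylinder(2)[OF assms]
    by (simp add: real_sqrt_mult mult.assoc power2_eq_square flip: powr_add)
  finally show "l2norm cyl (weighted s m (bessel_mode s m \<tau> k)) \<le> sqrt (measure lborel cube * flux s) * freq m k powr s"
    by simp
qed

lemma smooth_mode_measurable:
  assumes "0 < \<epsilon>"
  shows "fst (smooth_mode \<epsilon> s m \<tau> k) \<in> borel_measurable cyl" "snd (smooth_mode \<epsilon> s m \<tau> k) \<in> borel_measurable cyl"
proof -
  have c1: "continuous_on A (matern_reg \<epsilon> s \<omega>)" for A \<omega>
    using matern_reg_has_deriv[OF assms] by (meson DERIV_isCont continuous_at_imp_continuous_on)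
  have c2: "continuous_on A (matern_reg_deriv \<epsilon> s \<omega>)" for A \<omega>
  proof -
    have "isCont (\<lambda>y. bessel_int (s - 1) (\<omega>\<^sup>2 * y\<^sup>2 / 4 + \<epsilon>)) y" for y
      using bessel_int_quadratic_deriv[OF assms] DERIV_isCont by blast
    then have "isCont (matern_reg_deriv \<epsilon> s \<omega>) y" for y
      unfolding matern_reg_deriv_def[abs_def] divide_inverse by (intro continuous_intros)
    then show ?thesis by (simp add: continuous_at_imp_continuous_on)
  qed
  show "fst (smooth_mode \<epsilon> s m \<tau> k) \<in> borel_measurable cyl" "snd (smooth_mode \<epsilon> s m \<tau> k) \<in> borel_measurable cyl"
    unfolding smooth_mode_def by (rule mode_measurable[OF c1 c2])+
qed

lemma smooth_mode_diff_bound: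
  assumes m: "0 < m" and s: "0 < s" and e: "0 < \<epsilon>" "\<epsilon> \<le> 1" and z: "z \<in> cylinder"
  shows "(norm (weighted s m (bessel_mode s m \<tau> k) z - weighted s m (smooth_mode \<epsilon> s m \<tau> k) z))\<^sup>2 \<le>
    (1 + bessel_int s 0 / bessel_int s 1)\<^sup>2 *
    (snd z powr (1 - 2 * s) * ((matern_deriv s (freq m k) (snd z))\<^sup>2 + ((real k)\<^sup>2 + m\<^sup>2) * (matern s (freq m k) (snd z))\<^sup>2))"
proof -
  let ?\<Lambda> = "bessel_int s 0 / bessel_int s 1" and ?w = "freq m k" and ?y = "snd z"
  have y: "0 < ?y" using z by (auto simp: cylinder_def)
  have Lp: "?\<Lambda> > 0" using s by (simp add: bessel_int_pos)
  note b = matern_reg_bounds[OF e freq_pos[OF m, of k] y s]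
  have 1: "(matern s ?w ?y - matern_reg \<epsilon> s ?w ?y)\<^sup>2 \<le> (1 + ?\<Lambda>)\<^sup>2 * (matern s ?w ?y)\<^sup>2"
  proof -
    have "\<bar>matern s ?w ?y - matern_reg \<epsilon> s ?w ?y\<bar> \<le> (1 + ?\<Lambda>) * matern s ?w ?y"
      using b(1) matern_pos[OF s, of ?w ?y] abs_triangle_ineq4[of "matern s ?w ?y" "matern_reg \<epsilon> s ?w ?y"]
      by (simp add: distrib_right)
    then have "\<bar>matern s ?w ?y - matern_reg \<epsilon> s ?w ?y\<bar>\<^sup>2 \<le> ((1 + ?\<Lambda>) * matern s ?w ?y)\<^sup>2" by (intro power_mono) auto
    then show ?thesis by (simp add: power_mult_distrib)
  qed
  have 2: "(matern_deriv s ?w ?y - matern_reg_deriv \<epsilon> s ?w ?y)\<^sup>2 \<le> (1 + ?\<Lambda>)\<^sup>2 * (matern_deriv s ?w ?y)\<^sup>2"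
  proof -
    have "\<bar>matern_deriv s ?w ?y - matern_reg_deriv \<epsilon> s ?w ?y\<bar> \<le> (1 + ?\<Lambda>) * \<bar>matern_deriv s ?w ?y\<bar>"
      using b(2) abs_triangle_ineq4[of "matern_deriv s ?w ?y" "matern_reg_deriv \<epsilon> s ?w ?y"]
      by (simp add: distrib_right)
    then have "\<bar>matern_deriv s ?w ?y - matern_reg_deriv \<epsilon> s ?w ?y\<bar>\<^sup>2 \<le> ((1 + ?\<Lambda>) * \<bar>matern_deriv s ?w ?y\<bar>)\<^sup>2" by (intro power_mono) auto
    then show ?thesis by (simp add: power_mult_distrib)
  qed
  have "(norm (weighted s m (bessel_mode s m \<tau> k) z - weighted s m (smooth_mode \<epsilon> s m \<tau> k) z))\<^sup>2 \<le>
    ?y powr (1 - 2 * s) * ((matern_deriv s ?w ?y - matern_reg_deriv \<epsilon> s ?w ?y)\<^sup>2 + ((real k)\<^sup>2 + m\<^sup>2) * (matern s ?w ?y - matern_reg \<epsilon> s ?w ?y)\<^sup>2)"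
    unfolding bessel_mode_def smooth_mode_def mode_diff by (rule mode_norm_bound)
  also have "\<dots> \<le> ?y powr (1 - 2 * s) * ((1 + ?\<Lambda>)\<^sup>2 * (matern_deriv s ?w ?y)\<^sup>2 + ((real k)\<^sup>2 + m\<^sup>2) * ((1 + ?\<Lambda>)\<^sup>2 * (matern s ?w ?y)\<^sup>2))"
    by (intro mult_left_mono add_mono 1 2) auto
  finally show ?thesis by (simp add: algebra_simps)
qed

lemma smooth_mode_sq_integrable:
  assumes m: "0 < m" and s: "0 < s" "s < 1" and e: "0 < \<epsilon>" "\<epsilon> \<le> 1"
  shows "sq_integrable cyl (weighted s m (smooth_mode \<epsilon> s m \<tau> k))"
proof -
  let ?d = "\<lambda>z. weighted s m (bessel_mode s m \<tau> k) z - weighted s m (smooth_mode \<epsilon> s m \<tau> k) z"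
  have meas: "?d \<in> borel_measurable cyl"
    by (intro borel_measurable_diff weighted_measurable bessel_mode_measurable smooth_mode_measurable m e)
  have "integrable cyl (\<lambda>z. (norm (?d z))\<^sup>2)"
  proof (rule Bochner_Integration.integrable_bound[OF Bochner_Integration.integrable_mult_right[OF energy_density_cylinder(1)[OF m s, of k]]])
    show "AE z in cyl. norm ((norm (?d z))\<^sup>2) \<le> norm ((1 + bessel_int s 0 / bessel_int s 1)\<^sup>2 *
        (snd z powr (1 - 2 * s) * ((matern_deriv s (freq m k) (snd z))\<^sup>2 + ((real k)\<^sup>2 + m\<^sup>2) * (matern s (freq m k) (snd z))\<^sup>2)))"
    proof (rule AE_I2)
      fix z assume "z \<in> space cyl"
      then have "z \<in> cylinder" by simp
      from smooth_mode_diff_bound[OF m s(1) e this, of \<tau> k] order_trans[OF _ abs_ge_self]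
      show "norm ((norm (?d z))\<^sup>2) \<le> norm ((1 + bessel_int s 0 / bessel_int s 1)\<^sup>2 *
        (snd z powr (1 - 2 * s) * ((matern_deriv s (freq m k) (snd z))\<^sup>2 + ((real k)\<^sup>2 + m\<^sup>2) * (matern s (freq m k) (snd z))\<^sup>2)))"
        unfolding real_norm_def abs_of_nonneg[OF zero_le_power2] by blast
    qed
  qed (use meas in auto)
  then have "sq_integrable cyl ?d" using meas by (simp add: sq_integrable_def)
  from sq_integrable_diff[OF bessel_mode_sq_integrable(1)[OF m s, of \<tau> k] this] show ?thesis by simp
qed

text \<open>Dominated convergence, with the energy density of the limiting profile as majorant.\<close>

lemma smooth_mode_converges:
  assumes m: "0 < m" and s: "0 < s" "s < 1"
  shows "(\<lambda>n. l2norm cyl (\<lambda>z. weighted s m (bessel_mode s m \<tau> k) z - weighted s m (smooth_mode (1 / real (Suc n)) s m \<tau> k) z)) \<longlonglongrightarrow> 0"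
proof -
  let ?d = "\<lambda>n z. weighted s m (bessel_mode s m \<tau> k) z - weighted s m (smooth_mode (1 / real (Suc n)) s m \<tau> k) z"
  let ?e = "\<lambda>z::(real^3)\<times>real. (1 + bessel_int s 0 / bessel_int s 1)\<^sup>2 * (snd z powr (1 - 2 * s) * ((matern_deriv s (freq m k) (snd z))\<^sup>2 + ((real k)\<^sup>2 + m\<^sup>2) * (matern s (freq m k) (snd z))\<^sup>2))"
  have meas: "?d n \<in> borel_measurable cyl" for n
    by (intro borel_measurable_diff weighted_measurable bessel_mode_measurable smooth_mode_measurable m) auto
  have "(\<lambda>n. LINT z|cyl. (norm (?d n z))\<^sup>2) \<longlonglongrightarrow> (LINT z|cyl. 0)"
  proof (rule integral_dominated_convergence[where w = ?e])
    show "(\<lambda>z. (norm (?d n z))\<^sup>2) \<in> borel_measurable cyl" for n using meas by measurable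
    show "integrable cyl ?e" by (intro Bochner_Integration.integrable_mult_right energy_density_cylinder(1) m s)
    show "AE z in cyl. norm ((norm (?d n z))\<^sup>2) \<le> ?e z" for n
      by (intro AE_I2) (use smooth_mode_diff_bound[OF m s(1), of "1 / real (Suc n)" _ \<tau> k] in \<open>auto simp: divide_le_eq\<close>)
    show "AE z in cyl. (\<lambda>n. (norm (?d n z))\<^sup>2) \<longlonglongrightarrow> 0"
    proof (intro AE_I2)
      fix z assume "z \<in> space cyl"
      then have y: "0 < snd z" by (auto simp: cylinder_def)
      have sq: "filterlim (\<lambda>n. 1 / real (Suc n)) (at_right 0) sequentially"
        unfolding filterlim_at using LIMSEQ_inverse_real_of_nat
        by (auto simp: inverse_eq_divide)
      have "(\<lambda>n. weighted s m (smooth_mode (1 / real (Suc n)) s m \<tau> k) z) \<longlonglongrightarrow> weighted s m (bessel_mode s m \<tau> k) z"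
        unfolding weighted_def smooth_mode_def bessel_mode_def mode_def fst_conv snd_conv
        by (intro tendsto_intros filterlim_compose[OF matern_reg_tendsto(1) sq] filterlim_compose[OF matern_reg_tendsto(2) sq]
             freq_pos m y s)
      then have "(\<lambda>n. (norm (?d n z))\<^sup>2) \<longlonglongrightarrow> (norm (weighted s m (bessel_mode s m \<tau> k) z - weighted s m (bessel_mode s m \<tau> k) z))\<^sup>2"
        by (intro tendsto_intros)
      then show "(\<lambda>n. (norm (?d n z))\<^sup>2) \<longlonglongrightarrow> 0" by simp
    qed
  qed simp
  then have "(\<lambda>n. sqrt (LINT z|cyl. (norm (?d n z))\<^sup>2)) \<longlonglongrightarrow> sqrt (LINT z|cyl. 0)"
    by (intro tendsto_intros)
  then show ?thesis by (simp add: l2norm_def)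
qed

section \<open>Smoothness of the regularised modes\<close>

lemma C_on_SucI:
  fixes f :: "'a::euclidean_space \<Rightarrow> real"
  assumes "\<And>x. x \<in> S \<Longrightarrow> (f has_derivative (\<lambda>h. \<Sum>b\<in>Basis. (h \<bullet> b) * D b x)) (at x within S)"
    "\<And>b. b \<in> Basis \<Longrightarrow> C_on k S (D b)"
  shows "C_on (Suc k) S f"
  using assms by auto

lemma C_on_SucE:
  fixes f :: "'a::euclidean_space \<Rightarrow> real"
  assumes "C_on (Suc k) S f"
  obtains D where "\<And>x. x \<in> S \<Longrightarrow> (f has_derivative (\<lambda>h. \<Sum>b\<in>Basis. (h \<bullet> b) * D b x)) (at x within S)"
    "\<And>b. b \<in> Basis \<Longrightarrow> C_on k S (D b)"
  using assms that unfolding C_on.simps(2) by blast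

lemma C_on_pred: "C_on (Suc k) S f \<Longrightarrow> C_on k S f"
proof (induction k arbitrary: f)
  case 0
  then have "\<And>x. x \<in> S \<Longrightarrow> f differentiable (at x within S)" by (auto simp: differentiable_def)
  then show ?case by (simp add: differentiable_imp_continuous_within continuous_on_eq_continuous_within)
next
  case (Suc k)
  then obtain D where "\<forall>x\<in>S. (f has_derivative (\<lambda>h. \<Sum>b\<in>Basis. (h \<bullet> b) * D b x)) (at x within S)"
    "\<forall>b\<in>Basis. C_on (Suc k) S (D b)" by (auto simp only: C_on.simps(2)[of "Suc k"])
  with Suc.IH show ?case by (intro C_on_SucI[where D = D]) auto
qed

lemma C_on_const: "C_on k S (\<lambda>_. c)"
proof (induction k arbitrary: c)
  case (Suc k)
  then show ?case by (intro C_on_SucI[where D = "\<lambda>_ _. 0"]) auto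
qed simp

lemma C_on_add: "C_on k S f \<Longrightarrow> C_on k S g \<Longrightarrow> C_on k S (\<lambda>x. f x + g x)"
proof (induction k arbitrary: f g)
  case 0 then show ?case by (simp add: continuous_on_add)
next
  case (Suc k)
  obtain D where D: "\<And>x. x \<in> S \<Longrightarrow> (f has_derivative (\<lambda>h. \<Sum>b\<in>Basis. (h \<bullet> b) * D b x)) (at x within S)"
      "\<And>b. b \<in> Basis \<Longrightarrow> C_on k S (D b)"
    using C_on_SucE[OF Suc.prems(1)] by blast
  obtain E where E: "\<And>x. x \<in> S \<Longrightarrow> (g has_derivative (\<lambda>h. \<Sum>b\<in>Basis. (h \<bullet> b) * E b x)) (at x within S)"
      "\<And>b. b \<in> Basis \<Longrightarrow> C_on k S (E b)"
    using C_on_SucE[OF Suc.prems(2)] by blast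
  show ?case
  proof (rule C_on_SucI[where D = "\<lambda>b x. D b x + E b x"])
    fix x assume "x \<in> S"
    from has_derivative_add[OF D(1)[OF this] E(1)[OF this]]
    show "((\<lambda>x. f x + g x) has_derivative (\<lambda>h. \<Sum>b\<in>Basis. (h \<bullet> b) * (D b x + E b x))) (at x within S)"
      by (simp add: distrib_left sum.distrib)
  qed (use Suc.IH D(2) E(2) in auto)
qed

lemma C_on_mult: "C_on k S f \<Longrightarrow> C_on k S g \<Longrightarrow> C_on k S (\<lambda>x. f x * g x)"
proof (induction k arbitrary: f g)
  case 0 then show ?case by (simp add: continuous_on_mult)
next
  case (Suc k)
  obtain D where D: "\<And>x. x \<in> S \<Longrightarrow> (f has_derivative (\<lambda>h. \<Sum>b\<in>Basis. (h \<bullet> b) * D b x)) (at x within S)"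
      "\<And>b. b \<in> Basis \<Longrightarrow> C_on k S (D b)"
    using C_on_SucE[OF Suc.prems(1)] by blast
  obtain E where E: "\<And>x. x \<in> S \<Longrightarrow> (g has_derivative (\<lambda>h. \<Sum>b\<in>Basis. (h \<bullet> b) * E b x)) (at x within S)"
      "\<And>b. b \<in> Basis \<Longrightarrow> C_on k S (E b)"
    using C_on_SucE[OF Suc.prems(2)] by blast
  have fg: "C_on k S f" "C_on k S g" using Suc.prems by (blast dest: C_on_pred)+
  show ?case
  proof (rule C_on_SucI[where D = "\<lambda>b x. f x * E b x + D b x * g x"])
    fix x assume "x \<in> S"
    from has_derivative_mult[OF D(1)[OF this] E(1)[OF this]]
    show "((\<lambda>x. f x * g x) has_derivative (\<lambda>h. \<Sum>b\<in>Basis. (h \<bullet> b) * (f x * E b x + D b x * g x))) (at x within S)"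
      by (simp add: distrib_left sum.distrib sum_distrib_left sum_distrib_right mult_ac)
  next
    fix b :: 'a assume "b \<in> Basis"
    then show "C_on k S (\<lambda>x. f x * E b x + D b x * g x)"
      by (intro C_on_add Suc.IH fg D(2) E(2))
  qed
qed

lemma C_on_sum: "(\<And>i. i \<in> A \<Longrightarrow> C_on k S (f i)) \<Longrightarrow> C_on k S (\<lambda>x. \<Sum>i\<in>A. f i x)"
  by (induction A rule: infinite_finite_induct) (auto intro: C_on_const C_on_add)

lemma linear_Basis_sum:
  fixes L :: "'a::euclidean_space \<Rightarrow> real"
  assumes "linear L"
  shows "(\<Sum>b\<in>Basis. (h \<bullet> b) * L b) = L h"
proof -
  have "L h = L (\<Sum>b\<in>Basis. (h \<bullet> b) *\<^sub>R b)" by (simp add: euclidean_representation)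
  also have "\<dots> = (\<Sum>b\<in>Basis. (h \<bullet> b) * L b)" by (simp add: linear_sum[OF assms] linear_scale[OF assms])
  finally show ?thesis by simp
qed

text \<open>Every factor of a regularised mode is a function of one linear coordinate; this reduces its smoothness to
  derivatives of real functions.\<close>

lemma C_on_Suc_linear:
  fixes L :: "'a::euclidean_space \<Rightarrow> real" and H H' :: "real \<Rightarrow> real"
  assumes L: "bounded_linear L" and H: "\<And>t. (H has_real_derivative H' t) (at t)" and C: "C_on k S (\<lambda>z. H' (L z))"
  shows "C_on (Suc k) S (\<lambda>z. H (L z))"
proof (rule C_on_SucI[where D = "\<lambda>b z. L b * H' (L z)"])
  fix z assume "z \<in> S"
  have "((\<lambda>z. H (L z)) has_derivative (\<lambda>h. H' (L z) * L h)) (at z within S)"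
    using has_derivative_compose[OF bounded_linear_imp_has_derivative[OF L, of "at z within S"] H[of "L z", unfolded has_field_derivative_def]]
    by simp
  moreover have "(\<Sum>b\<in>Basis. (h \<bullet> b) * (L b * H' (L z))) = H' (L z) * L h" for h
    using linear_Basis_sum[OF bounded_linear.linear[OF L], of h] by (simp add: sum_distrib_right[symmetric] flip: mult.assoc)
  ultimately show "((\<lambda>z. H (L z)) has_derivative (\<lambda>h. \<Sum>b\<in>Basis. (h \<bullet> b) * (L b * H' (L z)))) (at z within S)" by simp
next
  fix b show "C_on k S (\<lambda>z. L b * H' (L z))" by (intro C_on_mult C_on_const C)
qed

lemma coord1_linear: "bounded_linear (\<lambda>z :: (real^3) \<times> real. fst z $ 1)"
  by (rule bounded_linear_compose[OF bounded_linear_vec_nth bounded_linear_fst])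

lemma C_on_sin: "C_on n S (\<lambda>z :: (real^3) \<times> real. sin (c * (fst z $ 1) + d))"
proof (induction n arbitrary: d)
  case 0 show ?case by (auto intro!: continuous_intros)
next
  case (Suc n)
  show ?case
  proof (rule C_on_Suc_linear[OF coord1_linear, where H = "\<lambda>t. sin (c * t + d)" and H' = "\<lambda>t. c * sin (c * t + (d + pi / 2))"])
    (* The derivative is again a shifted sine, so the induction closes without treating cosine separately. *)
    show "((\<lambda>t. sin (c * t + d)) has_real_derivative c * sin (c * t + (d + pi / 2))) (at t)" for t
    proof -
      have "sin (c * t + (d + pi / 2)) = cos (c * t + d)" using sin_add[of "c * t + d" "pi / 2"] by (simp add: add.assoc)
      moreover have "((\<lambda>t. sin (c * t + d)) has_real_derivative c * cos (c * t + d)) (at t)"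
        by (auto intro!: derivative_eq_intros)
      ultimately show ?thesis by simp
    qed
  qed (intro C_on_mult C_on_const Suc.IH)
qed

lemma C_on_snd: "C_on n S (\<lambda>z :: (real^3) \<times> real. snd z)"
proof (cases n)
  case 0 then show ?thesis by (auto intro!: continuous_intros)
next
  case (Suc k)
  then show ?thesis
    using C_on_Suc_linear[of "snd :: (real^3) \<times> real \<Rightarrow> real" "\<lambda>t. t" "\<lambda>_. 1" k S, OF bounded_linear_snd _ C_on_const] by (simp del: C_on.simps)
qed

text \<open>The derivative has the same form with \<open>\<sigma> - 1\<close>, so the induction generalises over \<open>\<sigma>\<close>, which becomes negative.\<close>

lemma C_on_bessel:
  assumes "0 < \<epsilon>"
  shows "C_on n S (\<lambda>z :: (real^3) \<times> real. bessel_int \<sigma> (\<omega>\<^sup>2 * (snd z)\<^sup>2 / 4 + \<epsilon>))"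
proof (induction n arbitrary: \<sigma>)
  case 0
  have "isCont (\<lambda>y. bessel_int \<sigma> (\<omega>\<^sup>2 * y\<^sup>2 / 4 + \<epsilon>)) y" for y
    using bessel_int_quadratic_deriv[OF assms] DERIV_isCont by blast
  then have "continuous_on UNIV (\<lambda>y. bessel_int \<sigma> (\<omega>\<^sup>2 * y\<^sup>2 / 4 + \<epsilon>))" by (simp add: continuous_at_imp_continuous_on)
  from continuous_on_compose2[OF this continuous_on_snd[OF continuous_on_id], of S] show ?case by simp
next
  case (Suc n)
  show ?case
  proof (rule C_on_Suc_linear[OF bounded_linear_snd, where H = "\<lambda>y. bessel_int \<sigma> (\<omega>\<^sup>2 * y\<^sup>2 / 4 + \<epsilon>)"
      and H' = "\<lambda>y. - (\<omega>\<^sup>2 * y / 2) * bessel_int (\<sigma> - 1) (\<omega>\<^sup>2 * y\<^sup>2 / 4 + \<epsilon>)"])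
    have "C_on n S (\<lambda>z :: (real^3) \<times> real. (- (\<omega>\<^sup>2 / 2) * snd z) * bessel_int (\<sigma> - 1) (\<omega>\<^sup>2 * (snd z)\<^sup>2 / 4 + \<epsilon>))"
      by (intro C_on_mult C_on_const C_on_snd Suc.IH)
    then show "C_on n S (\<lambda>z :: (real^3) \<times> real. - (\<omega>\<^sup>2 * snd z / 2) * bessel_int (\<sigma> - 1) (\<omega>\<^sup>2 * (snd z)\<^sup>2 / 4 + \<epsilon>))"
      by simp
  qed (rule bessel_int_quadratic_deriv[OF assms])
qed

lemma smooth_mode_smooth: "0 < \<epsilon> \<Longrightarrow> C_on n S (fst (smooth_mode \<epsilon> s m \<tau> k))"
proof -
  assume e: "0 < \<epsilon>"
  have "C_on n S (\<lambda>z. sin (real k * (fst z $ 1) + real k * \<tau>) * (bessel_int s ((freq m k)\<^sup>2 * (snd z)\<^sup>2 / 4 + \<epsilon>) * (1 / bessel_int s \<epsilon>)))"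
    by (intro C_on_mult C_on_sin C_on_bessel C_on_const e)
  then show ?thesis by (simp add: smooth_mode_def mode_def matern_reg_def distrib_left)
qed

lemma mode_has_derivative:
  assumes "(h has_real_derivative h' (snd z)) (at (snd z))"
  shows "(fst (mode \<tau> k h h') has_derivative (\<lambda>v. v \<bullet> snd (mode \<tau> k h h') z)) (at z)"
proof -
  have 1: "((\<lambda>z :: (real^3) \<times> real. sin (real k * (fst z $ 1 + \<tau>))) has_derivative
      (\<lambda>v. real k * cos (real k * (fst z $ 1 + \<tau>)) * (fst v $ 1))) (at z)"
  proof -
    have "((\<lambda>t. sin (real k * (t + \<tau>))) has_derivative (\<lambda>x. real k * cos (real k * (fst z $ 1 + \<tau>)) * x)) (at (fst z $ 1))"
      by (rule has_field_derivative_imp_has_derivative) (auto intro!: derivative_eq_intros)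
    from has_derivative_compose[OF bounded_linear_imp_has_derivative[OF coord1_linear, of "at z"] this]
    show ?thesis by simp
  qed
  have 2: "((\<lambda>z :: (real^3) \<times> real. h (snd z)) has_derivative (\<lambda>v. h' (snd z) * snd v)) (at z)"
    using has_derivative_compose[OF bounded_linear_imp_has_derivative[OF bounded_linear_snd, of "at z"]
       assms[unfolded has_field_derivative_def]] by simp
  have "((\<lambda>z. sin (real k * (fst z $ 1 + \<tau>)) * h (snd z)) has_derivative
     (\<lambda>v. sin (real k * (fst z $ 1 + \<tau>)) * (h' (snd z) * snd v) + real k * cos (real k * (fst z $ 1 + \<tau>)) * (fst v $ 1) * h (snd z))) (at z)"
    by (rule has_derivative_mult[OF 1 2])
  moreover have "(\<lambda>v. sin (real k * (fst z $ 1 + \<tau>)) * (h' (snd z) * snd v) + real k * cos (real k * (fst z $ 1 + \<tau>)) * (fst v $ 1) * h (snd z)) =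
     (\<lambda>v. v \<bullet> snd (mode \<tau> k h h') z)"
    by (simp add: mode_def fun_eq_iff inner_prod_def inner_axis algebra_simps)
  ultimately show ?thesis by (simp add: mode_def)
qed

lemma grad_eqI:
  assumes "(f has_derivative (\<lambda>v. v \<bullet> g)) (at z)"
  shows "grad f z = g"
proof -
  have "frechet_derivative f (at z) = (\<lambda>v. v \<bullet> g)" using frechet_derivative_at[OF assms] by simp
  then show ?thesis by (simp add: grad_def inner_commute[of _ g] euclidean_representation)
qed

definition smooth_sum :: "real \<Rightarrow> real \<Rightarrow> real \<Rightarrow> real \<Rightarrow> (nat \<Rightarrow> real) \<Rightarrow> nat \<Rightarrow> X_elem" where
  "smooth_sum \<epsilon> s m \<tau> b n = (\<lambda>z. \<Sum>k<n. b k * fst (smooth_mode \<epsilon> s m \<tau> k) z, \<lambda>z. \<Sum>k<n. b k *\<^sub>R snd (smooth_mode \<epsilon> s m \<tau> k) z)"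

lemma smooth_sum_grad:
  assumes "0 < \<epsilon>"
  shows "grad (fst (smooth_sum \<epsilon> s m \<tau> b n)) z = snd (smooth_sum \<epsilon> s m \<tau> b n) z"
proof (rule grad_eqI)
  have "((\<lambda>z. \<Sum>k<n. b k * fst (smooth_mode \<epsilon> s m \<tau> k) z) has_derivative (\<lambda>v. \<Sum>k<n. b k * (v \<bullet> snd (smooth_mode \<epsilon> s m \<tau> k) z))) (at z)"
    unfolding smooth_mode_def
    by (intro has_derivative_sum has_derivative_mult_right mode_has_derivative matern_reg_has_deriv assms)
  then show "(fst (smooth_sum \<epsilon> s m \<tau> b n) has_derivative (\<lambda>v. v \<bullet> snd (smooth_sum \<epsilon> s m \<tau> b n) z)) (at z)"
    by (simp add: smooth_sum_def inner_sum_right)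
qed

lemma weighted_sum:
  "weighted s m (\<lambda>z. \<Sum>k\<in>A. b k * fst (E k) z, \<lambda>z. \<Sum>k\<in>A. b k *\<^sub>R snd (E k) z) z = (\<Sum>k\<in>A. b k *\<^sub>R weighted s m (E k) z)"
  by (simp add: weighted_def prod_eq_iff fst_sum snd_sum sum_distrib_left sum_distrib_right scaleR_sum_right mult_ac)

lemma smooth_sum_trace: "0 < \<epsilon> \<Longrightarrow> fst (smooth_sum \<epsilon> s m \<tau> b n) (x, 0) = (\<Sum>k<n. b k * sin (real k * (x $ 1 + \<tau>)))"
  by (simp add: smooth_sum_def smooth_mode_def mode_def matern_reg_0)

lemma smooth_sum_smooth_periodic:
  assumes m: "0 < m" and s: "0 < s" "s < 1" and e: "0 < \<epsilon>" "\<epsilon> \<le> 1"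
  shows "fst (smooth_sum \<epsilon> s m \<tau> b n) \<in> smooth_periodic s"
proof -
  have "smooth_on (UNIV \<times> {0..}) (fst (smooth_sum \<epsilon> s m \<tau> b n))"
    unfolding smooth_on_def smooth_sum_def fst_conv
    by (intro allI C_on_sum C_on_mult C_on_const smooth_mode_smooth e)
  moreover have "periodic (\<lambda>x. fst (smooth_sum \<epsilon> s m \<tau> b n) (x, y))" for y
    using periodic_coord1[of "\<lambda>t. \<Sum>k<n. b k * (sin (real k * t) * matern_reg \<epsilon> s (freq m k) y)" \<tau>]
    by (simp add: smooth_sum_def smooth_mode_def mode_def sin_nat_periodic)
  moreover have "X_finite s (fst (smooth_sum \<epsilon> s m \<tau> b n), grad (fst (smooth_sum \<epsilon> s m \<tau> b n)))"
  proof -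
    have g: "grad (fst (smooth_sum \<epsilon> s m \<tau> b n)) = snd (smooth_sum \<epsilon> s m \<tau> b n)"
      using smooth_sum_grad[OF e(1)] by blast
    have "X_finite s (smooth_sum \<epsilon> s m \<tau> b n)"
    proof (rule weighted_X_finite[of m])
      show "fst (smooth_sum \<epsilon> s m \<tau> b n) \<in> borel_measurable cyl"
        unfolding smooth_sum_def fst_conv by (intro borel_measurable_sum borel_measurable_times borel_measurable_const smooth_mode_measurable e)
      show "snd (smooth_sum \<epsilon> s m \<tau> b n) \<in> borel_measurable cyl"
        unfolding smooth_sum_def snd_conv by (intro borel_measurable_sum borel_measurable_scaleR borel_measurable_const smooth_mode_measurable e)
      show "sq_integrable cyl (weighted s m (smooth_sum \<epsilon> s m \<tau> b n))"
        unfolding smooth_sum_def weighted_sum[abs_def]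
        by (intro sq_integrable_sum sq_integrable_scale smooth_mode_sq_integrable m s e)
    qed (use m in auto)
    then show ?thesis by (simp add: g)
  qed
  ultimately show ?thesis by (simp add: smooth_periodic_def)
qed

text \<open>Directional derivatives of a smooth function, continuous up to the boundary and equal in the interior to the
  components of \<open>grad \<phi>\<close>.\<close>

lemma smooth_periodic_directional:
  assumes "\<phi> \<in> smooth_periodic s"
  obtains D where "\<And>z. 0 < snd z \<Longrightarrow> (\<phi> has_derivative D z) (at z)"
    "\<And>v. continuous_on (UNIV \<times> {0..}) (\<lambda>z. D z v)"
    "\<And>z w. 0 < snd z \<Longrightarrow> grad \<phi> z \<bullet> w = D z w"
    "continuous_on (UNIV \<times> {0..}) \<phi>"
proof -
  let ?S = "UNIV \<times> {0..} :: ((real^3) \<times> real) set"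
  have C: "C_on n ?S \<phi>" for n using assms by (simp add: smooth_periodic_def smooth_on_def)
  from C[of "Suc 0"] obtain E where
    E: "\<And>z. z \<in> ?S \<Longrightarrow> (\<phi> has_derivative (\<lambda>h. \<Sum>b\<in>Basis. (h \<bullet> b) * E b z)) (at z within ?S)"
      "\<And>b. b \<in> Basis \<Longrightarrow> continuous_on ?S (E b)" by auto
  define D where "D = (\<lambda>z h. \<Sum>b\<in>Basis. (h \<bullet> b) * E b z)"
  have der: "(\<phi> has_derivative D z) (at z)" if "0 < snd z" for z
  proof -
    have o: "open (UNIV \<times> {0<..} :: ((real^3) \<times> real) set)" by (intro open_Times) auto
    have "z \<in> ?S" using that by (cases z) auto
    moreover have "UNIV \<times> {0<..} \<subseteq> ?S" by auto
    ultimately have "(\<phi> has_derivative D z) (at z within (UNIV \<times> {0<..}))"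
      unfolding D_def by (intro has_derivative_subset[OF E(1)])
    then show ?thesis using at_within_open[OF _ o, of z] that by (cases z) auto
  qed
  show thesis
  proof (rule that[of D])
    show "continuous_on ?S (\<lambda>z. D z v)" for v unfolding D_def by (intro continuous_intros E) auto
    show "continuous_on ?S \<phi>" using C[of 0] by simp
    fix z w assume "0 < snd (z :: (real^3) \<times> real)"
    from der[OF this] have "frechet_derivative \<phi> (at z) = D z" and lin: "linear (D z)"
      using frechet_derivative_at has_derivative_linear by (metis, blast)
    then have "grad \<phi> z \<bullet> w = (\<Sum>b\<in>Basis. (w \<bullet> b) * D z b)" unfolding grad_def inner_sum_left by (simp add: inner_commute mult.commute)
    then show "grad \<phi> z \<bullet> w = D z w" using linear_Basis_sum[OF lin] by simp
  qed (rule der)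
qed

section \<open>Pairing a mode with a smooth function\<close>

lemma cyl_integrable_set:
  fixes f :: "(real^3) \<times> real \<Rightarrow> real"
  assumes c: "continuous_on cylinder f" and i: "integrable cyl f"
  shows "set_integrable lborel cylinder f" "(LINT z|cyl. f z) = (LINT z:cylinder|lborel. f z)"
  using lebesgue_on_eq_set(1,2)[OF cylinder_sets continuous_indicator_measurable[OF c cylinder_sets]] i by auto

text \<open>For fixed \<open>y\<close> the integrand is, up to a factor depending on \<open>y\<close>, the derivative in \<open>x\<^sub>1\<close> of the periodic function \<open>k cos (k (x\<^sub>1 + \<tau>)) \<phi>(x, y)\<close>.\<close>

lemma bessel_mode_horizontal_integral:
  assumes m: "0 < m" and s: "0 < s" "s < 1" and \<phi>: "\<phi> \<in> smooth_periodic s"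
    and D: "\<And>z. 0 < snd z \<Longrightarrow> (\<phi> has_derivative D z) (at z)"
      "\<And>v. continuous_on (UNIV \<times> {0..}) (\<lambda>z. D z v)" "continuous_on (UNIV \<times> {0..}) \<phi>"
    and i: "integrable cyl (\<lambda>z. snd z powr (1 - 2 * s) * matern s (freq m k) (snd z) *
        (real k * cos (real k * (fst z $ 1 + \<tau>)) * D z (axis 1 1, 0) - (real k)\<^sup>2 * sin (real k * (fst z $ 1 + \<tau>)) * \<phi> z))"
  shows "(LINT z|cyl. snd z powr (1 - 2 * s) * matern s (freq m k) (snd z) *
        (real k * cos (real k * (fst z $ 1 + \<tau>)) * D z (axis 1 1, 0) - (real k)\<^sup>2 * sin (real k * (fst z $ 1 + \<tau>)) * \<phi> z)) = 0"
proof -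
  let ?g = "\<lambda>z. real k * cos (real k * (fst z $ 1 + \<tau>)) * D z (axis 1 1, 0) - (real k)\<^sup>2 * sin (real k * (fst z $ 1 + \<tau>)) * \<phi> z"
  let ?f = "\<lambda>z. snd z powr (1 - 2 * s) * matern s (freq m k) (snd z) * ?g z"
  have sub: "cylinder \<subseteq> UNIV \<times> {0..}" by (auto simp: cylinder_def)
  have c: "continuous_on cylinder ?f"
    by (intro continuous_intros continuous_on_subset[OF D(2) sub] continuous_on_subset[OF D(3) sub]
        continuous_on_compose2[OF matern_continuous[OF freq_pos[OF m]]]) (auto simp: cylinder_def)
  note e = cyl_integrable_set[OF c i]
  have "(LINT x:cube|lborel. ?f (x, y)) = 0" if y: "0 < y" for y
  proof -
    define G where "G = (\<lambda>x :: real^3. real k * cos (real k * (x $ 1 + \<tau>)) * \<phi> (x, y))"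
    have cg: "continuous_on UNIV (\<lambda>x. ?g (x, y))"
      by (intro continuous_intros continuous_on_compose2[OF D(2)] continuous_on_compose2[OF D(3)]) (use y in auto)
    have "(LINT x|lebesgue_on cube. ?g (x, y)) = 0"
    proof (rule cube_integral_partial1[where G = G])
      show "continuous_on UNIV (\<lambda>x. ?g (x, y))" by (rule cg)
      have "periodic (\<lambda>x. \<phi> (x, y))" using \<phi> y by (simp add: smooth_periodic_def)
      moreover have "periodic (\<lambda>x. cos (real k * (x $ 1 + \<tau>)))"
        by (rule periodic_coord1) (rule cos_nat_periodic)
      ultimately show "periodic G" by (simp add: periodic_def G_def)
      show "((\<lambda>a. G (vec3 a b c)) has_real_derivative ?g (vec3 a b c, y)) (at a)" for a b c
      proof -
        have "((\<lambda>a. (vec3 a b c, y)) has_derivative (\<lambda>h. (h *\<^sub>R axis 1 1, 0))) (at a)"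
        proof -
          have eq: "(\<lambda>a. (vec3 a b c, y)) = (\<lambda>a. (vec3 0 b c + a *\<^sub>R axis 1 1, y))"
            by (simp add: fun_eq_iff vec_eq_iff vec3_def axis_def)
          show ?thesis unfolding eq by (auto intro!: derivative_eq_intros)
        qed
        from has_derivative_compose[OF this D(1)] y
        have d: "((\<lambda>a. \<phi> (vec3 a b c, y)) has_derivative (\<lambda>h. D (vec3 a b c, y) (h *\<^sub>R axis 1 1, 0))) (at a)" by simp
        have "linear (D (vec3 a b c, y))" using D(1)[of "(vec3 a b c, y)"] y has_derivative_linear by auto
        then have "D (vec3 a b c, y) (h *\<^sub>R axis 1 1, 0) = D (vec3 a b c, y) (axis 1 1, 0) * h" for h
          using linear_scale[of "D (vec3 a b c, y)" h "(axis 1 1, 0)"] by (simp add: mult.commute)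
        with d have d': "((\<lambda>a. \<phi> (vec3 a b c, y)) has_real_derivative D (vec3 a b c, y) (axis 1 1, 0)) (at a)"
          by (simp add: has_field_derivative_def)
        show ?thesis unfolding G_def vec3_nth
          by (rule derivative_eq_intros d' refl | simp add: power2_eq_square)+
      qed
    qed
    then have "(LINT x:cube|lborel. ?g (x, y)) = 0"
      using lebesgue_on_eq_set(2)[OF cube_sets continuous_indicator_measurable[OF continuous_on_subset[OF cg subset_UNIV] cube_sets]] by simp
    then show ?thesis by simp
  qed
  then have z: "indicator {0<..} y *\<^sub>R (LINT x:cube|lborel. ?f (x, y)) = 0" for y
    by (cases "0 < y") (simp_all only: indicator_simps greaterThan_iff scaleR_zero_left scaleR_zero_right not_False_eq_True)
  have "(LINT z:cylinder|lborel. ?f z) = (LINT y:{0<..}|lborel. LINT x:cube|lborel. ?f (x, y))"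
    by (rule cylinder_integral(1)[OF e(1)])
  also have "\<dots> = 0" unfolding set_lebesgue_integral_def[of lborel "{0<..}"] z by simp
  finally show ?thesis using e(2) by simp
qed

text \<open>For fixed \<open>x\<close> the integrand is, up to the sine, the derivative in \<open>y\<close> of \<open>y\<^sup>1\<^sup>-\<^sup>2\<^sup>s \<theta>' \<phi>\<close> by the
  differential equation of the profile; its integral is the boundary flux times \<open>\<phi>(x, 0)\<close>. The second integrability
  assumption says that this primitive is integrable, as \<open>half_line_FTC\<close> demands for its limit at infinity.\<close>

lemma bessel_mode_vertical_integral:
  assumes m: "0 < m" and s: "0 < s" "s < 1"
    and D: "\<And>z. 0 < snd z \<Longrightarrow> (\<phi> has_derivative D z) (at z)"
      "\<And>v. continuous_on (UNIV \<times> {0..}) (\<lambda>z. D z v)" "continuous_on (UNIV \<times> {0..}) \<phi>"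
    and i: "integrable cyl (\<lambda>z. sin (real k * (fst z $ 1 + \<tau>)) * (snd z powr (1 - 2 * s) *
        (matern_deriv s (freq m k) (snd z) * D z (0, 1) + (freq m k)\<^sup>2 * matern s (freq m k) (snd z) * \<phi> z)))"
    and i': "integrable cyl (\<lambda>z. snd z powr (1 - 2 * s) * matern_deriv s (freq m k) (snd z) * \<phi> z)"
  shows "(LINT z|cyl. sin (real k * (fst z $ 1 + \<tau>)) * (snd z powr (1 - 2 * s) *
        (matern_deriv s (freq m k) (snd z) * D z (0, 1) + (freq m k)\<^sup>2 * matern s (freq m k) (snd z) * \<phi> z))) =
     flux s * freq m k powr (2 * s) * (LINT x|lebesgue_on cube. sin (real k * (x $ 1 + \<tau>)) * \<phi> (x, 0))"
proof -
  let ?w = "freq m k" and ?c = "\<lambda>x::real^3. sin (real k * (x $ 1 + \<tau>))"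
  let ?g = "\<lambda>z. snd z powr (1 - 2 * s) * (matern_deriv s ?w (snd z) * D z (0, 1) + ?w\<^sup>2 * matern s ?w (snd z) * \<phi> z)"
  let ?F = "\<lambda>z. ?c (fst z) * ?g z"
  let ?h = "\<lambda>z. snd z powr (1 - 2 * s) * matern_deriv s ?w (snd z) * \<phi> z"
  let ?C = "flux s * ?w powr (2 * s)"
  have w: "?w > 0" by (rule freq_pos[OF m])
  have sub: "cylinder \<subseteq> UNIV \<times> {0..}" by (auto simp: cylinder_def)
  have c: "continuous_on cylinder ?F"
    by (intro continuous_intros continuous_on_subset[OF D(2) sub] continuous_on_subset[OF D(3) sub]
        continuous_on_compose2[OF matern_continuous[OF w]] continuous_on_compose2[OF matern_deriv_continuous[OF w]]) (auto simp: cylinder_def)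
  have c': "continuous_on cylinder ?h"
    by (intro continuous_intros continuous_on_subset[OF D(3) sub]
        continuous_on_compose2[OF matern_deriv_continuous[OF w]]) (auto simp: cylinder_def)
  note e = cyl_integrable_set[OF c i] and e' = cyl_integrable_set[OF c' i']
  have inner: "(LINT y:{0<..}|lborel. ?F (x, y)) = ?C * (?c x * \<phi> (x, 0))"
    if F: "set_integrable lborel {0<..} (\<lambda>y. ?F (x, y))" and h: "set_integrable lborel {0<..} (\<lambda>y. ?h (x, y))" for x
  proof (cases "?c x = 0")
    case False
    (* The primitive, written with the conjugate profile, which has a limit at 0. *)
    let ?H = "\<lambda>y. ?C * matern (1 - s) ?w y * \<phi> (x, y)"
    have psi: "?C * matern (1 - s) ?w y = - (y powr (1 - 2 * s) * matern_deriv s ?w y)" if "0 < y" for y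
      using matern_weighted_deriv[OF w that s] by simp
    have "(LINT y:{0<..}|lborel. - ?g (x, y)) = - (?C * 1 * \<phi> (x, 0))"
    proof (rule half_line_FTC[where h = ?H])
      show "(?H has_real_derivative - ?g (x, y)) (at y)" if y: "0 < y" for y
      proof -
        have "((\<lambda>y. (x, y)) has_derivative (\<lambda>h. (0, h))) (at y)" by (auto intro!: derivative_eq_intros)
        from has_derivative_compose[OF this D(1)] y
        have d: "((\<lambda>y. \<phi> (x, y)) has_derivative (\<lambda>h. D (x, y) (0, h))) (at y)" by simp
        have "linear (D (x, y))" using D(1)[of "(x, y)"] y has_derivative_linear by auto
        then have "D (x, y) (0, h) = D (x, y) (0, 1) * h" for h
          using linear_scale[of "D (x, y)" h "(0, 1)"] by (simp add: mult.commute)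
        then have "(\<lambda>h. D (x, y) (0, h)) = (\<lambda>h. D (x, y) (0, 1) * h)" by blast
        with d have d': "((\<lambda>y. \<phi> (x, y)) has_real_derivative D (x, y) (0, 1)) (at y)"
          unfolding has_field_derivative_def by (simp only:)
        have "(?H has_real_derivative (- (y powr (1 - 2 * s) * ?w\<^sup>2 * matern s ?w y) * \<phi> (x, y) + D (x, y) (0, 1) * (?C * matern (1 - s) ?w y))) (at y)"
          by (intro DERIV_mult matern_conj_deriv w y s d')
        moreover have "- (y powr (1 - 2 * s) * ?w\<^sup>2 * matern s ?w y) * \<phi> (x, y) + D (x, y) (0, 1) * (?C * matern (1 - s) ?w y) = - ?g (x, y)"
          unfolding psi[OF y] by (simp add: algebra_simps)
        ultimately show ?thesis by simp
      qed
      show "isCont (\<lambda>y. - ?g (x, y)) y" if y: "0 < y" for y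
      proof -
        have "continuous_on {0<..} (\<lambda>y. - ?g (x, y))"
          by (intro continuous_intros continuous_on_compose2[OF D(2)] continuous_on_compose2[OF D(3)]
            continuous_on_compose2[OF matern_continuous[OF w]] continuous_on_compose2[OF matern_deriv_continuous[OF w]]) auto
        then show ?thesis using y by (simp add: continuous_on_eq_continuous_at)
      qed
      have "set_integrable lborel {0<..} (\<lambda>y. - (1 / ?c x) * ?F (x, y))"
        by (rule set_integrable_mult_right) (use F in auto)
      then show "set_integrable lborel {0<..} (\<lambda>y. - ?g (x, y))" using False by simp
      have "set_integrable lborel {0<..} (\<lambda>y. - 1 * ?h (x, y))"
        by (rule set_integrable_mult_right) (use h in auto)
      then show "set_integrable lborel {0<..} ?H"
        by (rule set_integrable_cong[THEN iffD1, rotated -1]) (auto simp: psi)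
      have "((\<lambda>y. \<phi> (x, y)) \<longlongrightarrow> \<phi> (x, 0)) (at 0 within {0..})"
      proof -
        have "continuous_on {0..} (\<lambda>y. \<phi> (x, y))"
          by (intro continuous_on_compose2[OF D(3)] continuous_intros) auto
        then show ?thesis by (simp add: continuous_on_def)
      qed
      then have "((\<lambda>y. \<phi> (x, y)) \<longlongrightarrow> \<phi> (x, 0)) (at_right 0)"
        by (rule tendsto_within_subset) auto
      then show "(?H \<longlongrightarrow> ?C * 1 * \<phi> (x, 0)) (at_right 0)"
        by (intro tendsto_intros matern_tendsto_0 w) (use s in auto)
    qed
    then have g: "(LINT y:{0<..}|lborel. ?g (x, y)) = ?C * \<phi> (x, 0)"
      by (simp add: set_lebesgue_integral_def)
    have "(LINT y:{0<..}|lborel. ?F (x, y)) = ?c x * (LINT y:{0<..}|lborel. ?g (x, y))" by simp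
    also have "\<dots> = ?c x * (?C * \<phi> (x, 0))" unfolding g ..
    also have "\<dots> = ?C * (?c x * \<phi> (x, 0))" by (rule mult.left_commute)
    finally show ?thesis .
  qed (simp add: set_lebesgue_integral_def)
  have cphi: "continuous_on UNIV (\<lambda>x. ?c x * \<phi> (x, 0))"
    by (intro continuous_intros continuous_on_compose2[OF D(3)]) auto
  have "(LINT z:cylinder|lborel. ?F z) = (LINT x:cube|lborel. LINT y:{0<..}|lborel. ?F (x, y))"
    by (rule cylinder_integral(2)[OF e(1)])
  also have "\<dots> = (LINT x:cube|lborel. ?C * (?c x * \<phi> (x, 0)))"
    unfolding set_lebesgue_integral_def[of lborel cube]
  proof (rule integral_cong_AE)
    show "(\<lambda>x. indicator cube x *\<^sub>R (LINT y:{0<..}|lborel. ?F (x, y))) \<in> borel_measurable lborel"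
      using cylinder_integral(3)[OF e(1)] by simp
    have "continuous_on UNIV (\<lambda>x. ?C * (?c x * \<phi> (x, 0)))" by (intro continuous_on_mult continuous_on_const cphi)
    from continuous_indicator_measurable[OF continuous_on_subset[OF this subset_UNIV] cube_sets]
    show "(\<lambda>x. indicator cube x *\<^sub>R (?C * (?c x * \<phi> (x, 0)))) \<in> borel_measurable lborel"
      by (simp only: measurable_lborel1 measurable_lborel2)
    show "AE x in lborel. indicator cube x *\<^sub>R (LINT y:{0<..}|lborel. ?F (x, y)) = indicator cube x *\<^sub>R (?C * (?c x * \<phi> (x, 0)))"
      using cylinder_integral(4)[OF e(1)] cylinder_integral(4)[OF e'(1)]
    proof eventually_elim
      case (elim x)
      show ?case
      proof (cases "x \<in> cube")
        case True
        with elim have "set_integrable lborel {0<..} (\<lambda>y. ?F (x, y))" "set_integrable lborel {0<..} (\<lambda>y. ?h (x, y))"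
          by blast+
        from inner[OF this] show ?thesis by (simp only:)
      next
        case False
        then have "indicator cube x = (0 :: real)" by simp
        then show ?thesis by (simp only: scaleR_zero_left)
      qed
    qed
  qed
  also have "\<dots> = ?C * (LINT x:cube|lborel. ?c x * \<phi> (x, 0))" by (rule set_integral_mult_right)
  also have "(LINT x:cube|lborel. ?c x * \<phi> (x, 0)) = (LINT x|lebesgue_on cube. ?c x * \<phi> (x, 0))"
    using lebesgue_on_eq_set(2)[OF cube_sets continuous_indicator_measurable[OF continuous_on_subset[OF cphi subset_UNIV] cube_sets]] by simp
  finally show ?thesis using e(2) by simp
qed

text \<open>Weak form of the boundary value problem for one mode. The term \<open>m\<^sup>2 \<theta> \<phi>\<close> is split as
  \<open>(k\<^sup>2 + m\<^sup>2) \<theta> \<phi> - k\<^sup>2 \<theta> \<phi>\<close>: the second part completes the horizontal derivative to a total derivative, the first part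
  the vertical one.\<close>

lemma bessel_mode_test:
  assumes m: "0 < m" and s: "0 < s" "s < 1" and \<phi>: "\<phi> \<in> smooth_periodic s"
  shows "(LINT z|cyl. weighted s m (bessel_mode s m \<tau> k) z \<bullet> weighted s m (\<phi>, grad \<phi>) z) =
     flux s * freq m k powr (2 * s) * (LINT x|lebesgue_on cube. sin (real k * (x $ 1 + \<tau>)) * \<phi> (x, 0))"
proof -
  obtain D where D: "\<And>z. 0 < snd z \<Longrightarrow> (\<phi> has_derivative D z) (at z)"
    "\<And>v. continuous_on (UNIV \<times> {0..}) (\<lambda>z. D z v)"
    "\<And>z w. 0 < snd z \<Longrightarrow> grad \<phi> z \<bullet> w = D z w"
    "continuous_on (UNIV \<times> {0..}) \<phi>"
    using smooth_periodic_directional[OF \<phi>] by blast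
  let ?w = "freq m k"
  let ?E = "bessel_mode s m \<tau> k"
  define r where "r = (real k)\<^sup>2 / m\<^sup>2"
  have r: "m\<^sup>2 * r = (real k)\<^sup>2" "m\<^sup>2 * (1 + r) = ?w\<^sup>2" using m by (auto simp: r_def freq_sq field_simps)
  have r0: "r \<ge> 0" by (simp add: r_def)
  (* P1 and P2 carry the two parts; the factors - r and 1 + r turn m^2 into - k^2 and k^2 + m^2. Pairing P3 with
     the test function gives the primitive in the vertical integral. Writing all three as elements of the
     weighted space reduces the integrability of the products to square integrability. *)
  define P1 :: X_elem where "P1 = (\<lambda>z. - r * fst ?E z, \<lambda>z. (fst (snd ?E z), 0))"
  define P2 :: X_elem where "P2 = (\<lambda>z. (1 + r) * fst ?E z, \<lambda>z. (0, snd (snd ?E z)))"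
  define P3 :: X_elem where "P3 = (\<lambda>z. (1 / m\<^sup>2) * matern_deriv s ?w (snd z), \<lambda>z. 0)"
  have Em: "fst ?E \<in> borel_measurable cyl" "snd ?E \<in> borel_measurable cyl"
    by (intro bessel_mode_measurable m)+
  have cm: "continuous_on cylinder (\<lambda>z. matern s ?w (snd z))" "continuous_on cylinder (\<lambda>z. matern_deriv s ?w (snd z))"
    by (intro continuous_on_compose2[OF matern_continuous[OF freq_pos[OF m]]] continuous_on_compose2[OF matern_deriv_continuous[OF freq_pos[OF m]]]
       continuous_intros; force simp: cylinder_def)+
  have cE: "continuous_on cylinder (fst ?E)" "continuous_on cylinder (\<lambda>z. fst (snd ?E z))" "continuous_on cylinder (\<lambda>z. snd (snd ?E z))"
    unfolding bessel_mode_def mode_def fst_conv snd_conv by (intro continuous_intros cm)+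
  have meas: "weighted s m P1 \<in> borel_measurable cyl" "weighted s m P2 \<in> borel_measurable cyl" "weighted s m P3 \<in> borel_measurable cyl"
    unfolding P1_def P2_def P3_def
    by (intro weighted_measurable cyl_measurable_continuous; unfold fst_conv snd_conv; intro continuous_intros cE cm)+
  have Esq: "sq_integrable cyl (weighted s m ?E)" by (rule bessel_mode_sq_integrable(1)[OF m s])
  have nE: "(norm (snd ?E z))\<^sup>2 = (norm (fst (snd ?E z)))\<^sup>2 + (snd (snd ?E z))\<^sup>2" for z by (simp add: norm_prod_def)
  have bd: "sq_integrable cyl (weighted s m P)" if P: "weighted s m P \<in> borel_measurable cyl"
     "\<And>z. (fst P z)\<^sup>2 \<le> (1 + r)\<^sup>2 * (fst ?E z)\<^sup>2" "\<And>z. (norm (snd P z))\<^sup>2 \<le> (norm (snd ?E z))\<^sup>2" for P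
  proof (rule sq_integrable_bound[OF sq_integrable_scale[OF Esq, of "1 + r"] P(1)])
    fix z
    have "(norm (weighted s m P z))\<^sup>2 \<le> (1 + r)\<^sup>2 * (norm (weighted s m ?E z))\<^sup>2"
    proof -
      have "(norm (snd P z))\<^sup>2 + m\<^sup>2 * (fst P z)\<^sup>2 \<le> (1 + r)\<^sup>2 * (norm (snd ?E z))\<^sup>2 + m\<^sup>2 * ((1 + r)\<^sup>2 * (fst ?E z)\<^sup>2)"
      proof (intro add_mono mult_left_mono P(2))
        have "1 * (norm (snd ?E z))\<^sup>2 \<le> (1 + r)\<^sup>2 * (norm (snd ?E z))\<^sup>2" using r0 by (intro mult_right_mono one_le_power) auto
        then show "(norm (snd P z))\<^sup>2 \<le> (1 + r)\<^sup>2 * (norm (snd ?E z))\<^sup>2" using P(3)[of z] by linarith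
      qed auto
      then have "snd z powr (1 - 2 * s) * ((norm (snd P z))\<^sup>2 + m\<^sup>2 * (fst P z)\<^sup>2) \<le> 
         snd z powr (1 - 2 * s) * ((1 + r)\<^sup>2 * (norm (snd ?E z))\<^sup>2 + m\<^sup>2 * ((1 + r)\<^sup>2 * (fst ?E z)\<^sup>2))"
        by (intro mult_left_mono) auto
      then show ?thesis unfolding weighted_norm_sq by (simp add: algebra_simps)
    qed
    also have "\<dots> = (norm ((1 + r) *\<^sub>R weighted s m ?E z))\<^sup>2" by (simp add: power_mult_distrib)
    finally show "norm (weighted s m P z) \<le> norm ((1 + r) *\<^sub>R weighted s m ?E z)" by (rule power2_le_imp_le) simp
  qed
  have sq1: "sq_integrable cyl (weighted s m P1)"
  proof (rule bd[OF meas(1)])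
    fix z
    show "(fst P1 z)\<^sup>2 \<le> (1 + r)\<^sup>2 * (fst ?E z)\<^sup>2"
      unfolding P1_def fst_conv power_mult_distrib using r0 by (intro mult_right_mono) (auto intro: power_mono)
    show "(norm (snd P1 z))\<^sup>2 \<le> (norm (snd ?E z))\<^sup>2" unfolding nE by (simp add: P1_def norm_prod_def)
  qed
  have sq2: "sq_integrable cyl (weighted s m P2)"
  proof (rule bd[OF meas(2)])
    fix z
    show "(fst P2 z)\<^sup>2 \<le> (1 + r)\<^sup>2 * (fst ?E z)\<^sup>2" by (simp add: P2_def power_mult_distrib)
    show "(norm (snd P2 z))\<^sup>2 \<le> (norm (snd ?E z))\<^sup>2" unfolding nE by (simp add: P2_def norm_prod_def)
  qed
  have sq3: "sq_integrable cyl (weighted s m P3)"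
    unfolding sq_integrable_def
  proof
    show "integrable cyl (\<lambda>z. (norm (weighted s m P3 z))\<^sup>2)"
    proof (rule Bochner_Integration.integrable_bound[OF Bochner_Integration.integrable_mult_right[OF energy_density_cylinder(1)[OF m s, of k], of "1 / m\<^sup>2"]])
      show "AE z in cyl. norm ((norm (weighted s m P3 z))\<^sup>2) \<le> norm (1 / m\<^sup>2 * (snd z powr (1 - 2 * s) * ((matern_deriv s ?w (snd z))\<^sup>2 + ((real k)\<^sup>2 + m\<^sup>2) * (matern s ?w (snd z))\<^sup>2)))"
      proof (rule AE_I2)
        fix z :: "(real^3) \<times> real"
        have "m\<^sup>2 * (1 / m\<^sup>2 * matern_deriv s ?w (snd z))\<^sup>2 = 1 / m\<^sup>2 * (matern_deriv s ?w (snd z))\<^sup>2"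
          using m by (simp add: power2_eq_square field_simps)
        then have "(norm (weighted s m P3 z))\<^sup>2 = 1 / m\<^sup>2 * (snd z powr (1 - 2 * s) * (matern_deriv s ?w (snd z))\<^sup>2)"
          unfolding weighted_norm_sq P3_def by simp
        also have "\<dots> \<le> 1 / m\<^sup>2 * (snd z powr (1 - 2 * s) * ((matern_deriv s ?w (snd z))\<^sup>2 + ((real k)\<^sup>2 + m\<^sup>2) * (matern s ?w (snd z))\<^sup>2))"
          by (intro mult_left_mono) auto
        finally show "norm ((norm (weighted s m P3 z))\<^sup>2) \<le> norm (1 / m\<^sup>2 * (snd z powr (1 - 2 * s) * ((matern_deriv s ?w (snd z))\<^sup>2 + ((real k)\<^sup>2 + m\<^sup>2) * (matern s ?w (snd z))\<^sup>2)))"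
          by simp
      qed
    qed (use meas in auto)
  qed (rule meas)
  have \<phi>sq: "sq_integrable cyl (weighted s m (\<phi>, grad \<phi>))"
    using \<phi> by (intro X_finite_weighted) (simp add: smooth_periodic_def)
  have y: "0 < snd z" if "z \<in> cylinder" for z using that by (auto simp: cylinder_def)
  have I1: "weighted s m P1 z \<bullet> weighted s m (\<phi>, grad \<phi>) z = snd z powr (1 - 2 * s) * matern s ?w (snd z) *
        (real k * cos (real k * (fst z $ 1 + \<tau>)) * D z (axis 1 1, 0) - (real k)\<^sup>2 * sin (real k * (fst z $ 1 + \<tau>)) * \<phi> z)"
    if "z \<in> cylinder" for z
  proof -
    have "snd P1 z \<bullet> grad \<phi> z = real k * cos (real k * (fst z $ 1 + \<tau>)) * matern s ?w (snd z) * D z (axis 1 1, 0)"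
    proof -
      have "snd P1 z = (real k * cos (real k * (fst z $ 1 + \<tau>)) * matern s ?w (snd z)) *\<^sub>R (axis 1 1, 0)"
        by (simp add: P1_def bessel_mode_def mode_def)
      then show ?thesis
        by (simp only: inner_scaleR_left inner_commute[of "(axis 1 1, 0)"] D(3)[OF y[OF that]])
    qed
    moreover have "m\<^sup>2 * fst P1 z = - (real k)\<^sup>2 * sin (real k * (fst z $ 1 + \<tau>)) * matern s ?w (snd z)"
      using r(1) by (simp add: P1_def bessel_mode_def mode_def flip: mult.assoc)
    ultimately show ?thesis unfolding weighted_inner fst_conv snd_conv by (simp add: algebra_simps)
  qed
  have I2: "weighted s m P2 z \<bullet> weighted s m (\<phi>, grad \<phi>) z = sin (real k * (fst z $ 1 + \<tau>)) * (snd z powr (1 - 2 * s) *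
        (matern_deriv s ?w (snd z) * D z (0, 1) + ?w\<^sup>2 * matern s ?w (snd z) * \<phi> z))"
    if "z \<in> cylinder" for z
  proof -
    have "snd P2 z \<bullet> grad \<phi> z = sin (real k * (fst z $ 1 + \<tau>)) * matern_deriv s ?w (snd z) * D z (0, 1)"
    proof -
      have "snd P2 z = (sin (real k * (fst z $ 1 + \<tau>)) * matern_deriv s ?w (snd z)) *\<^sub>R (0, 1)"
        by (simp add: P2_def bessel_mode_def mode_def)
      then show ?thesis
        by (simp only: inner_scaleR_left inner_commute[of "(0, 1)"] D(3)[OF y[OF that]])
    qed
    moreover have "m\<^sup>2 * fst P2 z = ?w\<^sup>2 * sin (real k * (fst z $ 1 + \<tau>)) * matern s ?w (snd z)"
      using r(2) by (simp add: P2_def bessel_mode_def mode_def flip: mult.assoc)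
    ultimately show ?thesis unfolding weighted_inner fst_conv snd_conv by (simp add: algebra_simps)
  qed
  have I3: "weighted s m P3 z \<bullet> weighted s m (\<phi>, grad \<phi>) z = snd z powr (1 - 2 * s) * matern_deriv s ?w (snd z) * \<phi> z" for z
    unfolding weighted_inner P3_def using m by simp
  have i1: "integrable cyl (\<lambda>z. snd z powr (1 - 2 * s) * matern s ?w (snd z) *
        (real k * cos (real k * (fst z $ 1 + \<tau>)) * D z (axis 1 1, 0) - (real k)\<^sup>2 * sin (real k * (fst z $ 1 + \<tau>)) * \<phi> z))"
    using sq_integrable_inner[OF sq1 \<phi>sq] by (rule Bochner_Integration.integrable_cong[THEN iffD1, rotated -1]) (auto simp: I1)
  have i2: "integrable cyl (\<lambda>z. sin (real k * (fst z $ 1 + \<tau>)) * (snd z powr (1 - 2 * s) *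
        (matern_deriv s ?w (snd z) * D z (0, 1) + ?w\<^sup>2 * matern s ?w (snd z) * \<phi> z)))"
    using sq_integrable_inner[OF sq2 \<phi>sq] by (rule Bochner_Integration.integrable_cong[THEN iffD1, rotated -1]) (auto simp: I2)
  have i3: "integrable cyl (\<lambda>z. snd z powr (1 - 2 * s) * matern_deriv s ?w (snd z) * \<phi> z)"
    using sq_integrable_inner[OF sq3 \<phi>sq] unfolding I3 .
  have split: "weighted s m ?E z = weighted s m P1 z + weighted s m P2 z" for z
    by (simp add: weighted_def P1_def P2_def algebra_simps prod_eq_iff)
  have "(LINT z|cyl. weighted s m ?E z \<bullet> weighted s m (\<phi>, grad \<phi>) z) =
     (LINT z|cyl. weighted s m P1 z \<bullet> weighted s m (\<phi>, grad \<phi>) z) + (LINT z|cyl. weighted s m P2 z \<bullet> weighted s m (\<phi>, grad \<phi>) z)"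
    unfolding split inner_add_left
    by (intro Bochner_Integration.integral_add sq_integrable_inner sq1 sq2 \<phi>sq)
  also have "(LINT z|cyl. weighted s m P1 z \<bullet> weighted s m (\<phi>, grad \<phi>) z) = 0"
    using bessel_mode_horizontal_integral[OF m s \<phi> D(1,2,4) i1]
    by (subst Bochner_Integration.integral_cong[OF refl I1]) auto
  also have "(LINT z|cyl. weighted s m P2 z \<bullet> weighted s m (\<phi>, grad \<phi>) z) =
     flux s * ?w powr (2 * s) * (LINT x|lebesgue_on cube. sin (real k * (x $ 1 + \<tau>)) * \<phi> (x, 0))"
    using bessel_mode_vertical_integral[OF m s D(1,2,4) i2 i3]
    by (subst Bochner_Integration.integral_cong[OF refl I2]) auto
  finally show ?thesis by simp
qed

section \<open>Fourier coefficients, traces and a Parseval identity\<close>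

lemma integral_cis_multiple:
  "integral {-pi..pi} (\<lambda>t. exp (\<i> * complex_of_real (real_of_int n * t))) = (if n = 0 then complex_of_real (2 * pi) else 0)"
proof (cases "n = 0")
  case False
  have "integral {-pi..pi} (\<lambda>t. exp (\<i> * complex_of_real (real_of_int n * t))) =
     (exp (\<i> * of_int n * of_real pi) - exp (\<i> * of_int n * of_real (- pi))) / (\<i> * of_int n)"
  proof (rule integral_unique)
    have "((\<lambda>t. exp (\<i> * complex_of_real (real_of_int n * t))) has_integral
      (exp (\<i> * of_int n * of_real pi) / (\<i> * of_int n) - exp (\<i> * of_int n * of_real (- pi)) / (\<i> * of_int n))) {-pi..pi}"
    proof (rule fundamental_theorem_of_calculus)
      fix t
      have "((\<lambda>z. exp (\<i> * of_int n * z) / (\<i> * of_int n)) has_field_derivative exp (\<i> * of_int n * of_real t)) (at (of_real t))"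
        using False by (auto intro!: derivative_eq_intros)
      from has_vector_derivative_real_field[OF this]
      show "((\<lambda>t. exp (\<i> * of_int n * of_real t) / (\<i> * of_int n)) has_vector_derivative exp (\<i> * complex_of_real (real_of_int n * t))) (at t within {-pi..pi})"
        by (simp add: has_vector_derivative_at_within mult.assoc)
    qed simp
    then show "((\<lambda>t. exp (\<i> * complex_of_real (real_of_int n * t))) has_integral
      (exp (\<i> * of_int n * of_real pi) - exp (\<i> * of_int n * of_real (- pi))) / (\<i> * of_int n)) {-pi..pi}"
      by (simp add: diff_divide_distrib)
  qed
  also have "exp (\<i> * of_int n * of_real pi) = exp (\<i> * of_int n * of_real (- pi))"
  proof -
    have "exp (\<i> * of_int n * of_real pi) = exp (\<i> * of_int n * of_real (- pi) + 2 * of_int n * of_real pi * \<i>)"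
      by (simp add: algebra_simps)
    also have "\<dots> = exp (\<i> * of_int n * of_real (- pi)) * exp (2 * of_int n * of_real pi * \<i>)"
      by (rule exp_add)
    also have "exp (2 * of_int n * of_real pi * \<i>) = 1"
      unfolding exp_eq_1 by (auto intro!: exI[of _ n])
    finally show ?thesis by (simp only: mult_1_right)
  qed
  finally show ?thesis unfolding diff_self using False by simp
qed (simp add: scaleR_conv_of_real)

abbreviation wave :: "int^3 \<Rightarrow> real^3 \<Rightarrow> complex" where
  "wave k x \<equiv> exp (- \<i> * complex_of_real (\<Sum>j\<in>UNIV. real_of_int (k $ j) * x $ j))"

lemma wave_continuous: "continuous_on A (wave k)"
  by (intro continuous_intros)

lemma measure_cube: "measure lborel cube = (2 * pi) ^ 3"
proof -
  have "measure lborel cube = (\<Prod>b\<in>Basis. ((\<chi> i. pi) - (\<chi> i. - pi) :: real^3) \<bullet> b)"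
    unfolding cube_def by (rule measure_lborel_box) (auto simp: Basis_vec_def inner_axis)
  also have "\<dots> = (\<Prod>b\<in>(Basis :: (real^3) set). 2 * pi)"
    by (intro prod.cong) (auto simp: Basis_vec_def inner_axis)
  finally show ?thesis by simp
qed

lemma finite_measure_cube: "finite_measure (lebesgue_on cube)"
proof
  have "emeasure (lebesgue_on cube) (space (lebesgue_on cube)) = emeasure lebesgue cube"
    by (subst emeasure_restrict_space) auto
  also have "\<dots> = emeasure lborel cube" by simp
  finally show "emeasure (lebesgue_on cube) (space (lebesgue_on cube)) \<noteq> \<infinity>" using cube_finite by (simp add: less_top[symmetric])
qed

lemma integral_one_cube: "(LINT x|lebesgue_on cube. (c::real)) = c * (2 * pi) ^ 3"
proof -
  have "measure (lebesgue_on cube) (space (lebesgue_on cube)) = measure lebesgue cube"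
    by (subst measure_restrict_space) auto
  also have "\<dots> = measure lborel cube" by (simp add: measure_def)
  finally show ?thesis by (simp add: measure_cube)
qed

text \<open>The integral factorises over the coordinates and each sine is a combination of two exponentials, so only the
  frequencies \<open>(\<plusminus>j, 0, 0)\<close> survive.\<close>

lemma wave_sine_integral:
  "norm (LINT x|lebesgue_on cube. complex_of_real (sin (real j * (x $ 1 + \<tau>))) * wave k x) \<le> (2 * pi) ^ 3"
  "\<not> (k $ 2 = 0 \<and> k $ 3 = 0 \<and> nat \<bar>k $ 1\<bar> = j) \<Longrightarrow>
    (LINT x|lebesgue_on cube. complex_of_real (sin (real j * (x $ 1 + \<tau>))) * wave k x) = 0"
proof -
  have "norm (LINT x|lebesgue_on cube. complex_of_real (sin (real j * (x $ 1 + \<tau>))) * wave k x)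
     \<le> (LINT x|lebesgue_on cube. norm (complex_of_real (sin (real j * (x $ 1 + \<tau>))) * wave k x))"
    by (rule integral_norm_bound)
  also have "\<dots> \<le> (LINT x|lebesgue_on cube. 1)"
    by (intro integral_mono cube_integrable continuous_intros wave_continuous) (simp add: norm_mult)
  finally show "norm (LINT x|lebesgue_on cube. complex_of_real (sin (real j * (x $ 1 + \<tau>))) * wave k x) \<le> (2 * pi) ^ 3"
    by (simp only: integral_one_cube mult_1)
next
  assume *: "\<not> (k $ 2 = 0 \<and> k $ 3 = 0 \<and> nat \<bar>k $ 1\<bar> = j)"
  let ?e = "\<lambda>n t. exp (\<i> * complex_of_real (real_of_int n * t))"
  let ?f = "\<lambda>t. complex_of_real (sin (real j * (t + \<tau>))) * ?e (- (k $ 1)) t"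
  have w: "wave k x = ?e (- (k $ 1)) (x $ 1) * ?e (- (k $ 2)) (x $ 2) * ?e (- (k $ 3)) (x $ 3)" for x
    by (simp add: sum_3 algebra_simps flip: exp_add)
  have "(LINT x|lebesgue_on cube. complex_of_real (sin (real j * (x $ 1 + \<tau>))) * wave k x) =
     (LINT x|lebesgue_on cube. ?f (x $ 1) * ?e (- (k $ 2)) (x $ 2) * ?e (- (k $ 3)) (x $ 3))"
    unfolding w by (simp only: mult.assoc)
  also have "\<dots> = integral {-pi..pi} ?f * integral {-pi..pi} (?e (- (k $ 2))) * integral {-pi..pi} (?e (- (k $ 3)))"
    by (rule cube_integral_prod) (intro continuous_intros)+
  also have "\<dots> = 0"
  proof (cases "k $ 2 = 0 \<and> k $ 3 = 0")
    case False
    then show ?thesis unfolding integral_cis_multiple by auto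
  next
    case True
    with * have j: "int j - k $ 1 \<noteq> 0" "- int j - k $ 1 \<noteq> 0" by auto
    have "?f t = exp (\<i> * of_real (real j * \<tau>)) / (2 * \<i>) * ?e (int j - k $ 1) t
        - exp (- \<i> * of_real (real j * \<tau>)) / (2 * \<i>) * ?e (- int j - k $ 1) t" for t
    proof -
      have "complex_of_real (sin (real j * (t + \<tau>))) =
          (exp (\<i> * of_real (real j * (t + \<tau>))) - exp (- (\<i> * of_real (real j * (t + \<tau>))))) / (2 * \<i>)"
        by (simp add: sin_of_real[symmetric] sin_exp_eq)
      moreover have "exp (\<i> * of_real (real j * (t + \<tau>))) * ?e (- (k $ 1)) t = exp (\<i> * of_real (real j * \<tau>)) * ?e (int j - k $ 1) t"
        by (simp add: algebra_simps flip: exp_add)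
      moreover have "exp (- (\<i> * of_real (real j * (t + \<tau>)))) * ?e (- (k $ 1)) t = exp (- \<i> * of_real (real j * \<tau>)) * ?e (- int j - k $ 1) t"
        by (simp add: algebra_simps flip: exp_add)
      ultimately show ?thesis by (simp only: times_divide_eq_left left_diff_distrib diff_divide_distrib)
    qed
    then have "integral {-pi..pi} ?f = integral {-pi..pi} (\<lambda>t. exp (\<i> * of_real (real j * \<tau>)) / (2 * \<i>) * ?e (int j - k $ 1) t
        - exp (- \<i> * of_real (real j * \<tau>)) / (2 * \<i>) * ?e (- int j - k $ 1) t)" by (simp only:)
    also have "\<dots> = exp (\<i> * of_real (real j * \<tau>)) / (2 * \<i>) * integral {-pi..pi} (?e (int j - k $ 1))
        - exp (- \<i> * of_real (real j * \<tau>)) / (2 * \<i>) * integral {-pi..pi} (?e (- int j - k $ 1))"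
      by (subst integral_diff) (auto intro!: integrable_continuous_real continuous_intros)
    also have "\<dots> = 0" unfolding integral_cis_multiple using j by (simp only: if_False mult_zero_right diff_zero)
    finally show ?thesis by simp
  qed
  finally show "(LINT x|lebesgue_on cube. complex_of_real (sin (real j * (x $ 1 + \<tau>))) * wave k x) = 0" .
qed

abbreviation shifted_series :: "real \<Rightarrow> (nat \<Rightarrow> real) \<Rightarrow> real^3 \<Rightarrow> real" where
  "shifted_series \<tau> b x \<equiv> sine_series b (x $ 1 + \<tau>)"

lemma shifted_series_continuous:
  assumes "summable (\<lambda>k. \<bar>b k\<bar>)"
  shows "continuous_on A (shifted_series \<tau> b)"
  by (rule continuous_on_compose2[OF sine_series_continuous[OF assms, of UNIV]]) (auto intro!: continuous_intros)

lemma fourier_coeff_series: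
  assumes b: "summable (\<lambda>k. \<bar>b k\<bar>)"
  shows "(norm (fourier_coeff (shifted_series \<tau> b) k))\<^sup>2 \<le> (if k $ 2 = 0 \<and> k $ 3 = 0 then (2 * pi) ^ 3 * (b (nat \<bar>k $ 1\<bar>))\<^sup>2 else 0)"
proof -
  let ?f = "\<lambda>j x. complex_of_real (b j) * (complex_of_real (sin (real j * (x $ 1 + \<tau>))) * wave k x)"
  let ?j = "nat \<bar>k $ 1\<bar>"
  let ?c = "if k $ 2 = 0 \<and> k $ 3 = 0 then \<bar>b ?j\<bar> else 0"
  have i: "integrable (lebesgue_on cube) (?f j)" for j by (intro cube_integrable continuous_intros wave_continuous)
  have nb: "norm (?f j x) \<le> \<bar>b j\<bar>" for j x by (simp add: norm_mult mult_left_le)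
  have sums: "(\<lambda>j. ?f j x) sums (complex_of_real (shifted_series \<tau> b x) * wave k x)" for x
  proof -
    have "(\<lambda>j. complex_of_real (b j * sin (real j * (x $ 1 + \<tau>))) * wave k x) sums (complex_of_real (shifted_series \<tau> b x) * wave k x)"
      unfolding sine_series_def by (intro sums_mult2 sums_of_real summable_sums sine_series_summable b)
    then show ?thesis by (simp add: mult.assoc)
  qed
  have "(\<lambda>j. LINT x|lebesgue_on cube. ?f j x) sums (LINT x|lebesgue_on cube. (\<Sum>j. ?f j x))"
  proof (rule sums_integral[OF i])
    show "AE x in lebesgue_on cube. summable (\<lambda>j. norm (?f j x))"
      by (intro AE_I2 summable_comparison_test'[OF b, of 0]) (use nb in auto)
    show "summable (\<lambda>j. LINT x|lebesgue_on cube. norm (?f j x))"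
    proof (rule summable_comparison_test'[of "\<lambda>j. \<bar>b j\<bar> * (2 * pi) ^ 3" 0])
      show "summable (\<lambda>j. \<bar>b j\<bar> * (2 * pi) ^ 3)" by (intro summable_mult2 b)
      fix j :: nat
      have "(LINT x|lebesgue_on cube. norm (?f j x)) \<le> (LINT x|lebesgue_on cube. \<bar>b j\<bar>)"
        by (intro integral_mono integrable_norm i cube_integrable continuous_intros nb)
      then show "norm (LINT x|lebesgue_on cube. norm (?f j x)) \<le> \<bar>b j\<bar> * (2 * pi) ^ 3" by (simp only: integral_one_cube) simp
    qed
  qed
  also have "(\<lambda>x. (\<Sum>j. ?f j x)) = (\<lambda>x. complex_of_real (shifted_series \<tau> b x) * wave k x)"
    using sums by (simp add: sums_iff)
  finally have s: "(\<lambda>j. LINT x|lebesgue_on cube. ?f j x) sums (LINT x|lebesgue_on cube. complex_of_real (shifted_series \<tau> b x) * wave k x)" .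
  have z: "(LINT x|lebesgue_on cube. ?f j x) = (if j = ?j then (LINT x|lebesgue_on cube. ?f ?j x) else 0)" for j
    using wave_sine_integral(2)[of k j \<tau>] by (auto simp: integral_mult_right_zero)
  have s1: "(\<lambda>j. if j = ?j then (LINT x|lebesgue_on cube. ?f ?j x) else 0) sums (LINT x|lebesgue_on cube. ?f ?j x)"
    using sums_If_finite_set[of "{?j}" "\<lambda>_. LINT x|lebesgue_on cube. ?f ?j x"] by simp
  have s2: "(\<lambda>j. if j = ?j then (LINT x|lebesgue_on cube. ?f ?j x) else 0) sums (LINT x|lebesgue_on cube. complex_of_real (shifted_series \<tau> b x) * wave k x)"
    by (rule sums_cong[THEN iffD1, OF z s])
  have "(LINT x|lebesgue_on cube. complex_of_real (shifted_series \<tau> b x) * wave k x) = (LINT x|lebesgue_on cube. ?f ?j x)"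
    by (rule sums_unique2[OF s2 s1])
  also have "\<dots> = complex_of_real (b ?j) * (LINT x|lebesgue_on cube. complex_of_real (sin (real ?j * (x $ 1 + \<tau>))) * wave k x)"
    by (rule integral_mult_right_zero)
  finally have eq: "(LINT x|lebesgue_on cube. complex_of_real (shifted_series \<tau> b x) * wave k x) = \<dots>" .
  have "norm (LINT x|lebesgue_on cube. complex_of_real (shifted_series \<tau> b x) * wave k x) \<le> ?c * (2 * pi) ^ 3"
  proof (cases "k $ 2 = 0 \<and> k $ 3 = 0")
    case True
    have "\<bar>b ?j\<bar> * norm (LINT x|lebesgue_on cube. complex_of_real (sin (real ?j * (x $ 1 + \<tau>))) * wave k x) \<le> \<bar>b ?j\<bar> * (2 * pi) ^ 3"
      by (intro mult_left_mono wave_sine_integral(1)) simp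
    then show ?thesis unfolding eq norm_mult using True by simp
  next
    case False
    then show ?thesis unfolding eq using wave_sine_integral(2)[of k ?j \<tau>] by (simp only: simp_thms if_False mult_zero_right norm_zero mult_zero_left)
  qed
  then have "norm (fourier_coeff (shifted_series \<tau> b) k) \<le> (2 * pi) powr (- 3 / 2) * (?c * (2 * pi) ^ 3)"
    unfolding fourier_coeff_def norm_mult by (simp add: mult_left_mono)
  then have "(norm (fourier_coeff (shifted_series \<tau> b) k))\<^sup>2 \<le> ((2 * pi) powr (- 3 / 2) * (?c * (2 * pi) ^ 3))\<^sup>2"
    by (intro power_mono) auto
  also have "\<dots> = ((2 * pi) powr (- 3 / 2))\<^sup>2 * (2 * pi) ^ 3 * ((2 * pi) ^ 3 * ?c\<^sup>2)"
    by (simp only: power_mult_distrib power2_eq_square mult_ac)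
  also have "((2 * pi) powr (- 3 / 2))\<^sup>2 * (2 * pi) ^ 3 = 1"
  proof -
    have "((2 * pi) powr (- 3 / 2))\<^sup>2 = (2 * pi) powr (- 3)" by (simp add: power2_eq_square flip: powr_add)
    also have "\<dots> = inverse ((2 * pi) ^ 3)" by (simp add: powr_minus powr_numeral)
    finally have i: "((2 * pi) powr (- 3 / 2))\<^sup>2 = inverse ((2 * pi) ^ 3)" .
    show ?thesis unfolding i by (rule left_inverse) simp
  qed
  finally show ?thesis by (auto split: if_splits)
qed

text \<open>Each \<open>j\<close> is the modulus of at most two integers.\<close>

lemma sum_fibres_int_le:
  fixes g :: "nat \<Rightarrow> real" and F :: "(int^3) set"
  assumes g: "\<And>j. 0 \<le> g j" "summable g" and F: "finite F"
  shows "(\<Sum>k\<in>F. if k $ 2 = 0 \<and> k $ 3 = 0 then g (nat \<bar>k $ 1\<bar>) else 0) \<le> 2 * suminf g"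
proof -
  let ?F = "{k \<in> F. k $ 2 = 0 \<and> k $ 3 = (0::int)}"
  let ?I = "(\<lambda>k :: int^3. k $ 1) ` ?F"
  have inj: "inj_on (\<lambda>k :: int^3. k $ 1) ?F" by (auto simp: inj_on_def vec_eq_iff forall_3)
  have fI: "finite ?I" using F by auto
  have "(\<Sum>k\<in>F. if k $ 2 = 0 \<and> k $ 3 = 0 then g (nat \<bar>k $ 1\<bar>) else 0) = (\<Sum>k\<in>?F. g (nat \<bar>k $ 1\<bar>))"
    using F by (simp add: sum.If_cases Int_def)
  also have "\<dots> = (\<Sum>i\<in>?I. g (nat \<bar>i\<bar>))" using sum.reindex[OF inj, of "\<lambda>i. g (nat \<bar>i\<bar>)"] by simp
  also have "\<dots> \<le> (\<Sum>i\<in>{i\<in>?I. i \<ge> 0}. g (nat \<bar>i\<bar>)) + (\<Sum>i\<in>{i\<in>?I. i < 0}. g (nat \<bar>i\<bar>))"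
    using fI by (subst sum.union_disjoint[symmetric]) (auto intro!: sum_mono2 g)
  also have "(\<Sum>i\<in>{i\<in>?I. i \<ge> 0}. g (nat \<bar>i\<bar>)) \<le> suminf g"
  proof -
    have "(\<Sum>i\<in>{i\<in>?I. i \<ge> 0}. g (nat \<bar>i\<bar>)) = sum g ((\<lambda>i. nat \<bar>i\<bar>) ` {i\<in>?I. i \<ge> 0})"
      by (subst sum.reindex) (auto simp: inj_on_def)
    also have "\<dots> \<le> suminf g" using fI g by (intro sum_le_suminf) auto
    finally show ?thesis .
  qed
  also have "(\<Sum>i\<in>{i\<in>?I. i < 0}. g (nat \<bar>i\<bar>)) \<le> suminf g"
  proof -
    have "(\<Sum>i\<in>{i\<in>?I. i < 0}. g (nat \<bar>i\<bar>)) = sum g ((\<lambda>i. nat \<bar>i\<bar>) ` {i\<in>?I. i < 0})"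
      by (subst sum.reindex) (auto simp: inj_on_def)
    also have "\<dots> \<le> suminf g" using fI g by (intro sum_le_suminf) auto
    finally show ?thesis .
  qed
  finally show ?thesis by simp
qed

lemma H_term_nonneg: "0 \<le> H_term s m u k" by (simp add: H_term_def)

lemma freq_powr: 
  assumes "0 < m" shows "freq m j powr (2 * s) = ((real j)\<^sup>2 + m\<^sup>2) powr s"
proof -
  have "((real j)\<^sup>2 + m\<^sup>2) powr s = (freq m j powr 2) powr s"
    using freq_pos[OF assms, of j] by (simp add: powr_numeral freq_sq)
  then show ?thesis by (simp add: powr_powr)
qed

text \<open>A sine series has Fourier coefficients only on the first axis, where their weights are those of \<open>energy\<close>.\<close>

lemma series_H_space:
  assumes m: "0 < m" and b: "summable (\<lambda>k. \<bar>b k\<bar>)" and e: "summable (\<lambda>k. freq m k powr (2 * s) * (b k)\<^sup>2)"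
  shows "shifted_series \<tau> b \<in> H_space s m"
    "(H_norm s m (shifted_series \<tau> b))\<^sup>2 \<le> 2 * (2 * pi) ^ 3 * energy (\<lambda>k. freq m k powr (2 * s)) b"
proof -
  let ?u = "shifted_series \<tau> b"
  let ?g = "\<lambda>j. (2 * pi) ^ 3 * (freq m j powr (2 * s) * (b j)\<^sup>2)"
  have g: "\<And>j. 0 \<le> ?g j" "summable ?g" by (auto intro!: summable_mult e)
  have le: "H_term s m ?u k \<le> (if k $ 2 = 0 \<and> k $ 3 = 0 then ?g (nat \<bar>k $ 1\<bar>) else 0)" for k
  proof (cases "k $ 2 = 0 \<and> k $ 3 = 0")
    case True
    have "(\<Sum>j\<in>UNIV. (real_of_int (k $ j))\<^sup>2) = (real (nat \<bar>k $ 1\<bar>))\<^sup>2" using True by (simp add: sum_3)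
    then have "H_term s m ?u k \<le> ((real (nat \<bar>k $ 1\<bar>))\<^sup>2 + m\<^sup>2) powr s * ((2 * pi) ^ 3 * (b (nat \<bar>k $ 1\<bar>))\<^sup>2)"
      unfolding H_term_def using fourier_coeff_series[OF b, of \<tau> k] True by (simp add: mult_left_mono)
    then show ?thesis unfolding freq_powr[OF m] using True by (simp add: mult_ac)
  next
    case False
    then have "(norm (fourier_coeff ?u k))\<^sup>2 \<le> 0" using fourier_coeff_series[OF b, of \<tau> k] by (simp only: if_False)
    then have "norm (fourier_coeff ?u k) = 0" by simp
    then show ?thesis using False by (simp add: H_term_def)
  qed
  have fin: "sum (H_term s m ?u) F \<le> 2 * suminf ?g" if "finite F" for F
    using sum_mono[of F, OF le] sum_fibres_int_le[OF g that] by (rule order_trans)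
  have sm: "H_term s m ?u summable_on UNIV"
    by (rule nonneg_bdd_above_summable_on) (auto simp: H_term_nonneg bdd_above_def intro!: exI[of _ "2 * suminf ?g"] fin)
  have c: "continuous_on UNIV ?u" by (rule shifted_series_continuous[OF b])
  have "periodic ?u" by (rule periodic_coord1) (rule sine_series_periodic)
  moreover have "integrable (lebesgue_on cube) (\<lambda>x. (?u x)\<^sup>2)" by (intro cube_integrable continuous_intros c)
  moreover have "?u \<in> borel_measurable (lebesgue_on cube)"
    using cube_integrable(1)[OF c] by (rule borel_measurable_integrable)
  ultimately show "?u \<in> H_space s m" using sm by (simp add: H_space_def)
  have "(H_norm s m ?u)\<^sup>2 = (\<Sum>\<^sub>\<infinity>k. H_term s m ?u k)"
    unfolding H_norm_def by (intro real_sqrt_pow2 infsum_nonneg H_term_nonneg)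
  also have "\<dots> \<le> 2 * suminf ?g" by (intro infsum_le_finite_sums sm fin)
  also have "suminf ?g = (2 * pi) ^ 3 * energy (\<lambda>k. freq m k powr (2 * s)) b"
    unfolding energy_def by (rule suminf_mult[OF e])
  finally show "(H_norm s m ?u)\<^sup>2 \<le> 2 * (2 * pi) ^ 3 * energy (\<lambda>k. freq m k powr (2 * s)) b" by simp
qed

text \<open>The unnormalised sine coefficient of \<open>v\<close> in the first variable, integrated over the other two.\<close>

definition sine_pairing :: "real \<Rightarrow> (real^3 \<Rightarrow> real) \<Rightarrow> nat \<Rightarrow> real" where
  "sine_pairing \<tau> v k = (LINT x|lebesgue_on cube. sin (real k * (x $ 1 + \<tau>)) * v x)"

lemma H_space_integrable:
  assumes "v \<in> H_space s m"
  shows "integrable (lebesgue_on cube) v"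
proof -
  interpret finite_measure "lebesgue_on cube" by (rule finite_measure_cube)
  show ?thesis
    by (rule square_integrable_imp_integrable) (use assms in \<open>auto simp: H_space_def\<close>)
qed

lemma cube_mult_integrable:
  fixes v :: "real^3 \<Rightarrow> 'b::{real_normed_field, euclidean_space}"
  assumes v: "integrable (lebesgue_on cube) v" and c: "continuous_on UNIV f" and B: "\<And>x. norm (f x) \<le> B"
  shows "integrable (lebesgue_on cube) (\<lambda>x. f x * v x)"
proof (rule Bochner_Integration.integrable_bound[of _ "\<lambda>x. B * norm (v x)"])
  show "integrable (lebesgue_on cube) (\<lambda>x. B * norm (v x))" using v by (intro Bochner_Integration.integrable_mult_right integrable_norm)
  show "(\<lambda>x. f x * v x) \<in> borel_measurable (lebesgue_on cube)"
    using cube_integrable(1)[OF c] v by (intro borel_measurable_times borel_measurable_integrable)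
  show "AE x in lebesgue_on cube. norm (f x * v x) \<le> norm (B * norm (v x))"
    by (intro AE_I2) (auto simp: norm_mult abs_mult intro!: mult_right_mono order_trans[OF B abs_ge_self])
qed

text \<open>Up to a phase and the normalisation, the pairing is the imaginary part of the Fourier coefficient of \<open>v\<close> at \<open>(k, 0, 0)\<close>, a single
  term of the sum that defines the norm.\<close>

lemma sine_pairing_bound:
  assumes m: "0 < m" and v: "v \<in> H_space s m"
  shows "\<bar>sine_pairing \<tau> v k\<bar> \<le> (2 * pi) powr (3 / 2) * freq m k powr (- s) * H_norm s m v"
proof -
  define \<kappa> :: "int^3" where "\<kappa> = (\<chi> i. if i = 1 then int k else 0)"
  have kap: "\<kappa> $ 1 = int k" "\<kappa> $ 2 = 0" "\<kappa> $ 3 = 0" by (auto simp: \<kappa>_def)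
  have vi: "integrable (lebesgue_on cube) v" by (rule H_space_integrable[OF v])
  then have vic: "integrable (lebesgue_on cube) (\<lambda>x. complex_of_real (v x))" by (rule integrable_of_real)
  let ?I = "LINT x|lebesgue_on cube. complex_of_real (v x) * wave \<kappa> x"
  have wi: "integrable (lebesgue_on cube) (\<lambda>x. wave \<kappa> x * complex_of_real (v x))"
    by (rule cube_mult_integrable[OF vic wave_continuous, of _ 1]) simp
  have "sine_pairing \<tau> v k = - Im (exp (- \<i> * of_real (real k * \<tau>)) * ?I)"
  proof -
    have pw: "sin (real k * (x $ 1 + \<tau>)) * v x = - Im (exp (- \<i> * of_real (real k * \<tau>)) * (complex_of_real (v x) * wave \<kappa> x))" for x
    proof -
      have "exp (- \<i> * of_real (real k * \<tau>)) * wave \<kappa> x = cis (- (real k * (x $ 1 + \<tau>)))"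
        by (simp add: sum_3 kap cis_conv_exp algebra_simps flip: exp_add)
      then have e: "exp (- \<i> * of_real (real k * \<tau>)) * (complex_of_real (v x) * wave \<kappa> x) = of_real (v x) * cis (- (real k * (x $ 1 + \<tau>)))"
        by (simp only: mult.left_commute[of "exp _" "complex_of_real (v x)"])
      show ?thesis unfolding e by simp
    qed
    have "exp (- \<i> * of_real (real k * \<tau>)) * ?I = (LINT x|lebesgue_on cube. exp (- \<i> * of_real (real k * \<tau>)) * (complex_of_real (v x) * wave \<kappa> x))"
      by (rule integral_mult_right_zero[symmetric])
    moreover have "integrable (lebesgue_on cube) (\<lambda>x. exp (- \<i> * of_real (real k * \<tau>)) * (complex_of_real (v x) * wave \<kappa> x))"
      using wi by (intro Bochner_Integration.integrable_mult_right) (simp add: mult.commute)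
    ultimately show ?thesis unfolding sine_pairing_def pw by (simp only: integral_Im Bochner_Integration.integral_minus)
  qed
  then have "\<bar>sine_pairing \<tau> v k\<bar> \<le> norm (exp (- \<i> * of_real (real k * \<tau>)) * ?I)"
    using abs_Im_le_cmod[of "exp (- \<i> * of_real (real k * \<tau>)) * ?I"] by simp
  also have "\<dots> = norm ?I"
  proof -
    have "norm (exp (- \<i> * complex_of_real (real k * \<tau>))) = 1" by (simp only: norm_exp_eq_Re) simp
    then show ?thesis by (simp only: norm_mult mult_1)
  qed
  finally have 1: "\<bar>sine_pairing \<tau> v k\<bar> \<le> norm ?I" .
  have 2: "norm (fourier_coeff v \<kappa>) = (2 * pi) powr (- 3 / 2) * norm ?I"
    by (simp add: fourier_coeff_def norm_mult)
  have "H_term s m v \<kappa> \<le> (\<Sum>\<^sub>\<infinity>k. H_term s m v k)"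
    using infsum_mono_neutral[of "H_term s m v" "{\<kappa>}" "H_term s m v" UNIV] v by (simp add: H_space_def H_term_nonneg)
  also have "\<dots> = (H_norm s m v)\<^sup>2"
    unfolding H_norm_def by (intro real_sqrt_pow2[symmetric] infsum_nonneg H_term_nonneg)
  finally have "H_term s m v \<kappa> \<le> (H_norm s m v)\<^sup>2" .
  moreover have "H_term s m v \<kappa> = (freq m k powr s * norm (fourier_coeff v \<kappa>))\<^sup>2"
  proof -
    have "H_term s m v \<kappa> = freq m k powr (2 * s) * (norm (fourier_coeff v \<kappa>))\<^sup>2"
      by (simp add: H_term_def sum_3 kap freq_powr[OF m])
    also have "freq m k powr (2 * s) = (freq m k powr s)\<^sup>2" by (simp add: power2_eq_square flip: powr_add)
    finally show ?thesis by (simp add: power_mult_distrib)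
  qed
  ultimately have sq: "(freq m k powr s * norm (fourier_coeff v \<kappa>))\<^sup>2 \<le> (H_norm s m v)\<^sup>2"
    by (simp only:)
  have "0 \<le> H_norm s m v"
    unfolding H_norm_def by (intro real_sqrt_ge_zero infsum_nonneg H_term_nonneg)
  from power2_le_imp_le[OF sq this] have "freq m k powr s * norm (fourier_coeff v \<kappa>) \<le> H_norm s m v" .
  then have 3: "freq m k powr s * ((2 * pi) powr (- 3 / 2) * norm ?I) \<le> H_norm s m v" unfolding 2 .
  have f: "freq m k powr (- s) * freq m k powr s = 1" using freq_pos[OF m, of k] by (simp flip: powr_add)
  have p: "(2 * pi) powr (3 / 2) * (2 * pi) powr (- 3 / 2) = 1" by (simp flip: powr_add)
  have "(2 * pi) powr (3 / 2) * freq m k powr (- s) * (freq m k powr s * ((2 * pi) powr (- 3 / 2) * norm ?I)) \<le> (2 * pi) powr (3 / 2) * freq m k powr (- s) * H_norm s m v"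
    by (intro mult_left_mono 3) auto
  moreover have "(2 * pi) powr (3 / 2) * freq m k powr (- s) * (freq m k powr s * ((2 * pi) powr (- 3 / 2) * norm ?I)) =
     ((2 * pi) powr (3 / 2) * (2 * pi) powr (- 3 / 2)) * (freq m k powr (- s) * freq m k powr s) * norm ?I"
    by (simp only: mult_ac)
  ultimately show ?thesis using 1 unfolding f p by linarith
qed

lemma sine_coeff_partial_sum:
  assumes g: "continuous_on {-pi..pi} g"
  shows "sine_coeff (\<lambda>t. g t - (\<Sum>j<N. sine_coeff g j * sin (real j * t))) k = (if k < N then 0 else sine_coeff g k)"
proof -
  let ?I = "integral {-pi..pi}"
  have "?I (\<lambda>t. (g t - (\<Sum>j<N. sine_coeff g j * sin (real j * t))) * sin (real k * t)) =
     ?I (\<lambda>t. g t * sin (real k * t)) - ?I (\<lambda>t. \<Sum>j<N. sine_coeff g j * (sin (real j * t) * sin (real k * t)))"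
    by (subst integral_diff[symmetric]) (auto intro!: integrable_continuous_real continuous_intros g simp: left_diff_distrib sum_distrib_right mult.assoc)
  also have "?I (\<lambda>t. \<Sum>j<N. sine_coeff g j * (sin (real j * t) * sin (real k * t))) =
     (\<Sum>j<N. sine_coeff g j * ?I (\<lambda>t. sin (real j * t) * sin (real k * t)))"
    by (subst integral_sum) (auto intro!: integrable_continuous_real continuous_intros)
  also have "\<dots> = (\<Sum>j<N. if j = k then sine_coeff g k * pi else 0)"
    by (intro sum.cong refl) (auto simp: integral_sin_sin sine_coeff_def)
  also have "\<dots> = (if k < N then sine_coeff g k * pi else 0)" by (simp add: sum.delta)
  finally show ?thesis by (simp add: sine_coeff_def)
qed

text \<open>Subtracting a partial sum from \<open>g\<close> removes the first \<open>N\<close> coefficients and leaves the others. By \<open>fejer_sine\<close>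
  the remainder is a uniform limit of sine sums with coefficients dominated by its own, so its integral against
  \<open>v\<close> is at most the tail of the absolutely convergent series.\<close>

lemma sine_parseval:
  assumes g: "continuous_on UNIV g" and per: "\<And>t. g (t + 2 * pi) = g t" and odd: "\<And>t. g (- t) = - g t"
    and v: "integrable (lebesgue_on cube) v" and s: "summable (\<lambda>k. \<bar>sine_coeff g k * sine_pairing \<tau> v k\<bar>)"
  shows "(\<lambda>k. sine_coeff g k * sine_pairing \<tau> v k) sums (LINT x|lebesgue_on cube. g (x $ 1 + \<tau>) * v x)"
proof -
  let ?V = "LINT x|lebesgue_on cube. \<bar>v x\<bar>"
  let ?a = "\<lambda>k. sine_coeff g k * sine_pairing \<tau> v k"
  have bounded: "\<exists>B. \<forall>x. \<bar>f x\<bar> \<le> B" if f: "continuous_on UNIV f" "\<And>t. f (t + 2 * pi) = f t" for f :: "real \<Rightarrow> real"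
  proof -
    obtain M where M: "M \<ge> 0" "\<And>x t. \<bar>f x - f t\<bar> \<le> 1 + M * (1 - cos (x - t))" by (rule periodic_modulus[OF f zero_less_one]) (rule that)
    have "\<bar>f x\<bar> \<le> \<bar>f 0\<bar> + (1 + M * 2)" for x
    proof -
      have "M * (1 - cos (x - 0)) \<le> M * 2" using cos_ge_minus_one[of x] M(1) by (intro mult_left_mono) auto
      then show ?thesis using M(2)[of x 0] by linarith
    qed
    then show ?thesis by blast
  qed
  have int: "integrable (lebesgue_on cube) (\<lambda>x. f (x $ 1 + \<tau>) * v x)" if f: "continuous_on UNIV f" "\<And>t. f (t + 2 * pi) = f t" for f :: "real \<Rightarrow> real"
  proof -
    obtain B where "\<And>x. \<bar>f x\<bar> \<le> B" using bounded[OF f] by blast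
    moreover have "continuous_on UNIV (\<lambda>x::real^3. f (x $ 1 + \<tau>))" by (intro continuous_on_compose2[OF f(1)] continuous_intros) auto
    ultimately show ?thesis using cube_mult_integrable[OF v, of "\<lambda>x. f (x $ 1 + \<tau>)" B] by simp
  qed
  have sinint: "integrable (lebesgue_on cube) (\<lambda>x. sin (real k * (x $ 1 + \<tau>)) * v x)" for k :: nat
    by (rule int[of "\<lambda>t. sin (real k * t)"]) (auto intro!: continuous_intros simp: sin_nat_periodic)
  have sumint: "(LINT x|lebesgue_on cube. (\<Sum>k<n. c k * sin (real k * (x $ 1 + \<tau>))) * v x) = (\<Sum>k<n. c k * sine_pairing \<tau> v k)" for c :: "nat \<Rightarrow> real" and n
  proof -
    have "(\<lambda>x. (\<Sum>k<n. c k * sin (real k * (x $ 1 + \<tau>))) * v x) = (\<lambda>x. \<Sum>k<n. c k * (sin (real k * (x $ 1 + \<tau>)) * v x))"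
      by (simp add: sum_distrib_right mult.assoc)
    then show ?thesis unfolding sine_pairing_def
      by (simp only:) (subst Bochner_Integration.integral_sum, auto intro!: sinint)
  qed
  have tail: "\<bar>(LINT x|lebesgue_on cube. g (x $ 1 + \<tau>) * v x) - (\<Sum>k<N. ?a k)\<bar> \<le> (\<Sum>k. \<bar>?a (k + N)\<bar>)" for N
  proof -
    define gN where "gN = (\<lambda>t. g t - (\<Sum>j<N. sine_coeff g j * sin (real j * t)))"
    have gNc: "continuous_on UNIV gN" unfolding gN_def by (intro continuous_intros g)
    have gNp: "gN (t + 2 * pi) = gN t" for t by (simp add: gN_def per sin_nat_periodic)
    have gNo: "gN (- t) = - gN t" for t by (simp add: gN_def odd sum_negf)
    have coeff: "sine_coeff gN k = (if k < N then 0 else sine_coeff g k)" for k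
      unfolding gN_def by (rule sine_coeff_partial_sum) (rule continuous_on_subset[OF g], simp)
    have gNint: "(LINT x|lebesgue_on cube. g (x $ 1 + \<tau>) * v x) - (\<Sum>k<N. ?a k) = (LINT x|lebesgue_on cube. gN (x $ 1 + \<tau>) * v x)"
    proof -
      have i: "integrable (lebesgue_on cube) (\<lambda>x. (\<Sum>k<N. sine_coeff g k * sin (real k * (x $ 1 + \<tau>))) * v x)"
        by (rule int[of "\<lambda>t. \<Sum>k<N. sine_coeff g k * sin (real k * t)"]) (auto intro!: continuous_intros simp: sin_nat_periodic)
      show ?thesis unfolding gN_def left_diff_distrib sumint[symmetric]
        by (rule Bochner_Integration.integral_diff[OF int[OF g per] i, symmetric])
    qed
    have sN: "summable (\<lambda>k. \<bar>?a (k + N)\<bar>)" using summable_ignore_initial_segment[OF s] .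
    have "\<bar>LINT x|lebesgue_on cube. gN (x $ 1 + \<tau>) * v x\<bar> \<le> (\<Sum>k. \<bar>?a (k + N)\<bar>) + e * ?V" if e: "e > 0" for e
    proof -
      obtain n c where c: "\<And>k. \<bar>c k\<bar> \<le> 1" "\<And>t. \<bar>gN t - (\<Sum>k<n. c k * sine_coeff gN k * sin (real k * t))\<bar> \<le> e"
        by (rule fejer_sine[OF gNc gNp gNo e]) (rule that)
      let ?T = "\<lambda>t. \<Sum>k<n. (c k * sine_coeff gN k) * sin (real k * t)"
      have Tc: "continuous_on UNIV ?T" by (intro continuous_intros)
      have Tp: "?T (t + 2 * pi) = ?T t" for t by (simp add: sin_nat_periodic)
      have "(LINT x|lebesgue_on cube. gN (x $ 1 + \<tau>) * v x) =
        (LINT x|lebesgue_on cube. (gN (x $ 1 + \<tau>) - ?T (x $ 1 + \<tau>)) * v x) + (LINT x|lebesgue_on cube. ?T (x $ 1 + \<tau>) * v x)"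
      proof -
        have "(LINT x|lebesgue_on cube. (gN (x $ 1 + \<tau>) - ?T (x $ 1 + \<tau>)) * v x) =
           (LINT x|lebesgue_on cube. gN (x $ 1 + \<tau>) * v x) - (LINT x|lebesgue_on cube. ?T (x $ 1 + \<tau>) * v x)"
          unfolding left_diff_distrib by (rule Bochner_Integration.integral_diff[OF int[OF gNc gNp] int[OF Tc Tp]])
        then show ?thesis by simp
      qed
      moreover have "\<bar>LINT x|lebesgue_on cube. (gN (x $ 1 + \<tau>) - ?T (x $ 1 + \<tau>)) * v x\<bar> \<le> e * ?V"
      proof -
        have di: "integrable (lebesgue_on cube) (\<lambda>x. (gN (x $ 1 + \<tau>) - ?T (x $ 1 + \<tau>)) * v x)"
          unfolding left_diff_distrib by (rule Bochner_Integration.integrable_diff[OF int[OF gNc gNp] int[OF Tc Tp]])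
        have "\<bar>LINT x|lebesgue_on cube. (gN (x $ 1 + \<tau>) - ?T (x $ 1 + \<tau>)) * v x\<bar> \<le> (LINT x|lebesgue_on cube. \<bar>(gN (x $ 1 + \<tau>) - ?T (x $ 1 + \<tau>)) * v x\<bar>)"
          by (rule integral_abs_bound)
        also have "\<dots> \<le> (LINT x|lebesgue_on cube. e * \<bar>v x\<bar>)"
        proof (rule integral_mono)
          show "integrable (lebesgue_on cube) (\<lambda>x. \<bar>(gN (x $ 1 + \<tau>) - ?T (x $ 1 + \<tau>)) * v x\<bar>)"
            by (rule integrable_abs[OF di])
          show "integrable (lebesgue_on cube) (\<lambda>x. e * \<bar>v x\<bar>)"
            by (intro Bochner_Integration.integrable_mult_right integrable_abs v)
          show "\<bar>(gN (x $ 1 + \<tau>) - ?T (x $ 1 + \<tau>)) * v x\<bar> \<le> e * \<bar>v x\<bar>" for x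
            unfolding abs_mult by (intro mult_right_mono c(2)) simp
        qed
        finally show ?thesis by simp
      qed
      moreover have "\<bar>LINT x|lebesgue_on cube. ?T (x $ 1 + \<tau>) * v x\<bar> \<le> (\<Sum>k. \<bar>?a (k + N)\<bar>)"
      proof -
        have "\<bar>LINT x|lebesgue_on cube. ?T (x $ 1 + \<tau>) * v x\<bar> = \<bar>\<Sum>k<n. c k * sine_coeff gN k * sine_pairing \<tau> v k\<bar>"
          unfolding sumint ..
        also have "\<dots> \<le> (\<Sum>k<n. \<bar>c k * sine_coeff gN k * sine_pairing \<tau> v k\<bar>)" by (rule sum_abs)
        also have "\<dots> \<le> (\<Sum>k<n. if k < N then 0 else \<bar>?a k\<bar>)"
        proof (rule sum_mono)
          fix k
          have "\<bar>c k\<bar> * \<bar>?a k\<bar> \<le> 1 * \<bar>?a k\<bar>" using c(1) by (intro mult_right_mono) auto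
          then show "\<bar>c k * sine_coeff gN k * sine_pairing \<tau> v k\<bar> \<le> (if k < N then 0 else \<bar>?a k\<bar>)"
            by (simp add: coeff abs_mult mult.assoc)
        qed
        also have "\<dots> \<le> (\<Sum>k<n + N. if k < N then 0 else \<bar>?a k\<bar>)" by (intro sum_mono2) auto
        also have "\<dots> = (\<Sum>k<n. \<bar>?a (k + N)\<bar>)"
        proof -
          have "(\<Sum>k<n + N. if k < N then 0 else \<bar>?a k\<bar>) = (\<Sum>k\<in>{N..<n + N}. \<bar>?a k\<bar>)"
            by (rule sum.mono_neutral_cong_right) auto
          also have "\<dots> = (\<Sum>k<n. \<bar>?a (k + N)\<bar>)"
            using sum.shift_bounds_nat_ivl[of "\<lambda>k. \<bar>?a k\<bar>" 0 N n] by (simp add: atLeast0LessThan)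
          finally show ?thesis .
        qed
        also have "\<dots> \<le> (\<Sum>k. \<bar>?a (k + N)\<bar>)" by (intro sum_le_suminf sN) auto
        finally show ?thesis .
      qed
      ultimately show ?thesis by linarith
    qed
    then have "\<bar>LINT x|lebesgue_on cube. gN (x $ 1 + \<tau>) * v x\<bar> \<le> (\<Sum>k. \<bar>?a (k + N)\<bar>)"
    proof -
      assume *: "\<And>e. e > 0 \<Longrightarrow> \<bar>LINT x|lebesgue_on cube. gN (x $ 1 + \<tau>) * v x\<bar> \<le> (\<Sum>k. \<bar>?a (k + N)\<bar>) + e * ?V"
      define W where "W = ?V"
      have V: "W \<ge> 0" unfolding W_def by simp
      show ?thesis
      proof (rule field_le_epsilon)
        fix d :: real assume d: "0 < d"
        have "d / (W + 1) * W \<le> d" using d V by (simp add: field_simps)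
        moreover have "0 < d / (W + 1)" using d V by simp
        ultimately show "\<bar>LINT x|lebesgue_on cube. gN (x $ 1 + \<tau>) * v x\<bar> \<le> (\<Sum>k. \<bar>?a (k + N)\<bar>) + d"
          using *[of "d / (W + 1)", folded W_def] by linarith
      qed
    qed
    then show ?thesis unfolding gNint .
  qed
  have "(\<lambda>N. \<Sum>k. \<bar>?a (k + N)\<bar>) \<longlonglongrightarrow> 0" by (rule suminf_exist_split2[OF s])
  then have "(\<lambda>N. (\<Sum>k<N. ?a k) - (LINT x|lebesgue_on cube. g (x $ 1 + \<tau>) * v x)) \<longlonglongrightarrow> 0"
    by (rule Lim_null_comparison[rotated]) (use tail in \<open>auto simp: abs_minus_commute\<close>)
  then show ?thesis unfolding sums_def by (rule LIM_zero_cancel)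
qed

section \<open>The extension of a sine series\<close>

lemma freq_weights_summable:
  assumes m: "0 < m" and s: "1 / 2 < s"
  shows "summable (\<lambda>k. 1 / freq m k powr (2 * s))"
proof (rule summable_comparison_test'[of "\<lambda>k. real k powr (- (2 * s))" 1])
  show "summable (\<lambda>k. real k powr (- (2 * s)))" using s by (simp add: summable_real_powr_iff)
  fix k :: nat assume k: "k \<ge> 1"
  note freq_ge(1)[of k m]
  then have "real k powr (2 * s) \<le> freq m k powr (2 * s)" using s by (intro powr_mono2) auto
  moreover have "real k powr (2 * s) > 0" using k by simp
  ultimately have "1 / freq m k powr (2 * s) \<le> 1 / real k powr (2 * s)" by (intro divide_left_mono) (auto simp: freq_pos[OF m] less_imp_neq[THEN not_sym])
  then show "norm (1 / freq m k powr (2 * s)) \<le> real k powr (- (2 * s))" by (simp add: powr_minus divide_inverse)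
qed

definition extension :: "real \<Rightarrow> real \<Rightarrow> real \<Rightarrow> (nat \<Rightarrow> real) \<Rightarrow> X_elem" where
  "extension s m \<tau> b = (\<lambda>z. \<Sum>k. b k * fst (bessel_mode s m \<tau> k) z, \<lambda>z. \<Sum>k. b k *\<^sub>R snd (bessel_mode s m \<tau> k) z)"

text \<open>At a point with \<open>y > 0\<close> the modes and their gradients are bounded uniformly in \<open>k\<close>: the factor \<open>k\<close>
  from the horizontal derivative is absorbed by \<open>matern_decay\<close>, the vertical derivative by \<open>matern_deriv_bound\<close>.\<close>

lemma extension_sums:
  assumes m: "0 < m" and s: "0 < s" "s < 1" and b: "summable (\<lambda>k. \<bar>b k\<bar>)" and z: "z \<in> cylinder"
  shows "(\<lambda>k. b k * fst (bessel_mode s m \<tau> k) z) sums fst (extension s m \<tau> b) z"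
    "(\<lambda>k. b k *\<^sub>R snd (bessel_mode s m \<tau> k) z) sums snd (extension s m \<tau> b) z"
    "(\<lambda>k. b k *\<^sub>R weighted s m (bessel_mode s m \<tau> k) z) sums weighted s m (extension s m \<tau> b) z"
proof -
  have y: "0 < snd z" using z by (auto simp: cylinder_def)
  let ?C = "2 * bessel_int (s + 1 / 2) 0 / bessel_int s 0"
  have f1: "\<bar>fst (bessel_mode s m \<tau> k) z\<bar> \<le> 1" for k
  proof -
    have "\<bar>sin (real k * (fst z $ 1 + \<tau>))\<bar> * \<bar>matern s (freq m k) (snd z)\<bar> \<le> 1 * 1"
      using matern_le_1[OF s(1), of "freq m k" "snd z"] matern_pos[OF s(1), of "freq m k" "snd z"]
      by (intro mult_mono) auto
    then show ?thesis by (simp add: bessel_mode_def mode_def abs_mult)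
  qed
  have "summable (\<lambda>k. b k * fst (bessel_mode s m \<tau> k) z)"
  proof (rule summable_comparison_test'[OF b, of 0])
    show "norm (b k * fst (bessel_mode s m \<tau> k) z) \<le> \<bar>b k\<bar>" for k
      unfolding real_norm_def abs_mult by (rule mult_left_le[OF f1]) simp
  qed
  then show 1: "(\<lambda>k. b k * fst (bessel_mode s m \<tau> k) z) sums fst (extension s m \<tau> b) z"
    unfolding extension_def fst_conv by (rule summable_sums)
  have bd: "norm (snd (bessel_mode s m \<tau> k) z) \<le> (?C + 2) / snd z" for k
  proof -
    let ?c = "real k * cos (real k * (fst z $ 1 + \<tau>)) * matern s (freq m k) (snd z)"
    let ?d = "sin (real k * (fst z $ 1 + \<tau>)) * matern_deriv s (freq m k) (snd z)"
    have e: "snd (bessel_mode s m \<tau> k) z = (?c *\<^sub>R axis 1 1, ?d)"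
      by (simp only: bessel_mode_def mode_def snd_conv)
    have "norm (snd (bessel_mode s m \<tau> k) z) \<le> norm (?c *\<^sub>R (axis 1 1 :: real^3)) + norm ?d"
      by (subst e) (rule norm_Pair_le)
    also have "norm (?c *\<^sub>R (axis 1 1 :: real^3)) = \<bar>?c\<bar>" by (simp only: norm_scaleR norm_axis_1 real_norm_def mult_1_right)
    also have "norm ?d = \<bar>?d\<bar>" by (rule real_norm_def)
    also have "\<bar>?c\<bar> \<le> ?C / snd z"
    proof -
      note freq_ge(1)[of k m]
      then have "real k * \<bar>cos (real k * (fst z $ 1 + \<tau>))\<bar> * matern s (freq m k) (snd z) \<le> freq m k * 1 * matern s (freq m k) (snd z)"
        using matern_pos[OF s(1), of "freq m k" "snd z"] by (intro mult_mono) auto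
      also have "\<dots> \<le> ?C / snd z"
        unfolding pos_le_divide_eq[OF y] using matern_decay[OF freq_pos[OF m] y s(1), of k] by (simp only: mult_ac mult_1_right)
      finally show ?thesis using matern_pos[OF s(1), of "freq m k" "snd z"] by (simp add: abs_mult)
    qed
    also have "\<bar>?d\<bar> \<le> 2 / snd z"
    proof -
      have "\<bar>?d\<bar> \<le> 1 * \<bar>matern_deriv s (freq m k) (snd z)\<bar>" unfolding abs_mult by (intro mult_right_mono) auto
      also have "\<dots> \<le> 2 / snd z"
        unfolding pos_le_divide_eq[OF y] using matern_deriv_bound[OF freq_pos[OF m] y s(1), of k] by (simp only: mult_ac mult_1_left)
      finally show ?thesis .
    qed
    finally show ?thesis by (simp add: add_divide_distrib)
  qed
  have "summable (\<lambda>k. b k *\<^sub>R snd (bessel_mode s m \<tau> k) z)"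
  proof (rule summable_comparison_test'[OF summable_mult2[OF b, of "(?C + 2) / snd z"], of 0])
    fix k show "norm (b k *\<^sub>R snd (bessel_mode s m \<tau> k) z) \<le> \<bar>b k\<bar> * ((?C + 2) / snd z)"
      unfolding norm_scaleR by (intro mult_left_mono bd) simp
  qed
  then show 2: "(\<lambda>k. b k *\<^sub>R snd (bessel_mode s m \<tau> k) z) sums snd (extension s m \<tau> b) z"
    unfolding extension_def snd_conv by (rule summable_sums)
  show "(\<lambda>k. b k *\<^sub>R weighted s m (bessel_mode s m \<tau> k) z) sums weighted s m (extension s m \<tau> b) z"
    unfolding sums_def weighted_sum[symmetric] 
    unfolding weighted_def fst_conv snd_conv
    by (intro tendsto_intros 1[unfolded sums_def] 2[unfolded sums_def])
qed

lemma l1_of_weighted: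
  assumes m: "0 < m" and s: "0 < s" and r: "summable (\<lambda>k. freq m k powr s * \<bar>b k\<bar>)"
  shows "summable (\<lambda>k. \<bar>b k\<bar>)"
proof (rule summable_comparison_test'[OF summable_mult[OF r, of "1 / m powr s"], of 0])
  fix k
  note freq_ge(2)[of m k]
  then have "m powr s \<le> freq m k powr s" using m s by (intro powr_mono2) auto
  then have "m powr s * \<bar>b k\<bar> \<le> freq m k powr s * \<bar>b k\<bar>" by (rule mult_right_mono) simp
  moreover have "m powr s > 0" using m by simp
  ultimately show "norm \<bar>b k\<bar> \<le> 1 / m powr s * (freq m k powr s * \<bar>b k\<bar>)" by (simp add: field_simps)
qed

lemma l2_of_weighted:
  assumes r: "summable (\<lambda>k. freq m k powr s * \<bar>b k\<bar>)"
  shows "summable (\<lambda>k. freq m k powr (2 * s) * (b k)\<^sup>2)"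
proof -
  have "summable (\<lambda>k. (freq m k powr s * \<bar>b k\<bar>) * (freq m k powr s * \<bar>b k\<bar>))"
  proof (rule summable_comparison_test'[OF summable_mult[OF r, of "\<Sum>k. freq m k powr s * \<bar>b k\<bar>"], of 0])
    fix k
    have "freq m k powr s * \<bar>b k\<bar> \<le> (\<Sum>k. freq m k powr s * \<bar>b k\<bar>)"
      using sum_le_suminf[OF r, of "{k}"] by simp
    then show "norm ((freq m k powr s * \<bar>b k\<bar>) * (freq m k powr s * \<bar>b k\<bar>)) \<le> (\<Sum>k. freq m k powr s * \<bar>b k\<bar>) * (freq m k powr s * \<bar>b k\<bar>)"
      by (simp add: mult_right_mono)
  qed
  moreover have "(freq m k powr s * \<bar>b k\<bar>) * (freq m k powr s * \<bar>b k\<bar>) = freq m k powr (2 * s) * (b k)\<^sup>2" for k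
  proof -
    have "freq m k powr s * freq m k powr s = freq m k powr (2 * s)" by (simp flip: powr_add)
    moreover have "\<bar>b k\<bar> * \<bar>b k\<bar> = (b k)\<^sup>2" by (simp add: power2_eq_square)
    ultimately show ?thesis by (metis mult.assoc mult.left_commute)
  qed
  ultimately show ?thesis by simp
qed

text \<open>The norm of a mode is at most a constant times \<open>freq m k powr s\<close>, so the series converges absolutely in norm by
  the regularity of \<open>b\<close>.\<close>

lemma extension_l2:
  assumes m: "0 < m" and s: "0 < s" "s < 1" and r: "summable (\<lambda>k. freq m k powr s * \<bar>b k\<bar>)"
  shows "sq_integrable cyl (weighted s m (extension s m \<tau> b))"
    "(\<lambda>n. l2norm cyl (\<lambda>z. weighted s m (extension s m \<tau> b) z - (\<Sum>k<n. b k *\<^sub>R weighted s m (bessel_mode s m \<tau> k) z))) \<longlonglongrightarrow> 0"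
proof -
  let ?K = "sqrt (measure lborel cube * flux s)"
  let ?f = "\<lambda>k z. b k *\<^sub>R weighted s m (bessel_mode s m \<tau> k) z"
  let ?a = "\<lambda>k. ?K * (freq m k powr s * \<bar>b k\<bar>)"
  have f: "sq_integrable cyl (?f k)" for k by (intro sq_integrable_scale bessel_mode_sq_integrable m s)
  have fa: "l2norm cyl (?f k) \<le> ?a k" for k
    unfolding l2norm_scale using mult_left_mono[OF bessel_mode_sq_integrable(2)[OF m s, of \<tau> k], of "\<bar>b k\<bar>"] by (simp add: mult_ac)
  have a: "summable ?a" by (intro summable_mult r)
  have lim: "(\<lambda>k. ?f k z) sums weighted s m (extension s m \<tau> b) z" if "z \<in> space cyl" for z
    using that by (intro extension_sums(3) m s l1_of_weighted[OF m s(1) r]) simp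
  show "sq_integrable cyl (weighted s m (extension s m \<tau> b))" by (rule l2_series(1)[OF f fa a lim])
  show "(\<lambda>n. l2norm cyl (\<lambda>z. weighted s m (extension s m \<tau> b) z - (\<Sum>k<n. ?f k z))) \<longlonglongrightarrow> 0"
  proof (rule Lim_null_comparison[OF _ suminf_exist_split2[OF a]])
    show "\<forall>\<^sub>F n in sequentially. norm (l2norm cyl (\<lambda>z. weighted s m (extension s m \<tau> b) z - (\<Sum>k<n. ?f k z))) \<le> (\<Sum>k. ?a (k + n))"
      using l2_series(2)[OF f fa a lim] by simp
  qed
qed

lemma extension_X_finite:
  assumes m: "0 < m" and s: "0 < s" "s < 1" and r: "summable (\<lambda>k. freq m k powr s * \<bar>b k\<bar>)"
  shows "X_finite s (extension s m \<tau> b)"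
proof (rule weighted_X_finite[of m])
  note b = l1_of_weighted[OF m s(1) r]
  show "fst (extension s m \<tau> b) \<in> borel_measurable cyl"
  proof (rule borel_measurable_LIMSEQ_metric)
    show "(\<lambda>z. \<Sum>k<n. b k * fst (bessel_mode s m \<tau> k) z) \<in> borel_measurable cyl" for n
      by (intro borel_measurable_sum borel_measurable_times borel_measurable_const bessel_mode_measurable m)
    show "(\<lambda>n. \<Sum>k<n. b k * fst (bessel_mode s m \<tau> k) z) \<longlonglongrightarrow> fst (extension s m \<tau> b) z" if "z \<in> space cyl" for z
      using extension_sums(1)[OF m s b, of z \<tau>] that by (simp add: sums_def)
  qed
  show "snd (extension s m \<tau> b) \<in> borel_measurable cyl"
  proof (rule borel_measurable_LIMSEQ_metric)
    show "(\<lambda>z. \<Sum>k<n. b k *\<^sub>R snd (bessel_mode s m \<tau> k) z) \<in> borel_measurable cyl" for n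
      by (intro borel_measurable_sum borel_measurable_scaleR borel_measurable_const bessel_mode_measurable m)
    show "(\<lambda>n. \<Sum>k<n. b k *\<^sub>R snd (bessel_mode s m \<tau> k) z) \<longlonglongrightarrow> snd (extension s m \<tau> b) z" if "z \<in> space cyl" for z
      using extension_sums(2)[OF m s b, of z \<tau>] that by (simp add: sums_def)
  qed
qed (use m extension_l2(1)[OF m s r] in auto)

text \<open>The \<open>n\<close>-th approximant is the \<open>n\<close>-th partial sum with regularised modes, where \<open>\<epsilon>\<close> is so small that
  regularisation costs at most \<open>1 / (n + 1)\<close>. Its boundary values are exactly the partial sums of the sine series.\<close>

lemma extension_approx:
  assumes m: "0 < m" and s: "0 < s" "s < 1" and r: "summable (\<lambda>k. freq m k powr s * \<bar>b k\<bar>)"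
  obtains \<psi> where "X_approx s m \<psi> (extension s m \<tau> b)"
    "\<And>n x. \<psi> n (x, 0) = (\<Sum>k<n. b k * sin (real k * (x $ 1 + \<tau>)))"
proof -
  let ?W = "\<lambda>P. weighted s m P"
  let ?d = "\<lambda>\<epsilon> k z. ?W (bessel_mode s m \<tau> k) z - ?W (smooth_mode \<epsilon> s m \<tau> k) z"
  have ex: "\<exists>\<epsilon>. 0 < \<epsilon> \<and> \<epsilon> \<le> 1 \<and> (\<Sum>k<n. \<bar>b k\<bar> * l2norm cyl (?d \<epsilon> k)) < 1 / real (Suc n)" for n
  proof -
    have l0: "(\<lambda>j. l2norm cyl (?d (1 / real (Suc j)) k)) \<longlonglongrightarrow> 0" for k
      by (rule smooth_mode_converges[OF m s])
    have "(\<lambda>j. \<Sum>k<n. \<bar>b k\<bar> * l2norm cyl (?d (1 / real (Suc j)) k)) \<longlonglongrightarrow> (\<Sum>k<n. \<bar>b k\<bar> * 0)"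
      by (rule tendsto_sum[OF tendsto_mult[OF tendsto_const l0]])
    then have "\<forall>\<^sub>F j in sequentially. (\<Sum>k<n. \<bar>b k\<bar> * l2norm cyl (?d (1 / real (Suc j)) k)) < 1 / real (Suc n)"
      by (intro order_tendstoD) auto
    then obtain j where "(\<Sum>k<n. \<bar>b k\<bar> * l2norm cyl (?d (1 / real (Suc j)) k)) < 1 / real (Suc n)"
      by (auto simp: eventually_sequentially)
    then show ?thesis by (intro exI[of _ "1 / real (Suc j)"]) auto
  qed
  have "\<exists>\<epsilon>. \<forall>n. 0 < \<epsilon> n \<and> \<epsilon> n \<le> 1 \<and> (\<Sum>k<n. \<bar>b k\<bar> * l2norm cyl (?d (\<epsilon> n) k)) < 1 / real (Suc n)"
    by (rule choice) (rule allI, rule ex)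
  then obtain \<epsilon> where "\<forall>n. 0 < \<epsilon> n \<and> \<epsilon> n \<le> 1 \<and> (\<Sum>k<n. \<bar>b k\<bar> * l2norm cyl (?d (\<epsilon> n) k)) < 1 / real (Suc n)"
    by (rule exE)
  then have \<epsilon>: "\<And>n. 0 < \<epsilon> n" "\<And>n. \<epsilon> n \<le> 1" "\<And>n. (\<Sum>k<n. \<bar>b k\<bar> * l2norm cyl (?d (\<epsilon> n) k)) < 1 / real (Suc n)"
    by simp_all
  let ?A = "\<lambda>n. smooth_sum (\<epsilon> n) s m \<tau> b n"
  let ?U = "extension s m \<tau> b"
  have dsq: "sq_integrable cyl (?d (\<epsilon> n) k)" for n k
    by (intro sq_integrable_diff bessel_mode_sq_integrable smooth_mode_sq_integrable m s \<epsilon>)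
  have "(\<lambda>n. X_norm s m (\<lambda>z. fst ?U z - fst (?A n) z, \<lambda>z. snd ?U z - grad (fst (?A n)) z)) \<longlonglongrightarrow> 0"
  proof (rule Lim_null_comparison)
    let ?t = "\<lambda>n z. ?W ?U z - (\<Sum>k<n. b k *\<^sub>R ?W (bessel_mode s m \<tau> k) z)"
    have i0: "(\<lambda>n. 1 / real (Suc n)) \<longlonglongrightarrow> 0" using LIMSEQ_inverse_real_of_nat by (simp only: inverse_eq_divide)
    have "sqrt (kappa s) \<noteq> 0" using kappa_pos[OF s] by simp
    then have "(\<lambda>n. (l2norm cyl (?t n) + 1 / real (Suc n)) / sqrt (kappa s)) \<longlonglongrightarrow> (0 + 0) / sqrt (kappa s)"
      by (rule tendsto_divide[OF tendsto_add[OF extension_l2(2)[OF m s r] i0] tendsto_const])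
    then show "(\<lambda>n. (l2norm cyl (?t n) + 1 / real (Suc n)) / sqrt (kappa s)) \<longlonglongrightarrow> 0" by simp
    show "\<forall>\<^sub>F n in sequentially. norm (X_norm s m (\<lambda>z. fst ?U z - fst (?A n) z, \<lambda>z. snd ?U z - grad (fst (?A n)) z)) \<le>
        (l2norm cyl (?t n) + 1 / real (Suc n)) / sqrt (kappa s)"
    proof (intro always_eventually allI)
      fix n
      have g: "grad (fst (?A n)) = snd (?A n)" using smooth_sum_grad[OF \<epsilon>(1)] by blast
      have eq: "?W (\<lambda>z. fst ?U z - fst (?A n) z, \<lambda>z. snd ?U z - grad (fst (?A n)) z) z = ?t n z + (\<Sum>k<n. b k *\<^sub>R ?d (\<epsilon> n) k z)" for z
        unfolding g weighted_diff unfolding smooth_sum_def weighted_sum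
        by (simp add: scaleR_diff_right sum_subtractf)
      have tsq: "sq_integrable cyl (?t n)"
        by (intro sq_integrable_diff extension_l2(1) sq_integrable_sum sq_integrable_scale bessel_mode_sq_integrable m s r)
      have "l2norm cyl (?W (\<lambda>z. fst ?U z - fst (?A n) z, \<lambda>z. snd ?U z - grad (fst (?A n)) z)) =
          l2norm cyl (\<lambda>z. ?t n z + (\<Sum>k<n. b k *\<^sub>R ?d (\<epsilon> n) k z))"
        by (rule l2norm_cong) (rule eq)
      also have "\<dots> \<le> l2norm cyl (?t n) + l2norm cyl (\<lambda>z. \<Sum>k<n. b k *\<^sub>R ?d (\<epsilon> n) k z)"
        by (intro l2norm_triangle tsq sq_integrable_sum sq_integrable_scale dsq)
      also have "l2norm cyl (\<lambda>z. \<Sum>k<n. b k *\<^sub>R ?d (\<epsilon> n) k z) \<le> (\<Sum>k<n. l2norm cyl (\<lambda>z. b k *\<^sub>R ?d (\<epsilon> n) k z))"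
        by (intro l2norm_sum sq_integrable_scale dsq)
      also have "\<dots> \<le> 1 / real (Suc n)" unfolding l2norm_scale using \<epsilon>(3)[of n] by simp
      finally show "norm (X_norm s m (\<lambda>z. fst ?U z - fst (?A n) z, \<lambda>z. snd ?U z - grad (fst (?A n)) z)) \<le>
        (l2norm cyl (?t n) + 1 / real (Suc n)) / sqrt (kappa s)"
        unfolding X_norm_eq using kappa_pos[OF s] by (simp add: divide_right_mono)
    qed
  qed
  then have "X_approx s m (\<lambda>n. fst (?A n)) ?U"
    unfolding X_approx_def using smooth_sum_smooth_periodic[OF m s \<epsilon>(1) \<epsilon>(2)] by auto
  then show thesis
    by (rule that) (rule smooth_sum_trace[OF \<epsilon>(1)])
qed

lemma X_inner_approx_limit:
  assumes s: "0 < s" "s < 1" and U: "X_finite s U" and V: "X_finite s V" and \<psi>: "X_approx s m \<psi> V"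
  shows "(\<lambda>n. X_inner s m U (\<psi> n, grad (\<psi> n))) \<longlonglongrightarrow> X_inner s m U V"
proof -
  let ?W = "weighted s m"
  have k: "kappa s > 0" by (rule kappa_pos[OF s])
  have sq: "sq_integrable cyl (?W U)" "sq_integrable cyl (?W V)" "sq_integrable cyl (?W (\<psi> n, grad (\<psi> n)))" for n
    using U V \<psi> by (auto intro!: X_finite_weighted simp: X_approx_def smooth_periodic_def)
  let ?N = "\<lambda>n. X_norm s m (\<lambda>z. fst V z - \<psi> n z, \<lambda>z. snd V z - grad (\<psi> n) z)"
  have N0: "?N \<longlonglongrightarrow> 0" using \<psi> by (simp add: X_approx_def)
  have "(\<lambda>n. X_inner s m U V - X_inner s m U (\<psi> n, grad (\<psi> n))) \<longlonglongrightarrow> 0"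
  proof (rule Lim_null_comparison)
    have "(\<lambda>n. l2norm cyl (?W U) / sqrt (kappa s) * ?N n) \<longlonglongrightarrow> l2norm cyl (?W U) / sqrt (kappa s) * 0"
      by (intro tendsto_intros N0)
    then show "(\<lambda>n. l2norm cyl (?W U) / sqrt (kappa s) * ?N n) \<longlonglongrightarrow> 0" by simp
    show "\<forall>\<^sub>F n in sequentially. norm (X_inner s m U V - X_inner s m U (\<psi> n, grad (\<psi> n))) \<le> l2norm cyl (?W U) / sqrt (kappa s) * ?N n"
    proof (intro always_eventually allI)
      fix n
      let ?D = "(\<lambda>z. fst V z - \<psi> n z, \<lambda>z. snd V z - grad (\<psi> n) z)"
      have D: "?W ?D z = ?W V z - ?W (\<psi> n, grad (\<psi> n)) z" for z
        using weighted_diff[of s m V "(\<psi> n, grad (\<psi> n))" z] by simp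
      have Dsq: "sq_integrable cyl (?W ?D)"
        unfolding D[abs_def] by (intro sq_integrable_diff sq)
      have "X_inner s m U V - X_inner s m U (\<psi> n, grad (\<psi> n)) = (LINT z|cyl. ?W U z \<bullet> ?W ?D z) / kappa s"
        unfolding X_inner_eq D inner_diff_right
        by (subst Bochner_Integration.integral_diff) (auto intro!: sq_integrable_inner sq simp: diff_divide_distrib)
      then have "norm (X_inner s m U V - X_inner s m U (\<psi> n, grad (\<psi> n))) = \<bar>LINT z|cyl. ?W U z \<bullet> ?W ?D z\<bar> / kappa s"
        using k by simp
      also have "\<dots> \<le> l2norm cyl (?W U) * l2norm cyl (?W ?D) / kappa s"
        using k by (intro divide_right_mono l2_Cauchy_Schwarz sq Dsq) auto
      also have "\<dots> = l2norm cyl (?W U) / sqrt (kappa s) * X_norm s m ?D"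
        unfolding X_norm_eq times_divide_times_eq using k by simp
      finally show "norm (X_inner s m U V - X_inner s m U (\<psi> n, grad (\<psi> n))) \<le> l2norm cyl (?W U) / sqrt (kappa s) * ?N n" .
    qed
  qed
  from tendsto_diff[OF tendsto_const[of "X_inner s m U V"] this] show ?thesis by simp
qed

text \<open>Sum of \<open>bessel_mode_test\<close> over all modes; the series converges because that of the extension converges in norm.\<close>

lemma extension_inner_smooth:
  assumes m: "0 < m" and s: "0 < s" "s < 1" and r: "summable (\<lambda>k. freq m k powr s * \<bar>b k\<bar>)"
    and \<phi>: "\<phi> \<in> smooth_periodic s"
  shows "(\<lambda>k. flux s / kappa s * (freq m k powr (2 * s) * b k) * sine_pairing \<tau> (\<lambda>x. \<phi> (x, 0)) k)
    sums X_inner s m (extension s m \<tau> b) (\<phi>, grad \<phi>)"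
proof -
  let ?W = "weighted s m" and ?P = "(\<phi>, grad \<phi>)" and ?U = "extension s m \<tau> b"
  have Psq: "sq_integrable cyl (?W ?P)" using \<phi> by (intro X_finite_weighted) (simp add: smooth_periodic_def)
  let ?t = "\<lambda>n z. ?W ?U z - (\<Sum>k<n. b k *\<^sub>R ?W (bessel_mode s m \<tau> k) z)"
  have tsq: "sq_integrable cyl (?t n)" for n
    by (intro sq_integrable_diff extension_l2(1) sq_integrable_sum sq_integrable_scale bessel_mode_sq_integrable m s r)
  let ?I = "LINT z|cyl. ?W ?U z \<bullet> ?W ?P z"
  let ?c = "\<lambda>k. flux s * freq m k powr (2 * s) * sine_pairing \<tau> (\<lambda>x. \<phi> (x, 0)) k"
  have eq: "?I - (\<Sum>k<n. b k * ?c k) = (LINT z|cyl. ?t n z \<bullet> ?W ?P z)" for n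
  proof -
    have si: "integrable cyl (\<lambda>z. ?W (bessel_mode s m \<tau> k) z \<bullet> ?W ?P z)" for k
      by (intro sq_integrable_inner bessel_mode_sq_integrable m s Psq)
    have "(LINT z|cyl. ?t n z \<bullet> ?W ?P z) = ?I - (LINT z|cyl. (\<Sum>k<n. b k * (?W (bessel_mode s m \<tau> k) z \<bullet> ?W ?P z)))"
      unfolding inner_diff_left inner_sum_left inner_scaleR_left
      by (intro Bochner_Integration.integral_diff sq_integrable_inner extension_l2(1) m s r Psq
          Bochner_Integration.integrable_sum Bochner_Integration.integrable_mult_right si)
    also have "(LINT z|cyl. (\<Sum>k<n. b k * (?W (bessel_mode s m \<tau> k) z \<bullet> ?W ?P z))) = (\<Sum>k<n. b k * (LINT z|cyl. ?W (bessel_mode s m \<tau> k) z \<bullet> ?W ?P z))"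
      by (subst Bochner_Integration.integral_sum) (auto intro!: Bochner_Integration.integrable_mult_right si)
    also have "\<dots> = (\<Sum>k<n. b k * ?c k)"
      by (intro sum.cong refl) (simp add: bessel_mode_test[OF m s \<phi>] sine_pairing_def)
    finally show ?thesis by simp
  qed
  have "(\<lambda>n. ?I - (\<Sum>k<n. b k * ?c k)) \<longlonglongrightarrow> 0"
  proof (rule Lim_null_comparison)
    have "(\<lambda>n. l2norm cyl (?t n) * l2norm cyl (?W ?P)) \<longlonglongrightarrow> 0 * l2norm cyl (?W ?P)"
      by (rule tendsto_mult[OF extension_l2(2)[OF m s r] tendsto_const])
    then show "(\<lambda>n. l2norm cyl (?t n) * l2norm cyl (?W ?P)) \<longlonglongrightarrow> 0" by simp
    show "\<forall>\<^sub>F n in sequentially. norm (?I - (\<Sum>k<n. b k * ?c k)) \<le> l2norm cyl (?t n) * l2norm cyl (?W ?P)"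
      unfolding eq real_norm_def by (intro always_eventually allI l2_Cauchy_Schwarz tsq Psq)
  qed
  from tendsto_diff[OF tendsto_const[of ?I] this] have "(\<lambda>k. b k * ?c k) sums ?I" by (simp add: sums_def)
  from sums_divide[OF this, of "kappa s"] show ?thesis
    unfolding X_inner_eq by (simp add: mult_ac)
qed

lemma extension_trace:
  assumes m: "0 < m" and s: "0 < s" "s < 1" and r: "summable (\<lambda>k. freq m k powr s * \<bar>b k\<bar>)"
  shows "is_trace s m (extension s m \<tau> b) (shifted_series \<tau> b)"
proof -
  let ?U = "extension s m \<tau> b"
  note l1 = l1_of_weighted[OF m s(1) r] and l2 = l2_of_weighted[OF r]
  obtain \<psi> where \<psi>: "X_approx s m \<psi> ?U" "\<And>n x. \<psi> n (x, 0) = (\<Sum>k<n. b k * sin (real k * (x $ 1 + \<tau>)))"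
    using extension_approx[OF m s r] by metis
  have U: "?U \<in> X_space s m" using \<psi>(1) extension_X_finite[OF m s r] by (auto simp: X_space_def)
  define c where "c = (\<lambda>n k. if k < n then 0 else - b k)"
  have eq: "(\<lambda>x. \<psi> n (x, 0) - shifted_series \<tau> b x) = shifted_series \<tau> (c n)" for n
  proof
    fix x :: "real^3"
    have "(\<lambda>k. (if k < n then b k * sin (real k * (x $ 1 + \<tau>)) else 0) - b k * sin (real k * (x $ 1 + \<tau>))) sums
       ((\<Sum>k<n. b k * sin (real k * (x $ 1 + \<tau>))) - shifted_series \<tau> b x)"
      unfolding sine_series_def
      by (intro sums_diff summable_sums sine_series_summable l1) (use sums_If_finite_set[of "{..<n}"] in simp)
    moreover have "(\<lambda>k. (if k < n then b k * sin (real k * (x $ 1 + \<tau>)) else 0) - b k * sin (real k * (x $ 1 + \<tau>))) =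
       (\<lambda>k. c n k * sin (real k * (x $ 1 + \<tau>)))" by (auto simp: c_def)
    ultimately show "\<psi> n (x, 0) - shifted_series \<tau> b x = shifted_series \<tau> (c n) x"
      unfolding \<psi>(2) by (simp add: sine_series_def sums_iff)
  qed
  have c1: "summable (\<lambda>k. \<bar>c n k\<bar>)" for n
    by (rule summable_comparison_test'[OF l1, of 0]) (simp add: c_def)
  have c2: "summable (\<lambda>k. freq m k powr (2 * s) * (c n k)\<^sup>2)" for n
    by (rule summable_comparison_test'[OF l2, of 0]) (simp add: c_def)
  have en: "energy (\<lambda>k. freq m k powr (2 * s)) (c n) = (\<Sum>k. freq m (k + n) powr (2 * s) * (b (k + n))\<^sup>2)" for n
    unfolding energy_def by (subst suminf_split_initial_segment[OF c2, of _ n]) (simp add: c_def)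
  have "(\<lambda>n. sqrt (2 * (2 * pi) ^ 3 * energy (\<lambda>k. freq m k powr (2 * s)) (c n))) \<longlonglongrightarrow> sqrt (2 * (2 * pi) ^ 3 * 0)"
    unfolding en by (intro tendsto_intros suminf_exist_split2[OF l2])
  then have lim: "(\<lambda>n. sqrt (2 * (2 * pi) ^ 3 * energy (\<lambda>k. freq m k powr (2 * s)) (c n))) \<longlonglongrightarrow> 0" by simp
  have "(\<lambda>n. H_norm s m (shifted_series \<tau> (c n))) \<longlonglongrightarrow> 0"
  proof (rule Lim_null_comparison[OF _ lim], intro always_eventually allI)
    fix n
    have "0 \<le> H_norm s m (shifted_series \<tau> (c n))"
      unfolding H_norm_def by (intro real_sqrt_ge_zero infsum_nonneg H_term_nonneg)
    then show "norm (H_norm s m (shifted_series \<tau> (c n))) \<le> sqrt (2 * (2 * pi) ^ 3 * energy (\<lambda>k. freq m k powr (2 * s)) (c n))"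
      using series_H_space(2)[OF m c1 c2, of n \<tau>] by (simp add: real_le_rsqrt)
  qed
  then show ?thesis
    unfolding is_trace_def using U \<psi>(1) series_H_space(1)[OF m l1 l2] series_H_space(1)[OF m c1 c2] eq
    by (auto intro!: exI[of _ \<psi>])
qed

lemma cube_integral_coord1:
  fixes f :: "real \<Rightarrow> real"
  assumes f: "continuous_on UNIV f"
  shows "(LINT x|lebesgue_on cube. f (x $ 1)) = (2 * pi)\<^sup>2 * integral {-pi..pi} f"
proof -
  define M where "M = (LINT p:period \<times> period|(lborel :: (real \<times> real) measure). (1::real))"
  have gen: "(LINT x|lebesgue_on cube. f (x $ 1)) = integral {-pi..pi} f * M" if f: "continuous_on UNIV f" for f :: "real \<Rightarrow> real"
  proof -
    have "continuous_on UNIV (\<lambda>x::real^3. f (x $ 1))" by (intro continuous_on_compose2[OF f] continuous_intros) auto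
    from cube_integral_iterated[OF this]
    have "(LINT x|lebesgue_on cube. f (x $ 1)) = (LINT p:period \<times> period|lborel. integral {-pi..pi} f * 1)"
      by (simp add: period_integral_eq[OF f])
    also have "\<dots> = integral {-pi..pi} f * M" unfolding M_def by (rule set_integral_mult_right)
    finally show ?thesis .
  qed
  have "(2 * pi) ^ 3 = 2 * pi * M" using gen[of "\<lambda>_. 1"] integral_one_cube[of 1] by simp
  then have "M = (2 * pi)\<^sup>2" by (simp add: power2_eq_square power3_eq_cube)
  then show ?thesis using gen[OF f] by simp
qed

lemma sine_pairing_modes:
  "sine_pairing \<tau> (\<lambda>x. sin (real j * (x $ 1 + \<tau>))) k = (if j = k \<and> j \<noteq> 0 then 4 * pi ^ 3 else 0)"
proof -
  have c: "integral {-pi..pi} (\<lambda>t. cos (real_of_int n * (t + \<tau>))) = (if n = 0 then 2 * pi else 0)" for n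
    using integral_cos_shift_mult[of "\<lambda>_. 1" "real_of_int n" "- \<tau>"]
    by (auto simp: integral_cos_multiple integral_sin_multiple)
  have eq: "(\<lambda>t. sin (real k * (t + \<tau>)) * sin (real j * (t + \<tau>))) =
      (\<lambda>t. (1/2) * (cos (real_of_int (int k - int j) * (t + \<tau>)) - cos (real_of_int (int k + int j) * (t + \<tau>))))"
    by (simp add: sin_times_sin fun_eq_iff left_diff_distrib distrib_right)
  have "integral {-pi..pi} (\<lambda>t. sin (real k * (t + \<tau>)) * sin (real j * (t + \<tau>))) = (if j = k \<and> j \<noteq> 0 then pi else 0)"
    unfolding eq integral_mult_right
    by (subst integral_diff)
       (auto intro!: integrable_continuous_real continuous_intros simp: c simp del: of_int_diff of_int_add)
  moreover have "sine_pairing \<tau> (\<lambda>x. sin (real j * (x $ 1 + \<tau>))) k =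
     (2 * pi)\<^sup>2 * integral {-pi..pi} (\<lambda>t. sin (real k * (t + \<tau>)) * sin (real j * (t + \<tau>)))"
    unfolding sine_pairing_def by (rule cube_integral_coord1) (intro continuous_intros)
  ultimately show ?thesis by (auto simp: power2_eq_square power3_eq_cube)
qed

text \<open>The inner product of the extension with its approximants is known from \<open>extension_inner_smooth\<close> and the orthogonality of
  the sines. The coefficient at index 0 must vanish as it contributes to \<open>energy\<close> but not to the function.\<close>

lemma extension_norm:
  assumes m: "0 < m" and s: "0 < s" "s < 1" and r: "summable (\<lambda>k. freq m k powr s * \<bar>b k\<bar>)" and b0: "b 0 = 0"
  shows "(X_norm s m (extension s m \<tau> b))\<^sup>2 = 4 * pi ^ 3 * (flux s / kappa s) * energy (\<lambda>k. freq m k powr (2 * s)) b"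
proof -
  let ?U = "extension s m \<tau> b" and ?\<beta> = "flux s / kappa s"
  note l2 = l2_of_weighted[OF r]
  obtain \<psi> where \<psi>: "X_approx s m \<psi> ?U" "\<And>n x. \<psi> n (x, 0) = (\<Sum>k<n. b k * sin (real k * (x $ 1 + \<tau>)))"
    using extension_approx[OF m s r] by metis
  have fin: "X_finite s ?U" by (rule extension_X_finite[OF m s r])
  have lim: "(\<lambda>n. X_inner s m ?U (\<psi> n, grad (\<psi> n))) \<longlonglongrightarrow> X_inner s m ?U ?U"
    by (rule X_inner_approx_limit[OF s fin fin \<psi>(1)])
  have val: "X_inner s m ?U (\<psi> n, grad (\<psi> n)) = 4 * pi ^ 3 * ?\<beta> * (\<Sum>k<n. freq m k powr (2 * s) * (b k)\<^sup>2)" for n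
  proof -
    have pair: "sine_pairing \<tau> (\<lambda>x. \<psi> n (x, 0)) k = (if k < n then 4 * pi ^ 3 * b k else 0)" for k
    proof -
      have i: "integrable (lebesgue_on cube) (\<lambda>x. b j * (sin (real k * (x $ 1 + \<tau>)) * sin (real j * (x $ 1 + \<tau>))))" for j
        by (intro cube_integrable continuous_intros)
      have "sine_pairing \<tau> (\<lambda>x. \<psi> n (x, 0)) k = (LINT x|lebesgue_on cube. (\<Sum>j<n. b j * (sin (real k * (x $ 1 + \<tau>)) * sin (real j * (x $ 1 + \<tau>)))))"
        unfolding sine_pairing_def \<psi>(2) by (simp add: sum_distrib_left mult_ac)
      also have "\<dots> = (\<Sum>j<n. b j * sine_pairing \<tau> (\<lambda>x. sin (real j * (x $ 1 + \<tau>))) k)"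
        unfolding sine_pairing_def by (subst Bochner_Integration.integral_sum[OF i]) simp
      also have "\<dots> = (\<Sum>j<n. if j = k then 4 * pi ^ 3 * b k else 0)"
        unfolding sine_pairing_modes using b0 by (intro sum.cong) auto
      also have "\<dots> = (if k < n then 4 * pi ^ 3 * b k else 0)" by (simp add: sum.delta)
      finally show ?thesis .
    qed
    have "\<psi> n \<in> smooth_periodic s" using \<psi>(1) by (auto simp: X_approx_def)
    from extension_inner_smooth[OF m s r this, of \<tau>]
    have "(\<lambda>k. ?\<beta> * (freq m k powr (2 * s) * b k) * (if k < n then 4 * pi ^ 3 * b k else 0)) sums X_inner s m ?U (\<psi> n, grad (\<psi> n))"
      unfolding pair .
    moreover have "(\<lambda>k. ?\<beta> * (freq m k powr (2 * s) * b k) * (if k < n then 4 * pi ^ 3 * b k else 0)) =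
       (\<lambda>k. if k \<in> {..<n} then 4 * pi ^ 3 * ?\<beta> * (freq m k powr (2 * s) * (b k)\<^sup>2) else 0)"
      by (auto simp: fun_eq_iff power2_eq_square)
    ultimately have "X_inner s m ?U (\<psi> n, grad (\<psi> n)) = (\<Sum>k<n. 4 * pi ^ 3 * ?\<beta> * (freq m k powr (2 * s) * (b k)\<^sup>2))"
      using sums_If_finite_set[of "{..<n}" "\<lambda>k. 4 * pi ^ 3 * ?\<beta> * (freq m k powr (2 * s) * (b k)\<^sup>2)"] sums_unique2 by (simp only:) blast
    then show ?thesis by (simp only: sum_distrib_left)
  qed
  have "(\<lambda>n. 4 * pi ^ 3 * ?\<beta> * (\<Sum>k<n. freq m k powr (2 * s) * (b k)\<^sup>2)) \<longlonglongrightarrow> 4 * pi ^ 3 * ?\<beta> * energy (\<lambda>k. freq m k powr (2 * s)) b"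
    unfolding energy_def by (intro tendsto_mult tendsto_const summable_LIMSEQ l2)
  with lim have "X_inner s m ?U ?U = 4 * pi ^ 3 * ?\<beta> * energy (\<lambda>k. freq m k powr (2 * s)) b"
    unfolding val using LIMSEQ_unique by blast
  moreover have "0 \<le> X_inner s m ?U ?U"
    unfolding X_inner_eq using kappa_pos[OF s] by (intro divide_nonneg_pos Bochner_Integration.integral_nonneg) auto
  ultimately show ?thesis by (simp add: X_norm_def)
qed

section \<open>Weak solutions and their translates\<close>

text \<open>For the smooth approximants of a test function both sides of the equation have the same expansion in sine pairings. In the limit
  the left-hand side converges by continuity of the inner product. On the right-hand side the Parseval series
  is bounded by the norm of the trace, as \<open>sine_pairing_bound\<close> gains \<open>freq m k powr (- s)\<close> against coefficients of size
  \<open>freq m k powr (2 * s) * |b k|\<close>.\<close>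

lemma weak_solution_of_coefficients:
  assumes m: "0 < m" and s: "0 < s" "s < 1" and q: "1 < q" and p: "1 < p"
    and r: "summable (\<lambda>k. freq m k powr s * \<bar>b k\<bar>)" and b0: "b 0 = 0"
    and eq: "\<And>k. sine_coeff (\<lambda>t. nonlinearity lam q p (sine_series b t)) k =
       (a + B * (4 * pi ^ 3 * (flux s / kappa s) * energy (\<lambda>k. freq m k powr (2 * s)) b)) * (flux s / kappa s) * (freq m k powr (2 * s) * b k)"
  shows "weak_solution s a B m q p lam (shifted_series \<tau> b)"
proof -
  let ?U = "extension s m \<tau> b" and ?u = "shifted_series \<tau> b" and ?\<beta> = "flux s / kappa s"
  note l1 = l1_of_weighted[OF m s(1) r] and l2 = l2_of_weighted[OF r]
  define c where "c = a + B * (X_norm s m ?U)\<^sup>2"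
  define g where "g = (\<lambda>t. nonlinearity lam q p (sine_series b t))"
  have coeff: "sine_coeff g k = c * ?\<beta> * (freq m k powr (2 * s) * b k)" for k
    unfolding g_def c_def eq extension_norm[OF m s r b0] ..
  have gc: "continuous_on UNIV g"
    unfolding g_def by (rule continuous_on_compose2[OF nonlinearity_continuous[OF q p, of UNIV] sine_series_continuous[OF l1]]) simp
  have gp: "g (t + 2 * pi) = g t" for t by (simp only: g_def sine_series_periodic)
  have go: "g (- t) = - g t" for t
    by (simp add: g_def sine_series_odd[OF l1] nonlinearity_def)
  have tr: "is_trace s m ?U ?u" by (rule extension_trace[OF m s r])
  have uH: "?u \<in> H_space s m" and UX: "?U \<in> X_space s m" using tr by (auto simp: is_trace_def)
  have Ufin: "X_finite s ?U" by (rule extension_X_finite[OF m s r])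
  define K where "K = \<bar>c * ?\<beta>\<bar> * (2 * pi) powr (3 / 2)"
  have bound: "\<bar>sine_coeff g k * P\<bar> \<le> K * M * (freq m k powr s * \<bar>b k\<bar>)"
    if P: "\<bar>P\<bar> \<le> (2 * pi) powr (3 / 2) * freq m k powr (- s) * M" for P M k
  proof -
    have "\<bar>sine_coeff g k * P\<bar> \<le> \<bar>sine_coeff g k\<bar> * ((2 * pi) powr (3 / 2) * freq m k powr (- s) * M)"
      unfolding abs_mult by (intro mult_left_mono P) simp
    also have "\<bar>sine_coeff g k\<bar> = \<bar>c * ?\<beta>\<bar> * (freq m k powr (2 * s) * \<bar>b k\<bar>)"
      unfolding coeff by (simp add: abs_mult)
    also have "\<bar>c * ?\<beta>\<bar> * (freq m k powr (2 * s) * \<bar>b k\<bar>) * ((2 * pi) powr (3 / 2) * freq m k powr (- s) * M) =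
       K * M * ((freq m k powr (2 * s) * freq m k powr (- s)) * \<bar>b k\<bar>)"
      unfolding K_def by (simp only: mult_ac)
    also have "freq m k powr (2 * s) * freq m k powr (- s) = freq m k powr s"
      by (simp flip: powr_add)
    finally show ?thesis .
  qed
  have key: "c * X_inner s m ?U V = (LINT x|lebesgue_on cube. g (x $ 1 + \<tau>) * v x)"
    if V: "V \<in> X_space s m" and vtr: "is_trace s m V v" for V v
  proof -
    obtain \<psi> where \<psi>: "X_approx s m \<psi> V" "\<And>n. (\<lambda>x. \<psi> n (x, 0) - v x) \<in> H_space s m"
      "(\<lambda>n. H_norm s m (\<lambda>x. \<psi> n (x, 0) - v x)) \<longlonglongrightarrow> 0" and vH: "v \<in> H_space s m"
      using vtr unfolding is_trace_def by blast
    let ?w = "\<lambda>n x. \<psi> n (x, 0) - v x"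
    have vi: "integrable (lebesgue_on cube) v" by (rule H_space_integrable[OF vH])
    have wi: "integrable (lebesgue_on cube) (?w n)" for n by (rule H_space_integrable[OF \<psi>(2)])
    have wsum: "summable (\<lambda>k. \<bar>sine_coeff g k * sine_pairing \<tau> u k\<bar>)"
      and wle: "(\<Sum>k. \<bar>sine_coeff g k * sine_pairing \<tau> u k\<bar>) \<le> K * H_norm s m u * (\<Sum>k. freq m k powr s * \<bar>b k\<bar>)"
      if u: "u \<in> H_space s m" for u
    proof -
      have le: "\<bar>sine_coeff g k * sine_pairing \<tau> u k\<bar> \<le> K * H_norm s m u * (freq m k powr s * \<bar>b k\<bar>)" for k
        by (rule bound[OF sine_pairing_bound[OF m u]])
      have sm: "summable (\<lambda>k. K * H_norm s m u * (freq m k powr s * \<bar>b k\<bar>))" by (rule summable_mult[OF r])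
      show s1: "summable (\<lambda>k. \<bar>sine_coeff g k * sine_pairing \<tau> u k\<bar>)"
        by (rule summable_comparison_test'[OF sm, of 0]) (use le in simp)
      have "(\<Sum>k. \<bar>sine_coeff g k * sine_pairing \<tau> u k\<bar>) \<le> (\<Sum>k. K * H_norm s m u * (freq m k powr s * \<bar>b k\<bar>))"
        by (rule suminf_le[OF le s1 sm])
      also have "\<dots> = K * H_norm s m u * (\<Sum>k. freq m k powr s * \<bar>b k\<bar>)" by (rule suminf_mult[OF r])
      finally show "(\<Sum>k. \<bar>sine_coeff g k * sine_pairing \<tau> u k\<bar>) \<le> K * H_norm s m u * (\<Sum>k. freq m k powr s * \<bar>b k\<bar>)" .
    qed
    have pars: "(\<lambda>k. sine_coeff g k * sine_pairing \<tau> u k) sums (LINT x|lebesgue_on cube. g (x $ 1 + \<tau>) * u x)"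
      if u: "u \<in> H_space s m" for u
      by (rule sine_parseval[OF gc gp go H_space_integrable[OF u] wsum[OF u]])
    let ?I = "\<lambda>u. LINT x|lebesgue_on cube. g (x $ 1 + \<tau>) * u x"
    have smooth: "c * X_inner s m ?U (\<psi> n, grad (\<psi> n)) = ?I (?w n) + ?I v" for n
    proof -
      have pair: "sine_pairing \<tau> (\<lambda>x. \<psi> n (x, 0)) k = sine_pairing \<tau> (?w n) k + sine_pairing \<tau> v k" for k
      proof -
        have i: "integrable (lebesgue_on cube) (\<lambda>x. sin (real k * (x $ 1 + \<tau>)) * u x)"
          if "integrable (lebesgue_on cube) u" for u
          by (rule cube_mult_integrable[OF that, of _ 1]) (auto intro!: continuous_intros)
        have "sine_pairing \<tau> (?w n) k + sine_pairing \<tau> v k =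
           (LINT x|lebesgue_on cube. sin (real k * (x $ 1 + \<tau>)) * ?w n x + sin (real k * (x $ 1 + \<tau>)) * v x)"
          unfolding sine_pairing_def by (rule Bochner_Integration.integral_add[OF i[OF wi] i[OF vi], symmetric])
        then show ?thesis by (simp add: sine_pairing_def right_diff_distrib)
      qed
      have "\<psi> n \<in> smooth_periodic s" using \<psi>(1) by (auto simp: X_approx_def)
      from sums_mult[OF extension_inner_smooth[OF m s r this, of \<tau>], of c]
      have 1: "(\<lambda>k. sine_coeff g k * sine_pairing \<tau> (\<lambda>x. \<psi> n (x, 0)) k) sums (c * X_inner s m ?U (\<psi> n, grad (\<psi> n)))"
        unfolding coeff by (simp add: mult.assoc)
      have 2: "(\<lambda>k. sine_coeff g k * sine_pairing \<tau> (\<lambda>x. \<psi> n (x, 0)) k) sums (?I (?w n) + ?I v)"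
        unfolding pair distrib_left by (rule sums_add[OF pars[OF \<psi>(2)] pars[OF vH]])
      show ?thesis by (rule sums_unique2[OF 1 2])
    qed
    have "(\<lambda>n. ?I (?w n)) \<longlonglongrightarrow> 0"
    proof (rule Lim_null_comparison)
      have "(\<lambda>n. K * H_norm s m (?w n) * (\<Sum>k. freq m k powr s * \<bar>b k\<bar>)) \<longlonglongrightarrow> K * 0 * (\<Sum>k. freq m k powr s * \<bar>b k\<bar>)"
        by (rule tendsto_mult[OF tendsto_mult[OF tendsto_const \<psi>(3)] tendsto_const])
      then show "(\<lambda>n. K * H_norm s m (?w n) * (\<Sum>k. freq m k powr s * \<bar>b k\<bar>)) \<longlonglongrightarrow> 0" by simp
      show "\<forall>\<^sub>F n in sequentially. norm (?I (?w n)) \<le> K * H_norm s m (?w n) * (\<Sum>k. freq m k powr s * \<bar>b k\<bar>)"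
      proof (intro always_eventually allI)
        fix n
        have "?I (?w n) = (\<Sum>k. sine_coeff g k * sine_pairing \<tau> (?w n) k)"
          by (rule sums_unique[OF pars[OF \<psi>(2)]])
        also have "norm \<dots> \<le> (\<Sum>k. norm (sine_coeff g k * sine_pairing \<tau> (?w n) k))"
          by (rule summable_norm) (use wsum[OF \<psi>(2)] in simp)
        also have "\<dots> \<le> K * H_norm s m (?w n) * (\<Sum>k. freq m k powr s * \<bar>b k\<bar>)"
          using wle[OF \<psi>(2)] by simp
        finally show "norm (?I (?w n)) \<le> K * H_norm s m (?w n) * (\<Sum>k. freq m k powr s * \<bar>b k\<bar>)" .
      qed
    qed
    from tendsto_add[OF this tendsto_const[of "?I v"]]
    have R: "(\<lambda>n. c * X_inner s m ?U (\<psi> n, grad (\<psi> n))) \<longlonglongrightarrow> ?I v" unfolding smooth by simp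
    have "X_finite s V" using V by (simp add: X_space_def)
    from tendsto_mult[OF tendsto_const[of c] X_inner_approx_limit[OF s Ufin this \<psi>(1)]]
    show ?thesis using R by (rule LIMSEQ_unique)
  qed
  show ?thesis
    unfolding weak_solution_def
  proof (intro conjI bexI[of _ ?U] ballI allI impI)
    show "?u \<in> H_space s m" "is_trace s m ?U ?u" "?U \<in> X_space s m" by fact+
    fix V v assume "V \<in> X_space s m" "is_trace s m V v"
    from key[OF this] show "(a + B * (X_norm s m ?U)\<^sup>2) * X_inner s m ?U V =
      (LINT x|lebesgue_on cube. (lam * \<bar>?u x\<bar> powr (q - 2) * ?u x + \<bar>?u x\<bar> powr (p - 2) * ?u x) * v x)"
      by (simp only: c_def g_def nonlinearity_def)
  qed
qed

lemma nontrivial_translates: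
  fixes m s :: real
  assumes m: "0 < m" and s: "1 / 2 < s" "s < 1" and a: "0 < a" and B: "0 < B" and q: "1 < q" "q < 2" and p: "2 < p"
  obtains L where "0 < L"
    "\<And>lam. 0 < lam \<Longrightarrow> lam < L \<Longrightarrow> \<exists>b. summable (\<lambda>k. \<bar>b k\<bar>) \<and> (\<exists>t. sine_series b t \<noteq> 0) \<and>
        (\<forall>\<tau>. weak_solution s a B m q p lam (shifted_series \<tau> b))"
proof -
  have s0: "0 < s" using s by simp
  let ?w = "\<lambda>k. freq m k powr (2 * s)"
  define \<beta> where "\<beta> = flux s / kappa s"
  have \<beta>: "\<beta> > 0" using flux_pos[OF s0 s(2)] kappa_pos[OF s0 s(2)] by (simp add: \<beta>_def)
  have w: "0 < ?w k" for k using freq_pos[OF m, of k] by simp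
  have ws: "summable (\<lambda>k. 1 / ?w k)" by (rule freq_weights_summable[OF m s(1)])
  (* The ratio beta of flux and kappa, the factor 4 pi^3 from extension_norm and the factor pi between integrals
     and coefficients enter al and be, so that the coefficient equation becomes the one required of a weak solution. *)
  define al where "al = pi * a * \<beta>"
  define be where "be = 4 * pi ^ 4 * B * \<beta>\<^sup>2"
  have al: "0 < al" and be: "0 < be" using a B \<beta> by (auto simp: al_def be_def)
  obtain L where L: "0 < L" "\<And>lam. 0 < lam \<Longrightarrow> lam < L \<Longrightarrow>
    \<exists>b. summable (\<lambda>k. ?w k * (b k)\<^sup>2) \<and> (\<exists>k. b k \<noteq> 0) \<and>
      (\<forall>k. (al + be * energy ?w b) * ?w k * b k =
         integral {-pi..pi} (\<lambda>t. nonlinearity lam q p (sine_series b t) * sin (real k * t)))"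
    by (rule sine_problem_solution[OF w ws al less_imp_le[OF be] q p]) (rule that)
  show thesis
  proof (rule that[OF L(1)])
    fix lam assume lam: "0 < lam" "lam < L"
    obtain b where b: "summable (\<lambda>k. ?w k * (b k)\<^sup>2)" "\<exists>k. b k \<noteq> 0"
      "\<And>k. (al + be * energy ?w b) * ?w k * b k =
         integral {-pi..pi} (\<lambda>t. nonlinearity lam q p (sine_series b t) * sin (real k * t))"
      using L(2)[OF lam] by blast
    have E0: "energy ?w b \<ge> 0" unfolding energy_def by (intro suminf_nonneg b) simp
    have C0: "al + be * energy ?w b > 0" using al be E0 by (simp add: add_pos_nonneg)
    have l1: "summable (\<lambda>k. \<bar>b k\<bar>)" by (rule weighted_l1_bound(1)[OF w ws b(1)])
    let ?g = "\<lambda>t. nonlinearity lam q p (sine_series b t)"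
    have gc: "continuous_on {-pi..pi} ?g"
      using q p by (intro continuous_on_compose2[OF nonlinearity_continuous[of q p UNIV]] sine_series_continuous[OF l1]) auto
    have pc: "pi * sine_coeff ?g k = (al + be * energy ?w b) * (?w k * b k)" for k
      unfolding sine_coeff_def by (simp only: b(3)[symmetric] mult.assoc) simp
    have wb: "?w k * b k = pi / (al + be * energy ?w b) * sine_coeff ?g k" for k
      unfolding times_divide_eq_left pc using C0 by simp
    have "summable (\<lambda>k. sqrt (?w k) * \<bar>b k\<bar>)" by (rule sine_coeff_regularity[OF w ws gc wb])
    moreover have "sqrt (?w k) = freq m k powr s" for k
    proof -
      have "?w k = (freq m k powr s)\<^sup>2" by (simp add: power2_eq_square flip: powr_add)
      then show ?thesis by simp
    qed
    ultimately have r: "summable (\<lambda>k. freq m k powr s * \<bar>b k\<bar>)" by simp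
    have b0: "b 0 = 0" using b(3)[of 0] C0 w[of 0] by simp
    have coeff: "sine_coeff ?g k = (a + B * (4 * pi ^ 3 * \<beta> * energy ?w b)) * \<beta> * (?w k * b k)" for k
    proof -
      note pc[of k]
      also have "al + be * energy ?w b = pi * ((a + B * (4 * pi ^ 3 * \<beta> * energy ?w b)) * \<beta>)"
        by (simp add: al_def be_def algebra_simps power2_eq_square eval_nat_numeral)
      finally show ?thesis by (simp add: mult.assoc)
    qed
    have "\<exists>t. sine_series b t \<noteq> 0"
    proof (rule ccontr)
      assume "\<not> (\<exists>t. sine_series b t \<noteq> 0)"
      then have "sine_series b t = 0" for t by blast
      then have "(al + be * energy ?w b) * ?w k * b k = 0" for k unfolding b(3) by (simp add: nonlinearity_def)
      then have "b k = 0" for k using C0 w[of k] by (metis less_irrefl mult_eq_0_iff)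
      then show False using b(2) by blast
    qed
    moreover have "weak_solution s a B m q p lam (shifted_series \<tau> b)" for \<tau>
      by (rule weak_solution_of_coefficients[OF m s0 s(2) q(1) _ r b0]) (use p coeff in \<open>auto simp: \<beta>_def\<close>)
    ultimately show "\<exists>b. summable (\<lambda>k. \<bar>b k\<bar>) \<and> (\<exists>t. sine_series b t \<noteq> 0) \<and>
        (\<forall>\<tau>. weak_solution s a B m q p lam (shifted_series \<tau> b))" using l1 by blast
  qed
qed

lemma ae_eq_continuous:
  assumes "(u, v) \<in> ae_eq" and u: "continuous_on UNIV u" and v: "continuous_on UNIV v" and x: "x \<in> cube"
  shows "u x = v x"
proof -
  let ?N = "{x \<in> cube. u x \<noteq> v x}"
  have "open ({x. u x \<noteq> v x} \<inter> cube)"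
    by (intro open_Int open_Collect_neq u v) (simp add: cube_def open_box)
  then have o: "open ?N" by (simp add: Int_def conj_commute)
  have "AE x in lebesgue_on cube. u x = v x" using assms(1) by (simp add: ae_eq_def)
  then have "AE x in lebesgue. x \<in> cube \<longrightarrow> u x = v x" by (subst (asm) AE_restrict_space_iff) auto
  then have "AE x in lebesgue. x \<notin> ?N" by eventually_elim auto
  then have "?N \<in> null_sets lebesgue" using o by (subst (asm) AE_iff_null_sets[symmetric]) auto
  then have "negligible ?N" by (simp add: negligible_iff_null_sets)
  then have "?N = {}" using open_not_negligible[OF o] by blast
  then show ?thesis using x by blast
qed

text \<open>Two continuous functions that agree almost everywhere on the cube agree at the origin, where the translate by \<open>\<tau>\<close> has
  the value \<open>sine_series b \<tau>\<close>. Finitely many classes would give the series a finite, hence by connectedness one-point,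
  range, although it vanishes at 0 and not everywhere.\<close>

lemma infinite_translate_classes:
  assumes b: "summable (\<lambda>k. \<bar>b k\<bar>)" and t: "sine_series b t \<noteq> 0"
    and sub: "\<And>\<tau>. shifted_series \<tau> b \<in> A"
  shows "infinite (A // ae_eq)"
proof
  assume fin: "finite (A // ae_eq)"
  let ?cl = "\<lambda>\<tau>. ae_eq `` {shifted_series \<tau> b}"
  have c: "continuous_on UNIV (shifted_series \<tau> b)" for \<tau> by (rule shifted_series_continuous[OF b])
  have zero: "(0 :: real^3) \<in> cube" by (simp add: cube_mem)
  have inj: "sine_series b \<tau> = sine_series b \<tau>'" if "?cl \<tau> = ?cl \<tau>'" for \<tau> \<tau>'
  proof -
    have "(shifted_series \<tau>' b, shifted_series \<tau>' b) \<in> ae_eq" by (simp add: ae_eq_def)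
    then have "(shifted_series \<tau> b, shifted_series \<tau>' b) \<in> ae_eq" using that by blast
    from ae_eq_continuous[OF this c c zero] show ?thesis by simp
  qed
  have "range ?cl \<subseteq> A // ae_eq" using sub by (auto simp: quotient_def)
  then have fcl: "finite (range ?cl)" using fin finite_subset by blast
  define h where "h = (\<lambda>C. sine_series b (SOME \<tau>. ?cl \<tau> = C))"
  have h: "h (?cl \<tau>) = sine_series b \<tau>" for \<tau>
    unfolding h_def by (rule inj) (rule someI[of "\<lambda>\<tau>'. ?cl \<tau>' = ?cl \<tau>"], rule refl)
  have "range (sine_series b) = h ` range ?cl" by (simp only: image_image h)
  then have finr: "finite (range (sine_series b))" using fcl by (simp only: finite_imageI)
  have "connected (range (sine_series b))"
    by (intro connected_continuous_image sine_series_continuous b) auto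
  from connected_finite_iff_sing[OF this] finr have "\<exists>x. range (sine_series b) = {x}"
    by (simp only: UNIV_not_empty image_is_empty simp_thms)
  then obtain x where "range (sine_series b) = {x}" by (rule exE)
  then have "sine_series b t = x" "sine_series b 0 = x" by (metis rangeI singletonD)+
  then show False using t by (simp add: sine_series_def)
qed

theorem theorem4:
  fixes s a b m q p :: real
  assumes "3 / 4 < s" and "s < 1"
    and "0 < a" and "0 < b" and "0 < m"
    and "1 < q" and "q < 2"
    and "p = critical_exponent s"
  shows "\<exists>lam_star>0. \<forall>lam. 0 < lam \<and> lam < lam_star \<longrightarrow>
           infinite ({u. weak_solution s a b m q p lam u} // ae_eq)"
proof -
  have s: "1 / 2 < s" using assms(1) by simp
  have p: "2 < p" using assms(1,2) by (simp add: assms(8) critical_exponent_def field_simps)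
  obtain L where L: "0 < L" "\<And>lam. 0 < lam \<Longrightarrow> lam < L \<Longrightarrow>
      \<exists>c. summable (\<lambda>k. \<bar>c k\<bar>) \<and> (\<exists>t. sine_series c t \<noteq> 0) \<and> (\<forall>\<tau>. weak_solution s a b m q p lam (shifted_series \<tau> c))"
    by (rule nontrivial_translates[OF assms(5) s assms(2) assms(3,4) assms(6,7) p]) (rule that)
  show ?thesis
  proof (intro exI[of _ L] conjI L(1) allI impI, elim conjE)
    fix lam assume "0 < lam" "lam < L"
    from L(2)[OF this] obtain c t where "summable (\<lambda>k. \<bar>c k\<bar>)" "sine_series c t \<noteq> 0"
      "\<And>\<tau>. weak_solution s a b m q p lam (shifted_series \<tau> c)" by blast
    then show "infinite ({u. weak_solution s a b m q p lam u} // ae_eq)"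
      by (intro infinite_translate_classes) auto
  qed
qed

end
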